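(* Let $b:\mathbb{R}_+\times\mathbb{R}^2\to\mathbb{R}$, $(t,x_1,x_2)\mapsto b(t,x_1,x_2)$, be measurable and such that both $b$ and its partial derivative $\partial_{x_1}b$ with respect to the first spatial variable are bounded and Hölder continuous in the spatial arguments $(x_1,x_2)$, uniformly in the time variable $t$. Suppose the initial law $\mathcal{L}(Z)\in\mathcal{P}_2(\mathbb{R}_+)$ admits a density $\rho:\mathbb{R}_+\to\mathbb{R}_+$ satisfying $$\int_0^1\frac{\rho(x)}{x^2}\,\mathrm{d}x<\infty.$$ Then the mean-field SDE $$\mathrm{d}X_t = \iota(X_t)\Bigl(\int_{(0,\infty)} b(t,X_t,y)\,\mu_t(\mathrm{d}y)\Bigr)\mathrm{d}t+ \iota(X_t)\sqrt{2}\,\mathrm{d}W_t,\qquad \mu_t:=\mathcal{L}(X_t),\quad X_0=Z,$$ has a unique weak solution $X$.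
   Context: $\iota(x):=\mathbf{1}_{\{x>0\}}$; $\mathbb{R}_+=[0,\infty)$; $\mathcal{P}_2(\mathbb{R}_+)$ is the set of probability measures on $\mathbb{R}_+$ with finite second moment; $\mathcal L(\cdot)$ denotes the law; $\Omega:=C([0,\infty),\mathbb{R})$. Weak solution with initial law $\rho_0\in\mathcal{P}(\mathbb{R}_+)$: a probability measure $\mathbb{Q}\in\mathcal{P}(\Omega)$ such that, with $F_t(\omega)=\omega(t)$ the canonical process, $\mathbb{Q}_s:=\mathbb{Q}\circ F_s^{-1}$ and the canonical filtration: (a) $\mathbb{Q}_0=\rho_0$; (b) for every $\varphi\in C^2_c(\mathbb{R})$ the process $$M^\varphi_t := \varphi(F_t)-\varphi(F_0)-\int_0^t \iota(F_s)\Bigl( \varphi'(F_s)\int_{(0,\infty)} b(s,F_s,y)\,\mathbb{Q}_s(\mathrm{d}y)+ \varphi''(F_s)\Bigr)\mathrm{d}s,\quad t\ge0,$$ is a $\mathbb{Q}$-martingale; (c) $\mathbb{Q}(F_t\in\mathbb{R}_+)=1$ for all $t\ge0$. *)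

theory Defs
  imports "HOL-Probability.Probability"
begin

text \<open>
  The space of continuous paths on \<open>[0,\<infinity>)\<close> with the \<open>\<sigma>\<close>-algebra generated by the evaluations
  (which is the Borel \<open>\<sigma>\<close>-algebra of locally uniform convergence). A path is represented by its
  unique extensional version, that is, with value \<open>undefined\<close> at negative times. Only
  the space and the \<open>\<sigma>\<close>-algebra matter here, not the measure carried by the restricted space.
\<close>

definition path_space :: "(real \<Rightarrow> real) measure" where
  "path_space = restrict_space (PiM {0..} (\<lambda>_. borel)) {\<omega>. continuous_on {0..} \<omega>}"

definition canonical_filtration :: "real \<Rightarrow> (real \<Rightarrow> real) measure" where
  "canonical_filtration t = sigma (space path_space)
     {(\<lambda>\<omega>. \<omega> s) -` A \<inter> space path_space | s A. 0 \<le> s \<and> s \<le> t \<and> A \<in> sets borel}"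

lemma space_path_space:
  "space path_space = {\<omega> \<in> extensional {0..}. continuous_on {0..} \<omega>}"
  by (auto simp: path_space_def space_restrict_space space_PiM PiE_def)

lemma measurable_path_eval:
  assumes "0 \<le> s"
  shows "(\<lambda>\<omega>. \<omega> s) \<in> borel_measurable path_space"
  unfolding path_space_def using assms
  by (intro measurable_restrict_space1 measurable_component_singleton) auto

lemma sets_canonical_filtration:
  "sets (canonical_filtration t) = sigma_sets (space path_space)
     {(\<lambda>\<omega>. \<omega> s) -` A \<inter> space path_space | s A. 0 \<le> s \<and> s \<le> t \<and> A \<in> sets borel}"
  unfolding canonical_filtration_def by (rule sets_measure_of) blast

lemma filtration_canonical: "filtration (space path_space) canonical_filtration"
proof
  show "space (canonical_filtration t) = space path_space" for t
    unfolding canonical_filtration_def by (rule space_measure_of) blast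
next
  fix s t :: real
  assume "s \<le> t"
  then show "sets (canonical_filtration s) \<le> sets (canonical_filtration t)"
    unfolding sets_canonical_filtration
    by (intro sigma_sets_mono') (blast intro: order_trans)
qed

lemma subalgebra_canonical: "subalgebra path_space (canonical_filtration t)"
proof -
  have "sets (canonical_filtration t) \<subseteq> sets path_space"
    unfolding sets_canonical_filtration
    by (rule sets.sigma_sets_subset) (blast intro: measurable_sets[OF measurable_path_eval])
  then show ?thesis
    using filtration.space_F[OF filtration_canonical] by (simp add: subalgebra_def)
qed

text \<open>Time runs over \<open>[0,\<infinity>)\<close>; the values of the process at negative times are irrelevant.\<close>

definition martingale ::
    "'a measure \<Rightarrow> (real \<Rightarrow> 'a measure) \<Rightarrow> (real \<Rightarrow> 'a \<Rightarrow> real) \<Rightarrow> bool" where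
  "martingale M F X \<longleftrightarrow>
     filtration (space M) F \<and>
     (\<forall>t\<ge>0. subalgebra M (F t) \<and> X t \<in> borel_measurable (F t) \<and> integrable M (X t)) \<and>
     (\<forall>s\<ge>0. \<forall>t\<ge>s. AE \<omega> in M. real_cond_exp M (F s) (X t) \<omega> = X s \<omega>)"

definition C2_compact_support :: "(real \<Rightarrow> real) \<Rightarrow> bool" where
  "C2_compact_support \<phi> \<longleftrightarrow>
     (\<forall>x. \<phi> differentiable (at x)) \<and>
     (\<forall>x. deriv \<phi> differentiable (at x)) \<and>
     continuous_on UNIV (deriv (deriv \<phi>)) \<and>
     compact (closure {x. \<phi> x \<noteq> 0})"

definition iota :: "real \<Rightarrow> real" where
  "iota x = indicator {0<..} x"

definition marginal :: "(real \<Rightarrow> real) measure \<Rightarrow> real \<Rightarrow> real measure" where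
  "marginal Q s = distr Q borel (\<lambda>\<omega>. \<omega> s)"

definition martingale_problem_process ::
    "(real \<Rightarrow> real \<Rightarrow> real \<Rightarrow> real) \<Rightarrow> (real \<Rightarrow> real) measure \<Rightarrow> (real \<Rightarrow> real) \<Rightarrow>
     real \<Rightarrow> (real \<Rightarrow> real) \<Rightarrow> real" where
  "martingale_problem_process b Q \<phi> t \<omega> =
     \<phi> (\<omega> t) - \<phi> (\<omega> 0) -
     (LINT s:{0..t}|lborel.
        iota (\<omega> s) *
          (deriv \<phi> (\<omega> s) * (LINT y:{0<..}|marginal Q s. b s (\<omega> s) y) +
           deriv (deriv \<phi>) (\<omega> s)))"

text \<open>
  Weak solutions, in the sense of the martingale problem, of
  \<open>dX\<^sub>t = \<iota>(X\<^sub>t) (\<integral>\<^bsub>(0,\<infinity>)\<^esub> b(t,X\<^sub>t,y) \<mu>\<^sub>t(dy)) dt + \<iota>(X\<^sub>t) \<surd>2 dW\<^sub>t\<close>, \<open>\<mu>\<^sub>t = Law(X\<^sub>t)\<close>, with initial law \<open>\<rho>0\<close>.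
\<close>

definition weak_solution ::
    "(real \<Rightarrow> real \<Rightarrow> real \<Rightarrow> real) \<Rightarrow> real measure \<Rightarrow> (real \<Rightarrow> real) measure \<Rightarrow> bool" where
  "weak_solution b \<rho>0 Q \<longleftrightarrow>
     prob_space Q \<and> sets Q = sets path_space \<and>
     marginal Q 0 = \<rho>0 \<and>
     (\<forall>\<phi>. C2_compact_support \<phi> \<longrightarrow>
        martingale Q canonical_filtration (martingale_problem_process b Q \<phi>)) \<and>
     (\<forall>t\<ge>0. measure Q {\<omega> \<in> space Q. \<omega> t \<ge> 0} = 1)"

definition P2_nonneg :: "real measure set" where
  "P2_nonneg = {\<mu>. prob_space \<mu> \<and> sets \<mu> = sets borel \<and> measure \<mu> {0..} = 1 \<and>
                   integrable \<mu> (\<lambda>x. x\<^sup>2)}"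

definition bounded_spatial :: "(real \<Rightarrow> real \<Rightarrow> real \<Rightarrow> real) \<Rightarrow> bool" where
  "bounded_spatial g \<longleftrightarrow> (\<exists>C. \<forall>t\<ge>0. \<forall>x y. \<bar>g t x y\<bar> \<le> C)"

definition Hoelder_spatial :: "(real \<Rightarrow> real \<Rightarrow> real \<Rightarrow> real) \<Rightarrow> bool" where
  "Hoelder_spatial g \<longleftrightarrow>
     (\<exists>\<alpha> C. 0 < \<alpha> \<and> \<alpha> \<le> 1 \<and>
        (\<forall>t\<ge>0. \<forall>x y x' y'. \<bar>g t x y - g t x' y'\<bar> \<le> C * dist (x, y) (x', y') powr \<alpha>))"

definition partial_1 :: "(real \<Rightarrow> real \<Rightarrow> real \<Rightarrow> real) \<Rightarrow> real \<Rightarrow> real \<Rightarrow> real \<Rightarrow> real" where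
  "partial_1 b t x y = deriv (\<lambda>z. b t z y) x"

end

theory Submission
  imports Defs
begin

text \<open>
  A weak solution is a solution \<open>Q\<close> of the linear martingale problem with generator
  \<open>\<iota>(x) (B(t,x) \<partial>\<^sub>x + \<partial>\<^sub>x\<^sub>x)\<close> whose drift \<open>B\<close> is its own mean field
  \<open>(t,x) \<mapsto> \<integral>\<^bsub>(0,\<infinity>)\<^esub> b(t,x,y) Q\<^sub>t(dy)\<close> (\<open>weak_solution_iff\<close>). So a weak solution is a fixed point of the map that takes
  a drift to the mean field of the solution of the linear problem, and the theorem follows once the linear problem is
  well posed and this map is a contraction.

  The discontinuity of \<open>\<iota>\<close> at the origin is handled by odd test functions. If \<open>\<phi>\<close> is odd and smooth, then \<open>\<phi>''(0) = 0\<close>,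
  hence \<open>\<iota> \<phi>'' = \<phi>''\<close> on \<open>[0,\<infinity>)\<close> and the second-order term no longer sees the absorption. For \<open>\<phi>(x) = sin (k x)\<close>, an
  eigenfunction of the second derivative, the martingale problem becomes a scalar linear equation in time, which
  variation of constants solves (\<open>expectation_sin\<close>). By uniqueness of characteristic functions, a functional on odd
  functions that vanishes on all sines vanishes (\<open>odd_functional_eq_0\<close>). This gives, for every bounded measurable odd \<open>g\<close>,
  the mild identity
  \<open>E g(X\<^sub>t) = E (P\<^sub>t\<^sub>-\<^sub>s g)(X\<^sub>s) + \<integral>\<^sub>s\<^sup>t E [\<iota>(X\<^sub>u) B(u,X\<^sub>u) (P\<^sub>t\<^sub>-\<^sub>u g)'(X\<^sub>u)] du\<close>
  with the heat semigroup \<open>P\<close> of \<open>\<surd>2 W\<close>, also in the presence of a weight \<open>G\<close> that depends on the path up to time \<open>s\<close>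
  (\<open>mild_identity\<close>).

  The gradient of \<open>P\<^sub>t\<^sub>-\<^sub>u g\<close> is of the order \<open>(t-u)\<^sup>-\<^sup>1\<^sup>/\<^sup>2 sup |g|\<close>, which is integrable in time. Therefore, for large \<open>l\<close>, if two drifts
  differ by at most \<open>d exp(l u)\<close>, the expectations of \<open>g\<close> under the two solutions differ by at most a constant times
  \<open>l\<^sup>-\<^sup>1\<^sup>/\<^sup>2 d exp(l t) sup |g|\<close> (\<open>stability\<close>). A function on \<open>[0,\<infinity>)\<close> that vanishes at the origin extends to an odd one, so odd
  functions determine the laws of nonnegative processes. With \<open>d = 0\<close> and weights \<open>G\<close> that encode earlier times,
  this gives uniqueness for the linear problem (\<open>linear_solution_unique\<close>). Applied to the odd extension of \<open>\<iota>(y) b(t,x,y)\<close> in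
  \<open>y\<close>, it shows that for large \<open>l\<close> the fixed-point map halves distances in the norm with weight \<open>exp(-l t)\<close>
  (\<open>mean_drift_contraction\<close>).

  For existence, all drifts that occur are Lipschitz in \<open>x\<close> because \<open>\<partial>\<^sub>x b\<close> is bounded. For such a drift, the equation
  \<open>Y\<^sub>t = Z + \<surd>2 W\<^sub>t + \<integral>\<^sub>0\<^sup>t B(u,Y\<^sub>u) du\<close> is solved path by path, since the noise is additive, and \<open>X\<close> is \<open>Y\<close> absorbed at its first
  zero. Ito's formula for \<open>X\<close> is obtained without stochastic integrals: a Taylor expansion over one small time step
  (\<open>one_step\<close>) is summed over a grid, keeping only the steps that begin before absorption (\<open>Ito_formula\<close>). The Brownian motion
  comes from Kolmogorov's extension theorem for its dyadic increments (\<open>Brownian_motion_exists\<close>).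
\<close>

section \<open>Integrals over bounded time intervals\<close>

lemma set_integrable_bounded_interval:
  fixes f :: "real \<Rightarrow> real"
  assumes "f \<in> borel_measurable borel" and "\<And>u. a \<le> u \<Longrightarrow> u \<le> b \<Longrightarrow> \<bar>f u\<bar> \<le> K"
  shows "set_integrable lborel {a..b} f"
  unfolding set_integrable_def
  by (rule integrableI_bounded_set_indicator[where B=K]) (use assms in \<open>auto simp: emeasure_lborel_Icc_eq\<close>)

lemma set_integral_split:
  fixes f :: "real \<Rightarrow> real"
  assumes f: "set_integrable lborel {a..c} f" and ab: "a \<le> b" "b \<le> c"
  shows "(LINT u:{a..c}|lborel. f u) = (LINT u:{a..b}|lborel. f u) + (LINT u:{b..c}|lborel. f u)"
proof -
  have eq: "{a..c} = {a..b} \<union> {b..c}" using ab by auto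
  have "AE u in lborel. \<not> (u \<in> {a..b} \<and> u \<in> {b..c})"
    using AE_lborel_singleton[of b] by eventually_elim auto
  then show ?thesis
    unfolding eq by (rule set_integral_Un_AE) (use f ab in \<open>auto elim!: set_integrable_subset\<close>)
qed

lemma set_integral_interval_le:
  fixes f :: "real \<Rightarrow> real"
  assumes f: "f \<in> borel_measurable borel" and K: "\<And>u. a \<le> u \<Longrightarrow> u \<le> b \<Longrightarrow> \<bar>f u\<bar> \<le> K" and ab: "a \<le> b"
  shows "\<bar>LINT u:{a..b}|lborel. f u\<bar> \<le> K * (b - a)"
proof -
  have "\<bar>LINT u:{a..b}|lborel. f u\<bar> \<le> (LINT u:{a..b}|lborel. \<bar>f u\<bar>)"
    using set_integral_norm_bound[OF set_integrable_bounded_interval[OF f K]] by simp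
  also have "\<dots> \<le> (LINT u:{a..b}|lborel. K)"
    by (rule set_integral_mono) (use f K in \<open>auto intro!: set_integrable_bounded_interval[where K="\<bar>K\<bar>"] intro: order_trans[OF _ abs_ge_self]\<close>)
  also have "\<dots> = K * (b - a)"
    using ab by (simp add: set_lebesgue_integral_def)
  finally show ?thesis .
qed

text \<open>
  The integrand is bounded, so the integral is Lipschitz in its upper limit.
\<close>

lemma continuous_on_set_integral:
  fixes f :: "real \<Rightarrow> real"
  assumes f: "f \<in> borel_measurable borel" and K: "\<And>u. a \<le> u \<Longrightarrow> \<bar>f u\<bar> \<le> K"
  shows "continuous_on {a..} (\<lambda>t. LINT u:{a..t}|lborel. f u)"
proof -
  have K0: "0 \<le> K" using K[of a] by auto
  have *: "\<bar>(LINT u:{a..y}|lborel. f u) - (LINT u:{a..x}|lborel. f u)\<bar> \<le> K * (y - x)"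
    if "a \<le> x" "x \<le> y" for x y
    using set_integral_split[of a y f x] set_integrable_bounded_interval[OF f, of a y K]
      set_integral_interval_le[OF f, of x y K] K that by auto
  have "K-lipschitz_on {a..} (\<lambda>t. LINT u:{a..t}|lborel. f u)"
  proof (rule lipschitz_onI)
    fix x y :: real assume xy: "x \<in> {a..}" "y \<in> {a..}"
    show "dist (LINT u:{a..x}|lborel. f u) (LINT u:{a..y}|lborel. f u) \<le> K * dist x y"
      using *[of x y] *[of y x] xy unfolding dist_real_def by (cases "x \<le> y") (auto simp: abs_minus_commute)
  qed (rule K0)
  then show ?thesis by (rule lipschitz_on_continuous_on)
qed

text \<open>
  Discretisations in time converge along continuous paths, so the process is jointly measurable in time and \<open>\<omega>\<close>.
  Time is fed through a continuous clipping function \<open>c\<close> with values in the time set;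
  with values in \<open>[0,t]\<close> this gives progressive measurability.
\<close>

lemma measurable_continuous_process:
  fixes X :: "real \<Rightarrow> 'w \<Rightarrow> real" and c :: "real \<Rightarrow> real"
  assumes X: "\<And>r. r \<in> I \<Longrightarrow> X r \<in> borel_measurable N"
    and cont: "\<And>w. w \<in> space N \<Longrightarrow> continuous_on I (\<lambda>r. X r w)"
    and c: "continuous_on UNIV c" "\<And>u. c u \<in> I"
  shows "(\<lambda>(u, w). X (c u) w) \<in> borel_measurable (borel \<Otimes>\<^sub>M N)"
proof -
  define p where "p n u = c (real_of_int \<lfloor>real (Suc n) * u\<rfloor> / real (Suc n))" for n u
  have meas: "(\<lambda>(u, w). X (p n u) w) \<in> borel_measurable (borel \<Otimes>\<^sub>M N)" for n
  proof -
    have "(\<lambda>z. (\<lambda>i z. X (c (real_of_int i / real (Suc n))) (snd z)) \<lfloor>real (Suc n) * fst z\<rfloor> z)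
        \<in> borel_measurable (borel \<Otimes>\<^sub>M N)"
      by (rule measurable_compose_countable)
        (auto intro!: measurable_compose[OF measurable_snd X] c(2))
    then show ?thesis by (simp add: p_def case_prod_unfold)
  qed
  have lim: "(\<lambda>n. X (p n u) w) \<longlonglongrightarrow> X (c u) w" if "w \<in> space N" for u w
  proof -
    have fl: "(\<lambda>n. real_of_int \<lfloor>real (Suc n) * u\<rfloor> / real (Suc n)) \<longlonglongrightarrow> u"
    proof (rule tendsto_sandwich)
      have fl_bounds: "u - 1 / N \<le> real_of_int \<lfloor>N * u\<rfloor> / N \<and> real_of_int \<lfloor>N * u\<rfloor> / N \<le> u" if "N > 0" for N :: real
      proof -
        have "u * N \<le> 1 + real_of_int \<lfloor>N * u\<rfloor>" "real_of_int \<lfloor>N * u\<rfloor> \<le> u * N"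
          using floor_correct[of "N * u"] unfolding mult.commute[of u N] by linarith+
        then have "u \<le> (1 + real_of_int \<lfloor>N * u\<rfloor>) / N" "real_of_int \<lfloor>N * u\<rfloor> / N \<le> u"
          using that by (simp_all only: pos_le_divide_eq pos_divide_le_eq)
        then show ?thesis by (simp add: add_divide_distrib)
      qed
      show "eventually (\<lambda>n. u - 1 / real (Suc n) \<le> real_of_int \<lfloor>real (Suc n) * u\<rfloor> / real (Suc n)) sequentially"
        using fl_bounds by (intro always_eventually allI) (metis of_nat_0_less_iff zero_less_Suc)
      show "eventually (\<lambda>n. real_of_int \<lfloor>real (Suc n) * u\<rfloor> / real (Suc n) \<le> u) sequentially"
        using fl_bounds by (intro always_eventually allI) (metis of_nat_0_less_iff zero_less_Suc)
      show "(\<lambda>n. u - 1 / real (Suc n)) \<longlonglongrightarrow> u"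
        using tendsto_diff[OF tendsto_const[of u] LIMSEQ_inverse_real_of_nat] by (simp add: divide_inverse)
    qed simp
    have "(\<lambda>n. p n u) \<longlonglongrightarrow> c u"
      unfolding p_def using c(1) by (intro continuous_on_tendsto_compose[OF c(1) fl]) auto
    then show ?thesis
      by (intro continuous_on_tendsto_compose[OF cont[OF that]]) (auto simp: c(2) p_def)
  qed
  show ?thesis
    by (rule borel_measurable_LIMSEQ_real[where u="\<lambda>n (u, w). X (p n u) w"])
      (auto simp: space_pair_measure intro!: lim meas)
qed

lemma geometric_Cauchy:
  fixes a :: "nat \<Rightarrow> real"
  assumes q: "0 \<le> q" "q < 1" and a: "\<And>n. \<bar>a (Suc n) - a n\<bar> \<le> K * q ^ n"
  obtains l where "a \<longlonglongrightarrow> l" "\<And>n. \<bar>a n - l\<bar> \<le> K / (1 - q) * q ^ n"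
proof -
  define D where "D = K / (1 - q)"
  have KD: "K = D * (1 - q)" using q by (simp add: D_def)
  have D0: "0 \<le> D" using a[of 0] q by (simp add: D_def)
  have fin: "\<bar>a (n + m) - a n\<bar> \<le> D * q ^ n * (1 - q ^ m)" for n m
  proof (induction m)
    case (Suc m)
    have "\<bar>a (n + Suc m) - a n\<bar> \<le> D * (1 - q) * q ^ (n + m) + D * q ^ n * (1 - q ^ m)"
      using a[of "n + m"] Suc unfolding KD by simp
    then show ?case by (simp add: power_add algebra_simps)
  qed simp
  have fin': "\<bar>a (n + m) - a n\<bar> \<le> K / (1 - q) * q ^ n" for n m
    by (rule order_trans[OF fin]) (use D0 q in \<open>simp add: D_def[symmetric] mult_left_le\<close>)
  have "summable (\<lambda>n. a (Suc n) - a n)"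
    by (rule summable_comparison_test'[where g="\<lambda>n. K * q ^ n" and N=0])
      (use a q in \<open>auto intro!: summable_mult summable_geometric\<close>)
  then have "convergent (\<lambda>n. \<Sum>i<n. a (Suc i) - a i)"
    by (simp add: summable_iff_convergent)
  then have "convergent (\<lambda>n. (a n - a 0) + a 0)"
    by (intro convergent_add) (auto simp: sum_lessThan_telescope convergent_const)
  then obtain l where l: "a \<longlonglongrightarrow> l" by (auto simp: convergent_def)
  have "\<bar>a n - l\<bar> \<le> K / (1 - q) * q ^ n" for n
  proof -
    have "(\<lambda>m. \<bar>a (m + n) - a n\<bar>) \<longlonglongrightarrow> \<bar>l - a n\<bar>"
      by (intro tendsto_intros LIMSEQ_ignore_initial_segment l)
    then have "\<bar>l - a n\<bar> \<le> K / (1 - q) * q ^ n"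
      by (rule LIMSEQ_le_const2) (use fin'[of n] in \<open>auto simp: add.commute\<close>)
    then show ?thesis by (simp add: abs_minus_commute)
  qed
  with l that show ?thesis by blast
qed

lemma set_integral_bounded_tendsto:
  fixes f :: "nat \<Rightarrow> real \<Rightarrow> real"
  assumes f: "\<And>n. f n \<in> borel_measurable borel" and f': "f' \<in> borel_measurable borel"
    and K: "\<And>n u. a \<le> u \<Longrightarrow> u \<le> b \<Longrightarrow> \<bar>f n u\<bar> \<le> K"
    and lim: "\<And>u. a \<le> u \<Longrightarrow> u \<le> b \<Longrightarrow> (\<lambda>n. f n u) \<longlonglongrightarrow> f' u"
  shows "(\<lambda>n. LINT u:{a..b}|lborel. f n u) \<longlonglongrightarrow> (LINT u:{a..b}|lborel. f' u)"
  unfolding set_lebesgue_integral_def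
proof (rule integral_dominated_convergence[where w="\<lambda>u. indicator {a..b} u *\<^sub>R K"])
  show "AE u in lborel. (\<lambda>n. indicator {a..b} u *\<^sub>R f n u) \<longlonglongrightarrow> indicator {a..b} u *\<^sub>R f' u"
    using lim by (auto simp: indicator_def)
  show "AE u in lborel. norm (indicator {a..b} u *\<^sub>R f n u) \<le> indicator {a..b} u *\<^sub>R K" for n
    using K by (auto simp: indicator_def)
  show "integrable lborel (\<lambda>u. indicator {a..b} u *\<^sub>R K)"
    by (cases "a \<le> b") auto
qed (use f f' in auto)

lemma (in prob_space) integral_bounded_tendsto:
  fixes f :: "nat \<Rightarrow> 'a \<Rightarrow> real"
  assumes f: "\<And>n. f n \<in> borel_measurable M"
    and K: "\<And>n w. w \<in> space M \<Longrightarrow> \<bar>f n w\<bar> \<le> K"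
    and lim: "\<And>w. w \<in> space M \<Longrightarrow> (\<lambda>n. f n w) \<longlonglongrightarrow> f' w"
  shows "(\<lambda>n. LINT w|M. f n w) \<longlonglongrightarrow> (LINT w|M. f' w)"
proof (rule integral_dominated_convergence[where w="\<lambda>_. K"])
  show "f' \<in> borel_measurable M"
    using lim f by (rule borel_measurable_LIMSEQ_real)
qed (use assms in auto)

lemma (in prob_space) integrable_bounded:
  fixes f :: "'a \<Rightarrow> real"
  assumes "f \<in> borel_measurable M" "\<And>w. w \<in> space M \<Longrightarrow> \<bar>f w\<bar> \<le> K"
  shows "integrable M f"
  using assms by (intro integrable_const_bound[where B=K]) auto

lemma (in prob_space) abs_integral_le:
  fixes f :: "'a \<Rightarrow> real"
  assumes K: "AE w in M. \<bar>f w\<bar> \<le> K" and "0 \<le> K"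
  shows "\<bar>LINT w|M. f w\<bar> \<le> K"
proof (cases "integrable M f")
  case True
  have "\<bar>LINT w|M. f w\<bar> \<le> (LINT w|M. \<bar>f w\<bar>)"
    using integral_norm_bound[of M f] by simp
  also have "\<dots> \<le> (LINT w|M. K)"
    using True K by (intro integral_mono_AE) auto
  finally show ?thesis by (simp add: prob_space)
qed (use assms in \<open>simp add: not_integrable_integral_eq\<close>)

lemma measurable_time_integral:
  fixes F :: "real \<Rightarrow> 'a \<Rightarrow> real"
  assumes F: "(\<lambda>(u, w). F u w) \<in> borel_measurable (borel \<Otimes>\<^sub>M N)"
  shows "(\<lambda>w. LINT u:{a..b}|lborel. F u w) \<in> borel_measurable N"
proof -
  have "(\<lambda>(u, w). F u w) \<in> borel_measurable (lborel \<Otimes>\<^sub>M N)"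
    using F by (simp cong: measurable_cong_sets sets_pair_measure_cong)
  from measurable_pair_swap[OF this] have [measurable]: "(\<lambda>(w, u). F u w) \<in> borel_measurable (N \<Otimes>\<^sub>M lborel)"
    by (simp add: case_prod_unfold)
  show ?thesis unfolding set_lebesgue_integral_def by measurable
qed

lemma (in prob_space) time_integral:
  fixes F :: "real \<Rightarrow> 'a \<Rightarrow> real"
  assumes F[measurable]: "(\<lambda>(u, w). F u w) \<in> borel_measurable (borel \<Otimes>\<^sub>M M)"
    and K: "\<And>u w. a \<le> u \<Longrightarrow> u \<le> b \<Longrightarrow> w \<in> space M \<Longrightarrow> \<bar>F u w\<bar> \<le> K"
  shows time_integral_Fubini: "(LINT w|M. (LINT u:{a..b}|lborel. F u w)) = (LINT u:{a..b}|lborel. (LINT w|M. F u w))"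
    and expectation_measurable: "(\<lambda>u. LINT w|M. F u w) \<in> borel_measurable borel"
proof -
  interpret P: pair_sigma_finite lborel M by unfold_locales
  have [measurable]: "(\<lambda>(u, w). F u w) \<in> borel_measurable (lborel \<Otimes>\<^sub>M M)"
    using F by (simp cong: measurable_cong_sets sets_pair_measure_cong)
  have "(\<lambda>u. LINT w|M. F u w) \<in> borel_measurable lborel" by measurable
  then show "(\<lambda>u. LINT w|M. F u w) \<in> borel_measurable borel" by simp
  have "integrable (lborel \<Otimes>\<^sub>M M) (\<lambda>z. indicator ({a..b} \<times> space M) z *\<^sub>R (case z of (u, w) \<Rightarrow> F u w))"
  proof (rule integrableI_bounded_set_indicator[where B=K])
    show "emeasure (lborel \<Otimes>\<^sub>M M) ({a..b} \<times> space M) < \<infinity>"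
      by (cases "a \<le> b") (simp_all add: emeasure_pair_measure_Times emeasure_space_1)
  qed (use K in \<open>auto\<close>)
  then have int: "integrable (lborel \<Otimes>\<^sub>M M) (\<lambda>(u, w). indicator {a..b} u *\<^sub>R F u w)"
    by (subst Bochner_Integration.integrable_cong[where g="\<lambda>z. indicator ({a..b} \<times> space M) z *\<^sub>R (case z of (u, w) \<Rightarrow> F u w)"])
      (auto simp: space_pair_measure indicator_def)
  show "(LINT w|M. (LINT u:{a..b}|lborel. F u w)) = (LINT u:{a..b}|lborel. (LINT w|M. F u w))"
    unfolding set_lebesgue_integral_def using P.Fubini_integral[OF int]
    by (simp flip: integral_mult_right_zero)
qed

lemma (in prob_space) abs_expectation_le:
  fixes f :: "'a \<Rightarrow> real"
  assumes K: "\<And>w. w \<in> space M \<Longrightarrow> \<bar>f w\<bar> \<le> K"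
  shows "\<bar>LINT w|M. f w\<bar> \<le> K"
proof (rule abs_integral_le)
  show "0 \<le> K" using not_empty K by (meson abs_ge_zero ex_in_conv order_trans)
qed (use K in auto)

section \<open>Solutions with a prescribed drift\<close>

locale path_drift = prob_space Q for Q :: "(real \<Rightarrow> real) measure" +
  fixes B :: "real \<Rightarrow> real \<Rightarrow> real" and C :: real
  assumes sets_Q: "sets Q = sets path_space"
    and drift_measurable: "(\<lambda>(u, x). B u x) \<in> borel_measurable (borel \<Otimes>\<^sub>M borel)"
    and drift_bounded: "\<And>u x. \<bar>B u x\<bar> \<le> C"

text \<open>
  The linear martingale problem for a given drift. Instead of a conditional expectation given the past of \<open>s\<close>, it uses
  bounded weights \<open>G\<close> that are measurable with respect to this past. Such weights can be carried through integrals over time, and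
  in the proof of uniqueness they become the indicators of earlier positions.
\<close>

locale linear_solution = path_drift Q B C for Q B C +
  assumes nonneg: "\<And>t. 0 \<le> t \<Longrightarrow> AE w in Q. 0 \<le> w t"
    and martingale_problem: "\<And>\<phi> s t G. C2_compact_support \<phi> \<Longrightarrow> 0 \<le> s \<Longrightarrow> s \<le> t \<Longrightarrow>
        G \<in> borel_measurable (canonical_filtration s) \<Longrightarrow> (\<And>w. \<bar>G w\<bar> \<le> 1) \<Longrightarrow>
        (LINT w|Q. G w * (\<phi> (w t) - \<phi> (w s) -
          (LINT u:{s..t}|lborel. iota (w u) * (deriv \<phi> (w u) * B u (w u) + deriv (deriv \<phi>) (w u))))) = 0"

lemma iota_cases: "iota x = (if 0 < x then 1 else 0)"
  by (simp add: iota_def)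

lemma iota_measurable[measurable]: "iota \<in> borel_measurable borel"
  unfolding iota_def[abs_def] by measurable

lemma measurable_canonical_imp_path:
  "G \<in> borel_measurable (canonical_filtration s) \<Longrightarrow> G \<in> borel_measurable path_space"
  by (rule measurable_from_subalg[OF subalgebra_canonical])

context path_drift
begin

lemma space_Q: "space Q = space path_space"
  using sets_Q by (rule sets_eq_imp_space_eq)

lemma canonical_measurable: "G \<in> borel_measurable (canonical_filtration s) \<Longrightarrow> G \<in> borel_measurable Q"
  using measurable_canonical_imp_path measurable_cong_sets[OF sets_Q refl] by blast

lemma eval_measurable: "0 \<le> s \<Longrightarrow> (\<lambda>w. w s) \<in> borel_measurable Q"
  using measurable_path_eval measurable_cong_sets[OF sets_Q refl] by blast

lemma path_continuous: "w \<in> space Q \<Longrightarrow> continuous_on {0..} w"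
  by (simp add: space_Q space_path_space)

lemma eval_max_measurable: "(\<lambda>(u, w). w (max 0 u)) \<in> borel_measurable (borel \<Otimes>\<^sub>M Q)"
  by (rule measurable_continuous_process[where I="{0..}" and X="\<lambda>r w. w r"])
    (auto intro: eval_measurable path_continuous continuous_intros)

lemma eval_max_measurable': "(\<lambda>w. w (max 0 u)) \<in> borel_measurable Q"
  by (rule eval_measurable) auto

lemma measurable_drift_compose:
  "f \<in> borel_measurable N \<Longrightarrow> g \<in> borel_measurable N \<Longrightarrow> (\<lambda>x. B (f x) (g x)) \<in> borel_measurable N"
  using measurable_compose[OF measurable_Pair drift_measurable] by simp

lemma measurable_generator:
  assumes q: "q \<in> borel_measurable N" and v: "v \<in> borel_measurable N"
    and a: "a \<in> borel_measurable borel" and e: "e \<in> borel_measurable borel"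
  shows "(\<lambda>z. iota (q z) * (a (q z) * B (v z) (q z) + e (q z))) \<in> borel_measurable N"
  by (intro borel_measurable_times borel_measurable_add measurable_drift_compose v q
        measurable_compose[OF q iota_measurable] measurable_compose[OF q a] measurable_compose[OF q e])

lemma drift_nonneg: "0 \<le> C"
  using drift_bounded[of 0 0] by linarith

end

section \<open>Cut-off functions\<close>

text \<open>
  The exponent is at least two, so the kink of the positive part at the origin does no harm.
\<close>

lemma DERIV_pos_part_power:
  "((\<lambda>u::real. max 0 u ^ Suc (Suc n)) has_real_derivative (real (Suc (Suc n)) * max 0 u ^ Suc n)) (at u)"
proof -
  consider "u > 0" | "u < 0" | "u = 0" by linarith
  then show ?thesis
  proof cases
    case 1
    have "((\<lambda>u::real. u ^ Suc (Suc n)) has_real_derivative (real (Suc (Suc n)) * u ^ Suc n)) (at u)"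
      by (rule derivative_eq_intros refl | simp)+
    then have "((\<lambda>u::real. max 0 u ^ Suc (Suc n)) has_real_derivative (real (Suc (Suc n)) * u ^ Suc n)) (at u)"
      by (rule has_field_derivative_transform_within_open[where S="{0<..}"]) (use 1 in auto)
    then show ?thesis using 1 by simp
  next
    case 2
    have "((\<lambda>u::real. 0) has_real_derivative 0) (at u)" by simp
    then have "((\<lambda>u::real. max 0 u ^ Suc (Suc n)) has_real_derivative 0) (at u)"
      by (rule has_field_derivative_transform_within_open[where S="{..<0}"]) (use 2 in auto)
    then show ?thesis using 2 by simp
  next
    case 3
    have "((\<lambda>h::real. max 0 h ^ Suc (Suc n) / h) \<longlongrightarrow> 0) (at 0)"
    proof (rule Lim_null_comparison)
      show "eventually (\<lambda>h::real. norm (max 0 h ^ Suc (Suc n) / h) \<le> max 0 h ^ Suc n) (at 0)"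
        by (auto simp: eventually_at_filter max_def)
      show "((\<lambda>h::real. max 0 h ^ Suc n) \<longlongrightarrow> 0) (at 0)"
        by (rule tendsto_eq_intros refl | simp)+
    qed
    then show ?thesis using 3 by (simp add: DERIV_def)
  qed
qed

text \<open>
  A cut-off at scale \<open>N\<close>, supported in \<open>[-N, N]\<close>. The third power is the smallest one for which it is twice continuously
  differentiable, and its two derivatives are polynomial expressions in \<open>x\<close> and the positive part.
\<close>

definition bump :: "real \<Rightarrow> real \<Rightarrow> real" where
  "bump N x = max 0 (1 - (x / N)\<^sup>2) ^ 3"

definition bump' :: "real \<Rightarrow> real \<Rightarrow> real" where
  "bump' N x = 3 * max 0 (1 - (x / N)\<^sup>2) ^ 2 * (- 2 * (x / N) / N)"

definition bump'' :: "real \<Rightarrow> real \<Rightarrow> real" where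
  "bump'' N x = 6 * max 0 (1 - (x / N)\<^sup>2) * (- 2 * (x / N) / N)\<^sup>2 + 3 * max 0 (1 - (x / N)\<^sup>2) ^ 2 * (- 2 / N\<^sup>2)"

lemma DERIV_bump: "N > 0 \<Longrightarrow> (bump N has_real_derivative bump' N x) (at x)"
proof -
  assume N: "N > 0"
  have "((\<lambda>x. 1 - (x / N)\<^sup>2) has_real_derivative (- 2 * (x / N) / N)) (at x)"
    using N by (auto intro!: derivative_eq_intros simp: power2_eq_square)
  from DERIV_chain2[OF DERIV_pos_part_power[of 1] this]
  show ?thesis unfolding bump_def[abs_def] bump'_def by (simp add: numeral_eq_Suc)
qed

lemma DERIV_bump': "N > 0 \<Longrightarrow> (bump' N has_real_derivative bump'' N x) (at x)"
proof -
  assume N: "N > 0"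
  have d: "((\<lambda>x. 1 - (x / N)\<^sup>2) has_real_derivative (- 2 * (x / N) / N)) (at x)"
    using N by (auto intro!: derivative_eq_intros simp: power2_eq_square)
  have "((\<lambda>x. max 0 (1 - (x / N)\<^sup>2) ^ 2) has_real_derivative 2 * max 0 (1 - (x / N)\<^sup>2) * (- 2 * (x / N) / N)) (at x)"
    using DERIV_chain2[OF DERIV_pos_part_power[of 0] d] by (simp add: numeral_eq_Suc)
  moreover have "((\<lambda>x. - 2 * (x / N) / N) has_real_derivative (- 2 / N\<^sup>2)) (at x)"
    using N by (auto intro!: derivative_eq_intros simp: power2_eq_square)
  ultimately have "((\<lambda>x. 3 * (max 0 (1 - (x / N)\<^sup>2) ^ 2 * (- 2 * (x / N) / N))) has_real_derivative
      3 * ((2 * max 0 (1 - (x / N)\<^sup>2) * (- 2 * (x / N) / N)) * (- 2 * (x / N) / N) + (- 2 / N\<^sup>2) * max 0 (1 - (x / N)\<^sup>2) ^ 2)) (at x)"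
    by (intro DERIV_cmult DERIV_mult)
  then show ?thesis
    unfolding bump'_def[abs_def] bump''_def by (simp add: algebra_simps power2_eq_square)
qed

lemma continuous_bump'': "N > 0 \<Longrightarrow> continuous_on UNIV (bump'' N)"
  unfolding bump''_def[abs_def] by (intro continuous_intros) auto

lemma bump_zero: "N > 0 \<Longrightarrow> \<bar>x\<bar> > N \<Longrightarrow> bump N x = 0"
proof -
  assume "N > 0" "\<bar>x\<bar> > N"
  then have "1 \<le> (x / N)\<^sup>2" by (subst abs_le_square_iff[of 1, simplified, symmetric]) (simp add: pos_le_divide_eq)
  then show ?thesis by (simp add: bump_def)
qed

lemma bump_bounds:
  assumes N: "N \<ge> 1"
  shows "\<bar>bump N x\<bar> \<le> 1" "\<bar>bump' N x\<bar> \<le> 6" "\<bar>bump'' N x\<bar> \<le> 30"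
proof -
  define y where "y = x / N"
  define m where "m = max 0 (1 - y\<^sup>2)"
  have m: "0 \<le> m" "m \<le> 1" by (auto simp: m_def)
  have m2: "0 \<le> m\<^sup>2" "m\<^sup>2 \<le> 1" using m by (auto simp: power_le_one)
  have iN: "0 \<le> 1 / N" "1 / N \<le> 1" using N by auto
  have "\<bar>bump N x\<bar> = m ^ 3" using m by (simp add: bump_def m_def y_def)
  then show "\<bar>bump N x\<bar> \<le> 1" using m by (simp add: power_le_one)
  show "\<bar>bump' N x\<bar> \<le> 6" "\<bar>bump'' N x\<bar> \<le> 30"
  proof -
    have "\<bar>bump' N x\<bar> \<le> 6 \<and> \<bar>bump'' N x\<bar> \<le> 30"
    proof (cases "\<bar>y\<bar> \<le> 1")
      case True
      define z where "z = - 2 * y / N"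
      have z: "\<bar>z\<bar> \<le> 2" using True N by (simp add: z_def abs_mult pos_divide_le_eq)
      then have z2: "z\<^sup>2 \<le> 4" using power_mono[OF z, of 2] by simp
      have "\<bar>bump' N x\<bar> = 3 * m\<^sup>2 * \<bar>z\<bar>" by (simp add: bump'_def m_def y_def z_def abs_mult)
      also have "\<dots> \<le> 3 * 1 * 2" using m2 z by (intro mult_mono) auto
      finally have 1: "\<bar>bump' N x\<bar> \<le> 6" by simp
      have n2: "2 / N\<^sup>2 \<le> 2" using N by (simp add: field_simps)
      have b2: "bump'' N x = 6 * m * z\<^sup>2 + 3 * m\<^sup>2 * (- 2 / N\<^sup>2)"
        by (simp only: bump''_def m_def y_def z_def)
      have "\<bar>bump'' N x\<bar> \<le> 6 * m * z\<^sup>2 + 3 * m\<^sup>2 * (2 / N\<^sup>2)"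
        unfolding b2 using m by (intro order_trans[OF abs_triangle_ineq]) (simp add: abs_mult)
      also have "\<dots> \<le> 6 * 1 * 4 + 3 * 1 * 2"
        using m m2 z2 n2 by (intro add_mono mult_mono) auto
      finally show ?thesis using 1 by simp
    next
      case False
      then have "1 \<le> y\<^sup>2" by (subst abs_le_square_iff[of 1, simplified, symmetric]) simp
      then show ?thesis by (simp add: bump'_def bump''_def y_def[symmetric])
    qed
    then show "\<bar>bump' N x\<bar> \<le> 6" "\<bar>bump'' N x\<bar> \<le> 30" by auto
  qed
qed

lemma bump_tendsto:
  "(\<lambda>n. bump (real (Suc n)) x) \<longlonglongrightarrow> 1" "(\<lambda>n. bump' (real (Suc n)) x) \<longlonglongrightarrow> 0" "(\<lambda>n. bump'' (real (Suc n)) x) \<longlonglongrightarrow> 0"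
proof -
  have i: "(\<lambda>n. 1 / real (Suc n)) \<longlonglongrightarrow> 0"
    using LIMSEQ_inverse_real_of_nat by (simp add: divide_inverse)
  have y: "(\<lambda>n. x / real (Suc n)) \<longlonglongrightarrow> 0"
    using tendsto_mult_left[OF i, of x] by simp
  have z: "(\<lambda>n. - 2 * (x / real (Suc n)) / real (Suc n)) \<longlonglongrightarrow> 0"
    using tendsto_mult[OF tendsto_mult_left[OF y, of "-2"] i] by simp
  have w: "(\<lambda>n. - 2 / (real (Suc n))\<^sup>2) \<longlonglongrightarrow> 0"
    using tendsto_mult_left[OF tendsto_mult[OF i i], of "-2"] by (simp add: power2_eq_square)
  have m: "(\<lambda>n. max 0 (1 - (x / real (Suc n))\<^sup>2)) \<longlonglongrightarrow> 1"
    using tendsto_max[OF tendsto_const[of 0] tendsto_diff[OF tendsto_const[of 1] tendsto_power[OF y, of 2]]] by simp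
  show "(\<lambda>n. bump (real (Suc n)) x) \<longlonglongrightarrow> 1"
    unfolding bump_def using tendsto_power[OF m, of 3] by simp
  show "(\<lambda>n. bump' (real (Suc n)) x) \<longlonglongrightarrow> 0"
    unfolding bump'_def using tendsto_mult[OF tendsto_mult_left[OF tendsto_power[OF m, of 2], of 3] z] by simp
  show "(\<lambda>n. bump'' (real (Suc n)) x) \<longlonglongrightarrow> 0"
    unfolding bump''_def
    using tendsto_add[OF tendsto_mult[OF tendsto_mult_left[OF m, of 6] tendsto_power[OF z, of 2]]
        tendsto_mult[OF tendsto_mult_left[OF tendsto_power[OF m, of 2], of 3] w]] by simp
qed

lemma C2_cutoff:
  assumes N: "N > 0" and \<phi>: "\<And>x. (\<phi> has_real_derivative \<phi>' x) (at x)"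
    and \<phi>': "\<And>x. (\<phi>' has_real_derivative \<phi>'' x) (at x)" and cont: "continuous_on UNIV \<phi>''"
  defines "f \<equiv> \<lambda>x. bump N x * \<phi> x"
  shows "C2_compact_support f"
    and "deriv f = (\<lambda>x. bump' N x * \<phi> x + bump N x * \<phi>' x)"
    and "deriv (deriv f) = (\<lambda>x. bump'' N x * \<phi> x + 2 * (bump' N x * \<phi>' x) + bump N x * \<phi>'' x)"
proof -
  have d1: "(f has_real_derivative (bump' N x * \<phi> x + bump N x * \<phi>' x)) (at x)" for x
    unfolding f_def by (rule derivative_eq_intros DERIV_bump N \<phi> refl | simp)+
  then show e1: "deriv f = (\<lambda>x. bump' N x * \<phi> x + bump N x * \<phi>' x)"
    by (intro ext DERIV_imp_deriv)
  have d2: "(deriv f has_real_derivative (bump'' N x * \<phi> x + 2 * (bump' N x * \<phi>' x) + bump N x * \<phi>'' x)) (at x)" for x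
    unfolding e1 by (rule derivative_eq_intros DERIV_bump DERIV_bump' N \<phi> \<phi>' refl | simp)+
  then show e2: "deriv (deriv f) = (\<lambda>x. bump'' N x * \<phi> x + 2 * (bump' N x * \<phi>' x) + bump N x * \<phi>'' x)"
    by (intro ext DERIV_imp_deriv)
  have "continuous_on UNIV (bump N)" "continuous_on UNIV (bump' N)" "continuous_on UNIV \<phi>" "continuous_on UNIV \<phi>'"
    by (intro continuous_at_imp_continuous_on ballI; rule DERIV_isCont, rule DERIV_bump[OF N] DERIV_bump'[OF N] \<phi> \<phi>')+
  then have c: "continuous_on UNIV (deriv (deriv f))"
    unfolding e2 by (intro continuous_intros continuous_bump'' N cont)
  have "{x. f x \<noteq> 0} \<subseteq> {-N..N}" using bump_zero[OF N] by (force simp: f_def)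
  then have "compact (closure {x. f x \<noteq> 0})"
    by (simp add: compact_closure) (meson bounded_closed_interval bounded_subset)
  then show "C2_compact_support f"
    unfolding C2_compact_support_def using d1 d2 c by (auto simp: real_differentiable_def)
qed

section \<open>Testing with bounded functions\<close>

context linear_solution
begin

text \<open>
  Cut-offs at scales tending to infinity and dominated convergence extend the martingale problem from compactly supported
  test functions to functions that are merely bounded together with two derivatives, such as sines.
\<close>

lemma expectation_smooth:
  assumes st: "0 \<le> s" "s \<le> t" and G: "G \<in> borel_measurable (canonical_filtration s)" "\<And>w. \<bar>G w\<bar> \<le> 1"
    and \<phi>: "\<And>x. (\<phi> has_real_derivative \<phi>' x) (at x)"
    and \<phi>': "\<And>x. (\<phi>' has_real_derivative \<phi>'' x) (at x)" and cont: "continuous_on UNIV \<phi>''"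
    and K: "\<And>x. \<bar>\<phi> x\<bar> \<le> K" "\<And>x. \<bar>\<phi>' x\<bar> \<le> K" "\<And>x. \<bar>\<phi>'' x\<bar> \<le> K"
  shows "(LINT w|Q. G w * \<phi> (w t)) - (LINT w|Q. G w * \<phi> (w s)) =
    (LINT u:{s..t}|lborel. (LINT w|Q. G w * (iota (w (max 0 u)) * (\<phi>' (w (max 0 u)) * B u (w (max 0 u)) + \<phi>'' (w (max 0 u))))))"
proof -
  define c where "c n = bump (real (Suc n))" for n
  define c' where "c' n = bump' (real (Suc n))" for n
  define c'' where "c'' n = bump'' (real (Suc n))" for n
  define f where "f n x = c n x * \<phi> x" for n x
  define f' where "f' n x = c' n x * \<phi> x + c n x * \<phi>' x" for n x
  define f'' where "f'' n x = c'' n x * \<phi> x + 2 * (c' n x * \<phi>' x) + c n x * \<phi>'' x" for n x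
  have C2: "C2_compact_support (f n)" and df: "deriv (f n) = f' n" and ddf: "deriv (deriv (f n)) = f'' n" for n
    using C2_cutoff[OF _ \<phi> \<phi>' cont, of "real (Suc n)"]
    by (simp_all add: f_def[abs_def] f'_def[abs_def] f''_def[abs_def] c_def c'_def c''_def)
  have K0: "0 \<le> K" using K(1)[of 0] by linarith
  have cb: "\<bar>c n x\<bar> \<le> 1" "\<bar>c' n x\<bar> \<le> 6" "\<bar>c'' n x\<bar> \<le> 30" for n x
    unfolding c_def c'_def c''_def by (rule bump_bounds; simp)+
  have mm: "\<bar>a * b\<bar> \<le> k * K" if "\<bar>a\<bar> \<le> k" "\<bar>b\<bar> \<le> K" for a b k
    unfolding abs_mult using that by (intro mult_mono) auto
  have fb: "\<bar>f n x\<bar> \<le> K" "\<bar>f' n x\<bar> \<le> 7 * K" "\<bar>f'' n x\<bar> \<le> 43 * K" for n x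
    using mm[OF cb(1) K(1), of n x x] mm[OF cb(2) K(1), of n x x] mm[OF cb(1) K(2), of n x x]
      mm[OF cb(3) K(1), of n x x] mm[OF cb(2) K(2), of n x x] mm[OF cb(1) K(3), of n x x] K0
    unfolding f_def f'_def f''_def by linarith+
  have fl: "(\<lambda>n. f n x) \<longlonglongrightarrow> \<phi> x" "(\<lambda>n. f' n x) \<longlonglongrightarrow> \<phi>' x" "(\<lambda>n. f'' n x) \<longlonglongrightarrow> \<phi>'' x" for x
    unfolding f_def f'_def f''_def c_def c'_def c''_def
    by (rule tendsto_eq_intros bump_tendsto refl | simp)+
  have isc: "continuous_on UNIV \<phi>" "continuous_on UNIV \<phi>'"
    by (intro continuous_at_imp_continuous_on ballI; rule DERIV_isCont, rule \<phi> \<phi>')+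
  have pm0[measurable]: "\<phi> \<in> borel_measurable borel" "\<phi>' \<in> borel_measurable borel" "\<phi>'' \<in> borel_measurable borel"
    by (rule borel_measurable_continuous_onI, rule isc cont)+
  have cm: "c n \<in> borel_measurable borel" "c' n \<in> borel_measurable borel" "c'' n \<in> borel_measurable borel" for n
    unfolding c_def[abs_def] c'_def[abs_def] c''_def[abs_def] bump_def[abs_def] bump'_def[abs_def] bump''_def[abs_def]
    by measurable
  note cm[measurable]
  have fm: "f n \<in> borel_measurable borel" "f' n \<in> borel_measurable borel" "f'' n \<in> borel_measurable borel" for n
    unfolding f_def[abs_def] f'_def[abs_def] f''_def[abs_def]
    by (intro borel_measurable_add borel_measurable_times borel_measurable_const cm pm0)+
  note fm[measurable]
  have Gm[measurable]: "G \<in> borel_measurable Q" using G(1) by (rule canonical_measurable)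
  define p where "p u w = w (max 0 u)" for u :: real and w :: "real \<Rightarrow> real"
  have p2[measurable]: "(\<lambda>(u, w). p u w) \<in> borel_measurable (borel \<Otimes>\<^sub>M Q)" "p u \<in> borel_measurable Q" for u
    unfolding p_def[abs_def] by (rule eval_max_measurable eval_max_measurable')+
  have pm: "(\<lambda>u. p u w) \<in> borel_measurable borel" if "w \<in> space Q" for w
    using measurable_Pair1[OF p2(1) that] by (simp only: prod.case)
  define L where "L n u w = iota (p u w) * (f' n (p u w) * B u (p u w) + f'' n (p u w))" for n u w
  define L' where "L' u w = iota (p u w) * (\<phi>' (p u w) * B u (p u w) + \<phi>'' (p u w))" for u w
  define KL where "KL = 7 * K * C + 43 * K"
  have ib: "\<bar>iota x * (a * B u y + b)\<bar> \<le> KL" if "\<bar>a\<bar> \<le> 7 * K" "\<bar>b\<bar> \<le> 43 * K" for x a u y b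
  proof -
    have "\<bar>a * B u y\<bar> \<le> 7 * K * C" unfolding abs_mult using that K0 by (intro mult_mono drift_bounded) auto
    then have "\<bar>a * B u y + b\<bar> \<le> KL" using that by (simp add: KL_def)
    moreover have "0 \<le> KL" using K0 drift_nonneg by (simp add: KL_def)
    ultimately show ?thesis by (simp add: iota_cases)
  qed
  have Lb: "\<bar>L n u w\<bar> \<le> KL" for n u w unfolding L_def by (intro ib fb)
  have Lb': "\<bar>L' u w\<bar> \<le> KL" for u w unfolding L'_def using K(2,3)[of "p u w"] K0 by (intro ib) linarith+
  have Lm: "(\<lambda>u. L n u w) \<in> borel_measurable borel" "(\<lambda>u. L' u w) \<in> borel_measurable borel" if "w \<in> space Q" for n w
    unfolding L_def L'_def
    by (rule measurable_generator[OF pm[OF that] measurable_ident_sets[OF refl] fm(2,3)],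
        rule measurable_generator[OF pm[OF that] measurable_ident_sets[OF refl] pm0(2,3)])
  have p2': "(\<lambda>z. p (fst z) (snd z)) \<in> borel_measurable (borel \<Otimes>\<^sub>M Q)"
    using p2(1) unfolding case_prod_unfold .
  have Lm2: "(\<lambda>(u, w). L n u w) \<in> borel_measurable (borel \<Otimes>\<^sub>M Q)" for n
    unfolding L_def case_prod_unfold by (rule measurable_generator[OF p2' measurable_fst fm(2,3)])
  have Lm2': "(\<lambda>(u, w). L' u w) \<in> borel_measurable (borel \<Otimes>\<^sub>M Q)"
    unfolding L'_def case_prod_unfold by (rule measurable_generator[OF p2' measurable_fst pm0(2,3)])
  have Lint: "(LINT u:{s..t}|lborel. iota (w u) * (deriv (f n) (w u) * B u (w u) + deriv (deriv (f n)) (w u)))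
      = (LINT u:{s..t}|lborel. L n u w)" for n w
    unfolding L_def p_def df ddf[unfolded df] using st by (intro set_lebesgue_integral_cong) auto
  have wst: "p s w = w s" "p t w = w t" for w using st by (simp_all add: p_def max_def)
  have Lmeas: "(\<lambda>w. LINT u:{s..t}|lborel. L n u w) \<in> borel_measurable Q" for n
    by (rule measurable_time_integral[OF Lm2])
  have Lmeas': "(\<lambda>w. LINT u:{s..t}|lborel. L' u w) \<in> borel_measurable Q"
    by (rule measurable_time_integral[OF Lm2'])
  have zero: "(LINT w|Q. G w * (f n (p t w) - f n (p s w) - (LINT u:{s..t}|lborel. L n u w))) = 0" for n
    using martingale_problem[OF C2 st G, of n] unfolding Lint wst .
  have intb: "\<bar>LINT u:{s..t}|lborel. L n u w\<bar> \<le> KL * (t - s)" if "w \<in> space Q" for n w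
    using Lm[OF that] Lb st by (intro set_integral_interval_le) auto
  have "(\<lambda>n. LINT w|Q. G w * (f n (p t w) - f n (p s w) - (LINT u:{s..t}|lborel. L n u w))) \<longlonglongrightarrow>
      (LINT w|Q. G w * (\<phi> (p t w) - \<phi> (p s w) - (LINT u:{s..t}|lborel. L' u w)))"
  proof (rule integral_bounded_tendsto)
    fix n w assume w: "w \<in> space Q"
    have "\<bar>f n (p t w) - f n (p s w) - (LINT u:{s..t}|lborel. L n u w)\<bar> \<le> K + K + KL * (t - s)"
      using fb(1)[of n "p t w"] fb(1)[of n "p s w"] intb[OF w, of n] by linarith
    then show "\<bar>G w * (f n (p t w) - f n (p s w) - (LINT u:{s..t}|lborel. L n u w))\<bar> \<le> 1 * (K + K + KL * (t - s))"
      unfolding abs_mult using G(2)[of w] by (intro mult_mono) auto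
  next
    fix w assume w: "w \<in> space Q"
    have "(\<lambda>n. LINT u:{s..t}|lborel. L n u w) \<longlonglongrightarrow> (LINT u:{s..t}|lborel. L' u w)"
      by (rule set_integral_bounded_tendsto[where K=KL])
        (intro Lm w Lb, intro Lm w, intro Lb, unfold L_def L'_def, intro tendsto_intros fl)
    then show "(\<lambda>n. G w * (f n (p t w) - f n (p s w) - (LINT u:{s..t}|lborel. L n u w))) \<longlonglongrightarrow>
        G w * (\<phi> (p t w) - \<phi> (p s w) - (LINT u:{s..t}|lborel. L' u w))"
      by (intro tendsto_intros fl)
  next
    show "(\<lambda>w. G w * (f n (p t w) - f n (p s w) - (LINT u:{s..t}|lborel. L n u w))) \<in> borel_measurable Q" for n
      by (intro borel_measurable_times borel_measurable_diff Gm Lmeas measurable_compose[OF p2(2) fm(1)])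
  qed
  then have eq: "(LINT w|Q. G w * (\<phi> (p t w) - \<phi> (p s w) - (LINT u:{s..t}|lborel. L' u w))) = 0"
    unfolding zero by (simp add: LIMSEQ_const_iff)
  have Gb: "\<bar>G w * a\<bar> \<le> k" if "\<bar>a\<bar> \<le> k" for w a k
    using mult_mono[OF G(2)[of w] that] by (simp add: abs_mult)
  have i1: "integrable Q (\<lambda>w. G w * \<phi> (p t w))" "integrable Q (\<lambda>w. G w * \<phi> (p s w))"
    by (rule integrable_bounded[where K=K], intro borel_measurable_times Gm measurable_compose[OF p2(2) pm0(1)], intro Gb K)+
  have intb': "\<bar>LINT u:{s..t}|lborel. L' u w\<bar> \<le> KL * (t - s)" if "w \<in> space Q" for w
    using Lm[OF that] Lb' st by (intro set_integral_interval_le) auto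
  have i2: "integrable Q (\<lambda>w. G w * (LINT u:{s..t}|lborel. L' u w))"
    by (rule integrable_bounded[where K="KL * (t - s)"]) (intro borel_measurable_times Gm Lmeas', intro Gb intb', assumption)
  have "(LINT w|Q. G w * \<phi> (p t w)) - (LINT w|Q. G w * \<phi> (p s w)) = (LINT w|Q. G w * (LINT u:{s..t}|lborel. L' u w))"
    using eq unfolding right_diff_distrib
    by (subst (asm) Bochner_Integration.integral_diff[OF Bochner_Integration.integrable_diff[OF i1] i2],
        subst (asm) Bochner_Integration.integral_diff[OF i1]) linarith
  also have "\<dots> = (LINT w|Q. (LINT u:{s..t}|lborel. G w * L' u w))"
    by (simp only: set_integral_mult_right)
  also have "\<dots> = (LINT u:{s..t}|lborel. (LINT w|Q. G w * L' u w))"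
  proof (rule time_integral_Fubini[where K=KL])
    show "(\<lambda>(u, w). G w * L' u w) \<in> borel_measurable (borel \<Otimes>\<^sub>M Q)"
      using borel_measurable_times[OF measurable_compose[OF measurable_snd Gm] Lm2'] by (simp add: case_prod_unfold)
  qed (intro Gb Lb')
  finally show ?thesis unfolding wst unfolding L'_def p_def .
qed

end

section \<open>Variation of constants\<close>

lemma integral_exp_interval:
  fixes l :: real assumes "u \<le> t"
  shows "(LINT r:{u..t}|lborel. l * exp (- l * (t - r))) = 1 - exp (- l * (t - u))"
proof -
  have "(LINT r:{u..t}|lborel. l * exp (- l * (t - r))) = (\<integral>r. l * exp (- l * (t - r)) * indicator {u..t} r \<partial>lborel)"
    unfolding set_lebesgue_integral_def by (intro Bochner_Integration.integral_cong) auto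
  also have "\<dots> = exp (- l * (t - t)) - exp (- l * (t - u))"
    by (rule integral_FTC_Icc_real[OF assms]) (auto intro!: derivative_eq_intros)
  finally show ?thesis by simp
qed

text \<open>
  The function \<open>f\<close> satisfies the equation \<open>f' = a - l f\<close> only in its integrated form, with \<open>a\<close> merely bounded and measurable.
  Instead of differentiating, one integrates the equation against \<open>l exp (- l (t - r))\<close> over \<open>r\<close> and exchanges the order of the
  two time integrals.
\<close>

lemma variation_of_constants:
  fixes f a :: "real \<Rightarrow> real"
  assumes st: "s \<le> t" and f[measurable]: "f \<in> borel_measurable borel" and a[measurable]: "a \<in> borel_measurable borel"
    and K: "\<And>u. s \<le> u \<Longrightarrow> u \<le> t \<Longrightarrow> \<bar>f u\<bar> \<le> K" "\<And>u. s \<le> u \<Longrightarrow> u \<le> t \<Longrightarrow> \<bar>a u\<bar> \<le> K"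
    and eq: "\<And>r. s \<le> r \<Longrightarrow> r \<le> t \<Longrightarrow> f r = f s + (LINT u:{s..r}|lborel. a u - l * f u)"
  shows "f t = exp (- l * (t - s)) * f s + (LINT u:{s..t}|lborel. exp (- l * (t - u)) * a u)"
proof -
  define d where "d u = a u - l * f u" for u
  have [measurable]: "d \<in> borel_measurable borel" unfolding d_def by measurable
  define w where "w u = exp (- l * (t - u))" for u
  have [measurable]: "w \<in> borel_measurable borel" unfolding w_def by measurable
  have lf: "\<bar>l * f u\<bar> \<le> \<bar>l\<bar> * K" if "s \<le> u" "u \<le> t" for u
    unfolding abs_mult using K(1)[OF that] by (intro mult_left_mono) auto
  have db: "\<bar>d u\<bar> \<le> K + \<bar>l\<bar> * K" if "s \<le> u" "u \<le> t" for u
    using lf[OF that] K(2)[OF that] by (simp add: d_def)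
  have wb: "\<bar>w u\<bar> \<le> exp (\<bar>l\<bar> * (t - s))" if "s \<le> u" "u \<le> t" for u
  proof -
    have "- l * (t - u) \<le> \<bar>l\<bar> * (t - u)" using that by (intro mult_right_mono) auto
    also have "\<dots> \<le> \<bar>l\<bar> * (t - s)" using that by (intro mult_left_mono) auto
    finally show ?thesis by (simp add: w_def)
  qed
  define Z where "Z = exp (\<bar>l\<bar> * (t - s))"
  have "integrable (lborel \<Otimes>\<^sub>M lborel) (\<lambda>z. indicator ({s..t} \<times> {s..t}) z *\<^sub>R
      (case z of (r, u) \<Rightarrow> l * w r * (if u \<le> r then d u else 0)))"
  proof (rule integrableI_bounded_set_indicator[where B="\<bar>l\<bar> * Z * (K + \<bar>l\<bar> * K)"])
    show "emeasure (lborel \<Otimes>\<^sub>M lborel) ({s..t} \<times> {s..t}) < \<infinity>"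
      using st by (simp add: lborel.emeasure_pair_measure_Times ennreal_mult_less_top)
    have "\<bar>l * w r * (if u \<le> r then d u else 0)\<bar> \<le> \<bar>l\<bar> * Z * (K + \<bar>l\<bar> * K)" if "s \<le> u" "u \<le> t" "s \<le> r" "r \<le> t" for r u
    proof -
      have "\<bar>if u \<le> r then d u else 0\<bar> \<le> K + \<bar>l\<bar> * K" using db[of u] that by (auto simp: indicator_def)
      then show ?thesis unfolding abs_mult using wb[of r] that
        by (intro mult_mono) (auto simp: Z_def)
    qed
    then show "AE z in lborel \<Otimes>\<^sub>M lborel. z \<in> {s..t} \<times> {s..t} \<longrightarrow>
        norm (case z of (r, u) \<Rightarrow> l * w r * (if u \<le> r then d u else 0)) \<le> \<bar>l\<bar> * Z * (K + \<bar>l\<bar> * K)"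
      by auto
  qed auto
  then have "integrable (lborel \<Otimes>\<^sub>M lborel) (\<lambda>(r, u). indicator {s..t} r * (l * w r) * (indicator {s..r} u * d u))"
    by (subst Bochner_Integration.integrable_cong[where g="\<lambda>z. indicator ({s..t} \<times> {s..t}) z *\<^sub>R
      (case z of (r, u) \<Rightarrow> l * w r * (if u \<le> r then d u else 0))"]) (auto simp: indicator_def)
  from lborel_pair.Fubini_integral[OF this]
  have fub: "(\<integral>u. (\<integral>r. indicator {s..t} r * (l * w r) * (indicator {s..r} u * d u) \<partial>lborel) \<partial>lborel) =
      (\<integral>r. indicator {s..t} r * (l * w r) * (\<integral>u. indicator {s..r} u * d u \<partial>lborel) \<partial>lborel)"
    by simp
  have inner: "(\<integral>r. indicator {s..t} r * (l * w r) * (indicator {s..r} u * d u) \<partial>lborel) = indicator {s..t} u * (d u * (1 - w u))" for u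
  proof -
    have "(\<integral>r. indicator {s..t} r * (l * w r) * (indicator {s..r} u * d u) \<partial>lborel) =
        (\<integral>r. (indicator {s..t} u * d u) * (indicator {u..t} r * (l * w r)) \<partial>lborel)"
      by (rule Bochner_Integration.integral_cong) (auto simp: indicator_def)
    also have "\<dots> = (indicator {s..t} u * d u) * (LINT r:{u..t}|lborel. l * w r)"
      unfolding set_lebesgue_integral_def real_scaleR_def by (rule integral_mult_right_zero)
    also have "\<dots> = indicator {s..t} u * (d u * (1 - w u))"
      using integral_exp_interval[of u t l] by (auto simp: w_def indicator_def)
    finally show ?thesis .
  qed
  have si: "set_integrable lborel {s..t} (\<lambda>u. w u * x u)" if "x \<in> borel_measurable borel"
      "\<And>u. s \<le> u \<Longrightarrow> u \<le> t \<Longrightarrow> \<bar>x u\<bar> \<le> k" for x k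
  proof (rule set_integrable_bounded_interval[where K="Z * k"])
    fix u assume "s \<le> u" "u \<le> t"
    then show "\<bar>w u * x u\<bar> \<le> Z * k" unfolding abs_mult using wb[of u] that(2)[of u] by (intro mult_mono) (auto simp: Z_def)
  qed (use that(1) in measurable)
  have sif: "set_integrable lborel {s..t} (\<lambda>u. l * (w u * f u))" by (intro set_integrable_mult_right si[of f K] f K)
  have sia: "set_integrable lborel {s..t} (\<lambda>u. w u * a u)" by (intro si[of a K] a K)
  have sid: "set_integrable lborel {s..t} d" by (rule set_integrable_bounded_interval[OF _ db]) auto
  have siwd: "set_integrable lborel {s..t} (\<lambda>u. w u * d u)" by (rule si[of d, OF _ db]) auto
  have siw: "set_integrable lborel {s..t} (\<lambda>r. l * w r)" using set_integrable_mult_right[OF si[of "\<lambda>_. 1" 1], of l] by simp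
  have "(LINT r:{s..t}|lborel. l * (w r * f r)) = (LINT r:{s..t}|lborel. l * w r * (f s + (LINT u:{s..r}|lborel. d u)))"
  proof (intro set_lebesgue_integral_cong allI impI)
    fix r assume "r \<in> {s..t}"
    then have "f r = f s + (LINT u:{s..r}|lborel. d u)" using eq[of r] by (simp only: d_def atLeastAtMost_iff)
    then show "l * (w r * f r) = l * w r * (f s + (LINT u:{s..r}|lborel. d u))" by (simp only: mult.assoc)
  qed simp
  also have "\<dots> = (LINT r:{s..t}|lborel. l * w r * f s) + (LINT r:{s..t}|lborel. l * w r * (LINT u:{s..r}|lborel. d u))"
  proof -
    have "set_integrable lborel {s..t} (\<lambda>r. l * w r * f s)" using siw by (intro set_integrable_mult_left) auto
    moreover have "set_integrable lborel {s..t} (\<lambda>r. l * (w r * f r) - l * w r * f s)"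
      by (intro set_integral_diff sif) fact
    then have "set_integrable lborel {s..t} (\<lambda>r. l * w r * (LINT u:{s..r}|lborel. d u))"
    proof (subst set_integrable_cong[OF refl refl])
      fix r assume "r \<in> {s..t}"
      then have "f r = f s + (LINT u:{s..r}|lborel. d u)" using eq[of r] by (simp only: d_def atLeastAtMost_iff)
      then show "l * w r * (LINT u:{s..r}|lborel. d u) = l * (w r * f r) - l * w r * f s"
        by (simp only: algebra_simps)
    qed
    ultimately show ?thesis by (simp add: distrib_left set_integral_add)
  qed
  also have "(LINT r:{s..t}|lborel. l * w r * (LINT u:{s..r}|lborel. d u)) = (LINT u:{s..t}|lborel. d u * (1 - w u))"
    using fub[symmetric, unfolded inner] unfolding set_lebesgue_integral_def real_scaleR_def mult.assoc .
  also have "\<dots> = (LINT u:{s..t}|lborel. d u) - (LINT u:{s..t}|lborel. w u * d u)"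
    using set_integral_diff(2)[OF sid siwd] by (simp add: algebra_simps)
  also have "(LINT u:{s..t}|lborel. d u) = f t - f s" using eq[of t] st by (simp add: d_def)
  also have "(LINT u:{s..t}|lborel. w u * d u) = (LINT u:{s..t}|lborel. w u * a u) - (LINT u:{s..t}|lborel. l * (w u * f u))"
    using set_integral_diff(2)[OF sia sif] by (simp add: d_def algebra_simps)
  also have "(LINT r:{s..t}|lborel. l * w r * f s) = (1 - w s) * f s"
    using integral_exp_interval[OF st, of l] by (simp add: w_def)
  finally show ?thesis by (simp add: w_def algebra_simps)
qed

section \<open>Gaussian averages\<close>

abbreviation "gauss \<equiv> std_normal_distribution"

interpretation gauss: real_distribution gauss
  by (rule real_dist_normal_dist)

lemma gauss_complex_exponential: "(CLINT x|gauss. iexp (a * x)) = complex_of_real (exp (- a\<^sup>2 / 2))"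
  using char_std_normal_distribution by (simp add: char_def fun_eq_iff)

lemma gauss_cos: "(LINT x|gauss. cos (a * x)) = exp (- a\<^sup>2 / 2)"
proof -
  have "(LINT x|gauss. Re (iexp (a * x))) = Re (CLINT x|gauss. iexp (a * x))"
    by (intro integral_Re gauss.integrable_iexp) auto
  then show ?thesis by (simp add: gauss_complex_exponential Re_exp del: of_real_mult)
qed

lemma gauss_sin: "(LINT x|gauss. sin (a * x)) = 0"
proof -
  have "(LINT x|gauss. Im (iexp (a * x))) = Im (CLINT x|gauss. iexp (a * x))"
    by (intro integral_Im gauss.integrable_iexp) auto
  then show ?thesis by (simp add: gauss_complex_exponential Im_exp del: of_real_mult)
qed

lemma integrable_gauss_id: "integrable gauss (\<lambda>x. x)"
  using integrable_std_normal_distribution_moment[of 1] by simp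

lemma integrable_gauss_mult:
  assumes "f \<in> borel_measurable borel" "\<And>x. \<bar>f x\<bar> \<le> K"
  shows "integrable gauss (\<lambda>x. x * f x)"
proof (rule Bochner_Integration.integrable_bound)
  show "integrable gauss (\<lambda>x. K * x)" using integrable_gauss_id by simp
  show "AE x in gauss. norm (x * f x) \<le> norm (K * x)"
  proof (rule AE_I2)
    fix x
    have "\<bar>x\<bar> * \<bar>f x\<bar> \<le> \<bar>x\<bar> * \<bar>K\<bar>" using assms(2)[of x] by (intro mult_left_mono) auto
    then show "norm (x * f x) \<le> norm (K * x)" by (simp add: abs_mult mult.commute)
  qed
qed (use assms(1) in simp)

lemma gauss_abs_le: "(LINT x|gauss. \<bar>x\<bar>) \<le> 1"
proof -
  have i2: "integrable gauss (\<lambda>x. x\<^sup>2)" using integrable_std_normal_distribution_moment[of 2] by simp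
  have "(LINT x|gauss. \<bar>x\<bar>) \<le> (LINT x|gauss. (1 + x\<^sup>2) / 2)"
  proof (rule integral_mono)
    show "\<bar>x\<bar> \<le> (1 + x\<^sup>2) / 2" for x :: real
      using sum_squares_bound[of 1 "\<bar>x\<bar>"] by simp
  qed (use i2 integrable_gauss_id in auto)
  also have "\<dots> = (1 + (LINT x|gauss. x\<^sup>2)) / 2"
    using i2 gauss.prob_space by simp
  also have "(LINT x|gauss. x\<^sup>2) = 1"
    using std_normal_distribution_even_moments(1)[of 1] by simp
  finally show ?thesis by simp
qed

lemma std_normal_density_le_inverse: "std_normal_density x \<le> \<bar>inverse x\<bar>" if "x \<noteq> 0"
proof -
  have "\<bar>x\<bar> \<le> 1 + x\<^sup>2 / 2" using sum_squares_bound[of 1 "\<bar>x\<bar>"] zero_le_power2[of "\<bar>x\<bar> - 1"]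
    by (simp add: power2_eq_square algebra_simps)
  also have "\<dots> \<le> exp (x\<^sup>2 / 2)" by (rule exp_ge_add_one_self)
  finally have "exp (- x\<^sup>2 / 2) \<le> \<bar>inverse x\<bar>"
    using that by (simp add: exp_minus field_simps)
  moreover have "std_normal_density x \<le> exp (- x\<^sup>2 / 2)"
  proof -
    have "1 \<le> sqrt (2 * pi)" using pi_ge_two by simp
    then have "1 / sqrt (2 * pi) \<le> 1" by simp
    then show ?thesis unfolding std_normal_density_def by (intro mult_left_le_one_le) auto
  qed
  ultimately show ?thesis by simp
qed

text \<open>Integration by parts against the Gaussian density, whose derivative is \<open>- x\<close> times itself.\<close>

lemma gauss_Stein:
  assumes h: "\<And>x. (h has_real_derivative h' x) (at x)" and h': "\<And>x. isCont h' x"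
    and K: "\<And>x. \<bar>h x\<bar> \<le> K" "\<And>x. \<bar>h' x\<bar> \<le> K"
  shows "(LINT x|gauss. x * h x) = (LINT x|gauss. h' x)"
proof -
  have [measurable]: "h \<in> borel_measurable borel" "h' \<in> borel_measurable borel"
    using h h' by (auto intro!: borel_measurable_continuous_onI continuous_at_imp_continuous_on intro: DERIV_isCont)
  have ih: "integrable gauss (\<lambda>x. x * h x)" by (rule integrable_gauss_mult[OF _ K(1)]) simp
  have ih': "integrable gauss h'" by (rule gauss.integrable_bounded[where K=K]) (use K in auto)
  define F where "F x = std_normal_density x * h x" for x
  define f where "f x = std_normal_density x * (h' x - x * h x)" for x
  have sd: "(std_normal_density has_real_derivative (- x * std_normal_density x)) (at x)" for x
  proof -
    have "((\<lambda>x. exp (- x\<^sup>2 / 2)) has_real_derivative (- x * exp (- x\<^sup>2 / 2))) (at x)"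
      by (auto intro!: derivative_eq_intros)
    from DERIV_cmult[OF this, of "1 / sqrt (2 * pi)"]
    show ?thesis unfolding std_normal_density_def[abs_def] by (simp only: mult.left_commute)
  qed
  have lim: "(F \<longlongrightarrow> 0) at_infinity"
  proof (rule Lim_null_comparison)
    have "\<bar>F x\<bar> \<le> K * \<bar>inverse x\<bar>" if "1 \<le> norm x" for x
    proof -
      have "\<bar>std_normal_density x\<bar> * \<bar>h x\<bar> \<le> \<bar>inverse x\<bar> * K"
        using std_normal_density_le_inverse[of x] that K(1)[of x] by (intro mult_mono) auto
      then show ?thesis by (simp add: F_def abs_mult mult.commute)
    qed
    then show "eventually (\<lambda>x. norm (F x) \<le> K * norm (inverse x)) at_infinity"
      by (auto simp: eventually_at_infinity)
    show "((\<lambda>x::real. K * norm (inverse x)) \<longlongrightarrow> 0) at_infinity"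
      using tendsto_mult_left[OF tendsto_norm_zero[OF tendsto_inverse_0], of K] unfolding mult_zero_right .
  qed
  have int: "integrable gauss (\<lambda>x. h' x - x * h x)" using ih ih' by auto
  have "(LBINT x=-\<infinity>..\<infinity>. f x) = 0 - 0"
  proof (rule interval_integral_FTC_integrable)
    show "(F has_vector_derivative f x) (at x)" for x
      unfolding has_real_derivative_iff_has_vector_derivative[symmetric] F_def f_def
      by (rule derivative_eq_intros sd h refl | simp add: algebra_simps)+
    show "isCont f x" for x
      unfolding f_def using DERIV_isCont[OF sd] DERIV_isCont[OF h] h' by (intro continuous_intros)
    show "set_integrable lborel (einterval (-\<infinity>) \<infinity>) f"
      using int by (simp add: set_integrable_def f_def integrable_density)
    show "((F \<circ> real_of_ereal) \<longlongrightarrow> 0) (at_right (-\<infinity>))" "((F \<circ> real_of_ereal) \<longlongrightarrow> 0) (at_left \<infinity>)"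
      unfolding ereal_tendsto_simps
      using lim at_top_le_at_infinity at_bot_le_at_infinity by (auto intro: tendsto_mono)
  qed simp
  then have "(LINT x|lborel. f x) = 0"
    by (simp add: interval_lebesgue_integral_def set_lebesgue_integral_def)
  then have "(LINT x|gauss. h' x - x * h x) = 0"
    by (simp add: integral_density f_def)
  then show ?thesis using ih ih' by simp
qed

lemma gauss_sin_shift: "(LINT z|gauss. sin (k * (x + a * z))) = exp (- (k * a)\<^sup>2 / 2) * sin (k * x)"
proof -
  have "(LINT z|gauss. sin (k * (x + a * z))) = (LINT z|gauss. sin (k * x) * cos ((k * a) * z) + cos (k * x) * sin ((k * a) * z))"
    by (rule Bochner_Integration.integral_cong) (auto simp: sin_add algebra_simps)
  also have "\<dots> = sin (k * x) * (LINT z|gauss. cos ((k * a) * z)) + cos (k * x) * (LINT z|gauss. sin ((k * a) * z))"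
  proof -
    have "integrable gauss (\<lambda>z. cos ((k * a) * z))" "integrable gauss (\<lambda>z. sin ((k * a) * z))"
      by (rule gauss.integrable_bounded[where K=1]; simp)+
    then show ?thesis by simp
  qed
  finally show ?thesis unfolding gauss_cos gauss_sin by (simp add: mult.commute)
qed

lemma gauss_mult_sin_shift: "(LINT z|gauss. z * sin (k * (x + a * z))) = k * a * exp (- (k * a)\<^sup>2 / 2) * cos (k * x)"
proof -
  have "(LINT z|gauss. z * sin (k * (x + a * z))) = (LINT z|gauss. k * a * cos (k * (x + a * z)))"
  proof (rule gauss_Stein[where K="1 + \<bar>k * a\<bar>"])
    show "\<bar>k * a * cos (k * (x + a * z))\<bar> \<le> 1 + \<bar>k * a\<bar>" for z
      using mult_left_le[OF abs_cos_le_one, of "\<bar>k * a\<bar>" "k * (x + a * z)"] by (simp add: abs_mult)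
    show "\<bar>sin (k * (x + a * z))\<bar> \<le> 1 + \<bar>k * a\<bar>" for z
      using abs_sin_le_one[of "k * (x + a * z)"] by linarith
  qed (auto intro!: derivative_eq_intros)
  also have "\<dots> = k * a * (LINT z|gauss. cos (k * (x + a * z)))" by simp
  also have "(LINT z|gauss. cos (k * (x + a * z))) = (LINT z|gauss. cos (k * x) * cos ((k * a) * z) - sin (k * x) * sin ((k * a) * z))"
    by (rule Bochner_Integration.integral_cong) (auto simp: cos_add algebra_simps)
  also have "\<dots> = cos (k * x) * (LINT z|gauss. cos ((k * a) * z)) - sin (k * x) * (LINT z|gauss. sin ((k * a) * z))"
  proof -
    have "integrable gauss (\<lambda>z. cos ((k * a) * z))" "integrable gauss (\<lambda>z. sin ((k * a) * z))"
      by (rule gauss.integrable_bounded[where K=1]; simp)+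
    then show ?thesis by simp
  qed
  finally show ?thesis unfolding gauss_cos gauss_sin by (simp add: mult_ac)
qed

section \<open>Functionals determined by sines\<close>

text \<open>
  A functional \<open>g \<mapsto> \<integral> w g(\<Xi>)\<close> on bounded odd functions is, up to a positive factor, the expectation of \<open>g\<close> under a
  probability measure: the law of \<open>sgn w \<cdot> \<Xi>\<close> under the density \<open>|w|\<close>. If it vanishes on all sines, then
  the characteristic function of that law is real, hence the law is symmetric and integrates every odd function to zero.
\<close>

lemma odd_functional_eq_0:
  fixes w \<Xi> :: "'a \<Rightarrow> real" and g :: "real \<Rightarrow> real"
  assumes w: "integrable N w" and \<Xi>[measurable]: "\<Xi> \<in> borel_measurable N"
    and sines: "\<And>k. (LINT x|N. w x * sin (k * \<Xi> x)) = 0"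
    and g[measurable]: "g \<in> borel_measurable borel" and K: "\<And>x. \<bar>g x\<bar> \<le> K" and odd: "\<And>x. g (- x) = - g x"
  shows "(LINT x|N. w x * g (\<Xi> x)) = 0"
proof -
  have [measurable]: "w \<in> borel_measurable N" using w by auto
  define c where "c = (LINT x|N. \<bar>w x\<bar>)"
  have iw: "integrable N (\<lambda>x. \<bar>w x\<bar>)" using w by auto
  have "0 \<le> c" unfolding c_def by simp
  show ?thesis
  proof (cases "c = 0")
    case True
    then have "AE x in N. w x = 0"
      using integral_nonneg_eq_0_iff_AE[OF iw] by (simp add: c_def)
    then have "(LINT x|N. w x * g (\<Xi> x)) = (LINT x|N. 0)" by (intro integral_cong_AE) auto
    then show ?thesis by simp
  next
    case False
    then have c: "c > 0" using \<open>0 \<le> c\<close> by simp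
    define \<nu> where "\<nu> = density N (\<lambda>x. ennreal (\<bar>w x\<bar> / c))"
    have [measurable_cong]: "sets \<nu> = sets N" by (simp add: \<nu>_def)
    have "emeasure \<nu> (space \<nu>) = (\<integral>\<^sup>+ x. ennreal (\<bar>w x\<bar> / c) \<partial>N)"
      unfolding \<nu>_def by (subst emeasure_density) (auto intro!: nn_integral_cong)
    also have "\<dots> = ennreal (LINT x|N. \<bar>w x\<bar> / c)"
      using iw c by (intro nn_integral_eq_integral) auto
    also have "(LINT x|N. \<bar>w x\<bar> / c) = 1" using c by (simp add: c_def)
    finally have "prob_space \<nu>" by (intro prob_spaceI) simp
    then interpret \<nu>: prob_space \<nu> .
    define m where "m = distr \<nu> borel (\<lambda>x. sgn (w x) * \<Xi> x)"
    have [measurable]: "(\<lambda>x. sgn (w x) * \<Xi> x) \<in> borel_measurable \<nu>" by measurable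
    have rm: "real_distribution m" unfolding m_def by (intro \<nu>.real_distribution_distr) simp
    then interpret m: real_distribution m .
    have int_m: "c * (LINT x|m. f x) = (LINT x|N. w x * f (\<Xi> x))"
      if f[measurable]: "f \<in> borel_measurable borel" and fodd: "\<And>x. f (- x) = - f x" for f :: "real \<Rightarrow> real"
    proof -
      have "f 0 = 0" using fodd[of 0] by simp
      then have *: "\<bar>w x\<bar> * f (sgn (w x) * \<Xi> x) = w x * f (\<Xi> x)" for x
        using fodd[of "\<Xi> x"] by (cases "w x > 0"; cases "w x = 0") (auto simp: sgn_if abs_if)
      have "(LINT x|m. f x) = (LINT x|\<nu>. f (sgn (w x) * \<Xi> x))"
        unfolding m_def by (rule integral_distr) measurable
      also have "\<dots> = (LINT x|N. (\<bar>w x\<bar> / c) * f (sgn (w x) * \<Xi> x))"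
        unfolding \<nu>_def using c by (subst integral_density) auto
      also have "\<dots> = (LINT x|N. (1 / c) * (w x * f (\<Xi> x)))"
        using * by (intro Bochner_Integration.integral_cong) (auto simp: field_simps)
      finally show ?thesis using c by simp
    qed
    define m' where "m' = distr m borel uminus"
    have rm': "real_distribution m'" unfolding m'_def by (intro m.real_distribution_distr) simp
    have "char m = char m'"
    proof
      fix k
      have "(LINT x|m. Im (iexp (k * x))) = 0"
        using int_m[of "\<lambda>x. sin (k * x)"] sines[of k] c by (simp add: Im_exp)
      then have Im0: "Im (char m k) = 0"
        unfolding char_def by (subst integral_Im[symmetric]) (auto intro!: m.integrable_iexp)
      have "char m' k = (CLINT x|m. iexp (k * (- x)))"
        unfolding char_def m'_def by (rule integral_distr) auto
      also have "\<dots> = (CLINT x|m. cnj (iexp (k * x)))"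
        by (intro Bochner_Integration.integral_cong) (auto simp: exp_cnj)
      also have "\<dots> = cnj (char m k)"
        unfolding char_def by (intro integral_bounded_linear bounded_linear_cnj m.integrable_iexp) auto
      also have "\<dots> = char m k" using Im0 by (simp add: complex_eq_iff)
      finally show "char m k = char m' k" by simp
    qed
    then have mm': "m = m'" by (intro Levy_uniqueness rm rm')
    have "(LINT x|m. g x) = (LINT x|m'. g x)" using mm' by simp
    also have "\<dots> = (LINT x|m. g (- x))" unfolding m'_def by (rule integral_distr) auto
    also have "\<dots> = - (LINT x|m. g x)" by (simp add: odd)
    finally have "(LINT x|m. g x) = 0" by simp
    then show ?thesis using int_m[OF g odd] by simp
  qed
qed

section \<open>An integrable time kernel\<close>

text \<open>
  The primitive of this kernel is an arctangent. Since \<open>exp (- l v) \<le> 1 / (1 + l v)\<close> for \<open>v \<ge> 0\<close>, the kernel dominates the product of the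
  singularity \<open>1 / sqrt (2 v)\<close> of the heat gradient with the exponential weight \<open>exp (- l v)\<close>, where \<open>v = t - u\<close>. Its integral
  becomes small as \<open>l\<close> grows, uniformly in the interval; this makes the fixed-point argument for the mean field a contraction.
\<close>

lemma time_kernel:
  fixes s t l :: real
  assumes l: "l > 0" and st: "s < t"
  shows set_integrable_time_kernel: "set_integrable lborel {s<..<t} (\<lambda>u. 1 / (sqrt (2 * (t - u)) * (1 + l * (t - u))))"
    and time_kernel_le: "(LINT u:{s<..<t}|lborel. 1 / (sqrt (2 * (t - u)) * (1 + l * (t - u)))) \<le> pi / sqrt (2 * l)"
proof -
  define F where "F u = - (2 / sqrt (2 * l)) * arctan (sqrt (l * (t - u)))" for u
  define f where "f u = 1 / (sqrt (2 * (t - u)) * (1 + l * (t - u)))" for u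
  have der: "DERIV F u :> f u" if "u < t" for u
  proof -
    have pos: "0 < l * (t - u)" using l that by simp
    have "DERIV F u :> - (2 / sqrt (2 * l)) * (inverse (1 + (sqrt (l * (t - u)))\<^sup>2) * (inverse (sqrt (l * (t - u))) / 2 * (- l)))"
    proof -
      have "DERIV (\<lambda>u. l * (t - u)) u :> - l" by (auto intro!: derivative_eq_intros)
      from DERIV_cmult[OF DERIV_chain2[OF DERIV_arctan DERIV_chain2[OF DERIV_real_sqrt[OF pos] this]]]
      show ?thesis unfolding F_def .
    qed
    also have "- (2 / sqrt (2 * l)) * (inverse (1 + (sqrt (l * (t - u)))\<^sup>2) * (inverse (sqrt (l * (t - u))) / 2 * (- l))) =
        l / (sqrt (2 * l) * sqrt (l * (t - u)) * (1 + l * (t - u)))"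
    proof -
      have "- (2 / r) * (inverse (1 + q\<^sup>2) * (inverse q / 2 * (- l))) = l / (r * q * (1 + q\<^sup>2))"
        if "q > 0" "r > 0" for q r :: real
        using that by (simp add: divide_simps)
      from this[of "sqrt (l * (t - u))" "sqrt (2 * l)"] pos l show ?thesis by simp
    qed
    also have "sqrt (2 * l) * sqrt (l * (t - u)) = l * sqrt (2 * (t - u))"
    proof -
      have "sqrt (2 * l) * sqrt (l * (t - u)) = sqrt (l\<^sup>2 * (2 * (t - u)))"
        unfolding real_sqrt_mult[symmetric] by (rule arg_cong[where f=sqrt]) (simp add: power2_eq_square)
      also have "\<dots> = l * sqrt (2 * (t - u))"
        using l by (simp only: real_sqrt_mult[of "l\<^sup>2"] real_sqrt_abs abs_of_pos)
      finally show ?thesis .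
    qed
    also have "l / (l * sqrt (2 * (t - u)) * (1 + l * (t - u))) = f u"
      using l by (simp add: f_def)
    finally show ?thesis .
  qed
  have cF: "isCont F u" for u unfolding F_def by (intro continuous_intros) 
  have D: "DERIV F u :> f u" if "ereal s < ereal u" "ereal u < ereal t" for u using der that by simp
  have I: "isCont f u" if "ereal s < ereal u" "ereal u < ereal t" for u
  proof -
    have "0 < t - u" "0 < 1 + l * (t - u)" using that l by (auto intro!: add_pos_pos)
    then show ?thesis unfolding f_def by (intro continuous_intros) auto
  qed
  have N: "AE u in lborel. ereal s < ereal u \<longrightarrow> ereal u < ereal t \<longrightarrow> 0 \<le> f u"
    using l by (auto simp: f_def)
  have L: "((F \<circ> real_of_ereal) \<longlongrightarrow> F s) (at_right (ereal s))" "((F \<circ> real_of_ereal) \<longlongrightarrow> F t) (at_left (ereal t))"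
    unfolding ereal_tendsto_simps using cF
    by (meson isCont_def tendsto_within_subset subset_UNIV)+
  have "ereal s < ereal t" using st by simp
  note FTC = interval_integral_FTC_nonneg[OF this D I N L]
  have "set_integrable lborel {s<..<t} f" using FTC(1) by simp
  then show "set_integrable lborel {s<..<t} (\<lambda>u. 1 / (sqrt (2 * (t - u)) * (1 + l * (t - u))))"
    unfolding f_def[abs_def] .
  have "(LINT u:{s<..<t}|lborel. f u) = F t - F s"
    using FTC(2) st by (simp add: interval_lebesgue_integral_def)
  also have "\<dots> = 2 / sqrt (2 * l) * arctan (sqrt (l * (t - s)))" by (simp add: F_def)
  also have "\<dots> \<le> 2 / sqrt (2 * l) * (pi / 2)"
    using l arctan_ubound[of "sqrt (l * (t - s))"] by (intro mult_left_mono) auto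
  finally show "(LINT u:{s<..<t}|lborel. 1 / (sqrt (2 * (t - u)) * (1 + l * (t - u)))) \<le> pi / sqrt (2 * l)"
    unfolding f_def by simp
qed

lemma set_integrable_inverse_sqrt:
  fixes s t :: real
  assumes st: "s < t"
  shows "set_integrable lborel {s<..<t} (\<lambda>u. 1 / sqrt (2 * (t - u)))"
proof (rule set_integrable_bound)
  show "set_integrable lborel {s<..<t} (\<lambda>u. (1 + (t - s)) * (1 / (sqrt (2 * (t - u)) * (1 + 1 * (t - u)))))"
    by (intro set_integrable_mult_right set_integrable_time_kernel) (use st in auto)
  have "1 / sqrt (2 * (t - u)) \<le> (1 + (t - s)) * (1 / (sqrt (2 * (t - u)) * (1 + 1 * (t - u))))" if "s < u" "u < t" for u
  proof -
    have "1 / sqrt (2 * (t - u)) * ((1 + (t - u)) / (1 + (t - u))) \<le> 1 / sqrt (2 * (t - u)) * ((1 + (t - s)) / (1 + (t - u)))"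
      using that by (intro mult_left_mono divide_right_mono) auto
    then show ?thesis using that by simp
  qed
  then show "AE u in lborel. u \<in> {s<..<t} \<longrightarrow> norm (1 / sqrt (2 * (t - u)))
      \<le> norm ((1 + (t - s)) * (1 / (sqrt (2 * (t - u)) * (1 + 1 * (t - u)))))"
    using st by (intro AE_I2) (auto intro!: order_trans[OF _ abs_ge_self])
qed (auto simp: set_borel_measurable_def)

section \<open>The mild identity\<close>

text \<open>
  For \<open>a = sqrt (2 t)\<close>, this is the heat semigroup of \<open>\<surd>2 W\<close> at time \<open>t\<close>. Its spatial derivative is written after an integration by
  parts, in a form that makes sense for every bounded measurable function.
\<close>

definition heat :: "real \<Rightarrow> (real \<Rightarrow> real) \<Rightarrow> real \<Rightarrow> real" where
  "heat a g x = (LINT z|gauss. g (x + a * z))"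

definition heat_gradient :: "real \<Rightarrow> (real \<Rightarrow> real) \<Rightarrow> real \<Rightarrow> real" where
  "heat_gradient a g x = (LINT z|gauss. z * g (x + a * z)) / a"

lemma measurable_heat[measurable]:
  assumes [measurable]: "g \<in> borel_measurable borel"
  shows "heat a g \<in> borel_measurable borel"
  unfolding heat_def[abs_def] by measurable

lemma measurable_heat_gradient[measurable]:
  assumes [measurable]: "g \<in> borel_measurable borel"
  shows "heat_gradient a g \<in> borel_measurable borel"
  unfolding heat_gradient_def[abs_def] by measurable

lemma heat_le: "(\<And>x. \<bar>g x\<bar> \<le> K) \<Longrightarrow> \<bar>heat a g x\<bar> \<le> K"
  unfolding heat_def by (rule gauss.abs_expectation_le) auto

lemma heat_gradient_le:
  assumes g[measurable]: "g \<in> borel_measurable borel" and K: "\<And>x. \<bar>g x\<bar> \<le> K" and a: "0 < a"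
  shows "\<bar>heat_gradient a g x\<bar> \<le> K / a"
proof -
  have K0: "0 \<le> K" using K[of 0] by linarith
  have "\<bar>LINT z|gauss. z * g (x + a * z)\<bar> \<le> (LINT z|gauss. \<bar>z * g (x + a * z)\<bar>)"
    using integral_norm_bound[of gauss "\<lambda>z. z * g (x + a * z)"] by simp
  also have "\<dots> \<le> (LINT z|gauss. K * \<bar>z\<bar>)"
  proof (rule integral_mono)
    show "integrable gauss (\<lambda>z. \<bar>z * g (x + a * z)\<bar>)"
      by (intro integrable_abs integrable_gauss_mult[where K=K]) (use K in auto)
    show "\<bar>z * g (x + a * z)\<bar> \<le> K * \<bar>z\<bar>" for z
      using mult_right_mono[OF K[of "x + a * z"], of "\<bar>z\<bar>"] by (simp add: abs_mult mult.commute)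
  qed (use integrable_gauss_id in auto)
  also have "\<dots> \<le> K * 1" using gauss_abs_le K0 by (simp add: mult_left_le)
  finally show ?thesis using a by (simp add: heat_gradient_def divide_right_mono)
qed

lemma heat_sin: "heat a (\<lambda>x. sin (k * x)) x = exp (- (k * a)\<^sup>2 / 2) * sin (k * x)"
  unfolding heat_def by (rule gauss_sin_shift)

lemma heat_gradient_sin: "a > 0 \<Longrightarrow> heat_gradient a (\<lambda>x. sin (k * x)) x = k * exp (- (k * a)\<^sup>2 / 2) * cos (k * x)"
  unfolding heat_gradient_def by (subst gauss_mult_sin_shift) simp

lemma integrable_product:
  fixes f :: "'a \<Rightarrow> real" and g :: "'b \<Rightarrow> real"
  assumes "sigma_finite_measure M1" "sigma_finite_measure M2"
    and f: "integrable M1 f" and g: "integrable M2 g"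
  shows "integrable (M1 \<Otimes>\<^sub>M M2) (\<lambda>z. f (fst z) * g (snd z))"
proof -
  interpret pair_sigma_finite M1 M2 using assms(1,2) by (simp add: pair_sigma_finite_def)
  have [measurable]: "f \<in> borel_measurable M1" "g \<in> borel_measurable M2" using f g by auto
  show ?thesis
  proof (rule Fubini_integrable)
    show "integrable M1 (\<lambda>x. LINT y|M2. norm (f (fst (x, y)) * g (snd (x, y))))"
      using f by (simp add: abs_mult)
  qed (use g in auto)
qed

context linear_solution
begin

text \<open>
  On \<open>[0,\<infinity>)\<close> one has \<open>\<iota>(x) sin (k x) = sin (k x)\<close>, because the sine vanishes at the origin. Hence \<open>f(u) = E [G sin (k X\<^sub>u)]\<close> satisfies
  \<open>f' = - k\<^sup>2 f + a\<close>, where \<open>a\<close> collects the drift term.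
\<close>

lemma expectation_sin:
  assumes st: "0 \<le> s" "s \<le> t" and G: "G \<in> borel_measurable (canonical_filtration s)" "\<And>w. \<bar>G w\<bar> \<le> 1"
  shows "(LINT w|Q. G w * sin (k * w t)) = exp (- k\<^sup>2 * (t - s)) * (LINT w|Q. G w * sin (k * w s)) +
    (LINT u:{s..t}|lborel. exp (- k\<^sup>2 * (t - u)) *
      (LINT w|Q. G w * (iota (w (max 0 u)) * B u (w (max 0 u)) * (k * cos (k * w (max 0 u))))))"
proof -
  define p where "p u w = w (max 0 u)" for u :: real and w :: "real \<Rightarrow> real"
  have p2: "(\<lambda>z. p (fst z) (snd z)) \<in> borel_measurable (borel \<Otimes>\<^sub>M Q)"
    using eval_max_measurable by (simp add: p_def case_prod_unfold)
  have p1: "p u \<in> borel_measurable Q" for u unfolding p_def[abs_def] by (rule eval_max_measurable')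
  have Gm: "G \<in> borel_measurable Q" by (rule canonical_measurable[OF G(1)])
  have Gb: "\<bar>G w * a\<bar> \<le> c" if "\<bar>a\<bar> \<le> c" for w a c
    using mult_mono[OF G(2)[of w] that] by (simp add: abs_mult)
  define K where "K = 1 + \<bar>k\<bar> + k\<^sup>2"
  have K1: "1 \<le> K" by (simp add: K_def)
  have sb: "\<bar>sin (k * x)\<bar> \<le> 1" "\<bar>k * cos (k * x)\<bar> \<le> \<bar>k\<bar>" "\<bar>- (k\<^sup>2 * sin (k * x))\<bar> \<le> k\<^sup>2" for x
    using mult_left_le[OF abs_cos_le_one[of "k * x"] abs_ge_zero[of k]] mult_left_le[OF abs_sin_le_one[of "k * x"] zero_le_power2[of k]]
    by (auto simp: abs_mult)
  define f where "f u = (LINT w|Q. G w * sin (k * p u w))" for u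
  define a where "a u = (LINT w|Q. G w * (iota (p u w) * B u (p u w) * (k * cos (k * p u w))))" for u
  have cm: "(\<lambda>x. sin (k * x)) \<in> borel_measurable borel" "(\<lambda>x. k * cos (k * x)) \<in> borel_measurable borel" by measurable
  have am: "(\<lambda>(u, w). G w * (iota (p u w) * B u (p u w) * (k * cos (k * p u w)))) \<in> borel_measurable (borel \<Otimes>\<^sub>M Q)"
    unfolding case_prod_unfold
    by (intro borel_measurable_times measurable_compose[OF measurable_snd Gm] measurable_compose[OF p2 iota_measurable]
       measurable_drift_compose measurable_fst p2 measurable_compose[OF p2 cm(2)])
  have am1: "(\<lambda>w. G w * (iota (p u w) * B u (p u w) * (k * cos (k * p u w)))) \<in> borel_measurable Q" for u
    by (intro borel_measurable_times Gm measurable_compose[OF p1 iota_measurable]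
       measurable_drift_compose measurable_const p1 measurable_compose[OF p1 cm(2)]) simp
  have fm: "(\<lambda>(u, w). G w * sin (k * p u w)) \<in> borel_measurable (borel \<Otimes>\<^sub>M Q)"
    unfolding case_prod_unfold by (intro borel_measurable_times measurable_compose[OF measurable_snd Gm] measurable_compose[OF p2 cm(1)])
  have fm1: "(\<lambda>w. G w * sin (k * p u w)) \<in> borel_measurable Q" for u
    by (intro borel_measurable_times Gm measurable_compose[OF p1 cm(1)])
  have ab: "\<bar>G w * (iota (p u w) * B u (p u w) * (k * cos (k * p u w)))\<bar> \<le> C * \<bar>k\<bar>" for u w
  proof (rule Gb)
    have "\<bar>B u (p u w)\<bar> * \<bar>k * cos (k * p u w)\<bar> \<le> C * \<bar>k\<bar>"
      using drift_bounded sb(2) drift_nonneg by (intro mult_mono) auto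
    then show "\<bar>iota (p u w) * B u (p u w) * (k * cos (k * p u w))\<bar> \<le> C * \<bar>k\<bar>"
      using drift_nonneg by (simp add: iota_cases abs_mult)
  qed
  have fbb: "\<bar>G w * sin (k * p u w)\<bar> \<le> 1" for u w by (intro Gb sb)
  have fmeas: "f \<in> borel_measurable borel" unfolding f_def[abs_def] by (rule expectation_measurable[OF fm fbb])
  have ameas: "a \<in> borel_measurable borel" unfolding a_def[abs_def] by (rule expectation_measurable[OF am ab])
  have fle: "\<bar>f u\<bar> \<le> 1 + C * \<bar>k\<bar>" for u
    unfolding f_def by (rule abs_expectation_le) (rule order_trans[OF fbb], simp add: drift_nonneg)
  have ale: "\<bar>a u\<bar> \<le> 1 + C * \<bar>k\<bar>" for u
    unfolding a_def by (rule abs_expectation_le) (rule order_trans[OF ab], simp)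
  have "f t = exp (- k\<^sup>2 * (t - s)) * f s + (LINT u:{s..t}|lborel. exp (- k\<^sup>2 * (t - u)) * a u)"
  proof (rule variation_of_constants[OF st(2) fmeas ameas fle ale])
    fix r assume r: "s \<le> r" "r \<le> t"
    have "(LINT w|Q. G w * sin (k * w r)) - (LINT w|Q. G w * sin (k * w s)) =
      (LINT u:{s..r}|lborel. (LINT w|Q. G w * (iota (w (max 0 u)) * (k * cos (k * w (max 0 u)) * B u (w (max 0 u)) + - (k\<^sup>2 * sin (k * w (max 0 u)))))))"
    proof (rule expectation_smooth[OF st(1) r(1) G, where K=K])
      show "((\<lambda>x. sin (k * x)) has_real_derivative k * cos (k * x)) (at x)" for x
        by (auto intro!: derivative_eq_intros)
      show "((\<lambda>x. k * cos (k * x)) has_real_derivative - (k\<^sup>2 * sin (k * x))) (at x)" for x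
        by (auto intro!: derivative_eq_intros simp: power2_eq_square)
      show "continuous_on UNIV (\<lambda>x. - (k\<^sup>2 * sin (k * x)))" by (intro continuous_intros)
      show "\<bar>sin (k * x)\<bar> \<le> K" "\<bar>k * cos (k * x)\<bar> \<le> K" "\<bar>- (k\<^sup>2 * sin (k * x))\<bar> \<le> K" for x
        using sb[of x] zero_le_power2[of k] abs_ge_zero[of k] unfolding K_def by linarith+
    qed
    moreover have "(LINT w|Q. G w * (iota (w (max 0 u)) * (k * cos (k * w (max 0 u)) * B u (w (max 0 u)) + - (k\<^sup>2 * sin (k * w (max 0 u)))))) = a u - k\<^sup>2 * f u" for u
    proof -
      have "AE w in Q. G w * (iota (w (max 0 u)) * (k * cos (k * w (max 0 u)) * B u (w (max 0 u)) + - (k\<^sup>2 * sin (k * w (max 0 u)))))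
          = G w * (iota (p u w) * B u (p u w) * (k * cos (k * p u w))) - k\<^sup>2 * (G w * sin (k * p u w))"
        using nonneg[of "max 0 u", simplified]
      proof eventually_elim
        case (elim w)
        consider "0 < w (max 0 u)" | "w (max 0 u) = 0" using elim by linarith
        then show ?case by cases (simp_all add: p_def iota_cases algebra_simps)
      qed
      then have "(LINT w|Q. G w * (iota (w (max 0 u)) * (k * cos (k * w (max 0 u)) * B u (w (max 0 u)) + - (k\<^sup>2 * sin (k * w (max 0 u))))))
          = (LINT w|Q. G w * (iota (p u w) * B u (p u w) * (k * cos (k * p u w))) - k\<^sup>2 * (G w * sin (k * p u w)))"
      proof (intro integral_cong_AE)
        have "(\<lambda>w. G w * (iota (p u w) * (k * cos (k * p u w) * B u (p u w) + - (k\<^sup>2 * sin (k * p u w))))) \<in> borel_measurable Q"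
          by (intro borel_measurable_times Gm measurable_generator[OF p1]) simp_all
        then show "(\<lambda>w. G w * (iota (w (max 0 u)) * (k * cos (k * w (max 0 u)) * B u (w (max 0 u)) + - (k\<^sup>2 * sin (k * w (max 0 u)))))) \<in> borel_measurable Q"
          unfolding p_def .
        show "(\<lambda>w. G w * (iota (p u w) * B u (p u w) * (k * cos (k * p u w))) - k\<^sup>2 * (G w * sin (k * p u w))) \<in> borel_measurable Q"
          by (intro borel_measurable_diff am1 borel_measurable_times[OF borel_measurable_const] fm1)
      qed
      also have "\<dots> = a u - k\<^sup>2 * f u"
      proof -
        have "integrable Q (\<lambda>w. G w * (iota (p u w) * B u (p u w) * (k * cos (k * p u w))))" by (rule integrable_bounded[OF am1 ab])
        moreover have "integrable Q (\<lambda>w. G w * sin (k * p u w))" by (rule integrable_bounded[OF fm1 fbb])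
        ultimately show ?thesis by (simp add: a_def f_def)
      qed
      finally show ?thesis .
    qed
    moreover have "f r = (LINT w|Q. G w * sin (k * w r))" "f s = (LINT w|Q. G w * sin (k * w s))"
      using st r by (simp_all add: f_def p_def max_def)
    ultimately show "f r = f s + (LINT u:{s..r}|lborel. a u - k\<^sup>2 * f u)" by simp
  qed
  moreover have "f t = (LINT w|Q. G w * sin (k * w t))" "f s = (LINT w|Q. G w * sin (k * w s))"
    using st by (simp_all add: f_def p_def max_def)
  ultimately show ?thesis by (simp add: a_def p_def)
qed

text \<open>
  For a sine, this is \<open>expectation_sin\<close>, because the heat semigroup multiplies \<open>sin (k x)\<close> by \<open>exp (- k\<^sup>2 t)\<close>. The difference of the two
  sides is linear in \<open>g\<close>. It is written as a single integral \<open>\<integral> w g(\<Xi>)\<close> over time, path and Gaussian variable, to which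
  \<open>odd_functional_eq_0\<close> applies.
\<close>

lemma mild_identity:
  assumes st: "0 \<le> s" "s < t" and G: "G \<in> borel_measurable (canonical_filtration s)" "\<And>w. \<bar>G w\<bar> \<le> 1"
    and g: "g \<in> borel_measurable borel" and K: "\<And>x. \<bar>g x\<bar> \<le> K" and odd: "\<And>x. g (- x) = - g x"
  shows "(LINT w|Q. G w * g (w t)) = (LINT w|Q. G w * heat (sqrt (2 * (t - s))) g (w s)) +
    (LINT u:{s<..<t}|lborel. (LINT w|Q. G w * (iota (w (max 0 u)) * B u (w (max 0 u)) *
        heat_gradient (sqrt (2 * (t - u))) g (w (max 0 u)))))"
proof -
  define p where "p u w = w (max 0 u)" for u :: real and w :: "real \<Rightarrow> real"
  have p2: "(\<lambda>z. p (fst z) (snd z)) \<in> borel_measurable (borel \<Otimes>\<^sub>M Q)"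
    using eval_max_measurable by (simp add: p_def case_prod_unfold)
  have p1: "p u \<in> borel_measurable Q" for u unfolding p_def[abs_def] by (rule eval_max_measurable')
  have Gm: "G \<in> borel_measurable Q" by (rule canonical_measurable[OF G(1)])
  interpret QD: pair_prob_space Q gauss ..
  let ?R = "Q \<Otimes>\<^sub>M gauss"
  interpret LR: pair_sigma_finite lborel ?R ..
  let ?N = "lborel \<Otimes>\<^sub>M ?R"
  define b where "b r = sqrt (2 * (t - r))" for r
  have bm: "b \<in> borel_measurable borel" unfolding b_def by measurable
  have bpos: "0 < b u" if "u < t" for u using that by (simp add: b_def)
  have mu: "(\<lambda>z. fst z) \<in> borel_measurable ?N" using measurable_fst[of lborel ?R] by simp
  have mw: "(\<lambda>z. fst (snd z)) \<in> measurable ?N Q" by (rule measurable_compose[OF measurable_snd measurable_fst])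
  have mx: "(\<lambda>z. snd (snd z)) \<in> borel_measurable ?N"
    using measurable_compose[OF measurable_snd measurable_snd, of lborel Q gauss] by simp
  have mp: "(\<lambda>z. p (fst z) (fst (snd z))) \<in> borel_measurable ?N"
    using measurable_compose[OF measurable_Pair[OF mu mw] p2] by simp
  have mB: "(\<lambda>z. B (fst z) (p (fst z) (fst (snd z)))) \<in> borel_measurable ?N"
    by (rule measurable_drift_compose[OF mu mp])
  have mi: "(\<lambda>z. iota (p (fst z) (fst (snd z)))) \<in> borel_measurable ?N"
    by (rule measurable_compose[OF mp iota_measurable])
  have mG: "(\<lambda>z. G (fst (snd z))) \<in> borel_measurable ?N" by (rule measurable_compose[OF mw Gm])
  have mps: "(\<lambda>z. p r (fst (snd z))) \<in> borel_measurable ?N" for r by (rule measurable_compose[OF mw p1])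
  have mb: "(\<lambda>z. b (fst z)) \<in> borel_measurable ?N" by (rule measurable_compose[OF mu bm])
  note meas = mu mx mp mB mi mG mps mb
  \<comment> \<open>The three terms occupy disjoint ranges of the time coordinate. The term with a time integral lives on \<open>(s, t)\<close>; the other two are spread over the artificial ranges \<open>[t, t+1]\<close> and \<open>(t+1, t+2]\<close> of length one.\<close>
  define F1 where "F1 h z = indicator {t..t+1} (fst z) * (G (fst (snd z)) * h (p t (fst (snd z))))"
    for h :: "real \<Rightarrow> real" and z :: "real \<times> (real \<Rightarrow> real) \<times> real"
  define F2 where "F2 h z = indicator {t+1<..t+2} (fst z) * (G (fst (snd z)) * h (p s (fst (snd z)) + b s * snd (snd z)))"
    for h :: "real \<Rightarrow> real" and z :: "real \<times> (real \<Rightarrow> real) \<times> real"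
  define J where "J h u w x = G w * (iota (p u w) * B u (p u w) * (x * h (p u w + b u * x) / b u))" for h u w x
  define F3 where "F3 h z = indicator {s<..<t} (fst z) * J h (fst z) (fst (snd z)) (snd (snd z))"
    for h :: "real \<Rightarrow> real" and z :: "real \<times> (real \<Rightarrow> real) \<times> real"
  define \<Xi> where "\<Xi> z = (if fst z < t then p (fst z) (fst (snd z)) + b (fst z) * snd (snd z)
     else if fst z \<le> t + 1 then p t (fst (snd z)) else p s (fst (snd z)) + b s * snd (snd z))"
    for z :: "real \<times> (real \<Rightarrow> real) \<times> real"
  have fle: "{z \<in> space ?N. fst z < t} \<in> sets ?N" "{z \<in> space ?N. fst z \<le> t + 1} \<in> sets ?N"
    using mu by measurable
  have \<Xi>m: "\<Xi> \<in> borel_measurable ?N"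
    unfolding \<Xi>_def by (intro measurable_If fle borel_measurable_add borel_measurable_times meas measurable_const) simp_all
  have Gb: "\<bar>G w * y\<bar> \<le> c" if "\<bar>y\<bar> \<le> c" for w y c
    using mult_mono[OF G(2)[of w] that] by (simp add: abs_mult)
  have im: "(\<lambda>z. indicator A (fst z) :: real) \<in> borel_measurable ?N" if "A \<in> sets borel" for A
    by (rule measurable_compose[OF mu]) (use that in simp)
  have Fm: "F1 h \<in> borel_measurable ?N" "F2 h \<in> borel_measurable ?N" "F3 h \<in> borel_measurable ?N"
    if h: "h \<in> borel_measurable borel" for h
    unfolding F1_def[abs_def] F2_def[abs_def] F3_def[abs_def] J_def
    by (intro borel_measurable_times borel_measurable_add borel_measurable_divide im meas
          measurable_compose[OF _ h] measurable_const; simp)+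
  have Jb: "\<bar>J h u w x\<bar> \<le> 1 / b u * (C * k * \<bar>x\<bar>)" if hk: "\<And>x. \<bar>h x\<bar> \<le> k" and u: "u < t" for h k u w x
    unfolding J_def
  proof (rule Gb)
    have "\<bar>iota (p u w) * B u (p u w)\<bar> \<le> C" using drift_bounded[of u "p u w"] drift_nonneg by (simp add: iota_cases)
    moreover have "\<bar>x * h (p u w + b u * x) / b u\<bar> \<le> \<bar>x\<bar> * k / b u"
      using bpos[OF u] hk by (auto simp: abs_mult intro!: divide_right_mono mult_left_mono)
    ultimately have "\<bar>iota (p u w) * B u (p u w) * (x * h (p u w + b u * x) / b u)\<bar> \<le> C * (\<bar>x\<bar> * k / b u)"
      unfolding abs_mult[of "iota (p u w) * B u (p u w)"] by (intro mult_mono drift_nonneg) auto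
    then show "\<bar>iota (p u w) * B u (p u w) * (x * h (p u w + b u * x) / b u)\<bar> \<le> 1 / b u * (C * k * \<bar>x\<bar>)"
      by (simp add: mult_ac)
  qed
  have iabs: "integrable ?R (\<lambda>r. C * k * \<bar>snd r\<bar>)" for k
  proof -
    have "integrable ?R (\<lambda>r. (C * k) * \<bar>snd r\<bar>)"
      by (rule integrable_product[of Q gauss "\<lambda>_. C * k" abs])
        (use integrable_gauss_id in \<open>auto intro: prob_space_imp_sigma_finite prob_space_axioms gauss.prob_space_axioms\<close>)
    then show ?thesis by simp
  qed
  have sf: "sigma_finite_measure lborel" "sigma_finite_measure ?R" by unfold_locales
  have iind: "integrable lborel (\<lambda>u. indicator A u * (1::real))" if "A \<in> sets borel" "emeasure lborel A < \<infinity>" for A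
    using that by simp
  have Fint: "integrable ?N (F1 h)" "integrable ?N (F2 h)" "integrable ?N (F3 h)"
    if h: "h \<in> borel_measurable borel" and hk: "\<And>x. \<bar>h x\<bar> \<le> k" for h k
  proof -
    have i12: "integrable ?N (\<lambda>z. indicator A (fst z) * k)" if "A \<in> sets borel" "emeasure lborel A < \<infinity>" for A
      using integrable_product[OF sf iind[OF that], of "\<lambda>_. k"] by simp
    have le12: "norm (indicator A u * (G w * y)) \<le> norm (indicator A u * k)" if "\<bar>y\<bar> \<le> k" for A :: "real set" and u w y
      using Gb[OF that, of w] by (auto simp: indicator_def)
    show "integrable ?N (F1 h)"
      by (rule Bochner_Integration.integrable_bound[OF i12[of "{t..t+1}"] Fm(1)[OF h]])
        (auto simp only: F1_def intro!: AE_I2 le12 hk, auto simp: emeasure_lborel_Icc_eq)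
    show "integrable ?N (F2 h)"
      by (rule Bochner_Integration.integrable_bound[OF i12[of "{t+1<..t+2}"] Fm(2)[OF h]])
        (auto simp only: F2_def intro!: AE_I2 le12 hk, auto)
    have k0: "0 \<le> k" using hk[of 0] by linarith
    have "integrable lborel (\<lambda>u. indicator {s<..<t} u * (1 / b u))"
      using set_integrable_inverse_sqrt[OF st(2)] by (simp add: set_integrable_def b_def)
    from integrable_product[OF sf this iabs[of k]]
    show "integrable ?N (F3 h)"
    proof (rule Bochner_Integration.integrable_bound[OF _ Fm(3)[OF h]], intro AE_I2)
      fix z :: "real \<times> (real \<Rightarrow> real) \<times> real"
      show "norm (F3 h z) \<le> norm (indicator {s<..<t} (fst z) * (1 / b (fst z)) * (C * k * \<bar>snd (snd z)\<bar>))"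
      proof (cases "fst z \<in> {s<..<t}")
        case True
        have "\<bar>J h (fst z) (fst (snd z)) (snd (snd z))\<bar> \<le> 1 / b (fst z) * (C * k * \<bar>snd (snd z)\<bar>)"
          by (rule Jb[OF hk]) (use True in auto)
        moreover have "F3 h z = J h (fst z) (fst (snd z)) (snd (snd z))" and
          "indicator {s<..<t} (fst z) * (1 / b (fst z)) * (C * k * \<bar>snd (snd z)\<bar>) = 1 / b (fst z) * (C * k * \<bar>snd (snd z)\<bar>)"
          using True by (simp_all add: F3_def)
        ultimately show ?thesis unfolding real_norm_def by (metis abs_ge_self order_trans)
      qed (simp add: F3_def)
    qed
  qed
  have Rint: "(LINT r|?R. \<psi> r) = (LINT w|Q. (LINT x|gauss. \<psi> (w, x)))" if "integrable ?R \<psi>" for \<psi> :: "(real \<Rightarrow> real) \<times> real \<Rightarrow> real"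
    using QD.integral_fst'[OF that] by simp
  have Nint: "(LINT z|?N. \<psi> z) = (LINT u|lborel. (LINT r|?R. \<psi> (u, r)))" if "integrable ?N \<psi>" for \<psi> :: "real \<times> (real \<Rightarrow> real) \<times> real \<Rightarrow> real"
    using LR.integral_fst'[OF that] by simp
  have mwR: "(\<lambda>r. fst r) \<in> measurable ?R Q" "(\<lambda>r. snd r) \<in> borel_measurable ?R"
    using measurable_fst[of Q gauss] measurable_snd[of Q gauss] by simp_all
  have I1: "(LINT z|?N. F1 h z) = (LINT w|Q. G w * h (w t))"
    if h: "h \<in> borel_measurable borel" and hk: "\<And>x. \<bar>h x\<bar> \<le> k" for h k
  proof -
    have "(LINT r|?R. G (fst r) * h (p t (fst r))) = (LINT w|Q. (LINT x|gauss. G (fst (w, x)) * h (p t (fst (w, x)))))"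
      by (rule Rint, rule QD.P.integrable_bounded[where K=k])
        (intro borel_measurable_times measurable_compose[OF mwR(1) Gm] measurable_compose[OF measurable_compose[OF mwR(1) p1] h], intro Gb hk)
    also have "\<dots> = (LINT w|Q. G w * h (p t w))" using gauss.prob_space by simp
    finally have "(LINT r|?R. G (fst r) * h (p t (fst r))) = (LINT w|Q. G w * h (w t))"
      using st by (simp add: p_def max_def)
    then show ?thesis unfolding Nint[OF Fint(1)[OF h hk]] by (simp add: F1_def)
  qed
  have I2: "(LINT z|?N. F2 h z) = (LINT w|Q. G w * heat (b s) h (w s))"
    if h: "h \<in> borel_measurable borel" and hk: "\<And>x. \<bar>h x\<bar> \<le> k" for h k
  proof -
    have "(LINT r|?R. G (fst r) * h (p s (fst r) + b s * snd r)) = (LINT w|Q. (LINT x|gauss. G (fst (w, x)) * h (p s (fst (w, x)) + b s * snd (w, x))))"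
      by (rule Rint, rule QD.P.integrable_bounded[where K=k])
        (intro borel_measurable_times measurable_compose[OF mwR(1) Gm] measurable_compose[OF _ h] borel_measurable_add
          measurable_compose[OF mwR(1) p1] mwR borel_measurable_const, intro Gb hk)
    also have "\<dots> = (LINT w|Q. G w * heat (b s) h (p s w))" by (simp add: heat_def)
    finally have "(LINT r|?R. G (fst r) * h (p s (fst r) + b s * snd r)) = (LINT w|Q. G w * heat (b s) h (w s))"
      using st by (simp add: p_def max_def)
    then show ?thesis unfolding Nint[OF Fint(2)[OF h hk]] by (simp add: F2_def)
  qed
  have I3: "(LINT z|?N. F3 h z) = (LINT u:{s<..<t}|lborel. (LINT w|Q. G w * (iota (p u w) * B u (p u w) * heat_gradient (b u) h (p u w))))"
    if h: "h \<in> borel_measurable borel" and hk: "\<And>x. \<bar>h x\<bar> \<le> k" for h k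
  proof -
    have inner: "(LINT r|?R. J h u (fst r) (snd r)) = (LINT w|Q. G w * (iota (p u w) * B u (p u w) * heat_gradient (b u) h (p u w)))"
      if u: "u < t" for u
    proof -
      have "(LINT r|?R. J h u (fst r) (snd r)) = (LINT w|Q. (LINT x|gauss. J h u (fst (w, x)) (snd (w, x))))"
      proof (rule Rint, rule Bochner_Integration.integrable_bound)
        show "integrable ?R (\<lambda>r. 1 / b u * (C * k * \<bar>snd r\<bar>))" by (intro integrable_mult_right iabs)
        note mpR = measurable_compose[OF mwR(1) p1]
        show "(\<lambda>r. J h u (fst r) (snd r)) \<in> borel_measurable ?R"
          unfolding J_def
          by (intro borel_measurable_times borel_measurable_divide measurable_compose[OF _ h] borel_measurable_add mpR mwR(2) borel_measurable_const
              measurable_drift_compose measurable_compose[OF mpR iota_measurable] measurable_compose[OF mwR(1) Gm])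
        show "AE r in ?R. norm (J h u (fst r) (snd r)) \<le> norm (1 / b u * (C * k * \<bar>snd r\<bar>))"
          unfolding real_norm_def by (intro AE_I2 order_trans[OF Jb[OF hk u] abs_ge_self])
      qed
      then show ?thesis by (simp add: J_def heat_gradient_def)
    qed
    show ?thesis
      unfolding Nint[OF Fint(3)[OF h hk]] set_lebesgue_integral_def real_scaleR_def
    proof (rule Bochner_Integration.integral_cong[OF refl])
      fix u
      show "(LINT r|?R. F3 h (u, r)) =
        indicator {s<..<t} u * (LINT w|Q. G w * (iota (p u w) * B u (p u w) * heat_gradient (b u) h (p u w)))"
        using inner[of u] by (cases "u \<in> {s<..<t}") (auto simp: F3_def)
    qed
  qed
  define W where "W z = F1 (\<lambda>_. 1) z - F2 (\<lambda>_. 1) z - F3 (\<lambda>_. 1) z" for z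
  have Wint: "integrable ?N W"
    unfolding W_def by (intro Bochner_Integration.integrable_diff Fint[of "\<lambda>_. 1" 1]) auto
  have W\<Xi>: "W z * h (\<Xi> z) = F1 h z - F2 h z - F3 h z" for h z
  proof -
    consider "fst z < t" | "t \<le> fst z" "fst z \<le> t + 1" | "t + 1 < fst z" by linarith
    then show ?thesis
    proof cases
      case 1 then show ?thesis by (auto simp: W_def F1_def F2_def F3_def J_def \<Xi>_def indicator_def)
    next
      case 2 then show ?thesis by (auto simp: W_def F1_def F2_def F3_def \<Xi>_def)
    next
      case 3 then show ?thesis by (auto simp: W_def F1_def F2_def F3_def \<Xi>_def indicator_def)
    qed
  qed
  have total: "(LINT z|?N. W z * h (\<Xi> z)) = (LINT w|Q. G w * h (w t)) - (LINT w|Q. G w * heat (b s) h (w s)) -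
      (LINT u:{s<..<t}|lborel. (LINT w|Q. G w * (iota (p u w) * B u (p u w) * heat_gradient (b u) h (p u w))))"
    if h: "h \<in> borel_measurable borel" and hk: "\<And>x. \<bar>h x\<bar> \<le> k" for h k
  proof -
    have "(LINT z|?N. F1 h z - F2 h z - F3 h z) = (LINT z|?N. F1 h z) - (LINT z|?N. F2 h z) - (LINT z|?N. F3 h z)"
      using Fint[OF h hk] by simp
    then show ?thesis unfolding W\<Xi> I1[OF h hk] I2[OF h hk] I3[OF h hk] .
  qed
  have "(LINT z|?N. W z * sin (k * \<Xi> z)) = 0" for k
  proof -
    have bb: "(k * b r)\<^sup>2 / 2 = k\<^sup>2 * (t - r)" if "r \<le> t" for r
      using that by (simp add: b_def power_mult_distrib)
    have e1: "(LINT w|Q. G w * heat (b s) (\<lambda>x. sin (k * x)) (w s)) = exp (- k\<^sup>2 * (t - s)) * (LINT w|Q. G w * sin (k * w s))"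
    proof -
      have "(LINT w|Q. G w * heat (b s) (\<lambda>x. sin (k * x)) (w s)) = (LINT w|Q. exp (- k\<^sup>2 * (t - s)) * (G w * sin (k * w s)))"
        using bb[of s] st by (intro Bochner_Integration.integral_cong) (auto simp: heat_sin)
      then show ?thesis by simp
    qed
    have "(LINT u:{s<..<t}|lborel. (LINT w|Q. G w * (iota (p u w) * B u (p u w) * heat_gradient (b u) (\<lambda>x. sin (k * x)) (p u w))))
       = (LINT u:{s<..<t}|lborel. exp (- k\<^sup>2 * (t - u)) * (LINT w|Q. G w * (iota (p u w) * B u (p u w) * (k * cos (k * p u w)))))"
    proof (intro set_lebesgue_integral_cong allI impI)
      fix u assume u: "u \<in> {s<..<t}"
      have "(LINT w|Q. G w * (iota (p u w) * B u (p u w) * heat_gradient (b u) (\<lambda>x. sin (k * x)) (p u w)))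
         = (LINT w|Q. exp (- k\<^sup>2 * (t - u)) * (G w * (iota (p u w) * B u (p u w) * (k * cos (k * p u w)))))"
        using bb[of u] bpos[of u] u by (intro Bochner_Integration.integral_cong) (auto simp: heat_gradient_sin)
      then show "(LINT w|Q. G w * (iota (p u w) * B u (p u w) * heat_gradient (b u) (\<lambda>x. sin (k * x)) (p u w)))
         = exp (- k\<^sup>2 * (t - u)) * (LINT w|Q. G w * (iota (p u w) * B u (p u w) * (k * cos (k * p u w))))"
        by simp
    qed simp
    also have "\<dots> = (LINT u:{s..t}|lborel. exp (- k\<^sup>2 * (t - u)) * (LINT w|Q. G w * (iota (p u w) * B u (p u w) * (k * cos (k * p u w)))))"
      unfolding set_lebesgue_integral_def
    proof (rule integral_cong_AE)
      have ne: "AE u in lborel. u \<noteq> s" "AE u in lborel. u \<noteq> t" by (rule AE_lborel_singleton)+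
      show "AE u in lborel. indicator {s<..<t} u *\<^sub>R (exp (- k\<^sup>2 * (t - u)) * (LINT w|Q. G w * (iota (p u w) * B u (p u w) * (k * cos (k * p u w))))) =
          indicator {s..t} u *\<^sub>R (exp (- k\<^sup>2 * (t - u)) * (LINT w|Q. G w * (iota (p u w) * B u (p u w) * (k * cos (k * p u w)))))"
        using ne by eventually_elim (auto simp: indicator_def)
      have cm: "(\<lambda>x. k * cos (k * x)) \<in> borel_measurable borel" by measurable
      have am: "(\<lambda>(u, w). G w * (iota (p u w) * B u (p u w) * (k * cos (k * p u w)))) \<in> borel_measurable (borel \<Otimes>\<^sub>M Q)"
        unfolding case_prod_unfold
        by (intro borel_measurable_times measurable_compose[OF measurable_snd Gm] measurable_compose[OF p2 iota_measurable]
           measurable_drift_compose measurable_fst p2 measurable_compose[OF p2 cm])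
      have ab: "\<bar>G w * (iota (p u w) * B u (p u w) * (k * cos (k * p u w)))\<bar> \<le> C * (\<bar>k\<bar> * 1)" for u w
      proof (rule Gb)
        have "\<bar>B u (p u w)\<bar> * \<bar>k * cos (k * p u w)\<bar> \<le> C * (\<bar>k\<bar> * 1)"
          unfolding abs_mult using drift_bounded drift_nonneg by (intro mult_mono) auto
        then show "\<bar>iota (p u w) * B u (p u w) * (k * cos (k * p u w))\<bar> \<le> C * (\<bar>k\<bar> * 1)"
          using drift_nonneg by (simp add: iota_cases abs_mult)
      qed
      note em = expectation_measurable[OF am ab]
      show "(\<lambda>u. indicator {s<..<t} u *\<^sub>R (exp (- k\<^sup>2 * (t - u)) * (LINT w|Q. G w * (iota (p u w) * B u (p u w) * (k * cos (k * p u w)))))) \<in> borel_measurable lborel"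
        "(\<lambda>u. indicator {s..t} u *\<^sub>R (exp (- k\<^sup>2 * (t - u)) * (LINT w|Q. G w * (iota (p u w) * B u (p u w) * (k * cos (k * p u w)))))) \<in> borel_measurable lborel"
        by (intro borel_measurable_scaleR borel_measurable_times; (simp add: em; fail | measurable))+
    qed
    finally have e2: "(LINT u:{s<..<t}|lborel. (LINT w|Q. G w * (iota (p u w) * B u (p u w) * heat_gradient (b u) (\<lambda>x. sin (k * x)) (p u w))))
      = (LINT w|Q. G w * sin (k * w t)) - exp (- k\<^sup>2 * (t - s)) * (LINT w|Q. G w * sin (k * w s))"
      using expectation_sin[OF st(1) less_imp_le[OF st(2)] G, of k] by (simp add: p_def)
    have sm: "(\<lambda>x. sin (k * x)) \<in> borel_measurable borel" by measurable
    show ?thesis unfolding total[of "\<lambda>x. sin (k * x)", OF sm abs_sin_le_one] e1 e2 by simp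
  qed
  from odd_functional_eq_0[OF Wint \<Xi>m this g K odd]
  show ?thesis unfolding total[OF g K] by (simp add: b_def p_def)
qed

end

section \<open>Stability and uniqueness\<close>

definition odd_extension :: "(real \<Rightarrow> real) \<Rightarrow> real \<Rightarrow> real" where
  "odd_extension f y = (if 0 < y then f y else if y < 0 then - f (- y) else 0)"

lemma measurable_odd_extension[measurable]:
  assumes [measurable]: "f \<in> borel_measurable borel"
  shows "odd_extension f \<in> borel_measurable borel"
  unfolding odd_extension_def[abs_def] by measurable

lemma odd_extension_minus: "odd_extension f (- y) = - odd_extension f y"
  by (simp add: odd_extension_def)

lemma odd_extension_le: "(\<And>y. \<bar>f y\<bar> \<le> K) \<Longrightarrow> \<bar>odd_extension f y\<bar> \<le> K"
  using abs_ge_zero[of "f 0"] order_trans[of 0 "\<bar>f 0\<bar>" K] by (auto simp: odd_extension_def)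

lemma odd_extension_nonneg: "0 \<le> y \<Longrightarrow> odd_extension f y = iota y * f y"
  by (simp add: odd_extension_def iota_cases)

lemma measurable_heat_gradient_pair[measurable]:
  assumes [measurable]: "g \<in> borel_measurable borel" "a \<in> borel_measurable N" "f \<in> borel_measurable N"
  shows "(\<lambda>z. heat_gradient (a z) g (f z)) \<in> borel_measurable N"
  unfolding heat_gradient_def by measurable

context linear_solution
begin

definition duhamel :: "((real \<Rightarrow> real) \<Rightarrow> real) \<Rightarrow> (real \<Rightarrow> real) \<Rightarrow> real \<Rightarrow> real \<Rightarrow> real" where
  "duhamel G g t u = (LINT w|Q. G w * (iota (w (max 0 u)) * B u (w (max 0 u)) *
      heat_gradient (sqrt (2 * (t - u))) g (w (max 0 u))))"

lemma integrable_weighted: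
  fixes k :: "real \<Rightarrow> real"
  assumes G: "G \<in> borel_measurable Q" "\<And>w. \<bar>G w\<bar> \<le> 1"
    and k: "k \<in> borel_measurable borel" "\<And>x. \<bar>k x\<bar> \<le> M"
  shows "integrable Q (\<lambda>w. G w * k (w (max 0 u)))"
proof (rule integrable_bounded[where K="1 * M"])
  show "(\<lambda>w. G w * k (w (max 0 u))) \<in> borel_measurable Q"
    by (intro borel_measurable_times G(1) measurable_compose[OF eval_max_measurable' k(1)])
  show "\<bar>G w * k (w (max 0 u))\<bar> \<le> 1 * M" for w
    unfolding abs_mult using G(2)[of w] k(2)[of "w (max 0 u)"] by (intro mult_mono) auto
qed

text \<open>
  On nonnegative paths, \<open>\<iota>\<close> times a function of the position is the odd extension of that function. So the integrand
  is again the expectation of an odd function, which is what allows the mild identity to be iterated.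
\<close>

lemma duhamel_odd:
  assumes G: "G \<in> borel_measurable Q"
    and g: "g \<in> borel_measurable borel"
  shows "duhamel G g t u = (LINT w|Q. G w *
     odd_extension (\<lambda>x. B u x * heat_gradient (sqrt (2 * (t - u))) g x) (w (max 0 u)))"
  unfolding duhamel_def
proof (rule integral_cong_AE)
  have m: "(\<lambda>x. B u x * heat_gradient (sqrt (2 * (t - u))) g x) \<in> borel_measurable borel"
    by (intro borel_measurable_times measurable_drift_compose measurable_heat_gradient g) simp_all
  show "(\<lambda>w. G w * odd_extension (\<lambda>x. B u x * heat_gradient (sqrt (2 * (t - u))) g x) (w (max 0 u))) \<in> borel_measurable Q"
    by (intro borel_measurable_times G measurable_compose[OF eval_max_measurable' measurable_odd_extension[OF m]])
  show "(\<lambda>w. G w * (iota (w (max 0 u)) * B u (w (max 0 u)) * heat_gradient (sqrt (2 * (t - u))) g (w (max 0 u)))) \<in> borel_measurable Q"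
    by (intro borel_measurable_times G measurable_compose[OF eval_max_measurable' iota_measurable] measurable_drift_compose
        eval_max_measurable' measurable_compose[OF eval_max_measurable' measurable_heat_gradient[OF g]]) simp
  show "AE w in Q. G w * (iota (w (max 0 u)) * B u (w (max 0 u)) * heat_gradient (sqrt (2 * (t - u))) g (w (max 0 u))) =
     G w * odd_extension (\<lambda>x. B u x * heat_gradient (sqrt (2 * (t - u))) g x) (w (max 0 u))"
    using nonneg[of "max 0 u", simplified] by eventually_elim (simp add: odd_extension_nonneg)
qed

lemma duhamel_bound:
  assumes G: "\<And>w. \<bar>G w\<bar> \<le> 1"
    and g: "g \<in> borel_measurable borel" "\<And>x. \<bar>g x\<bar> \<le> M" and u: "u < t"
  shows "\<bar>duhamel G g t u\<bar> \<le> C * (M / sqrt (2 * (t - u)))"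
  unfolding duhamel_def
proof (rule abs_expectation_le)
  fix w
  have "\<bar>iota (w (max 0 u)) * B u (w (max 0 u))\<bar> \<le> C"
    using drift_bounded drift_nonneg by (simp add: iota_cases)
  moreover have "\<bar>heat_gradient (sqrt (2 * (t - u))) g (w (max 0 u))\<bar> \<le> M / sqrt (2 * (t - u))"
    using u by (intro heat_gradient_le g) auto
  ultimately have "\<bar>iota (w (max 0 u)) * B u (w (max 0 u)) * heat_gradient (sqrt (2 * (t - u))) g (w (max 0 u))\<bar> \<le> C * (M / sqrt (2 * (t - u)))"
    unfolding abs_mult[of "iota (w (max 0 u)) * B u (w (max 0 u))"] by (intro mult_mono drift_nonneg) auto
  then have "\<bar>G w\<bar> * \<bar>iota (w (max 0 u)) * B u (w (max 0 u)) * heat_gradient (sqrt (2 * (t - u))) g (w (max 0 u))\<bar> \<le> 1 * (C * (M / sqrt (2 * (t - u))))"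
    by (intro mult_mono G) auto
  then show "\<bar>G w * (iota (w (max 0 u)) * B u (w (max 0 u)) * heat_gradient (sqrt (2 * (t - u))) g (w (max 0 u)))\<bar> \<le> C * (M / sqrt (2 * (t - u)))"
    by (simp only: abs_mult mult_1)
qed

lemma duhamel_integrable:
  assumes G: "G \<in> borel_measurable Q" "\<And>w. \<bar>G w\<bar> \<le> 1"
    and g: "g \<in> borel_measurable borel" "\<And>x. \<bar>g x\<bar> \<le> M" and st: "s < t"
  shows "set_integrable lborel {s<..<t} (duhamel G g t)"
proof (rule set_integrable_bound)
  show "set_integrable lborel {s<..<t} (\<lambda>u. C * M * (1 / sqrt (2 * (t - u))))"
    by (intro set_integrable_mult_right set_integrable_inverse_sqrt st)
  have p2: "(\<lambda>z. snd z (max 0 (fst z))) \<in> borel_measurable (borel \<Otimes>\<^sub>M Q)"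
    using eval_max_measurable by (simp add: case_prod_unfold)
  have "(\<lambda>(u, w). G w * (iota (w (max 0 u)) * B u (w (max 0 u)) * heat_gradient (sqrt (2 * (t - u))) g (w (max 0 u)))) \<in> borel_measurable (borel \<Otimes>\<^sub>M Q)"
    unfolding case_prod_unfold
    by (intro borel_measurable_times measurable_compose[OF measurable_snd G(1)] measurable_compose[OF p2 iota_measurable]
       measurable_drift_compose measurable_fst p2 measurable_heat_gradient_pair g borel_measurable_diff
       measurable_compose[OF _ borel_measurable_sqrt] borel_measurable_const)
  from expectation_measurable[OF this, of 1 0 0]
  have "duhamel G g t \<in> borel_measurable borel" unfolding duhamel_def[abs_def] by simp
  then show "set_borel_measurable lborel {s<..<t} (duhamel G g t)"
    by (simp add: set_borel_measurable_def)
  show "AE u in lborel. u \<in> {s<..<t} \<longrightarrow> norm (duhamel G g t u) \<le> norm (C * M * (1 / sqrt (2 * (t - u))))"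
  proof (intro AE_I2 impI)
    fix u assume "u \<in> {s<..<t}"
    then have "\<bar>duhamel G g t u\<bar> \<le> C * (M / sqrt (2 * (t - u)))" using G g by (intro duhamel_bound) auto
    then show "norm (duhamel G g t u) \<le> norm (C * M * (1 / sqrt (2 * (t - u))))"
      unfolding real_norm_def by (intro order_trans[OF _ abs_ge_self]) simp
  qed
qed

lemma mild_identity_duhamel:
  assumes "0 \<le> s" "s < t" "G \<in> borel_measurable (canonical_filtration s)" "\<And>w. \<bar>G w\<bar> \<le> 1"
    "g \<in> borel_measurable borel" "\<And>x. \<bar>g x\<bar> \<le> K" "\<And>x. g (- x) = - g x"
  shows "(LINT w|Q. G w * g (w t)) = (LINT w|Q. G w * heat (sqrt (2 * (t - s))) g (w s)) +
    (LINT u:{s<..<t}|lborel. duhamel G g t u)"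
  unfolding duhamel_def by (rule mild_identity[OF assms])

end

text \<open>
  Two solutions that agree at time \<open>s\<close> given the weight \<open>G\<close>. The initial situation is \<open>s = 0\<close> and \<open>G = 1\<close>; at later times \<open>G\<close>
  restricts the positions at earlier times.
\<close>

locale two_solutions = Q: linear_solution Q B C + Q': linear_solution Q' B' C for Q B Q' B' C +
  fixes s :: real and G :: "(real \<Rightarrow> real) \<Rightarrow> real"
  assumes s: "0 \<le> s" and G: "G \<in> borel_measurable (canonical_filtration s)" "\<And>w. \<bar>G w\<bar> \<le> 1"
    and agree: "\<And>k M. k \<in> borel_measurable borel \<Longrightarrow> (\<And>x. \<bar>k x\<bar> \<le> M) \<Longrightarrow>
        (LINT w|Q. G w * k (w s)) = (LINT w|Q'. G w * k (w s))"
begin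

lemma GQ: "G \<in> borel_measurable Q" "G \<in> borel_measurable Q'"
  using Q.canonical_measurable[OF G(1)] Q'.canonical_measurable[OF G(1)] by auto

text \<open>
  The drifts enter twice. Exchanging \<open>B\<close> for \<open>B'\<close> under the same law costs \<open>d\<close> times the size of the gradient; exchanging the laws under
  the same integrand is again a difference of expectations of an odd function, controlled by the given bound \<open>K\<close>.
\<close>

lemma duhamel_difference:
  assumes u: "s \<le> u" "u < t"
    and g: "g \<in> borel_measurable borel" "\<And>x. \<bar>g x\<bar> \<le> M"
    and d: "\<And>x. \<bar>B u x - B' u x\<bar> \<le> d"
    and K: "\<And>h M. h \<in> borel_measurable borel \<Longrightarrow> (\<And>x. \<bar>h x\<bar> \<le> M) \<Longrightarrow> (\<And>x. h (- x) = - h x) \<Longrightarrow>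
       \<bar>(LINT w|Q. G w * h (w u)) - (LINT w|Q'. G w * h (w u))\<bar> \<le> M * K"
  shows "\<bar>Q.duhamel G g t u - Q'.duhamel G g t u\<bar> \<le> M * (C * K + d) / sqrt (2 * (t - u))"
proof -
  define a where "a = sqrt (2 * (t - u))"
  have a: "0 < a" using u by (simp add: a_def)
  define \<gamma> where "\<gamma> x = heat_gradient a g x" for x
  have \<gamma>m: "\<gamma> \<in> borel_measurable borel" unfolding \<gamma>_def by (rule measurable_heat_gradient[OF g(1)])
  have \<gamma>b: "\<bar>\<gamma> x\<bar> \<le> M / a" for x unfolding \<gamma>_def by (rule heat_gradient_le[OF g a])
  have M0: "0 \<le> M" using g(2)[of 0] by linarith
  have mu: "max 0 u = u" using u s by simp
  define h where "h = odd_extension (\<lambda>x. B u x * \<gamma> x)"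
  define h' where "h' = odd_extension (\<lambda>x. B' u x * \<gamma> x)"
  have Bm: "(\<lambda>x. B u x * \<gamma> x) \<in> borel_measurable borel" "(\<lambda>x. B' u x * \<gamma> x) \<in> borel_measurable borel"
    by (intro borel_measurable_times Q.measurable_drift_compose Q'.measurable_drift_compose \<gamma>m; simp)+
  have hm: "h \<in> borel_measurable borel" "h' \<in> borel_measurable borel"
    unfolding h_def h'_def using Bm by (auto intro: measurable_odd_extension)
  have "\<bar>B u x * \<gamma> x\<bar> \<le> C * (M / a)" "\<bar>B' u x * \<gamma> x\<bar> \<le> C * (M / a)" for x
    unfolding abs_mult by (intro mult_mono \<gamma>b Q.drift_bounded Q'.drift_bounded Q.drift_nonneg; simp)+
  then have hb: "\<bar>h x\<bar> \<le> C * (M / a)" "\<bar>h' x\<bar> \<le> C * (M / a)" for x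
    unfolding h_def h'_def by (auto intro!: odd_extension_le)
  have hd: "\<bar>h x - h' x\<bar> \<le> d * (M / a)" for x
  proof -
    have "\<bar>(B u y - B' u y) * \<gamma> y\<bar> \<le> d * (M / a)" for y
      unfolding abs_mult by (intro mult_mono d \<gamma>b order_trans[OF abs_ge_zero d]) simp
    from odd_extension_le[of "\<lambda>y. (B u y - B' u y) * \<gamma> y", OF this, of x]
    show ?thesis by (auto simp: h_def h'_def odd_extension_def left_diff_distrib)
  qed
  have e: "Q.duhamel G g t u = (LINT w|Q. G w * h (w u))" "Q'.duhamel G g t u = (LINT w|Q'. G w * h' (w u))"
    using Q.duhamel_odd[OF GQ(1) g(1), of t u] Q'.duhamel_odd[OF GQ(2) g(1), of t u]
    unfolding mu h_def h'_def \<gamma>_def a_def by simp_all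
  have iQ: "integrable Q (\<lambda>w. G w * h (w u))" "integrable Q (\<lambda>w. G w * h' (w u))"
    using Q.integrable_weighted[OF GQ(1) G(2) hm(1) hb(1), of u] Q.integrable_weighted[OF GQ(1) G(2) hm(2) hb(2), of u]
    by (simp_all only: mu)
  have "\<bar>Q.duhamel G g t u - Q'.duhamel G g t u\<bar> =
      \<bar>(LINT w|Q. G w * h (w u) - G w * h' (w u)) + ((LINT w|Q. G w * h' (w u)) - (LINT w|Q'. G w * h' (w u)))\<bar>"
    using iQ by (simp add: e)
  also have "\<dots> \<le> d * (M / a) + C * (M / a) * K"
  proof (rule order_trans[OF abs_triangle_ineq], rule add_mono)
    show "\<bar>LINT w|Q. G w * h (w u) - G w * h' (w u)\<bar> \<le> d * (M / a)"
    proof (rule Q.abs_expectation_le)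
      fix w
      have "\<bar>G w\<bar> * \<bar>h (w u) - h' (w u)\<bar> \<le> 1 * (d * (M / a))" by (intro mult_mono G hd) auto
      then show "\<bar>G w * h (w u) - G w * h' (w u)\<bar> \<le> d * (M / a)" by (simp only: abs_mult[symmetric] right_diff_distrib mult_1)
    qed
    show "\<bar>(LINT w|Q. G w * h' (w u)) - (LINT w|Q'. G w * h' (w u))\<bar> \<le> C * (M / a) * K"
      by (rule K[OF hm(2) hb(2)]) (simp add: h'_def odd_extension_minus)
  qed
  also have "\<dots> = M * (C * K + d) / a" by (simp add: add_divide_distrib algebra_simps)
  finally show ?thesis by (simp add: a_def)
qed

text \<open>
  Inserting an a priori bound with constant \<open>K\<close> into the time integral of the mild identity returns one with constant
  \<open>\<pi> / sqrt (2 l) (C K + d)\<close>.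
\<close>

lemma stability_step:
  assumes l: "0 < l" and d: "\<And>u x. s \<le> u \<Longrightarrow> \<bar>B u x - B' u x\<bar> \<le> d * exp (l * u)"
    and K: "\<And>u h M. s \<le> u \<Longrightarrow> h \<in> borel_measurable borel \<Longrightarrow> (\<And>x. \<bar>h x\<bar> \<le> M) \<Longrightarrow> (\<And>x. h (- x) = - h x) \<Longrightarrow>
       \<bar>(LINT w|Q. G w * h (w u)) - (LINT w|Q'. G w * h (w u))\<bar> \<le> M * (K * exp (l * u))"
    and K0: "0 \<le> K" and d0: "0 \<le> d"
    and t: "s \<le> t" and g: "g \<in> borel_measurable borel" "\<And>x. \<bar>g x\<bar> \<le> M" "\<And>x. g (- x) = - g x"
  shows "\<bar>(LINT w|Q. G w * g (w t)) - (LINT w|Q'. G w * g (w t))\<bar> \<le> M * (pi / sqrt (2 * l) * (C * K + d) * exp (l * t))"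
proof (cases "s = t")
  case True
  have "0 \<le> M" using g(2)[of 0] by linarith
  then show ?thesis using agree[OF g(1,2)] True l K0 d0 Q.drift_nonneg by (simp add: pi_ge_zero)
next
  case False
  then have st: "s < t" using t by simp
  have M0: "0 \<le> M" using g(2)[of 0] by linarith
  have "(LINT w|Q. G w * heat (sqrt (2 * (t - s))) g (w s)) = (LINT w|Q'. G w * heat (sqrt (2 * (t - s))) g (w s))"
    by (rule agree[OF measurable_heat[OF g(1)] heat_le]) (rule g(2))
  then have "(LINT w|Q. G w * g (w t)) - (LINT w|Q'. G w * g (w t)) =
      (LINT u:{s<..<t}|lborel. Q.duhamel G g t u) - (LINT u:{s<..<t}|lborel. Q'.duhamel G g t u)"
    using Q.mild_identity_duhamel[OF s st G g] Q'.mild_identity_duhamel[OF s st G g] by linarith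
  also have "\<dots> = (LINT u:{s<..<t}|lborel. Q.duhamel G g t u - Q'.duhamel G g t u)"
    by (rule set_integral_diff(2)[symmetric])
      (rule Q.duhamel_integrable[OF GQ(1) G(2) g(1,2) st] Q'.duhamel_integrable[OF GQ(2) G(2) g(1,2) st])+
  finally have eq: "(LINT w|Q. G w * g (w t)) - (LINT w|Q'. G w * g (w t)) =
      (LINT u:{s<..<t}|lborel. Q.duhamel G g t u - Q'.duhamel G g t u)" .
  have int: "set_integrable lborel {s<..<t} (\<lambda>u. Q.duhamel G g t u - Q'.duhamel G g t u)"
    by (rule set_integral_diff(1))
      (rule Q.duhamel_integrable[OF GQ(1) G(2) g(1,2) st] Q'.duhamel_integrable[OF GQ(2) G(2) g(1,2) st])+
  define Z where "Z = M * (C * K + d) * exp (l * t)"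
  have Z0: "0 \<le> Z" using M0 Q.drift_nonneg K0 d0 by (simp add: Z_def)
  have "\<bar>LINT u:{s<..<t}|lborel. Q.duhamel G g t u - Q'.duhamel G g t u\<bar> \<le>
      (LINT u:{s<..<t}|lborel. \<bar>Q.duhamel G g t u - Q'.duhamel G g t u\<bar>)"
    using set_integral_norm_bound[OF int] by simp
  also have "\<dots> \<le> (LINT u:{s<..<t}|lborel. Z * (1 / (sqrt (2 * (t - u)) * (1 + l * (t - u)))))"
  proof (rule set_integral_mono)
    show "set_integrable lborel {s<..<t} (\<lambda>u. \<bar>Q.duhamel G g t u - Q'.duhamel G g t u\<bar>)"
      using set_integrable_abs[OF int] .
    show "set_integrable lborel {s<..<t} (\<lambda>u. Z * (1 / (sqrt (2 * (t - u)) * (1 + l * (t - u)))))"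
      by (intro set_integrable_mult_right set_integrable_time_kernel l st)
    fix u assume u: "u \<in> {s<..<t}"
    have "\<bar>Q.duhamel G g t u - Q'.duhamel G g t u\<bar> \<le> M * (C * (K * exp (l * u)) + d * exp (l * u)) / sqrt (2 * (t - u))"
    proof (rule duhamel_difference[OF _ _ g(1,2)])
      show "\<bar>(LINT w|Q. G w * h (w u)) - (LINT w|Q'. G w * h (w u))\<bar> \<le> M' * (K * exp (l * u))"
        if "h \<in> borel_measurable borel" "\<And>x. \<bar>h x\<bar> \<le> M'" "\<And>x. h (- x) = - h x" for h M'
        using u by (intro K that) auto
    qed (use u d in auto)
    also have "\<dots> = M * (C * K + d) * exp (l * u) / sqrt (2 * (t - u))" by (simp add: algebra_simps)
    also have "\<dots> \<le> M * (C * K + d) * (exp (l * t) / (1 + l * (t - u))) / sqrt (2 * (t - u))"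
    proof -
      have pos: "0 < 1 + l * (t - u)" using l u by (intro add_pos_nonneg) auto
      have "exp (l * u) * (1 + l * (t - u)) \<le> exp (l * u) * exp (l * (t - u))"
        by (intro mult_left_mono exp_ge_add_one_self) auto
      also have "\<dots> = exp (l * t)" by (simp add: exp_add[symmetric] algebra_simps)
      finally have "exp (l * u) \<le> exp (l * t) / (1 + l * (t - u))" using pos by (simp add: pos_le_divide_eq)
      then show ?thesis using M0 Q.drift_nonneg K0 d0 u by (intro divide_right_mono mult_left_mono) auto
    qed
    also have "\<dots> = Z * (1 / (sqrt (2 * (t - u)) * (1 + l * (t - u))))" by (simp add: Z_def)
    finally show "\<bar>Q.duhamel G g t u - Q'.duhamel G g t u\<bar> \<le> Z * (1 / (sqrt (2 * (t - u)) * (1 + l * (t - u))))" .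
  qed
  also have "\<dots> = Z * (LINT u:{s<..<t}|lborel. 1 / (sqrt (2 * (t - u)) * (1 + l * (t - u))))"
    by (rule set_integral_mult_right)
  also have "\<dots> \<le> Z * (pi / sqrt (2 * l))"
    by (intro mult_left_mono time_kernel_le l st Z0)
  also have "\<dots> = M * (pi / sqrt (2 * l) * (C * K + d) * exp (l * t))"
    by (simp add: Z_def)
  finally show ?thesis unfolding eq .
qed

text \<open>
  The step is applied repeatedly, beginning with the trivial bound \<open>2\<close>. As \<open>\<pi> / sqrt (2 l) C \<le> 1/4\<close>, each application
  halves the part of the bound that stems from the start, and only the part caused by the drifts survives.
\<close>

lemma stability:
  assumes l: "0 < l" and small: "pi / sqrt (2 * l) * C \<le> 1/4"
    and d: "\<And>u x. s \<le> u \<Longrightarrow> \<bar>B u x - B' u x\<bar> \<le> d * exp (l * u)" and d0: "0 \<le> d"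
    and t: "s \<le> t" and g: "g \<in> borel_measurable borel" "\<And>x. \<bar>g x\<bar> \<le> M" "\<And>x. g (- x) = - g x"
  shows "\<bar>(LINT w|Q. G w * g (w t)) - (LINT w|Q'. G w * g (w t))\<bar> \<le> M * (2 * (pi / sqrt (2 * l)) * d * exp (l * t))"
proof -
  define c where "c = pi / sqrt (2 * l)"
  have c0: "0 \<le> c" using l by (simp add: c_def pi_ge_zero)
  have bound: "\<bar>(LINT w|Q. G w * g (w t)) - (LINT w|Q'. G w * g (w t))\<bar> \<le> M * ((2 * (1/2)^n + 2 * c * d) * exp (l * t))"
    if t: "s \<le> t" and g: "g \<in> borel_measurable borel" "\<And>x. \<bar>g x\<bar> \<le> M" "\<And>x. g (- x) = - g x" for n t g M
    using that
  proof (induction n arbitrary: t g M)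
    case 0
    have M0: "0 \<le> M" using 0(3)[of 0] by linarith
    have "\<bar>LINT w|Q. G w * g (w t)\<bar> \<le> 1 * M"
      by (rule Q.abs_expectation_le) (unfold abs_mult, intro mult_mono G 0, auto)
    moreover have "\<bar>LINT w|Q'. G w * g (w t)\<bar> \<le> 1 * M"
      by (rule Q'.abs_expectation_le) (unfold abs_mult, intro mult_mono G 0, auto)
    ultimately have "\<bar>(LINT w|Q. G w * g (w t)) - (LINT w|Q'. G w * g (w t))\<bar> \<le> M * (2 * 1)" by simp
    also have "\<dots> \<le> M * ((2 + 2 * c * d) * exp (l * t))"
      using s 0(1) l c0 d0 M0 by (intro mult_left_mono mult_mono) auto
    finally show ?case by simp
  next
    case (Suc n)
    define K where "K = 2 * (1/2)^n + 2 * c * d"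
    have K0: "0 \<le> K" using c0 d0 by (simp add: K_def)
    have "\<bar>(LINT w|Q. G w * g (w t)) - (LINT w|Q'. G w * g (w t))\<bar> \<le> M * (c * (C * K + d) * exp (l * t))"
      unfolding c_def
    proof (rule stability_step[OF l d _ K0 d0 Suc.prems])
      show "\<bar>(LINT w|Q. G w * h (w u)) - (LINT w|Q'. G w * h (w u))\<bar> \<le> M' * (K * exp (l * u))"
        if "s \<le> u" "h \<in> borel_measurable borel" "\<And>x. \<bar>h x\<bar> \<le> M'" "\<And>x. h (- x) = - h x" for u h M'
        unfolding K_def by (rule Suc.IH[OF that])
    qed
    also have "\<dots> \<le> M * ((2 * (1/2)^Suc n + 2 * c * d) * exp (l * t))"
    proof (intro mult_left_mono mult_right_mono)
      have "c * C * K \<le> 1/4 * K" using small K0 by (intro mult_right_mono) (simp_all add: c_def)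
      then have "c * (C * K + d) \<le> K / 2 + c * d" using K0 by (simp add: algebra_simps)
      also have "K / 2 + c * d = 2 * (1/2)^Suc n + 2 * c * d" by (simp add: K_def add_divide_distrib)
      finally show "c * (C * K + d) \<le> 2 * (1/2)^Suc n + 2 * c * d" .
      show "0 \<le> M" using Suc.prems(3)[of 0] by linarith
    qed simp
    finally show ?case .
  qed
  have "(\<lambda>n. M * ((2 * (1/2)^n + 2 * c * d) * exp (l * t))) \<longlonglongrightarrow> M * ((2 * 0 + 2 * c * d) * exp (l * t))"
    by (intro tendsto_intros LIMSEQ_power_zero) simp
  then have "\<bar>(LINT w|Q. G w * g (w t)) - (LINT w|Q'. G w * g (w t))\<bar> \<le> M * ((2 * 0 + 2 * c * d) * exp (l * t))"
    by (rule LIMSEQ_le_const) (use bound[OF t g] in blast)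
  then show ?thesis by (simp add: c_def)
qed

end

lemma exists_contraction_rate:
  fixes C :: real
  assumes "0 \<le> C"
  obtains l where "0 < l" "pi / sqrt (2 * l) * C \<le> 1/4"
proof
  define l where "l = 8 * (pi * C)\<^sup>2 + 1"
  show "0 < l" by (simp add: l_def add_nonneg_pos)
  have "4 * (pi * C) = sqrt (16 * (pi * C)\<^sup>2)" using assms by (simp add: real_sqrt_mult)
  also have "\<dots> \<le> sqrt (2 * l)" by (intro real_sqrt_le_mono) (simp add: l_def)
  finally show "pi / sqrt (2 * l) * C \<le> 1/4" using \<open>0 < l\<close> by (simp add: field_simps)
qed

text \<open>
  On \<open>[0,\<infinity>)\<close> the function \<open>k - k 0\<close> coincides with its odd extension, because it vanishes at the origin; constants are covered by the
  agreement at time \<open>s\<close>.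
\<close>

lemma (in two_solutions) agree_later:
  assumes BB: "\<And>u x. s \<le> u \<Longrightarrow> B u x = B' u x" and t: "s \<le> t"
    and k: "k \<in> borel_measurable borel" "\<And>x. \<bar>k x\<bar> \<le> M"
  shows "(LINT w|Q. G w * k (w t)) = (LINT w|Q'. G w * k (w t))"
proof -
  obtain l where l: "0 < l" "pi / sqrt (2 * l) * C \<le> 1/4" using exists_contraction_rate Q.drift_nonneg by metis
  define h where "h = odd_extension (\<lambda>x. k x - k 0)"
  have hm: "h \<in> borel_measurable borel" unfolding h_def by (intro measurable_odd_extension borel_measurable_diff k) simp
  have "\<bar>k x - k 0\<bar> \<le> 2 * M" for x using k(2)[of x] k(2)[of 0] by linarith
  then have hb: "\<bar>h x\<bar> \<le> 2 * M" for x unfolding h_def by (rule odd_extension_le)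
  have "\<bar>(LINT w|Q. G w * h (w t)) - (LINT w|Q'. G w * h (w t))\<bar> \<le> 2 * M * (2 * (pi / sqrt (2 * l)) * 0 * exp (l * t))"
    by (rule stability[OF l _ _ t hm hb]) (use BB in \<open>auto simp: h_def odd_extension_minus\<close>)
  then have eq: "(LINT w|Q. G w * h (w t)) = (LINT w|Q'. G w * h (w t))" by simp
  have G1: "(LINT w|Q. G w * k 0) = (LINT w|Q'. G w * k 0)"
    by (rule agree[of "\<lambda>_. k 0" M]) (use k in auto)
  have mt: "max 0 t = t" using s t by simp
  have *: "(LINT w|R. G w * k (w t)) = (LINT w|R. G w * h (w t)) + (LINT w|R. G w * k 0)" if "linear_solution R D C" "G \<in> borel_measurable R" for R D
  proof -
    interpret R: linear_solution R D C by fact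
    have "(LINT w|R. G w * k (w t)) = (LINT w|R. G w * h (w t) + G w * k 0)"
    proof (rule integral_cong_AE)
      show "AE w in R. G w * k (w t) = G w * h (w t) + G w * k 0"
        using R.nonneg[of t] s t by (auto elim!: eventually_mono simp: h_def odd_extension_def right_diff_distrib)
      have "(\<lambda>w. w t) \<in> borel_measurable R" using R.eval_measurable s t by simp
      note compose = measurable_compose[OF this]
      show "(\<lambda>w. G w * k (w t)) \<in> borel_measurable R" "(\<lambda>w. G w * h (w t) + G w * k 0) \<in> borel_measurable R"
        by (intro borel_measurable_add borel_measurable_times that compose[OF k(1)] compose[OF hm] borel_measurable_const)+
    qed
    also have "\<dots> = (LINT w|R. G w * h (w t)) + (LINT w|R. G w * k 0)"
      using R.integrable_weighted[OF that(2) G(2) hm hb, of t] R.integrable_weighted[OF that(2) G(2), of "\<lambda>_. k 0" M] k(2)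
      by (intro Bochner_Integration.integral_add) (auto simp: mt)
    finally show ?thesis .
  qed
  show ?thesis
    using *[OF Q.linear_solution_axioms GQ(1)] *[OF Q'.linear_solution_axioms GQ(2)] eq G1 by simp
qed

fun cylinder :: "(real \<times> real set) list \<Rightarrow> (real \<Rightarrow> real) \<Rightarrow> real" where
  "cylinder [] w = 1"
| "cylinder ((t, A) # L) w = indicator A (w t) * cylinder L w"

lemma cylinder_le: "\<bar>cylinder L w\<bar> \<le> 1"
  by (induction L) (auto simp: indicator_def)

lemma cylinder_eq: "cylinder L w = (if \<forall>(t, A)\<in>set L. w t \<in> A then 1 else 0)"
  by (induction L) (auto simp: indicator_def)

lemma measurable_canonical_eval: "0 \<le> r \<Longrightarrow> r \<le> s \<Longrightarrow> (\<lambda>w. w r) \<in> borel_measurable (canonical_filtration s)"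
proof (rule measurableI)
  show "0 \<le> r \<Longrightarrow> r \<le> s \<Longrightarrow> A \<in> sets borel \<Longrightarrow> (\<lambda>w. w r) -` A \<inter> space (canonical_filtration s) \<in> sets (canonical_filtration s)" for A
    unfolding filtration.space_F[OF filtration_canonical] sets_canonical_filtration
    by (rule sigma_sets.Basic) blast
qed simp

lemma measurable_cylinder:
  assumes "\<And>t A. (t, A) \<in> set L \<Longrightarrow> 0 \<le> t \<and> t \<le> s \<and> A \<in> sets borel"
  shows "cylinder L \<in> borel_measurable (canonical_filtration s)"
  using assms
proof (induction L)
  case Nil
  have "cylinder [] = (\<lambda>_. 1)" by (rule ext) simp
  then show ?case by simp
next
  case (Cons p L)
  obtain t A where p: "p = (t, A)" by force
  have tA: "0 \<le> t" "t \<le> s" "A \<in> sets borel" using Cons.prems[of t A] p by auto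
  have "(\<lambda>w. indicator A (w t) * cylinder L w :: real) \<in> borel_measurable (canonical_filtration s)"
    by (intro borel_measurable_times measurable_compose[OF measurable_canonical_eval[OF tA(1,2)]] Cons.IH)
      (use tA Cons.prems in \<open>auto intro!: borel_measurable_indicator\<close>)
  then show ?case by (simp add: p)
qed

text \<open>
  The list runs from later to earlier times. By induction the two laws agree given the cylinder over the tail of the list;
  multiplying by the indicator at the head gives a new weight, from which \<open>agree_later\<close> carries the agreement on to any later time.
\<close>

lemma finite_dimensional_laws_agree:
  fixes k :: "real \<Rightarrow> real"
  assumes "linear_solution Q B C" "linear_solution Q' B C" and init: "marginal Q 0 = marginal Q' 0"
    and "sorted_wrt (\<ge>) (map fst L)" "\<And>t A. (t, A) \<in> set L \<Longrightarrow> 0 \<le> t \<and> t \<le> s \<and> A \<in> sets borel" "0 \<le> s"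
    "k \<in> borel_measurable borel" "\<And>x. \<bar>k x\<bar> \<le> M"
  shows "(LINT w|Q. cylinder L w * k (w s)) = (LINT w|Q'. cylinder L w * k (w s))"
  using assms(4-)
proof (induction L arbitrary: s k M)
  case Nil
  interpret Q: linear_solution Q B C by fact
  interpret Q': linear_solution Q' B C by fact
  have 0: "(LINT w|Q. k (w 0)) = (LINT w|Q'. k (w 0))" if "k \<in> borel_measurable borel" for k :: "real \<Rightarrow> real"
    using integral_distr[OF Q.eval_measurable[of 0] that] integral_distr[OF Q'.eval_measurable[of 0] that] init
    by (simp add: marginal_def)
  interpret two_solutions Q B Q' B C 0 "\<lambda>_. 1"
    by unfold_locales (use 0 in auto)
  show ?case using agree_later[OF refl Nil(3) Nil(4,5)] by simp
next
  case (Cons p L)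
  obtain t A where p: "p = (t, A)" by force
  have tA: "0 \<le> t" "t \<le> s" "A \<in> sets borel" using Cons.prems(2)[of t A] p by auto
  have srt: "sorted_wrt (\<ge>) (map fst L)" "\<And>r A. (r, A) \<in> set L \<Longrightarrow> r \<le> t"
    using Cons.prems(1) p by force+
  interpret Q: linear_solution Q B C by fact
  interpret Q': linear_solution Q' B C by fact
  interpret two_solutions Q B Q' B C t "cylinder (p # L)"
  proof unfold_locales
    show "cylinder (p # L) \<in> borel_measurable (canonical_filtration t)"
      by (rule measurable_cylinder) (use srt(2) tA p Cons.prems(2) in auto)
    show "\<bar>cylinder (p # L) w\<bar> \<le> 1" for w by (rule cylinder_le)
    fix k :: "real \<Rightarrow> real" and M assume k: "k \<in> borel_measurable borel" "\<And>x. \<bar>k x\<bar> \<le> M"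
    have "(LINT w|Q. cylinder L w * (indicator A (w t) * k (w t))) = (LINT w|Q'. cylinder L w * (indicator A (w t) * k (w t)))"
    proof (rule Cons.IH[OF srt(1) _ tA(1), where M=M])
      show "0 \<le> r \<and> r \<le> t \<and> A \<in> sets borel" if "(r, A) \<in> set L" for r A
        using Cons.prems(2)[of r A] srt(2) that by auto
      show "(\<lambda>x. indicator A x * k x) \<in> borel_measurable borel" using tA k by (intro borel_measurable_times borel_measurable_indicator) auto
      show "\<bar>indicator A x * k x\<bar> \<le> M" for x using k(2)[of x] order_trans[OF abs_ge_zero k(2)[of x]] by (auto simp: indicator_def)
    qed
    then show "(LINT w|Q. cylinder (p # L) w * k (w t)) = (LINT w|Q'. cylinder (p # L) w * k (w t))"
      by (simp add: p mult_ac)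
  qed (rule tA)
  show ?case by (rule agree_later[OF refl tA(2) Cons.prems(4,5)])
qed

text \<open>
  Finite-dimensional laws determine a measure on the product space, and the path space carries the trace of the product
  \<open>\<sigma>\<close>-algebra.
\<close>

theorem linear_solution_unique:
  assumes Q: "linear_solution Q B C" and Q': "linear_solution Q' B C" and init: "marginal Q 0 = marginal Q' 0"
  shows "Q = Q'"
proof -
  interpret Q: linear_solution Q B C by fact
  interpret Q': linear_solution Q' B C by fact
  let ?P = "PiM {0::real..} (\<lambda>_. borel :: real measure)"
  have id: "(\<lambda>w. w) \<in> measurable path_space ?P"
    unfolding path_space_def by (rule measurable_restrict_space1) simp
  have idQ: "(\<lambda>w. w) \<in> measurable Q ?P" "(\<lambda>w. w) \<in> measurable Q' ?P"
    using id Q.sets_Q Q'.sets_Q by (simp_all cong: measurable_cong_sets)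
  have box: "emeasure (distr Q ?P (\<lambda>w. w)) (prod_emb {0..} (\<lambda>_. borel) J (Pi\<^sub>E J A)) =
      emeasure (distr Q' ?P (\<lambda>w. w)) (prod_emb {0..} (\<lambda>_. borel) J (Pi\<^sub>E J A))"
    if J: "finite J" "J \<subseteq> {0..}" "\<And>j. j \<in> J \<Longrightarrow> A j \<in> sets borel" for J A
  proof -
    define L where "L = map (\<lambda>j. (j, A j)) (rev (sorted_list_of_set J))"
    define m where "m = (if J = {} then 0 else Max J)"
    have m: "0 \<le> m" "\<And>j. j \<in> J \<Longrightarrow> j \<le> m"
    proof -
      have "Max J \<in> {0..}" if "J \<noteq> {}" using Max_in[OF J(1) that] J(2) by blast
      then show "0 \<le> m" "\<And>j. j \<in> J \<Longrightarrow> j \<le> m" using J(1) by (auto simp: m_def)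
    qed
    have setL: "set L = (\<lambda>j. (j, A j)) ` J" using J by (simp add: L_def)
    have "map fst L = rev (sorted_list_of_set J)" by (simp add: L_def comp_def)
    then have srt: "sorted_wrt (\<ge>) (map fst L)" by (simp add: sorted_wrt_rev)
    have pe: "prod_emb {0..} (\<lambda>_. borel) J (Pi\<^sub>E J A) \<in> sets ?P" using J by (intro sets_PiM_I) auto
    have "emeasure (distr R ?P (\<lambda>w. w)) (prod_emb {0..} (\<lambda>_. borel) J (Pi\<^sub>E J A)) = ennreal (LINT w|R. cylinder L w * 1)"
      if "linear_solution R B C" "(\<lambda>w. w) \<in> measurable R ?P" for R
    proof -
      interpret R: linear_solution R B C by fact
      let ?S = "prod_emb {0..} (\<lambda>_. borel) J (Pi\<^sub>E J A) \<inter> space R"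
      have S: "?S \<in> sets R" using measurable_sets[OF that(2) pe] by simp
      have "(LINT w|R. cylinder L w * 1) = (LINT w|R. indicator ?S w)"
      proof (rule Bochner_Integration.integral_cong[OF refl])
        fix w assume w: "w \<in> space R"
        then have "w \<in> extensional {0..}" by (simp add: R.space_Q space_path_space)
        then have "w \<in> ?S \<longleftrightarrow> (\<forall>j\<in>J. w j \<in> A j)" using w J
          by (auto simp: prod_emb_def PiE_def Pi_iff)
        then show "cylinder L w * 1 = indicator ?S w" by (auto simp: cylinder_eq setL)
      qed
      also have "\<dots> = measure R ?S" using S by simp
      finally show ?thesis by (simp add: emeasure_distr[OF that(2) pe] R.emeasure_eq_measure)
    qed
    moreover have "(LINT w|Q. cylinder L w * 1) = (LINT w|Q'. cylinder L w * 1)"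
      by (rule finite_dimensional_laws_agree[OF Q Q' init srt _ m(1), where k="\<lambda>_. 1" and M=1])
        (use J m in \<open>auto simp: setL\<close>)
    ultimately show ?thesis using Q Q' idQ by simp
  qed
  have PP: "distr Q ?P (\<lambda>w. w) = distr Q' ?P (\<lambda>w. w)"
    by (rule measure_eqI_PiM_infinite[OF _ _ box])
      (use Q.finite_measure_distr[OF idQ(1)] in auto)
  show ?thesis
  proof (rule measure_eqI)
    show "sets Q = sets Q'" using Q.sets_Q Q'.sets_Q by simp
    fix X assume "X \<in> sets Q"
    then have "X \<in> sets path_space" using Q.sets_Q by simp
    then obtain Y where Y0: "Y \<in> sets ?P" "X = {w. continuous_on {0..} w} \<inter> Y"
      unfolding path_space_def sets_restrict_space by blast
    have "Y \<subseteq> extensional {0..}"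
      using sets.sets_into_space[OF Y0(1)] by (auto simp: space_PiM PiE_def)
    then have Y: "Y \<in> sets ?P" "X = Y \<inter> space path_space"
      using Y0 by (auto simp: space_path_space)
    show "emeasure Q X = emeasure Q' X"
      using emeasure_distr[OF idQ(1) Y(1)] emeasure_distr[OF idQ(2) Y(1)] PP
      by (simp add: Y(2) Q.space_Q Q'.space_Q)
  qed
qed

section \<open>The martingale problem\<close>

text \<open>
  Outside a large interval the function is constantly zero on an open set, so its derivatives vanish there as well.
\<close>

lemma C2_support:
  assumes "C2_compact_support \<phi>"
  obtains R where "\<And>x. R < \<bar>x\<bar> \<Longrightarrow> \<phi> x = 0" "\<And>x. R < \<bar>x\<bar> \<Longrightarrow> deriv \<phi> x = 0"
    "\<And>x. R < \<bar>x\<bar> \<Longrightarrow> deriv (deriv \<phi>) x = 0"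
proof -
  have "bounded (closure {x. \<phi> x \<noteq> 0})"
    using assms by (intro compact_imp_bounded) (simp add: C2_compact_support_def)
  then obtain R where R: "\<And>x. x \<in> closure {x. \<phi> x \<noteq> 0} \<Longrightarrow> \<bar>x\<bar> \<le> R"
    by (auto simp: bounded_iff)
  have o: "open {x :: real. R < \<bar>x\<bar>}" by (intro open_Collect_less continuous_intros)
  have deriv_0: "deriv f x = 0" if "\<And>x. R < \<bar>x\<bar> \<Longrightarrow> f x = 0" "R < \<bar>x\<bar>" for f :: "real \<Rightarrow> real" and x
  proof -
    have "((\<lambda>_. 0) has_real_derivative 0) (at x)" by simp
    then have "(f has_real_derivative 0) (at x)"
      by (rule has_field_derivative_transform_within_open[OF _ o]) (use that in auto)
    then show ?thesis by (rule DERIV_imp_deriv)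
  qed
  have 0: "\<phi> x = 0" if "R < \<bar>x\<bar>" for x using that R closure_subset[of "{x. \<phi> x \<noteq> 0}"] by fastforce
  have 1: "deriv \<phi> x = 0" if "R < \<bar>x\<bar>" for x by (rule deriv_0[OF 0 that])
  have 2: "deriv (deriv \<phi>) x = 0" if "R < \<bar>x\<bar>" for x by (rule deriv_0[OF 1 that])
  show thesis by (rule that[OF 0 1 2])
qed

lemma C2_bounded:
  assumes "C2_compact_support \<phi>"
  obtains K where "\<And>x. \<bar>\<phi> x\<bar> \<le> K" "\<And>x. \<bar>deriv \<phi> x\<bar> \<le> K" "\<And>x. \<bar>deriv (deriv \<phi>) x\<bar> \<le> K"
proof -
  obtain R where z: "\<And>x. R < \<bar>x\<bar> \<Longrightarrow> \<phi> x = 0" "\<And>x. R < \<bar>x\<bar> \<Longrightarrow> deriv \<phi> x = 0"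
    "\<And>x. R < \<bar>x\<bar> \<Longrightarrow> deriv (deriv \<phi>) x = 0"
    using C2_support[OF assms] by blast
  have bnd: "\<exists>K. \<forall>x. \<bar>f x\<bar> \<le> K" if "continuous_on UNIV f" "\<And>x. R < \<bar>x\<bar> \<Longrightarrow> f x = 0" for f :: "real \<Rightarrow> real"
  proof -
    have "bounded (f ` {-R..R})"
      using compact_continuous_image[OF continuous_on_subset[OF that(1)] compact_Icc] by (auto intro: compact_imp_bounded)
    then obtain K where K: "\<forall>x\<in>{-R..R}. \<bar>f x\<bar> \<le> K" by (auto simp: bounded_iff)
    have "\<bar>f x\<bar> \<le> max 0 K" for x
    proof (cases "R < \<bar>x\<bar>")
      case False
      then have "x \<in> {-R..R}" by auto
      then show ?thesis using K by (simp add: le_max_iff_disj)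
    qed (simp add: that(2))
    then show ?thesis by blast
  qed
  have c: "continuous_on UNIV \<phi>" "continuous_on UNIV (deriv \<phi>)" "continuous_on UNIV (deriv (deriv \<phi>))"
    using assms by (auto simp: C2_compact_support_def intro!: continuous_at_imp_continuous_on differentiable_imp_continuous_within)
  obtain K0 K1 K2 where "\<And>x. \<bar>\<phi> x\<bar> \<le> K0" "\<And>x. \<bar>deriv \<phi> x\<bar> \<le> K1" "\<And>x. \<bar>deriv (deriv \<phi>) x\<bar> \<le> K2"
    using bnd[OF c(1) z(1)] bnd[OF c(2) z(2)] bnd[OF c(3) z(3)] by blast
  then show thesis by (intro that[of "max K0 (max K1 K2)"]) (simp_all add: le_max_iff_disj)
qed

lemma C2_measurable:
  assumes "C2_compact_support \<phi>"
  shows "\<phi> \<in> borel_measurable borel" "deriv \<phi> \<in> borel_measurable borel" "deriv (deriv \<phi>) \<in> borel_measurable borel"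
proof -
  have d: "(\<phi> has_real_derivative deriv \<phi> x) (at x)" "(deriv \<phi> has_real_derivative deriv (deriv \<phi>) x) (at x)" for x
    using assms by (auto simp: C2_compact_support_def DERIV_deriv_iff_real_differentiable)
  have c: "continuous_on UNIV \<phi>" "continuous_on UNIV (deriv \<phi>)" "continuous_on UNIV (deriv (deriv \<phi>))"
    using d assms by (auto simp: C2_compact_support_def intro!: continuous_at_imp_continuous_on intro: DERIV_isCont)
  show "\<phi> \<in> borel_measurable borel" "deriv \<phi> \<in> borel_measurable borel" "deriv (deriv \<phi>) \<in> borel_measurable borel"
    by (rule borel_measurable_continuous_onI, rule c)+
qed

context path_drift
begin

definition compensator :: "(real \<Rightarrow> real) \<Rightarrow> real \<Rightarrow> real \<Rightarrow> (real \<Rightarrow> real) \<Rightarrow> real" where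
  "compensator \<phi> s t w =
     (LINT u:{s..t}|lborel. iota (w u) * (deriv \<phi> (w u) * B u (w u) + deriv (deriv \<phi>) (w u)))"

definition compensated :: "(real \<Rightarrow> real) \<Rightarrow> real \<Rightarrow> (real \<Rightarrow> real) \<Rightarrow> real" where
  "compensated \<phi> t w = \<phi> (w t) - \<phi> (w 0) - compensator \<phi> 0 t w"

lemma generator_bound:
  assumes "\<And>x. \<bar>deriv \<phi> x\<bar> \<le> K" "\<And>x. \<bar>deriv (deriv \<phi>) x\<bar> \<le> K"
  shows "\<bar>iota x * (deriv \<phi> x * B u x + deriv (deriv \<phi>) x)\<bar> \<le> K * C + K"
proof -
  have K0: "0 \<le> K" using assms(1)[of 0] by linarith
  have "\<bar>deriv \<phi> x * B u x\<bar> \<le> K * C" unfolding abs_mult by (intro mult_mono assms drift_bounded K0) simp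
  then have "\<bar>deriv \<phi> x * B u x + deriv (deriv \<phi>) x\<bar> \<le> K * C + K" using assms(2)[of x] by linarith
  then show ?thesis using K0 drift_nonneg by (simp add: iota_cases)
qed

lemma compensator_clip:
  assumes "\<And>u. s \<le> u \<Longrightarrow> u \<le> t \<Longrightarrow> c u = u"
  shows "compensator \<phi> s t w = (LINT u:{s..t}|lborel. iota (w (c u)) * (deriv \<phi> (w (c u)) * B u (w (c u)) + deriv (deriv \<phi>) (w (c u))))"
  unfolding compensator_def using assms by (intro set_lebesgue_integral_cong) auto

lemma compensator_measurable:
  assumes \<phi>: "C2_compact_support \<phi>" and st: "0 \<le> s" "s \<le> t" "t \<le> r"
  shows "compensator \<phi> s t \<in> borel_measurable (canonical_filtration r)"
proof -
  let ?c = "\<lambda>u. max 0 (min r u)"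
  have "(\<lambda>(u, w). w (?c u)) \<in> borel_measurable (borel \<Otimes>\<^sub>M canonical_filtration r)"
  proof (rule measurable_continuous_process[where I="{0..r}" and X="\<lambda>r w. w r" and c="?c"])
    show "(\<lambda>w. w q) \<in> borel_measurable (canonical_filtration r)" if "q \<in> {0..r}" for q
      using that by (intro measurable_canonical_eval) auto
    show "continuous_on {0..r} (\<lambda>r. w r)" if "w \<in> space (canonical_filtration r)" for w
      using that by (auto simp: filtration.space_F[OF filtration_canonical] space_path_space intro: continuous_on_subset)
  qed (use st in \<open>auto intro!: continuous_intros\<close>)
  then have q: "(\<lambda>z. snd z (?c (fst z))) \<in> borel_measurable (borel \<Otimes>\<^sub>M canonical_filtration r)"
    by (simp add: case_prod_unfold)
  have "(\<lambda>w. LINT u:{s..t}|lborel. iota (w (?c u)) * (deriv \<phi> (w (?c u)) * B u (w (?c u)) + deriv (deriv \<phi>) (w (?c u))))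
     \<in> borel_measurable (canonical_filtration r)"
    by (rule measurable_time_integral)
      (use measurable_generator[OF q measurable_fst C2_measurable(2,3)[OF \<phi>]] in \<open>simp add: case_prod_unfold\<close>)
  moreover have "compensator \<phi> s t = (\<lambda>w. LINT u:{s..t}|lborel. iota (w (?c u)) * (deriv \<phi> (w (?c u)) * B u (w (?c u)) + deriv (deriv \<phi>) (w (?c u))))"
    by (rule ext, rule compensator_clip) (use st in auto)
  ultimately show ?thesis by simp
qed

lemma compensator_integrand:
  assumes \<phi>: "C2_compact_support \<phi>" and w: "w \<in> space Q"
  shows "(\<lambda>u. iota (w (max 0 u)) * (deriv \<phi> (w (max 0 u)) * B u (w (max 0 u)) + deriv (deriv \<phi>) (w (max 0 u)))) \<in> borel_measurable borel"
proof -
  have q: "(\<lambda>u. w (max 0 u)) \<in> borel_measurable borel"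
    using measurable_Pair1[OF eval_max_measurable w] by simp
  show ?thesis
    by (rule measurable_generator[OF q measurable_ident_sets[OF refl] C2_measurable(2,3)[OF \<phi>]])
qed

lemma compensator_split:
  assumes \<phi>: "C2_compact_support \<phi>" and w: "w \<in> space Q" and st: "0 \<le> s" "s \<le> t" "t \<le> r"
  shows "compensator \<phi> s r w = compensator \<phi> s t w + compensator \<phi> t r w"
proof -
  obtain K where K: "\<And>x. \<bar>deriv \<phi> x\<bar> \<le> K" "\<And>x. \<bar>deriv (deriv \<phi>) x\<bar> \<le> K"
    using C2_bounded[OF \<phi>] by metis
  have "set_integrable lborel {s..r} (\<lambda>u. iota (w (max 0 u)) * (deriv \<phi> (w (max 0 u)) * B u (w (max 0 u)) + deriv (deriv \<phi>) (w (max 0 u))))"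
    by (rule set_integrable_bounded_interval[OF compensator_integrand[OF \<phi> w] generator_bound[OF K]])
  from set_integral_split[OF this st(2,3)]
  show ?thesis
    using st compensator_clip[where s=s and t=r and c="max 0"] compensator_clip[where s=s and t=t and c="max 0"]
      compensator_clip[where s=t and t=r and c="max 0"] by simp
qed

lemma compensator_bound:
  assumes \<phi>: "C2_compact_support \<phi>" and w: "w \<in> space Q" and st: "0 \<le> s" "s \<le> t"
    and K: "\<And>x. \<bar>deriv \<phi> x\<bar> \<le> K" "\<And>x. \<bar>deriv (deriv \<phi>) x\<bar> \<le> K"
  shows "\<bar>compensator \<phi> s t w\<bar> \<le> (K * C + K) * (t - s)"
  using st by (subst compensator_clip[where s=s and t=t and c="max 0"])
    (auto intro!: set_integral_interval_le compensator_integrand[OF \<phi> w] generator_bound K)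

lemma compensated_diff:
  assumes \<phi>: "C2_compact_support \<phi>" and w: "w \<in> space Q" and st: "0 \<le> s" "s \<le> t"
  shows "compensated \<phi> t w - compensated \<phi> s w = \<phi> (w t) - \<phi> (w s) - compensator \<phi> s t w"
  using compensator_split[OF \<phi> w _ st] st by (simp add: compensated_def)

lemma compensated_measurable:
  assumes \<phi>: "C2_compact_support \<phi>" and t: "0 \<le> t"
  shows "compensated \<phi> t \<in> borel_measurable (canonical_filtration t)"
  unfolding compensated_def[abs_def]
  by (intro borel_measurable_diff compensator_measurable[OF \<phi>]
      measurable_compose[OF measurable_canonical_eval C2_measurable(1)[OF \<phi>]]) (use t in auto)

lemma compensated_integrable:
  assumes \<phi>: "C2_compact_support \<phi>" and t: "0 \<le> t"
  shows "integrable Q (compensated \<phi> t)"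
proof -
  obtain K where K: "\<And>x. \<bar>\<phi> x\<bar> \<le> K" "\<And>x. \<bar>deriv \<phi> x\<bar> \<le> K" "\<And>x. \<bar>deriv (deriv \<phi>) x\<bar> \<le> K"
    using C2_bounded[OF \<phi>] by metis
  show ?thesis
  proof (rule integrable_bounded[where K="2 * K + (K * C + K) * t"])
    show "compensated \<phi> t \<in> borel_measurable Q"
      by (rule canonical_measurable[OF compensated_measurable[OF \<phi> t]])
    show "\<bar>compensated \<phi> t w\<bar> \<le> 2 * K + (K * C + K) * t" if "w \<in> space Q" for w
      using compensator_bound[OF \<phi> that order_refl t K(2,3)] K(1)[of "w t"] K(1)[of "w 0"]
      unfolding compensated_def by simp
  qed
qed

lemma subalgebra_Q: "subalgebra Q (canonical_filtration t)"
  using subalgebra_canonical[of t] sets_Q space_Q by (simp add: subalgebra_def)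

lemma sigma_finite_subalgebra_Q: "sigma_finite_subalgebra Q (canonical_filtration t)"
  by (rule finite_measure_subalgebra_is_sigma_finite) (unfold_locales, rule subalgebra_Q)

text \<open>
  A conditional expectation is tested by the indicators of past events, which are admissible weights; conversely a bounded weight
  measurable with respect to the past can be pulled into the conditional expectation.
\<close>

lemma martingale_compensated_iff:
  assumes \<phi>: "C2_compact_support \<phi>"
  shows "martingale Q canonical_filtration (compensated \<phi>) \<longleftrightarrow>
    (\<forall>s\<ge>0. \<forall>t\<ge>s. \<forall>G\<in>borel_measurable (canonical_filtration s). (\<forall>w. \<bar>G w\<bar> \<le> 1) \<longrightarrow>
      (LINT w|Q. G w * (\<phi> (w t) - \<phi> (w s) - compensator \<phi> s t w)) = 0)"
proof
  assume M: "martingale Q canonical_filtration (compensated \<phi>)"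
  show "\<forall>s\<ge>0. \<forall>t\<ge>s. \<forall>G\<in>borel_measurable (canonical_filtration s). (\<forall>w. \<bar>G w\<bar> \<le> 1) \<longrightarrow>
      (LINT w|Q. G w * (\<phi> (w t) - \<phi> (w s) - compensator \<phi> s t w)) = 0"
  proof (intro allI impI ballI)
    fix s t :: real and G :: "(real \<Rightarrow> real) \<Rightarrow> real"
    assume s: "0 \<le> s" and t: "s \<le> t" and G: "G \<in> borel_measurable (canonical_filtration s)" and Gb: "\<forall>w. \<bar>G w\<bar> \<le> 1"
    interpret F: sigma_finite_subalgebra Q "canonical_filtration s" by (rule sigma_finite_subalgebra_Q)
    have Gm: "G \<in> borel_measurable Q" by (rule canonical_measurable[OF G])
    have int: "integrable Q (\<lambda>w. G w * compensated \<phi> r w)" if "0 \<le> r" for r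
      by (rule Bochner_Integration.integrable_bound[OF compensated_integrable[OF \<phi> that]])
        (use Gm compensated_integrable[OF \<phi> that] Gb in \<open>auto simp: abs_mult intro!: mult_left_le_one_le\<close>)
    have t0: "0 \<le> t" using s t by simp
    have "(LINT w|Q. G w * compensated \<phi> t w) = (LINT w|Q. G w * real_cond_exp Q (canonical_filtration s) (compensated \<phi> t) w)"
      by (rule F.real_cond_exp_intg(2)[symmetric, OF int[OF t0] G]) (use compensated_integrable[OF \<phi> t0] in auto)
    also have "\<dots> = (LINT w|Q. G w * compensated \<phi> s w)"
    proof (rule integral_cong_AE)
      have "AE w in Q. real_cond_exp Q (canonical_filtration s) (compensated \<phi> t) w = compensated \<phi> s w"
        using M s t by (auto simp: martingale_def)
      then show "AE w in Q. G w * real_cond_exp Q (canonical_filtration s) (compensated \<phi> t) w = G w * compensated \<phi> s w"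
        by eventually_elim simp
    qed (use Gm compensated_integrable[OF \<phi> s] in auto)
    finally have "(LINT w|Q. G w * compensated \<phi> t w - G w * compensated \<phi> s w) = 0"
      using int[OF s] int[OF t0] by simp
    moreover have "(LINT w|Q. G w * (\<phi> (w t) - \<phi> (w s) - compensator \<phi> s t w)) = (LINT w|Q. G w * compensated \<phi> t w - G w * compensated \<phi> s w)"
      by (rule Bochner_Integration.integral_cong[OF refl])
        (simp add: compensated_diff[OF \<phi> _ s t, symmetric] right_diff_distrib)
    ultimately show "(LINT w|Q. G w * (\<phi> (w t) - \<phi> (w s) - compensator \<phi> s t w)) = 0" by simp
  qed
next
  assume zero: "\<forall>s\<ge>0. \<forall>t\<ge>s. \<forall>G\<in>borel_measurable (canonical_filtration s). (\<forall>w. \<bar>G w\<bar> \<le> 1) \<longrightarrow>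
      (LINT w|Q. G w * (\<phi> (w t) - \<phi> (w s) - compensator \<phi> s t w)) = 0"
  show "martingale Q canonical_filtration (compensated \<phi>)"
    unfolding martingale_def
  proof (intro conjI allI impI)
    show "filtration (space Q) canonical_filtration" using filtration_canonical by (simp add: space_Q)
    fix s :: real assume s: "0 \<le> s"
    show "subalgebra Q (canonical_filtration s)" by (rule subalgebra_Q)
    show "compensated \<phi> s \<in> borel_measurable (canonical_filtration s)" by (rule compensated_measurable[OF \<phi> s])
    show "integrable Q (compensated \<phi> s)" by (rule compensated_integrable[OF \<phi> s])
    fix t assume t: "s \<le> t"
    then have t0: "0 \<le> t" using s by simp
    interpret F: sigma_finite_subalgebra Q "canonical_filtration s" by (rule sigma_finite_subalgebra_Q)
    show "AE w in Q. real_cond_exp Q (canonical_filtration s) (compensated \<phi> t) w = compensated \<phi> s w"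
    proof (rule F.real_cond_exp_charact)
      fix A assume A: "A \<in> sets (canonical_filtration s)"
      then have AQ: "A \<in> sets Q" using subalgebra_Q by (auto simp: subalgebra_def)
      have "(LINT w|Q. indicator A w * (\<phi> (w t) - \<phi> (w s) - compensator \<phi> s t w)) = 0"
        using zero s t A by (auto simp: indicator_def)
      moreover have "(LINT w|Q. indicator A w * (\<phi> (w t) - \<phi> (w s) - compensator \<phi> s t w)) =
          (LINT w|Q. indicator A w *\<^sub>R compensated \<phi> t w - indicator A w *\<^sub>R compensated \<phi> s w)"
        by (rule Bochner_Integration.integral_cong[OF refl])
          (simp add: compensated_diff[OF \<phi> _ s t, symmetric] right_diff_distrib)
      moreover have "\<dots> = (LINT w:A|Q. compensated \<phi> t w) - (LINT w:A|Q. compensated \<phi> s w)"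
        unfolding set_lebesgue_integral_def
        by (intro Bochner_Integration.integral_diff integrable_mult_indicator AQ compensated_integrable[OF \<phi>] s t0)
      ultimately show "(LINT w:A|Q. compensated \<phi> t w) = (LINT w:A|Q. compensated \<phi> s w)" by simp
    qed (use compensated_integrable[OF \<phi>] compensated_measurable[OF \<phi>] s t0 in auto)
  qed
qed

end

section \<open>The mean-field drift\<close>

text \<open>
  Negative times are clipped to the origin, so that the drift is a measurable function on the whole plane and depends only on
  values of \<open>b\<close> at times in \<open>[0,\<infinity>)\<close>.
\<close>

definition mean_drift :: "(real \<Rightarrow> real \<Rightarrow> real \<Rightarrow> real) \<Rightarrow> (real \<Rightarrow> real) measure \<Rightarrow> real \<Rightarrow> real \<Rightarrow> real" where
  "mean_drift b Q u x = (LINT y:{0<..}|marginal Q (max 0 u). b (max 0 u) x y)"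

locale interaction =
  fixes b :: "real \<Rightarrow> real \<Rightarrow> real \<Rightarrow> real" and C :: real
  assumes b_measurable: "(\<lambda>(t, x, y). b (max 0 t) x y) \<in> borel_measurable (borel \<Otimes>\<^sub>M borel \<Otimes>\<^sub>M borel)"
    and b_bounded: "\<And>t x y. \<bar>b (max 0 t) x y\<bar> \<le> C"
begin

lemma measurable_b_compose:
  "f \<in> borel_measurable N \<Longrightarrow> g \<in> borel_measurable N \<Longrightarrow> h \<in> borel_measurable N \<Longrightarrow>
   (\<lambda>z. b (max 0 (f z)) (g z) (h z)) \<in> borel_measurable N"
  using measurable_compose[OF measurable_Pair[OF _ measurable_Pair] b_measurable] by simp

lemma C_nonneg: "0 \<le> C"
  using b_bounded[of 0 0 0] by linarith

lemma measurable_b_section: "b (max 0 u) x \<in> borel_measurable borel"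
  by (rule measurable_b_compose[of "\<lambda>_. u" borel "\<lambda>_. x" "\<lambda>y. y"]) simp_all

lemma mean_drift_eq:
  assumes "sets Q = sets path_space"
  shows "mean_drift b Q u x = (LINT w|Q. iota (w (max 0 u)) * b (max 0 u) x (w (max 0 u)))"
proof -
  have e: "(\<lambda>w. w (max 0 u)) \<in> borel_measurable Q"
    using measurable_path_eval measurable_cong_sets[OF assms refl] by (metis max.cobounded1)
  have "mean_drift b Q u x = (LINT y|marginal Q (max 0 u). iota y * b (max 0 u) x y)"
    by (simp add: mean_drift_def set_lebesgue_integral_def iota_def)
  also have "\<dots> = (LINT w|Q. iota (w (max 0 u)) * b (max 0 u) x (w (max 0 u)))"
    unfolding marginal_def
    by (rule integral_distr[OF e]) (intro borel_measurable_times iota_measurable measurable_b_section)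
  finally show ?thesis .
qed

lemma path_drift_mean_drift:
  assumes "prob_space Q" "sets Q = sets path_space"
  shows "path_drift Q (mean_drift b Q) C"
proof -
  interpret prob_space Q by fact
  have e: "(\<lambda>(u, w). w (max 0 u)) \<in> borel_measurable (borel \<Otimes>\<^sub>M Q)"
  proof (rule measurable_continuous_process[where I="{0..}" and X="\<lambda>r w. w r"])
    show "(\<lambda>w. w r) \<in> borel_measurable Q" if "r \<in> {0..}" for r
      using that measurable_path_eval measurable_cong_sets[OF assms(2) refl] by auto
    show "continuous_on {0..} (\<lambda>r. w r)" if "w \<in> space Q" for w
      using that sets_eq_imp_space_eq[OF assms(2)] by (simp add: space_path_space)
  qed (auto intro: continuous_intros)
  show ?thesis
  proof unfold_locales
    show "sets Q = sets path_space" by fact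
    have "(\<lambda>z. (fst (fst z), snd z)) \<in> measurable ((borel \<Otimes>\<^sub>M borel) \<Otimes>\<^sub>M Q) (borel \<Otimes>\<^sub>M Q)" by measurable
    from measurable_compose[OF this e]
    have e': "(\<lambda>z :: (real \<times> real) \<times> (real \<Rightarrow> real). snd z (max 0 (fst (fst z)))) \<in> borel_measurable ((borel \<Otimes>\<^sub>M borel) \<Otimes>\<^sub>M Q)" by simp
    have "(\<lambda>z. iota (snd z (max 0 (fst (fst z)))) * b (max 0 (fst (fst z))) (snd (fst z)) (snd z (max 0 (fst (fst z)))))
       \<in> borel_measurable ((borel \<Otimes>\<^sub>M borel) \<Otimes>\<^sub>M Q)"
      by (intro borel_measurable_times measurable_compose[OF e' iota_measurable] measurable_b_compose e') measurable
    then have "(\<lambda>z. LINT w|Q. iota (w (max 0 (fst z))) * b (max 0 (fst z)) (snd z) (w (max 0 (fst z)))) \<in> borel_measurable (borel \<Otimes>\<^sub>M borel)"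
      by (intro borel_measurable_lebesgue_integral) (simp add: case_prod_unfold)
    then show "(\<lambda>(u, x). mean_drift b Q u x) \<in> borel_measurable (borel \<Otimes>\<^sub>M borel)"
      by (simp add: mean_drift_eq[OF assms(2)] case_prod_unfold)
    show "\<bar>mean_drift b Q u x\<bar> \<le> C" for u x
      unfolding mean_drift_eq[OF assms(2)]
      by (rule abs_expectation_le) (use b_bounded C_nonneg in \<open>simp add: iota_cases\<close>)
  qed
qed

lemma martingale_problem_process_eq:
  assumes "prob_space Q" "sets Q = sets path_space" "0 \<le> t"
  shows "martingale_problem_process b Q \<phi> t = path_drift.compensated (mean_drift b Q) \<phi> t"
proof -
  interpret path_drift Q "mean_drift b Q" C by (rule path_drift_mean_drift[OF assms(1,2)])
  show ?thesis
  proof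
    fix w
    have "(LINT u:{0..t}|lborel. iota (w u) * (deriv \<phi> (w u) * (LINT y:{0<..}|marginal Q u. b u (w u) y) + deriv (deriv \<phi>) (w u))) =
        (LINT u:{0..t}|lborel. iota (w u) * (deriv \<phi> (w u) * mean_drift b Q u (w u) + deriv (deriv \<phi>) (w u)))"
      by (intro set_lebesgue_integral_cong allI impI) (simp_all add: mean_drift_def max_def)
    then show "martingale_problem_process b Q \<phi> t w = compensated \<phi> t w"
      by (simp only: martingale_problem_process_def compensated_def compensator_def)
  qed
qed

lemma martingale_cong:
  assumes "\<And>t. 0 \<le> t \<Longrightarrow> X t = Y t"
  shows "martingale M F X \<longleftrightarrow> martingale M F Y"
proof -
  have "\<And>s t. 0 \<le> s \<Longrightarrow> s \<le> t \<Longrightarrow> X t = Y t" using assms by auto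
  then show ?thesis unfolding martingale_def using assms by auto
qed

text \<open>
  At nonnegative times the process of the nonlinear problem is the compensated process of the linear problem with drift
  \<open>mean_drift b Q\<close>.
\<close>

lemma weak_solution_iff:
  "weak_solution b \<rho> Q \<longleftrightarrow> linear_solution Q (mean_drift b Q) C \<and> marginal Q 0 = \<rho>"
proof
  assume W: "weak_solution b \<rho> Q"
  then have Q: "prob_space Q" "sets Q = sets path_space" by (auto simp: weak_solution_def)
  interpret path_drift Q "mean_drift b Q" C by (rule path_drift_mean_drift[OF Q])
  have "linear_solution Q (mean_drift b Q) C"
  proof unfold_locales
    fix t :: real assume t: "0 \<le> t"
    then have "measure Q {w \<in> space Q. 0 \<le> w t} = 1" using W by (simp add: weak_solution_def)
    then show "AE w in Q. 0 \<le> w t"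
      using prob_Collect_eq_1[of "\<lambda>w. 0 \<le> w t"] borel_measurable_le[OF borel_measurable_const eval_measurable[OF t]] by simp
  next
    fix \<phi> and s t :: real and G :: "(real \<Rightarrow> real) \<Rightarrow> real"
    assume \<phi>: "C2_compact_support \<phi>" and st: "0 \<le> s" "s \<le> t" and G: "G \<in> borel_measurable (canonical_filtration s)" "\<And>w. \<bar>G w\<bar> \<le> 1"
    have "martingale Q canonical_filtration (martingale_problem_process b Q \<phi>)"
      using W \<phi> by (simp add: weak_solution_def)
    then have "martingale Q canonical_filtration (compensated \<phi>)"
      by (rule martingale_cong[THEN iffD1, rotated]) (rule martingale_problem_process_eq[OF Q])
    then have "(LINT w|Q. G w * (\<phi> (w t) - \<phi> (w s) - compensator \<phi> s t w)) = 0"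
      using st G by (simp add: martingale_compensated_iff[OF \<phi>])
    then show "(LINT w|Q. G w * (\<phi> (w t) - \<phi> (w s) -
          (LINT u:{s..t}|lborel. iota (w u) * (deriv \<phi> (w u) * mean_drift b Q u (w u) + deriv (deriv \<phi>) (w u))))) = 0"
      unfolding compensator_def .
  qed
  then show "linear_solution Q (mean_drift b Q) C \<and> marginal Q 0 = \<rho>" using W by (simp add: weak_solution_def)
next
  assume L: "linear_solution Q (mean_drift b Q) C \<and> marginal Q 0 = \<rho>"
  then interpret linear_solution Q "mean_drift b Q" C by simp
  show "weak_solution b \<rho> Q"
    unfolding weak_solution_def
  proof (intro conjI allI impI)
    show "prob_space Q" "sets Q = sets path_space" "marginal Q 0 = \<rho>"
      using L sets_Q by (auto intro: prob_space_axioms)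
    fix \<phi> assume \<phi>: "C2_compact_support \<phi>"
    have "martingale Q canonical_filtration (compensated \<phi>)"
      unfolding martingale_compensated_iff[OF \<phi>] compensator_def
      by (intro allI impI ballI, rule martingale_problem[OF \<phi>]) auto
    then show "martingale Q canonical_filtration (martingale_problem_process b Q \<phi>)"
      by (rule martingale_cong[THEN iffD2, rotated]) (rule martingale_problem_process_eq[OF prob_space_axioms sets_Q])
  next
    fix t :: real assume t: "0 \<le> t"
    show "measure Q {w \<in> space Q. 0 \<le> w t} = 1"
      using nonneg[OF t] prob_Collect_eq_1[of "\<lambda>w. 0 \<le> w t"] borel_measurable_le[OF borel_measurable_const eval_measurable[OF t]] by simp
  qed
qed

text \<open>
  For fixed \<open>u\<close> and \<open>x\<close>, both mean fields are expectations of one function of the position, the odd extension of \<open>b(u,x,\<sqdot>)\<close>, which is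
  bounded by \<open>C\<close>. The choice of \<open>l\<close> makes the constant of \<open>stability\<close> at most one half.
\<close>

lemma mean_drift_contraction:
  assumes Q: "linear_solution Q B C" and Q': "linear_solution Q' B' C" and init: "marginal Q 0 = marginal Q' 0"
    and l: "0 < l" "pi / sqrt (2 * l) * C \<le> 1/4"
    and d: "\<And>u x. 0 \<le> u \<Longrightarrow> \<bar>B u x - B' u x\<bar> \<le> d * exp (l * u)" "0 \<le> d" and u: "0 \<le> u"
  shows "\<bar>mean_drift b Q u x - mean_drift b Q' u x\<bar> \<le> d / 2 * exp (l * u)"
proof -
  interpret Q: linear_solution Q B C by fact
  interpret Q': linear_solution Q' B' C by fact
  have 0: "(LINT w|Q. k (w 0)) = (LINT w|Q'. k (w 0))" if "k \<in> borel_measurable borel" for k :: "real \<Rightarrow> real"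
    using integral_distr[OF Q.eval_measurable[of 0] that] integral_distr[OF Q'.eval_measurable[of 0] that] init
    by (simp add: marginal_def)
  interpret two_solutions Q B Q' B' C 0 "\<lambda>_. 1"
    by unfold_locales (use 0 in auto)
  define h where "h = odd_extension (b u x)"
  have bs: "b u x \<in> borel_measurable borel" "\<And>y. \<bar>b u x y\<bar> \<le> C"
    using measurable_b_section[of u x] b_bounded[of u x] u by simp_all
  have hm: "h \<in> borel_measurable borel" unfolding h_def using bs(1) by (rule measurable_odd_extension)
  have eq: "mean_drift b R u x = (LINT w|R. h (w u))" if "linear_solution R D C" for R D
  proof -
    interpret R: linear_solution R D C by fact
    have ev: "(\<lambda>w. w u) \<in> borel_measurable R" by (rule R.eval_measurable[OF u])
    have "mean_drift b R u x = (LINT w|R. iota (w u) * b u x (w u))"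
      using mean_drift_eq[OF R.sets_Q, of u x] u by simp
    also have "\<dots> = (LINT w|R. h (w u))"
    proof (rule integral_cong_AE)
      show "AE w in R. iota (w u) * b u x (w u) = h (w u)"
        using R.nonneg[OF u] by eventually_elim (simp add: h_def odd_extension_nonneg)
    qed (intro borel_measurable_times measurable_compose[OF ev iota_measurable] measurable_compose[OF ev bs(1)] measurable_compose[OF ev hm])+
    finally show ?thesis .
  qed
  have "\<bar>(LINT w|Q. h (w u)) - (LINT w|Q'. h (w u))\<bar> \<le> C * (2 * (pi / sqrt (2 * l)) * d * exp (l * u))"
    using stability[OF l d u hm, of C] odd_extension_le[of "b u x", OF bs(2)]
    by (simp add: h_def odd_extension_minus)
  also have "\<dots> = (pi / sqrt (2 * l) * C) * (2 * d * exp (l * u))" by simp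
  also have "\<dots> \<le> 1/4 * (2 * d * exp (l * u))" using l d(2) by (intro mult_right_mono) auto
  finally show ?thesis unfolding eq[OF Q] eq[OF Q'] by simp
qed

text \<open>
  The mean fields of the two solutions differ by at most \<open>2 C\<close>. The contraction applies to them again and again, because each is
  the drift of its own solution; so they coincide, and the linear problem has one solution.
\<close>

theorem weak_solution_unique:
  assumes W: "weak_solution b \<rho> Q" and W': "weak_solution b \<rho> Q'"
  shows "Q = Q'"
proof -
  define B where "B = mean_drift b Q"
  define B' where "B' = mean_drift b Q'"
  have Q: "linear_solution Q B C" and Q': "linear_solution Q' B' C" and init: "marginal Q 0 = marginal Q' 0"
    using W W' unfolding weak_solution_iff B_def B'_def by auto
  interpret Q: linear_solution Q B C by fact
  interpret Q': linear_solution Q' B' C by fact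
  obtain l where l: "0 < l" "pi / sqrt (2 * l) * C \<le> 1/4" using exists_contraction_rate[OF C_nonneg] by metis
  have bound: "\<bar>B u x - B' u x\<bar> \<le> 2 * C * (1/2)^n * exp (l * u)" if "0 \<le> u" for n u x
    using that
  proof (induction n arbitrary: u x)
    case 0
    have "\<bar>B u x - B' u x\<bar> \<le> 2 * C * 1" using Q.drift_bounded[of u x] Q'.drift_bounded[of u x] by simp
    also have "\<dots> \<le> 2 * C * exp (l * u)" using 0 l C_nonneg by (intro mult_left_mono) auto
    finally show ?case by simp
  next
    case (Suc n)
    have "\<bar>mean_drift b Q u x - mean_drift b Q' u x\<bar> \<le> 2 * C * (1/2)^n / 2 * exp (l * u)"
      by (rule mean_drift_contraction[OF Q Q' init l Suc.IH]) (use C_nonneg Suc.prems in auto)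
    then show ?case by (simp add: B_def B'_def)
  qed
  have eq: "B u x = B' u x" if "0 \<le> u" for u x
  proof -
    have "(\<lambda>n. 2 * C * (1/2)^n * exp (l * u)) \<longlonglongrightarrow> 2 * C * 0 * exp (l * u)"
      by (intro tendsto_intros LIMSEQ_power_zero) simp
    then have "\<bar>B u x - B' u x\<bar> \<le> 2 * C * 0 * exp (l * u)"
      by (rule LIMSEQ_le_const) (use bound[OF that] in blast)
    then show ?thesis by simp
  qed
  have "B u x = B' u x" for u x
    using eq[of "max 0 u" x] by (simp add: B_def B'_def mean_drift_def)
  then have "B = B'" by (intro ext)
  then show ?thesis using linear_solution_unique[OF Q _ init] Q' by simp
qed

end

section \<open>Brownian motion: dyadic increments\<close>

definition dyadic_normal :: "nat \<Rightarrow> real measure" where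
  "dyadic_normal n = density lborel (normal_density 0 (sqrt ((1/2) ^ n)))"

definition increments :: "nat \<Rightarrow> (nat \<Rightarrow> real) measure" where
  "increments n = PiM UNIV (\<lambda>_. dyadic_normal n)"

lemma sets_dyadic_normal[simp, measurable_cong]: "sets (dyadic_normal n) = sets borel"
  by (simp add: dyadic_normal_def)

lemma prob_space_dyadic_normal: "prob_space (dyadic_normal n)"
  unfolding dyadic_normal_def by (rule prob_space_normal_density) simp

lemma sets_increments[measurable_cong]: "sets (increments n) = sets (PiM UNIV (\<lambda>_. borel))"
  unfolding increments_def by (rule sets_PiM_cong) auto

lemma space_increments[simp]: "space (increments n) = UNIV"
  using sets_eq_imp_space_eq[OF sets_increments[of n]] by (simp add: space_PiM)

lemma prob_space_increments: "prob_space (increments n)"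
  unfolding increments_def by (rule prob_space_PiM) (rule prob_space_dyadic_normal)

lemma distr_increments_component: "distr (increments n) borel (\<lambda>x. x k) = dyadic_normal n"
proof -
  interpret product_prob_space "\<lambda>_. dyadic_normal n" UNIV
    by (rule product_prob_spaceI) (rule prob_space_dyadic_normal)
  have "distr (increments n) (dyadic_normal n) (\<lambda>x. x k) = dyadic_normal n"
    unfolding increments_def by (rule PiM_component) simp
  moreover have "distr (increments n) (dyadic_normal n) (\<lambda>x. x k) = distr (increments n) borel (\<lambda>x. x k)"
    by (rule distr_cong) auto
  ultimately show ?thesis by simp
qed

lemma indep_increments: "prob_space.indep_vars (increments n) (\<lambda>_. borel) (\<lambda>k x. x k) UNIV"
proof -
  interpret prob_space "increments n" by (rule prob_space_increments)
  have rv: "random_variable borel (\<lambda>x. x k)" for k by measurable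
  have "distr (increments n) (PiM UNIV (\<lambda>_. borel)) (\<lambda>x. \<lambda>i\<in>UNIV. x i) = increments n"
    using distr_id2[OF sets_increments[of n, symmetric]] by (simp add: restrict_UNIV)
  then show ?thesis
    by (subst indep_vars_iff_distr_eq_PiM[OF _ rv]) (simp_all add: distr_increments_component[unfolded increments_def] increments_def)
qed

definition pair_sum :: "(nat \<Rightarrow> real) \<Rightarrow> nat \<Rightarrow> real" where
  "pair_sum x k = x (2 * k) + x (2 * k + 1)"

lemma measurable_pair_sum[measurable]: "pair_sum \<in> measurable (PiM UNIV (\<lambda>_. borel)) (PiM UNIV (\<lambda>_. borel))"
proof (rule measurable_PiM_single')
  show "(\<lambda>x. pair_sum x k) \<in> borel_measurable (PiM UNIV (\<lambda>_. borel))" for k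
    unfolding pair_sum_def by measurable
qed (auto simp: space_PiM)

lemma distributed_increments_component: "distributed (increments n) lborel (\<lambda>x. x k) (normal_density 0 (sqrt ((1/2) ^ n)))"
proof -
  have m: "(\<lambda>x. x k) \<in> measurable (increments n) lborel" by measurable
  have "distr (increments n) lborel (\<lambda>x. x k) = distr (increments n) borel (\<lambda>x. x k)"
    by (rule distr_cong) auto
  then show ?thesis
    using m by (simp add: distributed_def distr_increments_component dyadic_normal_def)
qed

text \<open>
  Sums of two neighbouring increments of level \<open>n + 1\<close> are independent normal variables with the variance of level \<open>n\<close>. This makes
  the levels consistent.
\<close>

lemma distr_pair_sum: "distr (increments (Suc n)) (PiM UNIV (\<lambda>_. borel)) pair_sum = increments n"
proof -
  interpret prob_space "increments (Suc n)" by (rule prob_space_increments)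
  let ?K = "\<lambda>k::nat. {2 * k, 2 * k + 1}"
  have blocks: "indep_vars (\<lambda>k. PiM (?K k) (\<lambda>_. borel)) (\<lambda>k x. restrict (\<lambda>i. x i) (?K k)) UNIV"
  proof (rule indep_vars_restrict[OF indep_increments])
    show "disjoint_family ?K"
      unfolding disjoint_family_on_def by (auto; presburger)
  qed simp
  have "indep_vars (\<lambda>_. borel) (\<lambda>k x. (\<lambda>y. y (2 * k) + y (2 * k + 1)) (restrict (\<lambda>i. x i) (?K k))) UNIV"
    by (rule indep_vars_compose2[OF blocks]) measurable
  then have ind: "indep_vars (\<lambda>_. borel) (\<lambda>k x. pair_sum x k) UNIV"
    by (simp add: pair_sum_def)
  have law: "distr (increments (Suc n)) borel (\<lambda>x. pair_sum x k) = dyadic_normal n" for k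
  proof -
    have "indep_var borel (\<lambda>x. x (2 * k)) borel (\<lambda>x. \<Sum>i\<in>{2 * k + 1}. x i)"
      by (rule indep_vars_sum) (auto intro: indep_vars_subset[OF indep_increments])
    then have i: "indep_var borel (\<lambda>x. x (2 * k)) borel (\<lambda>x. x (2 * k + 1))" by simp
    have "distributed (increments (Suc n)) lborel (\<lambda>x. x (2 * k) + x (2 * k + 1))
        (normal_density (0 + 0) (sqrt ((sqrt ((1/2) ^ Suc n))\<^sup>2 + (sqrt ((1/2) ^ Suc n))\<^sup>2)))"
      by (rule add_indep_normal[OF i]) (simp, simp, (rule distributed_increments_component)+)
    then have "distributed (increments (Suc n)) lborel (\<lambda>x. pair_sum x k) (normal_density 0 (sqrt ((1/2) ^ n)))"
      by (simp add: pair_sum_def)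
    moreover have "distr (increments (Suc n)) lborel (\<lambda>x. pair_sum x k) = distr (increments (Suc n)) borel (\<lambda>x. pair_sum x k)"
      by (rule distr_cong) auto
    ultimately show ?thesis by (simp add: distributed_def dyadic_normal_def)
  qed
  have rv: "random_variable borel (\<lambda>x. pair_sum x k)" for k unfolding pair_sum_def by measurable
  show ?thesis
    using ind by (subst (asm) indep_vars_iff_distr_eq_PiM[OF _ rv]) (simp_all add: law[unfolded increments_def] increments_def restrict_UNIV)
qed

text \<open>Reading the increment \<open>(m, k)\<close> over \<open>[k 2\<^sup>-\<^sup>m, (k+1) 2\<^sup>-\<^sup>m]\<close> off the increments of level \<open>N \<ge> m\<close>.\<close>

definition coarsen :: "nat \<Rightarrow> (nat \<Rightarrow> real) \<Rightarrow> nat \<times> nat \<Rightarrow> real" where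
  "coarsen N x = (\<lambda>(m, k). \<Sum>i = k * 2 ^ (N - m)..<(k + 1) * 2 ^ (N - m). x i)"

lemma sum_pair_sum: "(\<Sum>i = 2 * a..<2 * b. x i) = (\<Sum>i = a..<b. pair_sum x i)"
proof (induction b)
  case (Suc b)
  show ?case
  proof (cases "a \<le> b")
    case True
    then have "{2 * a..<2 * Suc b} = insert (2 * b + 1) (insert (2 * b) {2 * a..<2 * b})" by auto
    moreover have "{a..<Suc b} = insert b {a..<b}" using True by auto
    ultimately show ?thesis using Suc True by (simp add: pair_sum_def)
  qed simp
qed simp

lemma coarsen_Suc: "m \<le> N \<Longrightarrow> coarsen (Suc N) x (m, k) = coarsen N (pair_sum x) (m, k)"
proof -
  assume "m \<le> N"
  then have "2 ^ (Suc N - m) = 2 * (2 ^ (N - m) :: nat)" by (simp add: Suc_diff_le)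
  then show ?thesis
    using sum_pair_sum[of x "k * 2 ^ (N - m)" "(k + 1) * 2 ^ (N - m)"]
    by (simp add: coarsen_def mult_ac)
qed

lemma measurable_coarsen[measurable]: "(\<lambda>x. coarsen N x p) \<in> borel_measurable (PiM UNIV (\<lambda>_. borel))"
  unfolding coarsen_def by (cases p) (simp, measurable)

lemma measurable_coarsen_restrict: "(\<lambda>x. restrict (coarsen N x) J) \<in> measurable (PiM UNIV (\<lambda>_. borel)) (PiM J (\<lambda>_. borel))"
  by (rule measurable_restrict) (rule measurable_coarsen)

definition level :: "(nat \<times> nat) set \<Rightarrow> nat" where
  "level J = Max (insert 0 (fst ` J))"

text \<open>
  The joint law of finitely many dyadic increments, read off the finest level that occurs among them.
\<close>

definition marginal_law :: "(nat \<times> nat) set \<Rightarrow> (nat \<times> nat \<Rightarrow> real) measure" where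
  "marginal_law J = distr (increments (level J)) (PiM J (\<lambda>_. borel)) (\<lambda>x. restrict (coarsen (level J) x) J)"

lemma level_le: "finite J \<Longrightarrow> (m, k) \<in> J \<Longrightarrow> m \<le> level J"
  unfolding level_def by (rule Max_ge) (auto simp: image_iff intro: rev_bexI)

text \<open>
  Any finer level gives the same law, since passing to the next level amounts to \<open>pair_sum\<close>.
\<close>

lemma marginal_law_eq:
  assumes "finite J" "level J \<le> N"
  shows "marginal_law J = distr (increments N) (PiM J (\<lambda>_. borel)) (\<lambda>x. restrict (coarsen N x) J)"
  using assms(2)
proof (induction N rule: dec_induct)
  case base
  show ?case by (rule marginal_law_def)
next
  case (step N)
  have m: "pair_sum \<in> measurable (increments (Suc N)) (PiM UNIV (\<lambda>_. borel))" by measurable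
  have "marginal_law J = distr (distr (increments (Suc N)) (PiM UNIV (\<lambda>_. borel)) pair_sum) (PiM J (\<lambda>_. borel)) (\<lambda>x. restrict (coarsen N x) J)"
    unfolding distr_pair_sum by (rule step)
  also have "\<dots> = distr (increments (Suc N)) (PiM J (\<lambda>_. borel)) ((\<lambda>x. restrict (coarsen N x) J) \<circ> pair_sum)"
    by (rule distr_distr[OF measurable_coarsen_restrict m])
  also have "(\<lambda>x. restrict (coarsen N x) J) \<circ> pair_sum = (\<lambda>x. restrict (coarsen (Suc N) x) J)"
  proof (intro ext)
    fix x p
    show "((\<lambda>x. restrict (coarsen N x) J) \<circ> pair_sum) x p = restrict (coarsen (Suc N) x) J p"
      using level_le[OF assms(1), of "fst p" "snd p"] step coarsen_Suc[of "fst p" N x "snd p"]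
      by (auto simp: restrict_def)
  qed
  finally show ?case .
qed

lemma marginal_law_restrict:
  assumes JH: "J \<subseteq> H" "finite H"
  shows "marginal_law J = distr (marginal_law H) (PiM J (\<lambda>_. borel)) (\<lambda>f. restrict f J)"
proof -
  from JH have J: "finite J" by (rule finite_subset)
  have lv: "level J \<le> level H" unfolding level_def using JH by (intro Max_mono) auto
  have m: "(\<lambda>x. restrict (coarsen (level H) x) H) \<in> measurable (increments (level H)) (PiM H (\<lambda>_. borel))"
    using measurable_coarsen_restrict by (simp cong: measurable_cong_sets add: sets_increments)
  have "distr (marginal_law H) (PiM J (\<lambda>_. borel)) (\<lambda>f. restrict f J) =
      distr (increments (level H)) (PiM J (\<lambda>_. borel)) ((\<lambda>f. restrict f J) \<circ> (\<lambda>x. restrict (coarsen (level H) x) H))"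
    unfolding marginal_law_def by (rule distr_distr[OF measurable_restrict_subset[OF JH(1)] m])
  also have "(\<lambda>f. restrict f J) \<circ> (\<lambda>x. restrict (coarsen (level H) x) H) = (\<lambda>x. restrict (coarsen (level H) x) J)"
    using JH by (auto simp: restrict_def fun_eq_iff)
  also have "distr (increments (level H)) (PiM J (\<lambda>_. borel)) \<dots> = marginal_law J"
    by (rule marginal_law_eq[OF J lv, symmetric])
  finally show ?thesis by (rule sym)
qed

lemma prob_space_marginal_law: "prob_space (marginal_law J)"
proof -
  interpret prob_space "increments (level J)" by (rule prob_space_increments)
  show ?thesis unfolding marginal_law_def
    by (rule prob_space_distr) (use measurable_coarsen_restrict in \<open>simp cong: measurable_cong_sets add: sets_increments\<close>)
qed

text \<open>
  Kolmogorov's extension theorem for the increments of all levels.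
\<close>

interpretation dyadic: polish_projective UNIV marginal_law
  unfolding polish_projective_def projective_family_def
  by (intro conjI allI impI) (rule marginal_law_restrict prob_space_marginal_law; assumption)+

definition dyadic_space :: "(nat \<times> nat \<Rightarrow> real) measure" where
  "dyadic_space = dyadic.lim"

lemma sets_dyadic_space[measurable_cong]: "sets dyadic_space = sets (PiM UNIV (\<lambda>_. borel))"
  unfolding dyadic_space_def by (rule dyadic.sets_lim)

lemma space_dyadic_space[simp]: "space dyadic_space = UNIV"
  by (simp add: dyadic_space_def dyadic.space_lim space_PiM)

lemma prob_space_dyadic_space: "prob_space dyadic_space"
  unfolding dyadic_space_def by unfold_locales

lemma emeasure_dyadic_space:
  assumes J: "finite J" and N: "level J \<le> N" and X: "X \<in> sets (PiM J (\<lambda>_. borel))"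
  shows "emeasure dyadic_space {w. restrict w J \<in> X} = emeasure (increments N) {x. restrict (coarsen N x) J \<in> X}"
proof -
  have "{w. restrict w J \<in> X} = prod_emb UNIV (\<lambda>_. borel) J X" by (auto simp: prod_emb_def)
  then have "emeasure dyadic_space {w. restrict w J \<in> X} = emeasure (marginal_law J) X"
    unfolding dyadic_space_def using dyadic.emeasure_lim_emb[OF _ J X] by simp
  also have "\<dots> = emeasure (increments N) ((\<lambda>x. restrict (coarsen N x) J) -` X \<inter> space (increments N))"
    unfolding marginal_law_eq[OF J N]
    by (rule emeasure_distr[OF _ X]) (use measurable_coarsen_restrict in \<open>simp cong: measurable_cong_sets add: sets_increments\<close>)
  finally show ?thesis by (simp add: vimage_def)
qed

lemma distr_dyadic_row: "distr dyadic_space (PiM UNIV (\<lambda>_. borel)) (\<lambda>w k. w (n, k)) = increments n"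
proof (rule measure_eqI_PiM_infinite[where I=UNIV and M="\<lambda>_. borel"])
  interpret prob_space dyadic_space by (rule prob_space_dyadic_space)
  have m: "(\<lambda>w k. w (n, k)) \<in> measurable dyadic_space (PiM UNIV (\<lambda>_. borel))"
    by (rule measurable_PiM_single') (auto simp: space_PiM)
  show "finite_measure (distr dyadic_space (PiM UNIV (\<lambda>_. borel)) (\<lambda>w k. w (n, k)))"
    by (rule finite_measure_distr[OF m])
  fix K :: "nat set" and A :: "nat \<Rightarrow> real set" assume K: "finite K" "\<And>k. k \<in> K \<Longrightarrow> A k \<in> sets borel"
  let ?J = "Pair n ` K"
  let ?X = "Pi\<^sub>E ?J (\<lambda>p. A (snd p))"
  have lv: "level ?J \<le> n" by (auto simp: level_def K)
  have X: "?X \<in> sets (PiM ?J (\<lambda>_. borel))" by (rule sets_PiM_I_finite) (use K in auto)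
  have pe: "prod_emb UNIV (\<lambda>_. borel) K (Pi\<^sub>E K A) \<in> sets (PiM UNIV (\<lambda>_. borel :: real measure))"
    by (rule sets_PiM_I) (use K in auto)
  have "emeasure (distr dyadic_space (PiM UNIV (\<lambda>_. borel)) (\<lambda>w k. w (n, k))) (prod_emb UNIV (\<lambda>_. borel) K (Pi\<^sub>E K A)) =
      emeasure dyadic_space {w. restrict w ?J \<in> ?X}"
    by (subst emeasure_distr[OF m pe]) (auto simp: prod_emb_def PiE_def Pi_iff extensional_def intro!: arg_cong[where f="emeasure dyadic_space"])
  also have "\<dots> = emeasure (increments n) {x. restrict (coarsen n x) ?J \<in> ?X}"
    by (rule emeasure_dyadic_space[OF _ lv X]) (use K in auto)
  also have "{x. restrict (coarsen n x) ?J \<in> ?X} = prod_emb UNIV (\<lambda>_. borel) K (Pi\<^sub>E K A)"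
    by (auto simp: prod_emb_def PiE_def Pi_iff extensional_def coarsen_def)
  finally show "emeasure (distr dyadic_space (PiM UNIV (\<lambda>_. borel)) (\<lambda>w k. w (n, k))) (prod_emb UNIV (\<lambda>_. borel) K (Pi\<^sub>E K A)) =
      emeasure (increments n) (prod_emb UNIV (\<lambda>_. borel) K (Pi\<^sub>E K A))" .
qed (simp_all add: sets_increments)

lemma AE_dyadic_additive: "AE w in dyadic_space. w (n, k) = w (Suc n, 2 * k) + w (Suc n, 2 * k + 1)"
proof -
  interpret prob_space dyadic_space by (rule prob_space_dyadic_space)
  interpret I: prob_space "increments (Suc n)" by (rule prob_space_increments)
  let ?J = "{(n, k), (Suc n, 2 * k), (Suc n, 2 * k + 1)}"
  let ?X = "{f \<in> space (PiM ?J (\<lambda>_. borel)). f (n, k) = f (Suc n, 2 * k) + f (Suc n, 2 * k + 1)}"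
  have X: "?X \<in> sets (PiM ?J (\<lambda>_. borel :: real measure))" by measurable
  have "emeasure dyadic_space {w. restrict w ?J \<in> ?X} = emeasure (increments (Suc n)) {x. restrict (coarsen (Suc n) x) ?J \<in> ?X}"
    by (rule emeasure_dyadic_space[OF _ _ X]) (simp_all add: level_def)
  also have "{x. restrict (coarsen (Suc n) x) ?J \<in> ?X} = UNIV"
    using sum_pair_sum[of _ k "Suc k"] by (auto simp: coarsen_def pair_sum_def space_PiM mult.commute)
  also have "emeasure (increments (Suc n)) UNIV = 1" using I.emeasure_space_1 by simp
  finally have "emeasure dyadic_space {w. restrict w ?J \<in> ?X} = 1" .
  moreover have "{w. restrict w ?J \<in> ?X} = {w \<in> space dyadic_space. w (n, k) = w (Suc n, 2 * k) + w (Suc n, 2 * k + 1)}"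
    by (auto simp: space_PiM)
  ultimately have "emeasure dyadic_space {w \<in> space dyadic_space. w (n, k) = w (Suc n, 2 * k) + w (Suc n, 2 * k + 1)} = 1"
    by (simp only:)
  then have "prob {w \<in> space dyadic_space. w (n, k) = w (Suc n, 2 * k) + w (Suc n, 2 * k + 1)} = 1"
    unfolding emeasure_eq_measure by simp
  then show ?thesis by (subst (asm) prob_Collect_eq_1) measurable
qed

section \<open>Brownian motion: continuous paths\<close>

definition walk :: "(nat \<times> nat \<Rightarrow> real) \<Rightarrow> nat \<Rightarrow> real \<Rightarrow> real" where
  "walk a n t = (\<Sum>k<nat \<lfloor>2 ^ n * t\<rfloor>. a (n, k))"

text \<open>
  At level \<open>n\<close> the walk changes by at most one increment when \<open>n\<close> is increased, and by at most one increment over times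
  shorter than the mesh. Geometric decay of the increments thus yields both uniform convergence and continuity of the limit.
\<close>

lemma walk_Suc_diff:
  assumes add: "\<And>n k. a (n, k) = a (Suc n, 2 * k) + a (Suc n, 2 * k + 1)" and t: "0 \<le> t"
  shows "walk a (Suc n) t - walk a n t = 0 \<or> walk a (Suc n) t - walk a n t = a (Suc n, 2 * nat \<lfloor>2 ^ n * t\<rfloor>)"
proof -
  define j where "j = nat \<lfloor>2 ^ n * t\<rfloor>"
  have sum2: "(\<Sum>k<2 * j. a (Suc n, k)) = (\<Sum>k<j. a (n, k))" for j
    by (induction j) (simp_all add: add[of n])
  have "0 \<le> 2 ^ n * t" using t by simp
  then have ij: "int j = \<lfloor>2 ^ n * t\<rfloor>" by (simp add: j_def)
  have "\<lfloor>2 ^ Suc n * t\<rfloor> = 2 * int j \<or> \<lfloor>2 ^ Suc n * t\<rfloor> = 2 * int j + 1"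
    unfolding ij by (simp add: mult.assoc) linarith
  then have "nat \<lfloor>2 ^ Suc n * t\<rfloor> = 2 * j \<or> nat \<lfloor>2 ^ Suc n * t\<rfloor> = Suc (2 * j)" by auto
  then show ?thesis unfolding walk_def using sum2[of j] by (auto simp: j_def[symmetric])
qed

lemma floor_le_grid:
  assumes "0 \<le> t" "t \<le> real T" shows "nat \<lfloor>2 ^ n * t\<rfloor> \<le> T * 2 ^ n"
proof -
  have "2 ^ n * t \<le> real (T * 2 ^ n)" using assms by (simp add: mult.commute)
  then show ?thesis by linarith
qed

lemma walk_small_step:
  assumes st: "0 \<le> s" "s \<le> t" "t \<le> real T" "t - s \<le> (1/2) ^ n" and b: "\<And>k. k \<le> T * 2 ^ n \<Longrightarrow> \<bar>a (n, k)\<bar> \<le> c"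
  shows "\<bar>walk a n t - walk a n s\<bar> \<le> c"
proof -
  define i where "i = nat \<lfloor>2 ^ n * s\<rfloor>"
  define j where "j = nat \<lfloor>2 ^ n * t\<rfloor>"
  have "2 ^ n * (t - s) \<le> 2 ^ n * (1/2) ^ n" using st(4) by (intro mult_left_mono) auto
  then have "2 ^ n * t \<le> 2 ^ n * s + 1" by (simp add: right_diff_distrib power_mult_distrib[symmetric])
  moreover have "2 ^ n * s \<le> 2 ^ n * t" "0 \<le> 2 ^ n * s" using st by auto
  ultimately have "j = i \<or> j = Suc i" unfolding i_def j_def by linarith
  moreover have "i \<le> T * 2 ^ n" unfolding i_def by (rule floor_le_grid) (use st in auto)
  moreover have "0 \<le> c" using b[of 0] by linarith
  ultimately show ?thesis using b[of i] by (auto simp: walk_def i_def[symmetric] j_def[symmetric])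
qed

lemma walk_converges:
  assumes add: "\<And>n k. a (n, k) = a (Suc n, 2 * k) + a (Suc n, 2 * k + 1)"
    and q: "0 < q" "q < 1" and bnd: "\<And>T. \<forall>\<^sub>F n in sequentially. \<forall>k\<le>T * 2 ^ n. \<bar>a (n, k)\<bar> \<le> q ^ n"
  shows "continuous_on {0..} (\<lambda>t. lim (\<lambda>n. walk a n t))" and "0 \<le> t \<Longrightarrow> (\<lambda>n. walk a n t) \<longlonglongrightarrow> lim (\<lambda>n. walk a n t)"
proof -
  define w where "w t = lim (\<lambda>n. walk a n t)" for t
  have main: "\<exists>n0. \<forall>n\<ge>n0. (\<forall>k\<le>T * 2 ^ n. \<bar>a (n, k)\<bar> \<le> q ^ n) \<and> (\<forall>t. 0 \<le> t \<longrightarrow> t \<le> real T \<longrightarrow>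
      (\<lambda>n. walk a n t) \<longlonglongrightarrow> w t \<and> \<bar>walk a n t - w t\<bar> \<le> q ^ n / (1 - q))" for T
  proof -
    obtain n0 where n0: "\<And>n k. n0 \<le> n \<Longrightarrow> k \<le> T * 2 ^ n \<Longrightarrow> \<bar>a (n, k)\<bar> \<le> q ^ n"
      using bnd[of T] by (auto simp: eventually_sequentially)
    have conv: "(\<lambda>n. walk a n t) \<longlonglongrightarrow> w t \<and> \<bar>walk a n t - w t\<bar> \<le> q ^ n / (1 - q)"
      if n: "n0 \<le> n" and t: "0 \<le> t" "t \<le> real T" for n t
    proof -
      have inc: "\<bar>walk a (Suc m + n) t - walk a (m + n) t\<bar> \<le> q ^ n * q ^ m" for m
      proof -
        have "2 * nat \<lfloor>2 ^ (m + n) * t\<rfloor> \<le> T * 2 ^ Suc (m + n)"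
          using floor_le_grid[OF t, of "m + n"] by simp
        then have "\<bar>a (Suc (m + n), 2 * nat \<lfloor>2 ^ (m + n) * t\<rfloor>)\<bar> \<le> q ^ Suc (m + n)"
          using n by (intro n0) auto
        also have "\<dots> \<le> q ^ n * q ^ m" using q by (simp add: power_add mult_left_le_one_le)
        finally show ?thesis using walk_Suc_diff[OF add t(1), of "m + n"] q by auto
      qed
      obtain l where l: "(\<lambda>m. walk a (m + n) t) \<longlonglongrightarrow> l" "\<And>j. \<bar>walk a (j + n) t - l\<bar> \<le> q ^ n / (1 - q) * q ^ j"
        by (rule geometric_Cauchy[OF _ q(2) inc]) (use q in auto)
      have "(\<lambda>n. walk a n t) \<longlonglongrightarrow> l" using l(1) by (rule LIMSEQ_offset)
      moreover from this have "w t = l" unfolding w_def by (rule limI)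
      ultimately show ?thesis using l(2)[of 0] by simp
    qed
    show ?thesis by (rule exI[of _ n0]) (use n0 conv in blast)
  qed
  show "(\<lambda>n. walk a n t) \<longlonglongrightarrow> lim (\<lambda>n. walk a n t)" if "0 \<le> t"
  proof -
    obtain T where "t \<le> real T" using real_arch_simple by blast
    with main[of T] that show ?thesis by (auto simp: w_def)
  qed
  show "continuous_on {0..} (\<lambda>t. lim (\<lambda>n. walk a n t))"
    unfolding w_def[symmetric]
  proof (rule continuous_on_iff[THEN iffD2], intro ballI allI impI)
    fix x e :: real assume x: "x \<in> {0..}" and e: "0 < e"
    obtain T where T: "x + 1 \<le> real T" using real_arch_simple by blast
    obtain n0 where n0: "\<And>n k. n0 \<le> n \<Longrightarrow> k \<le> T * 2 ^ n \<Longrightarrow> \<bar>a (n, k)\<bar> \<le> q ^ n"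
      "\<And>n t. n0 \<le> n \<Longrightarrow> 0 \<le> t \<Longrightarrow> t \<le> real T \<Longrightarrow> \<bar>walk a n t - w t\<bar> \<le> q ^ n / (1 - q)"
      using main[of T] by blast
    have "(\<lambda>n. q ^ n + 2 * (q ^ n / (1 - q))) \<longlonglongrightarrow> 0 + 2 * (0 / (1 - q))"
      by (intro tendsto_intros LIMSEQ_power_zero) (use q in auto)
    then have "\<forall>\<^sub>F n in sequentially. q ^ n + 2 * (q ^ n / (1 - q)) < e"
      using e by (intro order_tendstoD(2)) auto
    then obtain n1 where n1: "\<And>n. n1 \<le> n \<Longrightarrow> q ^ n + 2 * (q ^ n / (1 - q)) < e" by (auto simp: eventually_sequentially)
    define n where "n = max n0 n1"
    have close: "\<bar>w t - w s\<bar> < e" if "0 \<le> s" "s \<le> t" "t \<le> real T" "t - s \<le> (1/2) ^ n" for s t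
    proof -
      have "\<bar>walk a n t - walk a n s\<bar> \<le> q ^ n"
        by (rule walk_small_step[OF that]) (rule n0, auto simp: n_def)
      moreover have "\<bar>walk a n t - w t\<bar> \<le> q ^ n / (1 - q)" "\<bar>walk a n s - w s\<bar> \<le> q ^ n / (1 - q)"
        using that by (auto intro!: n0(2) simp: n_def)
      moreover have "q ^ n + 2 * (q ^ n / (1 - q)) < e" by (rule n1) (simp add: n_def)
      ultimately show ?thesis by linarith
    qed
    show "\<exists>d>0. \<forall>y\<in>{0..}. dist y x < d \<longrightarrow> dist (w y) (w x) < e"
    proof (intro exI[of _ "min 1 ((1/2) ^ n)"] conjI ballI impI)
      fix y :: real assume y: "y \<in> {0..}" "dist y x < min 1 ((1/2) ^ n)"
      then show "dist (w y) (w x) < e"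
        using close[of x y] close[of y x] x T by (cases "x \<le> y") (auto simp: dist_real_def abs_minus_commute)
    qed simp
  qed
qed

lemma measurable_dyadic_coordinate[measurable]: "(\<lambda>w. w p) \<in> borel_measurable dyadic_space"
  by measurable

lemma measurable_walk[measurable]: "(\<lambda>w. walk w n t) \<in> borel_measurable dyadic_space"
  unfolding walk_def by measurable

lemma distr_dyadic_coordinate: "distr dyadic_space borel (\<lambda>w. w (n, k)) = dyadic_normal n"
proof -
  have m: "(\<lambda>w k. w (n, k)) \<in> measurable dyadic_space (PiM UNIV (\<lambda>_. borel))"
    by (rule measurable_PiM_single') (auto simp: space_PiM)
  have "distr (distr dyadic_space (PiM UNIV (\<lambda>_. borel)) (\<lambda>w k. w (n, k))) borel (\<lambda>x. x k) = distr dyadic_space borel ((\<lambda>x. x k) \<circ> (\<lambda>w k. w (n, k)))"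
    by (rule distr_distr[OF _ m]) simp
  then show ?thesis unfolding distr_dyadic_row distr_increments_component by (simp add: comp_def)
qed

lemma dyadic_fourth_moment: "(LINT w|dyadic_space. w (n, k) ^ 4) = 3 * (1/4) ^ n" "integrable dyadic_space (\<lambda>w. w (n, k) ^ 4)"
proof -
  let ?s = "sqrt ((1/2) ^ n) :: real"
  have pos: "0 < ?s" by simp
  have "(LINT w|dyadic_space. w (n, k) ^ 4) = (LINT x|dyadic_normal n. x ^ 4)"
    unfolding distr_dyadic_coordinate[of n k, symmetric] by (rule integral_distr[symmetric]) auto
  also have "\<dots> = (LINT x|lborel. normal_density 0 ?s x * (x - 0) ^ (2 * 2))"
    unfolding dyadic_normal_def by (subst integral_density) auto
  also have "\<dots> = 3 * (?s ^ 2) ^ 2"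
    unfolding integral_normal_moment_even[OF pos] by (simp add: fact_numeral power_divide)
  also have "\<dots> = 3 * (1/4) ^ n" by (simp add: power_divide power2_eq_square power_mult_distrib[symmetric])
  finally show "(LINT w|dyadic_space. w (n, k) ^ 4) = 3 * (1/4) ^ n" .
  have "integrable lborel (\<lambda>x. normal_density 0 ?s x * (x - 0) ^ 4)" by (rule integrable_normal_moment) simp
  then have "integrable (dyadic_normal n) (\<lambda>x. x ^ 4)" unfolding dyadic_normal_def by (subst integrable_density) auto
  then show "integrable dyadic_space (\<lambda>w. w (n, k) ^ 4)"
    unfolding distr_dyadic_coordinate[of n k, symmetric] by (subst (asm) integrable_distr_eq) auto
qed

text \<open>
  By Markov's inequality for the fourth moment, an increment of level \<open>n\<close> exceeds \<open>q\<^sup>n\<close> with probability at most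
  \<open>3 \<sqdot> 4\<^sup>-\<^sup>n q\<^sup>-\<^sup>4\<^sup>n\<close>. About \<open>T 2\<^sup>n\<close> increments matter, so the bounds sum to a geometric series with ratio \<open>1 / (2 q\<^sup>4)\<close>, which is less
  than \<open>2/3\<close> for \<open>q = 19/20\<close>; the Borel--Cantelli lemma applies.
\<close>

lemma AE_increments_small: "AE w in dyadic_space. \<forall>\<^sub>F n in sequentially. \<forall>k\<le>T * 2 ^ n. \<bar>w (n, k)\<bar> \<le> (19/20) ^ n"
proof -
  interpret prob_space dyadic_space by (rule prob_space_dyadic_space)
  define q :: real where "q = 19/20"
  define A where "A n = {w \<in> space dyadic_space. \<exists>k\<le>T * 2 ^ n. q ^ n < \<bar>w (n, k)\<bar>}" for n
  define A1 where "A1 n k = {w \<in> space dyadic_space. (q ^ n) ^ 4 \<le> w (n, k) ^ 4}" for n k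
  have [measurable]: "A n \<in> sets dyadic_space" for n unfolding A_def by measurable
  have A1m[measurable]: "A1 n k \<in> sets dyadic_space" for n k unfolding A1_def by measurable
  have le1: "prob (A1 n k) \<le> 3 * (1/4) ^ n / (q ^ n) ^ 4" for n k
    using integral_Markov_inequality_measure[OF dyadic_fourth_moment(2)[of n k] A1m[of n k], of "(q ^ n) ^ 4"]
    by (simp add: A1_def dyadic_fourth_moment(1) q_def)
  have PA: "prob (A n) \<le> 3 * (real T + 1) * (2/3) ^ n" for n
  proof -
    have "A n \<subseteq> (\<Union>k\<le>T * 2 ^ n. A1 n k)"
    proof
      fix w assume "w \<in> A n"
      then obtain k where k: "k \<le> T * 2 ^ n" "q ^ n < \<bar>w (n, k)\<bar>" by (auto simp: A_def)
      then have "(q ^ n) ^ 4 \<le> \<bar>w (n, k)\<bar> ^ 4" by (intro power_mono) (auto simp: q_def)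
      then show "w \<in> (\<Union>k\<le>T * 2 ^ n. A1 n k)" using k by (auto simp: A1_def power_even_abs)
    qed
    then have "prob (A n) \<le> prob (\<Union>k\<le>T * 2 ^ n. A1 n k)" by (intro finite_measure_mono) auto
    also have "\<dots> \<le> (\<Sum>k\<le>T * 2 ^ n. prob (A1 n k))"
      by (rule finite_measure_subadditive_finite) auto
    also have "\<dots> \<le> (\<Sum>k\<le>T * 2 ^ n. 3 * (1/4) ^ n / (q ^ n) ^ 4)" by (intro sum_mono le1)
    also have "\<dots> = (real T * 2 ^ n + 1) * (3 * (1/4) ^ n / (q ^ n) ^ 4)" by simp
    also have "\<dots> \<le> ((real T + 1) * 2 ^ n) * (3 * (1/4) ^ n / (q ^ n) ^ 4)"
      by (intro mult_right_mono) (auto simp: q_def algebra_simps)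
    also have "\<dots> = 3 * (real T + 1) * (1 / (2 * q ^ 4)) ^ n"
    proof -
      have "2 ^ n * ((1/4) ^ n / (q ^ n) ^ 4) = (2 * (1/4) / q ^ 4) ^ n"
        by (simp only: power_mult_distrib power_divide power_mult[symmetric] mult.commute[of n 4] times_divide_eq_right)
      also have "2 * (1/4) / q ^ 4 = 1 / (2 * q ^ 4)" by simp
      finally have "3 * (real T + 1) * (2 ^ n * ((1/4) ^ n / (q ^ n) ^ 4)) = 3 * (real T + 1) * (1 / (2 * q ^ 4)) ^ n"
        by (simp only:)
      then show ?thesis by (simp only: mult_ac times_divide_eq_right)
    qed
    also have "\<dots> \<le> 3 * (real T + 1) * (2/3) ^ n"
      by (intro mult_left_mono power_mono) (auto simp: q_def power_divide)
    finally show ?thesis .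
  qed
  have "summable (\<lambda>n. prob (A n))"
  proof (rule summable_comparison_test')
    show "summable (\<lambda>n. 3 * (real T + 1) * (2/3 :: real) ^ n)" by (intro summable_mult summable_geometric) simp
    show "norm (prob (A n)) \<le> 3 * (real T + 1) * (2/3) ^ n" if "0 \<le> n" for n
      using PA[of n] measure_nonneg[of dyadic_space "A n"] by simp
  qed
  then have "AE w in dyadic_space. \<forall>\<^sub>F n in sequentially. w \<in> space dyadic_space - A n"
    by (intro borel_cantelli_AE1) (auto simp: emeasure_eq_measure)
  then show ?thesis
    by eventually_elim (auto elim!: eventually_mono simp: A_def q_def not_less)
qed

lemma Brownian_paths:
  obtains N W where "N \<in> null_sets dyadic_space"
    "\<And>w. continuous_on {0..} (\<lambda>t. W t w)" "\<And>t. W t \<in> borel_measurable dyadic_space" "\<And>w. W 0 w = (0 :: real)"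
    "\<And>w t. w \<notin> N \<Longrightarrow> 0 \<le> t \<Longrightarrow> (\<lambda>n. walk w n t) \<longlonglongrightarrow> W t w"
proof -
  have "AE w in dyadic_space. (\<forall>n k. w (n, k) = w (Suc n, 2 * k) + w (Suc n, 2 * k + 1)) \<and>
      (\<forall>T. \<forall>\<^sub>F n in sequentially. \<forall>k\<le>T * 2 ^ n. \<bar>w (n, k)\<bar> \<le> (19/20) ^ n)"
    using AE_dyadic_additive AE_increments_small by (simp add: AE_all_countable)
  then obtain N where "\<And>w. w \<in> space dyadic_space - N \<Longrightarrow> (\<forall>n k. w (n, k) = w (Suc n, 2 * k) + w (Suc n, 2 * k + 1)) \<and>
      (\<forall>T. \<forall>\<^sub>F n in sequentially. \<forall>k\<le>T * 2 ^ n. \<bar>w (n, k)\<bar> \<le> (19/20) ^ n)" "N \<in> null_sets dyadic_space"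
    by (rule AE_E3) blast
  then have N: "N \<in> null_sets dyadic_space"
    "\<And>w n k. w \<notin> N \<Longrightarrow> w (n, k) = w (Suc n, 2 * k) + w (Suc n, 2 * k + 1)"
    "\<And>w T. w \<notin> N \<Longrightarrow> \<forall>\<^sub>F n in sequentially. \<forall>k\<le>T * 2 ^ n. \<bar>w (n, k)\<bar> \<le> (19/20) ^ n"
    by auto
  \<comment> \<open>On the exceptional null set, and at negative times, the process is set to zero; so every path is continuous.\<close>
  define W where "W t w = (if w \<in> N \<or> t < 0 then 0 else lim (\<lambda>n. walk w n t))" for t w
  have conv: "(\<lambda>n. walk w n t) \<longlonglongrightarrow> W t w" if "w \<notin> N" "0 \<le> t" for w t
    using walk_converges(2)[OF N(2)[OF that(1)] _ _ N(3)[OF that(1)] that(2)] that by (simp add: W_def)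
  show thesis
  proof (rule that[OF N(1)])
    show "continuous_on {0..} (\<lambda>t. W t w)" for w
    proof (cases "w \<in> N")
      case False
      have "continuous_on {0..} (\<lambda>t. lim (\<lambda>n. walk w n t))"
        by (rule walk_converges(1)[OF N(2)[OF False] _ _ N(3)[OF False]]) auto
      then show ?thesis by (rule continuous_on_eq) (auto simp: W_def False)
    qed (simp add: W_def)
    show "W t \<in> borel_measurable dyadic_space" for t
    proof (rule borel_measurable_LIMSEQ_real[where u="\<lambda>n w. if w \<in> N \<or> t < 0 then 0 else walk w n t"])
      show "(\<lambda>n. if w \<in> N \<or> t < 0 then 0 else walk w n t) \<longlonglongrightarrow> W t w" for w
        using conv[of w t] by (cases "w \<in> N \<or> t < 0") (auto simp: W_def not_less)
      have [measurable]: "N \<in> sets dyadic_space" using N(1) by auto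
      show "(\<lambda>w. if w \<in> N \<or> t < 0 then 0 else walk w n t) \<in> borel_measurable dyadic_space" for n by measurable
    qed
    show "W 0 w = 0" for w
      using conv[of w 0] by (cases "w \<in> N") (auto simp: W_def walk_def LIMSEQ_const_iff)
  qed (rule conv)
qed

section \<open>Brownian motion: independent increments\<close>

interpretation dyadic_space: prob_space dyadic_space
  by (rule prob_space_dyadic_space)

lemma indep_dyadic_row: "dyadic_space.indep_vars (\<lambda>_. borel) (\<lambda>k w. w (n, k)) UNIV"
proof -
  have rv: "dyadic_space.random_variable borel (\<lambda>w. w (n, k))" for k by measurable
  show ?thesis
    by (subst dyadic_space.indep_vars_iff_distr_eq_PiM[OF _ rv])
      (simp_all add: restrict_UNIV distr_dyadic_row distr_dyadic_coordinate increments_def)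
qed

lemma expectation_normal:
  assumes "prob_space M" and X: "distributed M lborel X (normal_density 0 s)" and s: "0 < s" and f: "f \<in> borel_measurable borel"
  shows "(LINT w|M. f (X w)) = (LINT z|gauss. f (s * z) :: real)"
proof -
  interpret prob_space M by fact
  have "distributed M lborel (\<lambda>w. (X w - 0) / s) std_normal_density"
    using X normal_standard_normal_convert[OF s, of X 0] by simp
  then have d: "distr M lborel (\<lambda>w. X w / s) = gauss" and m: "(\<lambda>w. X w / s) \<in> measurable M lborel"
    by (auto simp: distributed_def)
  have fm: "(\<lambda>z. f (s * z)) \<in> borel_measurable lborel" by (rule measurable_compose[OF _ f]) simp
  have "(LINT z|gauss. f (s * z)) = (LINT w|M. f (s * (X w / s)))"
    unfolding d[symmetric] by (rule integral_distr[OF m fm])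
  then show ?thesis using s by simp
qed

lemma walk_increment:
  assumes "0 \<le> s" "s \<le> t"
  shows "walk w n t - walk w n s = (\<Sum>k\<in>{nat \<lfloor>2 ^ n * s\<rfloor>..<nat \<lfloor>2 ^ n * t\<rfloor>}. w (n, k))"
proof -
  have "2 ^ n * s \<le> 2 ^ n * t" using assms by simp
  then have "nat \<lfloor>2 ^ n * s\<rfloor> \<le> nat \<lfloor>2 ^ n * t\<rfloor>" by (intro nat_mono floor_mono)
  then have "{..<nat \<lfloor>2 ^ n * t\<rfloor>} = {..<nat \<lfloor>2 ^ n * s\<rfloor>} \<union> {nat \<lfloor>2 ^ n * s\<rfloor>..<nat \<lfloor>2 ^ n * t\<rfloor>}" by auto
  then show ?thesis unfolding walk_def by (simp add: sum.union_disjoint ivl_disj_int)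
qed

lemma walk_increment_law:
  assumes st: "0 \<le> s" "s \<le> t" and f: "f \<in> borel_measurable borel"
  shows "(LINT w|dyadic_space. f (walk w n t - walk w n s)) =
     (LINT z|gauss. f (sqrt (real (nat \<lfloor>2 ^ n * t\<rfloor> - nat \<lfloor>2 ^ n * s\<rfloor>) / 2 ^ n) * z) :: real)"
proof (cases "nat \<lfloor>2 ^ n * s\<rfloor> < nat \<lfloor>2 ^ n * t\<rfloor>")
  case True
  let ?I = "{nat \<lfloor>2 ^ n * s\<rfloor>..<nat \<lfloor>2 ^ n * t\<rfloor>}"
  have d1: "distributed dyadic_space lborel (\<lambda>w. w (n, k)) (normal_density 0 (sqrt ((1/2) ^ n)))" for k
  proof -
    have "distr dyadic_space lborel (\<lambda>w. w (n, k)) = distr dyadic_space borel (\<lambda>w. w (n, k))"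
      by (rule distr_cong) auto
    then show ?thesis by (simp add: distributed_def distr_dyadic_coordinate dyadic_normal_def)
  qed
  have "distributed dyadic_space lborel (\<lambda>w. \<Sum>k\<in>?I. w (n, k)) (normal_density (\<Sum>k\<in>?I. 0) (sqrt (\<Sum>k\<in>?I. (sqrt ((1/2) ^ n))\<^sup>2)))"
    by (rule dyadic_space.sum_indep_normal)
      (use True in \<open>auto intro: d1 dyadic_space.indep_vars_subset[OF indep_dyadic_row] simp del: of_nat_diff\<close>)
  moreover have "sqrt (\<Sum>k\<in>?I. (sqrt ((1/2) ^ n))\<^sup>2) = sqrt (real (nat \<lfloor>2 ^ n * t\<rfloor> - nat \<lfloor>2 ^ n * s\<rfloor>) / 2 ^ n)"
    by (simp add: power_divide del: of_nat_diff)
  ultimately have d: "distributed dyadic_space lborel (\<lambda>w. walk w n t - walk w n s)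
      (normal_density 0 (sqrt (real (nat \<lfloor>2 ^ n * t\<rfloor> - nat \<lfloor>2 ^ n * s\<rfloor>) / 2 ^ n)))"
    unfolding walk_increment[OF st] by simp
  show ?thesis
    by (rule expectation_normal[OF prob_space_dyadic_space d _ f]) (use True in auto)
next
  case False
  then have e: "nat \<lfloor>2 ^ n * t\<rfloor> - nat \<lfloor>2 ^ n * s\<rfloor> = 0" "{nat \<lfloor>2 ^ n * s\<rfloor>..<nat \<lfloor>2 ^ n * t\<rfloor>} = {}" by auto
  show ?thesis
    unfolding walk_increment[OF st] e using dyadic_space.prob_space gauss.prob_space by simp
qed

text \<open>
  The walk up to time \<open>s\<close> and its increment after \<open>s\<close> are built from disjoint blocks of independent variables.
\<close>

lemma walk_independent:
  assumes st: "0 \<le> s" "s \<le> t" and U: "finite U" "U \<subseteq> {0..s}"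
    and h: "\<And>u. u \<in> U \<Longrightarrow> h u \<in> borel_measurable borel" "\<And>u x. \<bar>h u x :: real\<bar> \<le> 1"
    and f: "f \<in> borel_measurable borel" "\<And>x. \<bar>f x :: real\<bar> \<le> 1"
  shows "(LINT w|dyadic_space. (\<Prod>u\<in>U. h u (walk w n u)) * f (walk w n t - walk w n s)) =
    (LINT w|dyadic_space. (\<Prod>u\<in>U. h u (walk w n u))) * (LINT w|dyadic_space. f (walk w n t - walk w n s))"
proof -
  define i where "i = nat \<lfloor>2 ^ n * s\<rfloor>"
  define j where "j = nat \<lfloor>2 ^ n * t\<rfloor>"
  define Y1 where "Y1 x = (\<Prod>u\<in>U. h u (\<Sum>k<nat \<lfloor>2 ^ n * u\<rfloor>. x k))" for x :: "nat \<Rightarrow> real"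
  define Y2 where "Y2 x = f (\<Sum>k\<in>{i..<j}. x k)" for x :: "nat \<Rightarrow> real"
  have le: "nat \<lfloor>2 ^ n * u\<rfloor> \<le> i" if "u \<in> U" for u
    unfolding i_def using that U by (intro nat_mono floor_mono mult_left_mono) auto
  have ind: "dyadic_space.indep_var (PiM {..<i} (\<lambda>_. borel)) (\<lambda>w. restrict (\<lambda>k. w (n, k)) {..<i})
      (PiM {i..<j} (\<lambda>_. borel)) (\<lambda>w. restrict (\<lambda>k. w (n, k)) {i..<j})"
    by (rule dyadic_space.indep_var_restrict[OF indep_dyadic_row]) auto
  have m1: "Y1 \<in> borel_measurable (PiM {..<i} (\<lambda>_. borel))"
    unfolding Y1_def
  proof (intro borel_measurable_prod)
    fix u assume u: "u \<in> U"
    have "(\<lambda>x. \<Sum>k<nat \<lfloor>2 ^ n * u\<rfloor>. x k :: real) \<in> borel_measurable (PiM {..<i} (\<lambda>_. borel))"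
      by (rule borel_measurable_sum[where f="\<lambda>k x. x k"], rule measurable_component_singleton) (use le[OF u] in auto)
    from measurable_compose[OF this h(1)[OF u]]
    show "(\<lambda>x. h u (\<Sum>k<nat \<lfloor>2 ^ n * u\<rfloor>. x k)) \<in> borel_measurable (PiM {..<i} (\<lambda>_. borel))" .
  qed
  have m2: "Y2 \<in> borel_measurable (PiM {i..<j} (\<lambda>_. borel))"
    unfolding Y2_def
    by (rule measurable_compose[OF _ f(1)], rule borel_measurable_sum[where f="\<lambda>k x. x k"], rule measurable_component_singleton) auto
  have e1: "(Y1 \<circ> (\<lambda>w. restrict (\<lambda>k. w (n, k)) {..<i})) w = (\<Prod>u\<in>U. h u (walk w n u))" for w
    unfolding comp_def Y1_def walk_def
    by (intro prod.cong refl arg_cong2[where f=h] sum.cong) (use le in \<open>auto dest!: le\<close>)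
  have e2: "(Y2 \<circ> (\<lambda>w. restrict (\<lambda>k. w (n, k)) {i..<j})) w = f (walk w n t - walk w n s)" for w
    unfolding comp_def Y2_def walk_increment[OF st] i_def j_def
    by (intro arg_cong[where f=f] sum.cong) auto
  have iv: "dyadic_space.indep_var borel (\<lambda>w. \<Prod>u\<in>U. h u (walk w n u)) borel (\<lambda>w. f (walk w n t - walk w n s))"
    using dyadic_space.indep_var_compose[OF ind m1 m2] unfolding e1[abs_def, symmetric] e2[abs_def, symmetric]
    by (simp add: e1 e2 comp_def)
  have hm: "(\<lambda>w. \<Prod>u\<in>U. h u (walk w n u)) \<in> borel_measurable dyadic_space"
    by (intro borel_measurable_prod measurable_compose[OF measurable_walk] h)
  have hb: "\<bar>\<Prod>u\<in>U. h u (walk w n u)\<bar> \<le> 1" for w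
    unfolding abs_prod by (intro prod_le_1) (use h in auto)
  have fm: "(\<lambda>w. f (walk w n t - walk w n s)) \<in> borel_measurable dyadic_space"
    by (intro measurable_compose[OF _ f(1)] borel_measurable_diff measurable_walk)
  show ?thesis
    by (rule dyadic_space.indep_var_lebesgue_integral[OF iv])
      (rule dyadic_space.integrable_bounded[OF hm hb] dyadic_space.integrable_bounded[OF fm f(2)])+
qed

lemma grid_length_tendsto:
  assumes "0 \<le> s" "s \<le> t"
  shows "(\<lambda>n. real (nat \<lfloor>2 ^ n * t\<rfloor> - nat \<lfloor>2 ^ n * s\<rfloor>) / 2 ^ n) \<longlonglongrightarrow> t - s"
proof -
  have one: "(\<lambda>n. real (nat \<lfloor>2 ^ n * r\<rfloor>) / 2 ^ n) \<longlonglongrightarrow> r" if "0 \<le> r" for r :: real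
  proof (rule tendsto_sandwich)
    have fl: "real (nat \<lfloor>2 ^ n * r\<rfloor>) = real_of_int \<lfloor>2 ^ n * r\<rfloor>" for n using that by simp
    have b: "r - (1/2) ^ n \<le> real (nat \<lfloor>2 ^ n * r\<rfloor>) / 2 ^ n \<and> real (nat \<lfloor>2 ^ n * r\<rfloor>) / 2 ^ n \<le> r" for n
    proof -
      have "r * 2 ^ n \<le> 1 + real (nat \<lfloor>2 ^ n * r\<rfloor>)" "real (nat \<lfloor>2 ^ n * r\<rfloor>) \<le> r * 2 ^ n"
        unfolding fl using floor_correct[of "2 ^ n * r"] unfolding mult.commute[of r] by linarith+
      then have "r \<le> (1 + real (nat \<lfloor>2 ^ n * r\<rfloor>)) / 2 ^ n" "real (nat \<lfloor>2 ^ n * r\<rfloor>) / 2 ^ n \<le> r"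
        by (simp_all only: pos_le_divide_eq pos_divide_le_eq zero_less_power zero_less_numeral)
      then show ?thesis by (simp add: add_divide_distrib power_divide)
    qed
    show "\<forall>\<^sub>F n in sequentially. r - (1/2) ^ n \<le> real (nat \<lfloor>2 ^ n * r\<rfloor>) / 2 ^ n"
      "\<forall>\<^sub>F n in sequentially. real (nat \<lfloor>2 ^ n * r\<rfloor>) / 2 ^ n \<le> r"
      using b by auto
    have "(\<lambda>n. r - (1/2) ^ n) \<longlonglongrightarrow> r - 0" by (intro tendsto_intros LIMSEQ_power_zero) simp
    then show "(\<lambda>n. r - (1/2) ^ n) \<longlonglongrightarrow> r" by simp
  qed simp
  have "real (nat \<lfloor>2 ^ n * t\<rfloor> - nat \<lfloor>2 ^ n * s\<rfloor>) / 2 ^ n = real (nat \<lfloor>2 ^ n * t\<rfloor>) / 2 ^ n - real (nat \<lfloor>2 ^ n * s\<rfloor>) / 2 ^ n" for n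
  proof -
    have "nat \<lfloor>2 ^ n * s\<rfloor> \<le> nat \<lfloor>2 ^ n * t\<rfloor>" using assms by (intro nat_mono floor_mono mult_left_mono) auto
    then show ?thesis by (simp add: of_nat_diff diff_divide_distrib)
  qed
  then show ?thesis using tendsto_diff[OF one one] assms by simp
qed

text \<open>
  Continuous approximations of the indicator of \<open>(-\<infinity>, c]\<close>.
\<close>

definition ramp :: "nat \<Rightarrow> real \<Rightarrow> real \<Rightarrow> real" where
  "ramp m c x = max 0 (min 1 (1 - real m * (x - c)))"

lemma ramp_properties:
  "continuous_on UNIV (ramp m c)" "\<bar>ramp m c x\<bar> \<le> 1" "(\<lambda>m. ramp m c x) \<longlonglongrightarrow> indicator {..c} x"
proof -
  show "continuous_on UNIV (ramp m c)" unfolding ramp_def[abs_def] by (intro continuous_intros)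
  show "\<bar>ramp m c x\<bar> \<le> 1" by (simp add: ramp_def)
  show "(\<lambda>m. ramp m c x) \<longlonglongrightarrow> indicator {..c} x"
  proof (cases "x \<le> c")
    case True
    then have "ramp m c x = 1" for m by (simp add: ramp_def mult_nonneg_nonpos)
    then show ?thesis using True by simp
  next
    case False
    then obtain m0 where m0: "1 < real m0 * (x - c)" using reals_Archimedean3[of "x - c"] by auto
    have "ramp m c x = 0" if "m0 \<le> m" for m
    proof -
      have "real m0 * (x - c) \<le> real m * (x - c)" using that False by (intro mult_right_mono) auto
      then show ?thesis using m0 by (simp add: ramp_def)
    qed
    then have "\<forall>\<^sub>F m in sequentially. ramp m c x = indicator {..c} x"
      using False by (auto simp: eventually_sequentially)
    then show ?thesis by (rule tendsto_eventually)
  qed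
qed

context
  fixes N :: "(nat \<times> nat \<Rightarrow> real) set" and W :: "real \<Rightarrow> (nat \<times> nat \<Rightarrow> real) \<Rightarrow> real"
  assumes N: "N \<in> null_sets dyadic_space"
    and Wm: "\<And>t. W t \<in> borel_measurable dyadic_space"
    and Wl: "\<And>w t. w \<notin> N \<Longrightarrow> 0 \<le> t \<Longrightarrow> (\<lambda>n. walk w n t) \<longlonglongrightarrow> W t w"
begin

text \<open>
  Independence passes from the walks to their limit as long as the test functions are continuous and bounded.
\<close>

lemma limit_independent_continuous:
  assumes st: "0 \<le> s" "s \<le> t" and U: "finite U" "U \<subseteq> {0..s}"
    and h: "\<And>u. continuous_on UNIV (h u)" "\<And>u x. \<bar>h u x :: real\<bar> \<le> 1"
    and f: "continuous_on UNIV f" "\<And>x. \<bar>f x :: real\<bar> \<le> 1"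
  shows "(LINT w|dyadic_space. (\<Prod>u\<in>U. h u (W u w)) * f (W t w - W s w)) =
    (LINT w|dyadic_space. (\<Prod>u\<in>U. h u (W u w))) * (LINT z|gauss. f (sqrt (t - s) * z))"
proof -
  have hm: "h u \<in> borel_measurable borel" for u using h(1) by (rule borel_measurable_continuous_onI)
  have fm: "f \<in> borel_measurable borel" using f(1) by (rule borel_measurable_continuous_onI)
  have hc: "(\<lambda>n. h u (x n)) \<longlonglongrightarrow> h u y" if "x \<longlonglongrightarrow> y" for u x y
    using continuous_on_tendsto_compose[OF h(1) that] by simp
  have fc: "(\<lambda>n. f (x n)) \<longlonglongrightarrow> f y" if "x \<longlonglongrightarrow> y" for x y
    using continuous_on_tendsto_compose[OF f(1) that] by simp
  have pb: "\<bar>\<Prod>u\<in>U. h u (x u)\<bar> \<le> 1" for x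
    unfolding abs_prod by (intro prod_le_1) (use h in auto)
  have AEN: "AE w in dyadic_space. w \<notin> N" by (rule AE_not_in[OF N])
  have limP: "(\<lambda>n. LINT w|dyadic_space. (\<Prod>u\<in>U. h u (walk w n u))) \<longlonglongrightarrow> (LINT w|dyadic_space. (\<Prod>u\<in>U. h u (W u w)))"
  proof (rule integral_dominated_convergence[where w="\<lambda>_. 1"])
    show "AE w in dyadic_space. (\<lambda>n. \<Prod>u\<in>U. h u (walk w n u)) \<longlonglongrightarrow> (\<Prod>u\<in>U. h u (W u w))"
      using AEN by eventually_elim (intro tendsto_prod hc Wl, use U in auto)
  qed (use pb in \<open>auto intro!: borel_measurable_prod measurable_compose[OF measurable_walk hm] measurable_compose[OF Wm hm]\<close>)
  have limPf: "(\<lambda>n. LINT w|dyadic_space. (\<Prod>u\<in>U. h u (walk w n u)) * f (walk w n t - walk w n s)) \<longlonglongrightarrow>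
     (LINT w|dyadic_space. (\<Prod>u\<in>U. h u (W u w)) * f (W t w - W s w))"
  proof (rule integral_dominated_convergence[where w="\<lambda>_. 1"])
    show "AE w in dyadic_space. (\<lambda>n. (\<Prod>u\<in>U. h u (walk w n u)) * f (walk w n t - walk w n s)) \<longlonglongrightarrow> (\<Prod>u\<in>U. h u (W u w)) * f (W t w - W s w)"
      using AEN by eventually_elim (intro tendsto_mult tendsto_prod hc fc tendsto_diff Wl, use U st in auto)
    show "AE w in dyadic_space. norm ((\<Prod>u\<in>U. h u (walk w n u)) * f (walk w n t - walk w n s)) \<le> 1" for n
      using mult_mono[OF pb f(2)] by (auto simp: abs_mult)
    show "(\<lambda>w. (\<Prod>u\<in>U. h u (W u w)) * f (W t w - W s w)) \<in> borel_measurable dyadic_space"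
      by (intro borel_measurable_times borel_measurable_prod measurable_compose[OF Wm hm] measurable_compose[OF _ fm] borel_measurable_diff Wm)
    show "(\<lambda>w. (\<Prod>u\<in>U. h u (walk w n u)) * f (walk w n t - walk w n s)) \<in> borel_measurable dyadic_space" for n
      by (intro borel_measurable_times borel_measurable_prod measurable_compose[OF measurable_walk hm] measurable_compose[OF _ fm] borel_measurable_diff measurable_walk)
  qed simp
  have limf: "(\<lambda>n. LINT w|dyadic_space. f (walk w n t - walk w n s)) \<longlonglongrightarrow> (LINT z|gauss. f (sqrt (t - s) * z))"
    unfolding walk_increment_law[OF st fm]
  proof (rule gauss.integral_bounded_tendsto[where K=1])
    show "(\<lambda>z. f (sqrt (real (nat \<lfloor>2 ^ n * t\<rfloor> - nat \<lfloor>2 ^ n * s\<rfloor>) / 2 ^ n) * z)) \<in> borel_measurable gauss" for n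
      by (intro measurable_compose[OF _ fm] borel_measurable_times borel_measurable_const measurable_ident_sets gauss.events_eq_borel)
    show "(\<lambda>n. f (sqrt (real (nat \<lfloor>2 ^ n * t\<rfloor> - nat \<lfloor>2 ^ n * s\<rfloor>) / 2 ^ n) * z)) \<longlonglongrightarrow> f (sqrt (t - s) * z)" for z
      by (intro fc tendsto_mult tendsto_real_sqrt grid_length_tendsto st tendsto_const)
  qed (rule f(2))
  show ?thesis
    by (rule LIMSEQ_unique[OF limPf]) (subst walk_independent[OF st U hm h(2) fm f(2)], intro tendsto_mult limP limf)
qed

lemma limit_independent:
  assumes st: "0 \<le> s" "s \<le> t" and U: "finite U" "U \<subseteq> {0..s}"
  shows "measure dyadic_space {w. (\<forall>u\<in>U. W u w \<le> a u) \<and> W t w - W s w \<le> c} =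
    measure dyadic_space {w. \<forall>u\<in>U. W u w \<le> a u} * measure gauss {z. sqrt (t - s) * z \<le> c}"
proof -
  have rm: "ramp m c \<in> borel_measurable borel" for m c using ramp_properties(1) by (rule borel_measurable_continuous_onI)
  have pb: "\<bar>\<Prod>u\<in>U. ramp m (a u) (x u)\<bar> \<le> 1" for x m
    unfolding abs_prod by (intro prod_le_1) (use ramp_properties(2) in auto)
  have D: "(\<lambda>w. W t w - W s w) \<in> borel_measurable dyadic_space" by (intro borel_measurable_diff Wm)
  have set1: "{w. \<forall>u\<in>U. W u w \<le> a u} \<in> sets dyadic_space"
  proof -
    have "{w \<in> space dyadic_space. \<forall>u\<in>U. W u w \<le> a u} \<in> sets dyadic_space"
      by (rule sets.sets_Collect_finite_All[OF _ U(1)]) (rule borel_measurable_le[OF Wm borel_measurable_const])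
    then show ?thesis by simp
  qed
  have set2: "{w. W t w - W s w \<le> c} \<in> sets dyadic_space"
    using borel_measurable_le[OF D borel_measurable_const, of c] by simp
  have ip: "(\<Prod>u\<in>U. indicator {..a u} (W u w)) = (indicator {w. \<forall>u\<in>U. W u w \<le> a u} w :: real)" for w
    using U(1) by (auto simp: indicator_def prod_zero_iff)
  have l1: "(\<lambda>m. LINT w|dyadic_space. (\<Prod>u\<in>U. ramp m (a u) (W u w)) * ramp m c (W t w - W s w)) \<longlonglongrightarrow>
     (LINT w|dyadic_space. (\<Prod>u\<in>U. indicator {..a u} (W u w)) * indicator {..c} (W t w - W s w))"
    by (rule dyadic_space.integral_bounded_tendsto[where K="1 * 1"])
      (intro borel_measurable_times borel_measurable_prod measurable_compose[OF Wm rm] measurable_compose[OF D rm],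
       unfold abs_mult, intro mult_mono pb ramp_properties, simp_all,
       intro tendsto_mult tendsto_prod ramp_properties)
  have l2: "(\<lambda>m. LINT w|dyadic_space. (\<Prod>u\<in>U. ramp m (a u) (W u w))) \<longlonglongrightarrow> (LINT w|dyadic_space. (\<Prod>u\<in>U. indicator {..a u} (W u w)))"
    by (rule dyadic_space.integral_bounded_tendsto[where K=1])
      (intro borel_measurable_prod measurable_compose[OF Wm rm], rule pb, intro tendsto_prod ramp_properties)
  have gm: "(\<lambda>z. sqrt (t - s) * z) \<in> borel_measurable gauss"
    by (intro borel_measurable_times borel_measurable_const measurable_ident_sets gauss.events_eq_borel)
  have l3: "(\<lambda>m. LINT z|gauss. ramp m c (sqrt (t - s) * z)) \<longlonglongrightarrow> (LINT z|gauss. indicator {..c} (sqrt (t - s) * z))"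
    by (rule gauss.integral_bounded_tendsto[where K=1])
      (rule measurable_compose[OF gm rm], rule ramp_properties, rule ramp_properties)
  have "(LINT w|dyadic_space. (\<Prod>u\<in>U. indicator {..a u} (W u w)) * indicator {..c} (W t w - W s w)) =
     (LINT w|dyadic_space. (\<Prod>u\<in>U. indicator {..a u} (W u w))) * (LINT z|gauss. indicator {..c} (sqrt (t - s) * z) :: real)"
    by (rule LIMSEQ_unique[OF l1])
      (subst limit_independent_continuous[OF st U ramp_properties(1,2) ramp_properties(1,2)], intro tendsto_mult l2 l3)
  moreover have "(LINT w|dyadic_space. (\<Prod>u\<in>U. indicator {..a u} (W u w)) * indicator {..c} (W t w - W s w)) =
      measure dyadic_space ({w. \<forall>u\<in>U. W u w \<le> a u} \<inter> {w. W t w - W s w \<le> c})"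
  proof -
    have "(\<Prod>u\<in>U. indicator {..a u} (W u w)) * indicator {..c} (W t w - W s w) =
       (indicator ({w. \<forall>u\<in>U. W u w \<le> a u} \<inter> {w. W t w - W s w \<le> c}) w :: real)" for w
      unfolding ip by (auto simp: indicator_def)
    then show ?thesis using set1 set2 by simp
  qed
  moreover have "(LINT w|dyadic_space. (\<Prod>u\<in>U. indicator {..a u} (W u w))) = measure dyadic_space {w. \<forall>u\<in>U. W u w \<le> a u}"
    unfolding ip using set1 by simp
  moreover have "(LINT z|gauss. indicator {..c} (sqrt (t - s) * z) :: real) = measure gauss {z. sqrt (t - s) * z \<le> c}"
  proof -
    have "{z. sqrt (t - s) * z \<le> c} \<in> sets gauss" using borel_measurable_le[OF gm borel_measurable_const, of c] by simp
    moreover have "indicator {..c} (sqrt (t - s) * z) = (indicator {z. sqrt (t - s) * z \<le> c} z :: real)" for z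
      by (auto simp: indicator_def)
    ultimately show ?thesis by simp
  qed
  ultimately show ?thesis by (simp add: Collect_conj_eq)
qed

end

section \<open>Brownian motion with its filtration\<close>

text \<open>
  These are the properties of a Brownian motion that enter the proof of Ito's formula: moments of the increments, and the
  orthogonality of the increments and of their centred squares to the past. The variable \<open>Z\<close> is a starting point, known at all
  times.
\<close>

locale brownian = prob_space M for M :: "'a measure" +
  fixes F :: "real \<Rightarrow> 'a measure" and W :: "real \<Rightarrow> 'a \<Rightarrow> real" and Z :: "'a \<Rightarrow> real"
  assumes F_subalgebra: "\<And>s. subalgebra M (F s)"
    and F_mono: "\<And>s t. s \<le> t \<Longrightarrow> subalgebra (F t) (F s)"
    and Z_measurable: "\<And>s. Z \<in> borel_measurable (F s)"
    and W_adapted: "\<And>s. 0 \<le> s \<Longrightarrow> W s \<in> borel_measurable (F s)"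
    and W_continuous: "\<And>w. w \<in> space M \<Longrightarrow> continuous_on {0..} (\<lambda>t. W t w)"
    and W_0: "\<And>w. w \<in> space M \<Longrightarrow> W 0 w = 0"
    and increment_integrable: "\<And>s t. 0 \<le> s \<Longrightarrow> s \<le> t \<Longrightarrow> integrable M (\<lambda>w. (W t w - W s w) ^ 4)"
    and increment_moment2: "\<And>s t. 0 \<le> s \<Longrightarrow> s \<le> t \<Longrightarrow> (LINT w|M. (W t w - W s w)\<^sup>2) = t - s"
    and increment_moment4: "\<And>s t. 0 \<le> s \<Longrightarrow> s \<le> t \<Longrightarrow> (LINT w|M. (W t w - W s w) ^ 4) = 3 * (t - s)\<^sup>2"
    and increment_orthogonal: "\<And>s t G K. 0 \<le> s \<Longrightarrow> s \<le> t \<Longrightarrow> G \<in> borel_measurable (F s) \<Longrightarrow> (\<And>w. \<bar>G w\<bar> \<le> K) \<Longrightarrow>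
        (LINT w|M. G w * (W t w - W s w)) = 0"
    and increment_square_orthogonal: "\<And>s t G K. 0 \<le> s \<Longrightarrow> s \<le> t \<Longrightarrow> G \<in> borel_measurable (F s) \<Longrightarrow> (\<And>w. \<bar>G w\<bar> \<le> K) \<Longrightarrow>
        (LINT w|M. G w * ((W t w - W s w)\<^sup>2 - (t - s))) = 0"

lemma measure_pair_Times:
  assumes "prob_space M1" "prob_space M2" "A \<in> sets M1" "B \<in> sets M2"
  shows "measure (M1 \<Otimes>\<^sub>M M2) (A \<times> B) = measure M1 A * measure M2 B"
proof -
  interpret M2: prob_space M2 by fact
  show ?thesis using assms by (simp add: measure_def M2.emeasure_pair_measure_Times enn2real_mult)
qed

lemma gauss_moments: "(LINT z|gauss. z) = 0" "(LINT z|gauss. z\<^sup>2) = 1" "(LINT z|gauss. z ^ 4) = 3"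
  using integral_std_normal_distribution_moment_odd[of 1] std_normal_distribution_even_moments(1)[of 1]
    std_normal_distribution_even_moments(1)[of 2] by (simp_all add: fact_numeral)

text \<open>
  On the product of the law of the starting point and the space of increments, \<open>F s\<close> is generated by the sets
  \<open>A \<times> {W\<^sub>u \<le> a\<^sub>u, u \<in> U}\<close> with finite \<open>U \<subseteq> [0,s]\<close>. These sets are stable under intersection, so independence of an increment from
  \<open>F s\<close> needs to be checked on them only, where it is \<open>limit_independent\<close>.
\<close>

theorem Brownian_motion_exists:
  fixes \<rho> :: "real measure"
  assumes \<rho>: "prob_space \<rho>" "sets \<rho> = sets borel"
  obtains F W Z where "brownian (\<rho> \<Otimes>\<^sub>M dyadic_space) F W Z" "distr (\<rho> \<Otimes>\<^sub>M dyadic_space) borel Z = \<rho>"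
proof -
  obtain N B where N: "N \<in> null_sets dyadic_space"
    and Bc: "\<And>w. continuous_on {0..} (\<lambda>t. B t w)" and Bm: "\<And>t. B t \<in> borel_measurable dyadic_space" and B0: "\<And>w. B 0 w = (0 :: real)"
    and Bl: "\<And>w t. w \<notin> N \<Longrightarrow> 0 \<le> t \<Longrightarrow> (\<lambda>n. walk w n t) \<longlonglongrightarrow> B t w"
  proof (rule Brownian_paths)
    fix N B
    assume "N \<in> null_sets dyadic_space" "\<And>w. continuous_on {0..} (\<lambda>t. B t w)" "\<And>t. B t \<in> borel_measurable dyadic_space"
      "\<And>w. B 0 w = (0 :: real)" "\<And>w t. w \<notin> N \<Longrightarrow> 0 \<le> t \<Longrightarrow> (\<lambda>n. walk w n t) \<longlonglongrightarrow> B t w"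
    then show thesis by (rule that)
  qed
  have ind: "measure dyadic_space {w. (\<forall>u\<in>U. B u w \<le> a u) \<and> B t w - B s w \<le> c} =
      measure dyadic_space {w. \<forall>u\<in>U. B u w \<le> a u} * measure gauss {z. sqrt (t - s) * z \<le> c}"
    if "0 \<le> s" "s \<le> t" "finite U" "U \<subseteq> {0..s}" for s t U a c
    by (rule limit_independent[OF N Bm _ that]) (rule Bl)
  let ?M = "\<rho> \<Otimes>\<^sub>M dyadic_space"
  interpret M: prob_space ?M by (rule prob_space_pair[OF \<rho>(1) prob_space_dyadic_space])
  interpret \<rho>: prob_space \<rho> by fact
  have sp\<rho>: "space \<rho> = UNIV" using sets_eq_imp_space_eq[OF \<rho>(2)] by simp
  have spM: "space ?M = UNIV" by (simp add: space_pair_measure sp\<rho>)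
  define W where "W t z = B t (snd z)" for t and z :: "real \<times> (nat \<times> nat \<Rightarrow> real)"
  define E where "E U a = {w. \<forall>u\<in>U. B u w \<le> a u}" for U :: "real set" and a :: "real \<Rightarrow> real"
  define \<A> where "\<A> s = {A \<times> E U a | A U a. A \<in> sets (borel :: real measure) \<and> finite U \<and> U \<subseteq> {0..s}}" for s
  define F where "F s = sigma UNIV (\<A> s)" for s
  have Es: "E U a \<in> sets dyadic_space" if "finite U" for U a
  proof -
    have "{w \<in> space dyadic_space. \<forall>u\<in>U. B u w \<le> a u} \<in> sets dyadic_space"
      by (rule sets.sets_Collect_finite_All[OF _ that]) (rule borel_measurable_le[OF Bm borel_measurable_const])
    then show ?thesis by (simp add: E_def)
  qed
  have Wm: "W t \<in> borel_measurable ?M" for t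
    unfolding W_def[abs_def] by (rule measurable_compose[OF measurable_snd Bm])
  have \<A>s: "\<A> s \<subseteq> sets ?M" for s
    unfolding \<A>_def using \<rho>(2) Es by (auto intro!: pair_measureI)
  have sF: "sets (F s) = sigma_sets UNIV (\<A> s)" and spF: "space (F s) = UNIV" for s
    unfolding F_def by (auto intro: sets_measure_of space_measure_of)
  have sub: "subalgebra ?M (F s)" for s
    unfolding subalgebra_def sF spF spM using sets.sigma_sets_subset[OF \<A>s] by (auto simp: spM)
  have mono: "subalgebra (F t) (F s)" if "s \<le> t" for s t
    unfolding subalgebra_def sF spF
    using that by (intro conjI refl sigma_sets_mono') (force simp: \<A>_def)
  have Zm: "fst \<in> borel_measurable (F s)" for s
  proof (rule measurableI)
    fix A :: "real set" assume "A \<in> sets borel"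
    then have "A \<times> E {} (\<lambda>_. 0) \<in> \<A> s" unfolding \<A>_def by blast
    then have "A \<times> E {} (\<lambda>_. 0) \<in> sets (F s)" unfolding sF by (rule sigma_sets.Basic)
    moreover have "A \<times> E {} (\<lambda>_. 0) = fst -` A \<inter> space (F s)" by (auto simp: E_def spF)
    ultimately show "fst -` A \<inter> space (F s) \<in> sets (F s)" by simp
  qed simp
  have Wa: "W s \<in> borel_measurable (F s)" if "0 \<le> s" for s
    unfolding borel_measurable_iff_le
  proof
    fix c
    have "UNIV \<times> E {s} (\<lambda>_. c) \<in> \<A> s" unfolding \<A>_def using that by (intro CollectI exI[of _ UNIV] exI[of _ "{s}"] exI[of _ "\<lambda>_. c"]) auto
    then have "UNIV \<times> E {s} (\<lambda>_. c) \<in> sets (F s)" unfolding sF by (rule sigma_sets.Basic)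
    moreover have "UNIV \<times> E {s} (\<lambda>_. c) = {z \<in> space (F s). W s z \<le> c}" by (auto simp: E_def spF W_def)
    ultimately show "{z \<in> space (F s). W s z \<le> c} \<in> sets (F s)" by simp
  qed
  have Dm: "(\<lambda>z. W t z - W s z) \<in> borel_measurable ?M" for s t by (intro borel_measurable_diff Wm)
  have Dset: "{w. B t w - B s w \<le> c} \<in> sets dyadic_space" for s t c
    using borel_measurable_le[OF borel_measurable_diff[OF Bm Bm] borel_measurable_const, of t s c] by simp
  have DP: "{z. W t z - W s z \<le> c} = UNIV \<times> {w. B t w - B s w \<le> c}" for s t c by (auto simp: W_def)
  have UN: "UNIV \<in> sets \<rho>" "measure \<rho> UNIV = 1" using \<rho>.prob_space sp\<rho> sets.top[of \<rho>] by auto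
  have cdf: "measure ?M {z. W t z - W s z \<le> c} = measure gauss {z. sqrt (t - s) * z \<le> c}" if st: "0 \<le> s" "s \<le> t" for s t c
  proof -
    have "measure ?M {z. W t z - W s z \<le> c} = measure dyadic_space {w. B t w - B s w \<le> c}"
      unfolding DP using measure_pair_Times[OF \<rho>(1) prob_space_dyadic_space UN(1) Dset] UN(2) by simp
    also have "\<dots> = measure gauss {z. sqrt (t - s) * z \<le> c}"
      using ind[OF st, of "{}" "\<lambda>_. 0" c] dyadic_space.prob_space by simp
    finally show ?thesis .
  qed
  have gm: "(\<lambda>z. sqrt (t - s) * z) \<in> borel_measurable gauss" for s t
    by (intro borel_measurable_times borel_measurable_const measurable_ident_sets gauss.events_eq_borel)
  have law: "distr ?M borel (\<lambda>z. W t z - W s z) = distr gauss borel (\<lambda>z. sqrt (t - s) * z)" if st: "0 \<le> s" "s \<le> t" for s t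
  proof (rule cdf_unique)
    show "real_distribution (distr ?M borel (\<lambda>z. W t z - W s z))" by (rule M.real_distribution_distr[OF Dm])
    show "real_distribution (distr gauss borel (\<lambda>z. sqrt (t - s) * z))" by (rule gauss.real_distribution_distr[OF gm])
    show "cdf (distr ?M borel (\<lambda>z. W t z - W s z)) = cdf (distr gauss borel (\<lambda>z. sqrt (t - s) * z))"
    proof
      fix c
      show "cdf (distr ?M borel (\<lambda>z. W t z - W s z)) c = cdf (distr gauss borel (\<lambda>z. sqrt (t - s) * z)) c"
        using cdf[OF st, of c] unfolding cdf_def
        by (subst measure_distr[OF Dm], simp, subst measure_distr[OF gm], simp) (simp add: spM vimage_def)
    qed
  qed
  have expect: "(LINT z|?M. f (W t z - W s z)) = (LINT z|gauss. f (sqrt (t - s) * z))"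
    and expect_int: "integrable ?M (\<lambda>z. f (W t z - W s z)) \<longleftrightarrow> integrable gauss (\<lambda>z. f (sqrt (t - s) * z))"
    if st: "0 \<le> s" "s \<le> t" and f: "f \<in> borel_measurable borel" for s t and f :: "real \<Rightarrow> real"
  proof -
    show "(LINT z|?M. f (W t z - W s z)) = (LINT z|gauss. f (sqrt (t - s) * z))"
      using integral_distr[OF Dm[of t s] f] integral_distr[OF gm[of t s] f] law[OF st] by simp
    show "integrable ?M (\<lambda>z. f (W t z - W s z)) \<longleftrightarrow> integrable gauss (\<lambda>z. f (sqrt (t - s) * z))"
      using integrable_distr_eq[OF Dm[of t s] f] integrable_distr_eq[OF gm[of t s] f] law[OF st] by simp
  qed
  have pow: "(\<lambda>x :: real. x ^ k) \<in> borel_measurable borel" for k :: nat by measurable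
  have Dint: "integrable ?M (\<lambda>z. (W t z - W s z) ^ k)" if st: "0 \<le> s" "s \<le> t" for s t and k :: nat
    unfolding expect_int[OF st pow] power_mult_distrib by (intro integrable_mult_right integrable_std_normal_distribution_moment)
  have Dmom: "(LINT z|?M. (W t z - W s z) ^ k) = sqrt (t - s) ^ k * (LINT z|gauss. z ^ k)" if st: "0 \<le> s" "s \<le> t" for s t and k :: nat
    unfolding expect[OF st pow] power_mult_distrib by simp
  have m1: "(LINT z|?M. W t z - W s z) = 0" if "0 \<le> s" "s \<le> t" for s t
    using Dmom[OF that, of 1] gauss_moments by simp
  have m2: "(LINT z|?M. (W t z - W s z)\<^sup>2) = t - s" if "0 \<le> s" "s \<le> t" for s t
    using Dmom[OF that, of 2] gauss_moments that by simp
  have m4: "(LINT z|?M. (W t z - W s z) ^ 4) = 3 * (t - s)\<^sup>2" if "0 \<le> s" "s \<le> t" for s t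
  proof -
    have "sqrt (t - s) ^ 4 = ((sqrt (t - s))\<^sup>2)\<^sup>2" by simp
    then have "sqrt (t - s) ^ 4 = (t - s)\<^sup>2" using that by simp
    then show ?thesis using Dmom[OF that, of 4] gauss_moments by simp
  qed
  have indep: "M.indep_var borel G borel (\<lambda>z. W t z - W s z)" if st: "0 \<le> s" "s \<le> t" and G: "G \<in> borel_measurable (F s)" for s t G
  proof -
    define \<B> where "\<B> = {{z. W t z - W s z \<le> c} | c. True}"
    have \<B>s: "\<B> \<subseteq> sets ?M" unfolding \<B>_def DP using UN(1) Dset by (auto intro!: pair_measureI)
    have "M.indep_set (\<A> s) \<B>"
    proof (rule M.indep_setI[OF \<A>s \<B>s])
      fix a b assume "a \<in> \<A> s" "b \<in> \<B>"
      then obtain A U r c where a: "a = A \<times> E U r" "A \<in> sets \<rho>" "finite U" "U \<subseteq> {0..s}" and b: "b = {z. W t z - W s z \<le> c}"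
        unfolding \<A>_def \<B>_def \<rho>(2) by auto
      have X: "{w. (\<forall>u\<in>U. B u w \<le> r u) \<and> B t w - B s w \<le> c} = E U r \<inter> {w. B t w - B s w \<le> c}" by (auto simp: E_def)
      have "a \<inter> b = A \<times> (E U r \<inter> {w. B t w - B s w \<le> c})" by (auto simp: a b W_def)
      then have "measure ?M (a \<inter> b) = measure \<rho> A * measure dyadic_space (E U r \<inter> {w. B t w - B s w \<le> c})"
        using measure_pair_Times[OF \<rho>(1) prob_space_dyadic_space a(2) sets.Int[OF Es[OF a(3)] Dset]] by simp
      also have "measure dyadic_space (E U r \<inter> {w. B t w - B s w \<le> c}) = measure dyadic_space (E U r) * measure gauss {z. sqrt (t - s) * z \<le> c}"
        using ind[OF st a(3,4), of r c] unfolding X by (simp add: E_def)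
      also have "measure \<rho> A * (measure dyadic_space (E U r) * measure gauss {z. sqrt (t - s) * z \<le> c}) = measure ?M a * measure ?M b"
        unfolding a(1) b cdf[OF st] measure_pair_Times[OF \<rho>(1) prob_space_dyadic_space a(2) Es[OF a(3)]] by simp
      finally show "measure ?M (a \<inter> b) = measure ?M a * measure ?M b" .
    qed
    moreover have "Int_stable (\<A> s)"
    proof (rule Int_stableI)
      fix a b assume "a \<in> \<A> s" "b \<in> \<A> s"
      then obtain A U r A' U' r' where a: "a = A \<times> E U r" "A \<in> sets borel" "finite U" "U \<subseteq> {0..s}"
        and b: "b = A' \<times> E U' r'" "A' \<in> sets borel" "finite U'" "U' \<subseteq> {0..s}"
        unfolding \<A>_def by auto
      define q where "q u = (if u \<in> U then if u \<in> U' then min (r u) (r' u) else r u else r' u)" for u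
      have "a \<inter> b = (A \<inter> A') \<times> E (U \<union> U') q" unfolding a b E_def q_def by (auto split: if_splits)
      then show "a \<inter> b \<in> \<A> s" unfolding \<A>_def using a b by (intro CollectI exI[of _ "A \<inter> A'"] exI[of _ "U \<union> U'"] exI[of _ q]) auto
    qed
    moreover have "Int_stable \<B>"
    proof (rule Int_stableI)
      fix a b assume "a \<in> \<B>" "b \<in> \<B>"
      then obtain c d where ab: "a = {z. W t z - W s z \<le> c}" "b = {z. W t z - W s z \<le> d}" unfolding \<B>_def by auto
      have "a \<inter> b = {z. W t z - W s z \<le> min c d}" unfolding ab by auto
      then show "a \<inter> b \<in> \<B>" unfolding \<B>_def by blast
    qed
    ultimately have ids: "M.indep_set (sigma_sets (space ?M) (\<A> s)) (sigma_sets (space ?M) \<B>)"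
      by (rule M.indep_set_sigma_sets)
    have GM: "G \<in> borel_measurable ?M" by (rule measurable_from_subalg[OF sub G])
    have Gs: "sigma_sets (space ?M) {G -` A \<inter> space ?M |A. A \<in> sets borel} \<subseteq> sigma_sets (space ?M) (\<A> s)"
    proof (rule sigma_sets_mono, safe)
      fix A :: "real set" assume "A \<in> sets borel"
      from measurable_sets[OF G this] show "G -` A \<inter> space ?M \<in> sigma_sets (space ?M) (\<A> s)"
        unfolding sF spF spM .
    qed
    have Ds: "sigma_sets (space ?M) {(\<lambda>z. W t z - W s z) -` A \<inter> space ?M |A. A \<in> sets borel} \<subseteq> sigma_sets (space ?M) \<B>"
    proof (rule sigma_sets_mono, safe)
      fix A :: "real set" assume A: "A \<in> sets borel"
      have "(\<lambda>z. W t z - W s z) \<in> borel_measurable (sigma UNIV \<B>)"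
        unfolding borel_measurable_iff_le
      proof
        fix c
        have "{z. W t z - W s z \<le> c} \<in> \<B>" unfolding \<B>_def by blast
        then show "{z \<in> space (sigma UNIV \<B>). W t z - W s z \<le> c} \<in> sets (sigma UNIV \<B>)"
          by (simp add: space_measure_of_conv sets_measure_of_conv sigma_sets.Basic)
      qed
      from measurable_sets[OF this A]
      show "(\<lambda>z. W t z - W s z) -` A \<inter> space ?M \<in> sigma_sets (space ?M) \<B>"
        by (simp add: space_measure_of_conv sets_measure_of_conv spM)
    qed
    show ?thesis
      unfolding M.indep_var_eq
    proof (intro conjI GM Dm M.indep_setI)
      show "sigma_sets (space ?M) {G -` A \<inter> space ?M |A. A \<in> sets borel} \<subseteq> M.events"
        using Gs M.indep_setD_ev1[OF ids] by blast
      show "sigma_sets (space ?M) {(\<lambda>z. W t z - W s z) -` A \<inter> space ?M |A. A \<in> sets borel} \<subseteq> M.events"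
        using Ds M.indep_setD_ev2[OF ids] by blast
    qed (rule M.indep_setD[OF ids]; use Gs Ds in blast)
  qed
  show thesis
  proof (rule that)
    show "distr ?M borel fst = \<rho>"
    proof -
      have "distr ?M borel fst = distr ?M \<rho> fst" by (rule distr_cong) (use \<rho>(2) in auto)
      then show ?thesis using dyadic_space.distr_pair_fst[of \<rho>] by simp
    qed
    show "brownian ?M F W fst"
    proof unfold_locales
      fix s t :: real and G :: "real \<times> (nat \<times> nat \<Rightarrow> real) \<Rightarrow> real" and K
      assume st: "0 \<le> s" "s \<le> t" and G: "G \<in> borel_measurable (F s)" "\<And>w. \<bar>G w\<bar> \<le> K"
      have Gi: "integrable ?M G" by (rule M.integrable_bounded[OF measurable_from_subalg[OF sub G(1)] G(2)])
      have D1: "integrable ?M (\<lambda>z. W t z - W s z)" using Dint[OF st, of 1] by simp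
      show "(LINT w|?M. G w * (W t w - W s w)) = 0"
        using M.indep_var_lebesgue_integral[OF indep[OF st G(1)] Gi D1] m1[OF st] by simp
      have "M.indep_var borel (id \<circ> G) borel ((\<lambda>x. x\<^sup>2 - (t - s)) \<circ> (\<lambda>z. W t z - W s z))"
        by (rule M.indep_var_compose[OF indep[OF st G(1)]]) measurable
      then have i2: "M.indep_var borel G borel (\<lambda>z. (W t z - W s z)\<^sup>2 - (t - s))" by (simp add: comp_def)
      have D2: "integrable ?M (\<lambda>z. (W t z - W s z)\<^sup>2 - (t - s))"
        by (intro Bochner_Integration.integrable_diff Dint[OF st] M.integrable_const)
      have "(LINT z|?M. (W t z - W s z)\<^sup>2 - (t - s)) = 0"
        using Dint[OF st, of 2] m2[OF st] M.prob_space by simp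
      then show "(LINT w|?M. G w * ((W t w - W s w)\<^sup>2 - (t - s))) = 0"
        using M.indep_var_lebesgue_integral[OF i2 Gi D2] by simp
    qed (use sub mono Zm Wa Bc B0 Dint m2 m4 in \<open>auto simp: W_def\<close>)
  qed
qed

section \<open>Differential equations with additive noise\<close>

locale lipschitz_drift =
  fixes B :: "real \<Rightarrow> real \<Rightarrow> real" and C L :: real
  assumes drift_measurable: "(\<lambda>(u, x). B u x) \<in> borel_measurable (borel \<Otimes>\<^sub>M borel)"
    and drift_bounded: "\<And>u x. \<bar>B u x\<bar> \<le> C"
    and drift_Lipschitz: "\<And>u x y. \<bar>B u x - B u y\<bar> \<le> L * \<bar>x - y\<bar>"
begin

lemma C_nonneg: "0 \<le> C"
  using drift_bounded[of 0 0] by linarith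

lemma L_nonneg: "0 \<le> L"
  using drift_Lipschitz[of 0 0 1] by simp

lemma measurable_drift:
  "f \<in> borel_measurable N \<Longrightarrow> g \<in> borel_measurable N \<Longrightarrow> (\<lambda>x. B (f x) (g x)) \<in> borel_measurable N"
  using measurable_compose[OF measurable_Pair drift_measurable] by simp

lemma drift_path_measurable:
  assumes "continuous_on {0..} y"
  shows "(\<lambda>u. B u (y (max 0 u))) \<in> borel_measurable borel"
proof (rule measurable_drift)
  show "(\<lambda>u. y (max 0 u)) \<in> borel_measurable borel"
    by (intro borel_measurable_continuous_onI continuous_on_compose2[OF assms] continuous_intros) auto
qed simp

lemma drift_integral_clip: "(LINT u:{0..t}|lborel. B u (y u)) = (LINT u:{0..t}|lborel. B u (y (max 0 u)))"
  by (intro set_lebesgue_integral_cong) auto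

fun picard :: "(real \<Rightarrow> real) \<Rightarrow> nat \<Rightarrow> real \<Rightarrow> real" where
  "picard f 0 t = f t"
| "picard f (Suc n) t = f t + (LINT u:{0..t}|lborel. B u (picard f n (max 0 u)))"

lemma continuous_picard:
  assumes f: "continuous_on {0..} f"
  shows "continuous_on {0..} (picard f n)"
proof (induction n)
  case 0
  then show ?case using f by (simp cong: continuous_on_cong)
next
  case (Suc n)
  have "continuous_on {0..} (\<lambda>t. f t + (LINT u:{0..t}|lborel. B u (picard f n (max 0 u))))"
    by (intro continuous_on_add f continuous_on_set_integral[where K=C] drift_path_measurable Suc drift_bounded)
  then show ?case by (simp cong: continuous_on_cong)
qed

text \<open>
  With respect to the weight \<open>exp ((2 L + 1) t)\<close> the Picard map has contraction factor \<open>L / (2 L + 1) \<le> 1/2\<close>.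
\<close>

lemma picard_step:
  assumes f: "continuous_on {0..} f" and t: "0 \<le> t"
  shows "\<bar>picard f (Suc n) t - picard f n t\<bar> \<le> C * exp ((2 * L + 1) * t) * (1/2) ^ n"
  using t
proof (induction n arbitrary: t)
  case 0
  have "\<bar>LINT u:{0..t}|lborel. B u (f (max 0 u))\<bar> \<le> C * (t - 0)"
    using 0 by (intro set_integral_interval_le drift_path_measurable f drift_bounded) auto
  also have "\<dots> \<le> C * exp ((2 * L + 1) * t)"
  proof (intro mult_left_mono C_nonneg)
    have "t \<le> (2 * L + 1) * t" using 0 L_nonneg by (simp add: algebra_simps)
    also have "\<dots> \<le> exp ((2 * L + 1) * t)" using exp_ge_add_one_self[of "(2 * L + 1) * t"] by linarith
    finally show "t - 0 \<le> exp ((2 * L + 1) * t)" by simp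
  qed
  finally show ?case by simp
next
  case (Suc n)
  define l where "l = 2 * L + 1"
  have l: "0 < l" "2 * L \<le> l" using L_nonneg by (auto simp: l_def)
  let ?y = "\<lambda>n u. picard f n (max 0 u)"
  have m: "(\<lambda>u. B u (?y n u)) \<in> borel_measurable borel" for n
    by (rule drift_path_measurable[OF continuous_picard[OF f]])
  have i: "set_integrable lborel {0..t} (\<lambda>u. B u (?y n u))" for n
    by (rule set_integrable_bounded_interval[OF m drift_bounded])
  have ie: "set_integrable lborel {0..t} (\<lambda>u. C * (1/2) ^ n * (L * exp (l * u)))"
    by (rule set_integrable_bounded_interval[where K="\<bar>C * (1/2) ^ n * (L * exp (l * t))\<bar>"])
      (use C_nonneg L_nonneg l in \<open>auto simp: abs_mult intro!: mult_left_mono\<close>)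
  have "picard f (Suc (Suc n)) t - picard f (Suc n) t = (LINT u:{0..t}|lborel. B u (?y (Suc n) u) - B u (?y n u))"
    unfolding set_integral_diff(2)[OF i i] picard.simps(2)[of f "Suc n" t] picard.simps(2)[of f n t] by linarith
  then have "\<bar>picard f (Suc (Suc n)) t - picard f (Suc n) t\<bar> \<le> (LINT u:{0..t}|lborel. \<bar>B u (?y (Suc n) u) - B u (?y n u)\<bar>)"
    using set_integral_norm_bound[OF set_integral_diff(1)[OF i i]] unfolding real_norm_def by (simp only:)
  also have "\<dots> \<le> (LINT u:{0..t}|lborel. C * (1/2) ^ n * (L * exp (l * u)))"
  proof (rule set_integral_mono[OF set_integrable_abs[OF set_integral_diff(1)[OF i i]] ie])
    fix u assume u: "u \<in> {0..t}"
    have "\<bar>B u (?y (Suc n) u) - B u (?y n u)\<bar> \<le> L * \<bar>?y (Suc n) u - ?y n u\<bar>" by (rule drift_Lipschitz)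
    also have "\<dots> \<le> L * (C * exp (l * max 0 u) * (1/2) ^ n)"
      unfolding l_def by (intro mult_left_mono Suc.IH L_nonneg) simp
    also have "\<dots> = C * (1/2) ^ n * (L * exp (l * u))" using u by (simp add: max_def)
    finally show "\<bar>B u (?y (Suc n) u) - B u (?y n u)\<bar> \<le> C * (1/2) ^ n * (L * exp (l * u))" .
  qed
  also have "\<dots> = C * (1/2) ^ n * L * (LINT u:{0..t}|lborel. exp (l * u))"
    by (simp add: mult.assoc)
  also have "(LINT u:{0..t}|lborel. exp (l * u)) = (\<integral>u. exp (l * u) * indicator {0..t} u \<partial>lborel)"
    by (simp add: set_lebesgue_integral_def mult.commute)
  also have "\<dots> = exp (l * t) / l - exp (l * 0) / l"
    by (rule integral_FTC_Icc_real) (use Suc.prems l in \<open>auto intro!: derivative_eq_intros\<close>)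
  also have "C * (1/2) ^ n * L * (exp (l * t) / l - exp (l * 0) / l) \<le> C * (1/2) ^ n * L * (exp (l * t) / l)"
    using C_nonneg L_nonneg l by (intro mult_left_mono) auto
  also have "\<dots> = C * (1/2) ^ n * exp (l * t) * (L / l)" by simp
  also have "\<dots> \<le> C * (1/2) ^ n * exp (l * t) * (1/2)"
    using C_nonneg L_nonneg l by (intro mult_left_mono) (auto simp: divide_le_eq)
  finally show ?case unfolding l_def power_Suc by (simp only: mult_ac)
qed

definition solution :: "(real \<Rightarrow> real) \<Rightarrow> real \<Rightarrow> real" where
  "solution f t = lim (\<lambda>n. picard f n t)"

lemma picard_converges:
  assumes f: "continuous_on {0..} f" and t: "0 \<le> t"
  shows "(\<lambda>n. picard f n t) \<longlonglongrightarrow> solution f t"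
    and "\<bar>picard f n t - solution f t\<bar> \<le> 2 * C * exp ((2 * L + 1) * t) * (1/2) ^ n"
proof -
  obtain y where y: "(\<lambda>n. picard f n t) \<longlonglongrightarrow> y" "\<And>n. \<bar>picard f n t - y\<bar> \<le> C * exp ((2 * L + 1) * t) / (1 - 1/2) * (1/2) ^ n"
    by (rule geometric_Cauchy[OF _ _ picard_step[OF f t]]) auto
  have "y = solution f t" unfolding solution_def using limI[OF y(1)] by simp
  then show "(\<lambda>n. picard f n t) \<longlonglongrightarrow> solution f t"
    "\<bar>picard f n t - solution f t\<bar> \<le> 2 * C * exp ((2 * L + 1) * t) * (1/2) ^ n"
    using y(1) y(2)[of n] by simp_all
qed

lemma continuous_solution:
  assumes f: "continuous_on {0..} f"
  shows "continuous_on {0..} (solution f)"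
proof -
  have T: "continuous_on {0..T} (solution f)" for T
  proof (rule uniform_limit_theorem)
    show "\<forall>\<^sub>F n in sequentially. continuous_on {0..T} (picard f n)"
      by (intro always_eventually allI continuous_on_subset[OF continuous_picard[OF f]]) auto
    show "uniform_limit {0..T} (picard f) (solution f) sequentially"
    proof (rule uniform_limitI)
      fix e :: real assume e: "0 < e"
      have "(\<lambda>n. 2 * C * exp ((2 * L + 1) * T) * (1/2) ^ n) \<longlonglongrightarrow> 2 * C * exp ((2 * L + 1) * T) * 0"
        by (intro tendsto_intros LIMSEQ_power_zero) simp
      then have "\<forall>\<^sub>F n in sequentially. 2 * C * exp ((2 * L + 1) * T) * (1/2) ^ n < e"
        using e by (intro order_tendstoD(2)) auto
      then show "\<forall>\<^sub>F n in sequentially. \<forall>t\<in>{0..T}. dist (picard f n t) (solution f t) < e"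
      proof eventually_elim
        case (elim n)
        show ?case
        proof
          fix t assume t: "t \<in> {0..T}"
          have "\<bar>picard f n t - solution f t\<bar> \<le> 2 * C * exp ((2 * L + 1) * t) * (1/2) ^ n"
            using t by (intro picard_converges(2)[OF f]) auto
          also have "\<dots> \<le> 2 * C * exp ((2 * L + 1) * T) * (1/2) ^ n"
            using t C_nonneg L_nonneg by (intro mult_right_mono mult_left_mono) auto
          finally show "dist (picard f n t) (solution f t) < e" using elim by (simp add: dist_real_def)
        qed
      qed
    qed
  qed simp
  show ?thesis
    unfolding continuous_on_eq_continuous_within
  proof
    fix x :: real assume x: "x \<in> {0..}"
    have "continuous (at x within {0..x + 1}) (solution f)"
      using T[of "x + 1"] x unfolding continuous_on_eq_continuous_within by auto
    moreover have "at x within {0..x + 1} = at x within {0..}"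
      by (rule at_within_nhd[of _ "{..<x + 1}"]) auto
    ultimately show "continuous (at x within {0..}) (solution f)" by simp
  qed
qed

lemma solution_equation:
  assumes f: "continuous_on {0..} f" and t: "0 \<le> t"
  shows "solution f t = f t + (LINT u:{0..t}|lborel. B u (solution f u))"
proof -
  have "(\<lambda>n. LINT u:{0..t}|lborel. B u (picard f n (max 0 u))) \<longlonglongrightarrow> (LINT u:{0..t}|lborel. B u (solution f (max 0 u)))"
  proof (rule set_integral_bounded_tendsto[where K=C])
    show "(\<lambda>u. B u (picard f n (max 0 u))) \<in> borel_measurable borel" for n
      by (rule drift_path_measurable[OF continuous_picard[OF f]])
    show "(\<lambda>u. B u (solution f (max 0 u))) \<in> borel_measurable borel"
      by (rule drift_path_measurable[OF continuous_solution[OF f]])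
    fix u
    have c: "continuous_on UNIV (B u)"
      by (rule lipschitz_on_continuous_on[of L], rule lipschitz_onI)
        (use drift_Lipschitz L_nonneg in \<open>auto simp: dist_real_def\<close>)
    show "(\<lambda>n. B u (picard f n (max 0 u))) \<longlonglongrightarrow> B u (solution f (max 0 u))"
      using continuous_on_tendsto_compose[OF c picard_converges(1)[OF f, of "max 0 u"]] by simp
  qed (rule drift_bounded)
  then have "(\<lambda>n. picard f (Suc n) t) \<longlonglongrightarrow> f t + (LINT u:{0..t}|lborel. B u (solution f (max 0 u)))"
    by (simp add: tendsto_add)
  moreover have "(\<lambda>n. picard f (Suc n) t) \<longlonglongrightarrow> solution f t"
    by (rule LIMSEQ_Suc[OF picard_converges(1)[OF f t]])
  ultimately show ?thesis by (subst drift_integral_clip) (rule LIMSEQ_unique)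
qed

lemma solution_adapted:
  assumes f: "\<And>s. 0 \<le> s \<Longrightarrow> (\<lambda>w. f w s) \<in> borel_measurable (F s)" "\<And>w. w \<in> space M \<Longrightarrow> continuous_on {0..} (f w)"
    and mono: "\<And>s t. s \<le> t \<Longrightarrow> subalgebra (F t) (F s)" and sp: "\<And>s. space (F s) = space M" and t: "0 \<le> t"
  shows "(\<lambda>w. solution (f w) t) \<in> borel_measurable (F t)"
proof -
  have pm: "(\<lambda>w. picard (f w) n t) \<in> borel_measurable (F t)" if "0 \<le> t" for n t
    using that
  proof (induction n arbitrary: t)
    case 0
    then show ?case using f(1) by simp
  next
    case (Suc n)
    let ?c = "\<lambda>u. max 0 (min t u)"
    have "(\<lambda>(u, w). picard (f w) n (?c u)) \<in> borel_measurable (borel \<Otimes>\<^sub>M F t)"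
    proof (rule measurable_continuous_process[where I="{0..t}"])
      show "(\<lambda>w. picard (f w) n r) \<in> borel_measurable (F t)" if "r \<in> {0..t}" for r
        using that by (intro measurable_from_subalg[OF mono[of r t]] Suc.IH) auto
      show "continuous_on {0..t} (\<lambda>r. picard (f w) n r)" if "w \<in> space (F t)" for w
        by (rule continuous_on_subset[OF continuous_picard[OF f(2)]]) (use that sp in auto)
    qed (use Suc.prems in \<open>auto intro!: continuous_intros\<close>)
    then have "(\<lambda>z. B (fst z) (picard (f (snd z)) n (?c (fst z)))) \<in> borel_measurable (borel \<Otimes>\<^sub>M F t)"
      by (intro measurable_drift measurable_fst) (simp add: case_prod_unfold)
    then have "(\<lambda>w. LINT u:{0..t}|lborel. B u (picard (f w) n (?c u))) \<in> borel_measurable (F t)"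
      by (intro measurable_time_integral) (simp add: case_prod_unfold)
    moreover have "(LINT u:{0..t}|lborel. B u (picard (f w) n (?c u))) = (LINT u:{0..t}|lborel. B u (picard (f w) n (max 0 u)))" for w
      by (intro set_lebesgue_integral_cong) auto
    ultimately show ?case using f(1)[OF Suc.prems] by simp
  qed
  show ?thesis
  proof (rule borel_measurable_LIMSEQ_real[where u="\<lambda>n w. picard (f w) n t"])
    show "(\<lambda>n. picard (f w) n t) \<longlonglongrightarrow> solution (f w) t" if "w \<in> space (F t)" for w
      by (rule picard_converges(1)[OF f(2) t]) (use that sp in simp)
  qed (rule pm[OF t])
qed

end

section \<open>Absorption at the origin\<close>

definition absorb :: "(real \<Rightarrow> real) \<Rightarrow> real \<Rightarrow> real" where
  "absorb y t = (if \<forall>u\<in>{0..t}. 0 < y u then y t else 0)"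

lemma absorb_nonneg: "0 \<le> t \<Longrightarrow> 0 \<le> absorb y t"
  by (auto simp: absorb_def less_imp_le)

lemma first_zero:
  fixes y :: "real \<Rightarrow> real"
  assumes y: "continuous_on {0..} y" and y0: "0 < y 0" and ex: "0 \<le> t" "y t \<le> 0"
  obtains \<tau> where "0 < \<tau>" "\<tau> \<le> t" "y \<tau> = 0" "\<And>u. 0 \<le> u \<Longrightarrow> u < \<tau> \<Longrightarrow> 0 < y u"
proof -
  define S where "S = {u \<in> {0..t}. y u \<le> 0}"
  have cy: "continuous_on {0..t} y" by (rule continuous_on_subset[OF y]) auto
  have "S = {0..t} \<inter> y -` {..0}" by (auto simp: S_def)
  then have "closed S" using continuous_closed_preimage[OF cy] by simp
  have ne: "S \<noteq> {}" and bd: "bdd_below S" using ex by (auto simp: S_def bdd_below_def)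
  define \<tau> where "\<tau> = Inf S"
  have \<tau>S: "\<tau> \<in> S" unfolding \<tau>_def by (rule closed_contains_Inf[OF ne bd \<open>closed S\<close>])
  have pos: "0 < y u" if "0 \<le> u" "u < \<tau>" for u
  proof (rule ccontr)
    assume "\<not> 0 < y u"
    then have "u \<in> S" using that \<tau>S by (auto simp: S_def)
    then show False using cInf_lower[OF _ bd, of u] that by (simp add: \<tau>_def)
  qed
  have \<tau>0: "0 < \<tau>" using \<tau>S y0 by (cases "\<tau> = 0") (auto simp: S_def)
  have "y \<tau> = 0"
  proof (rule ccontr)
    assume "y \<tau> \<noteq> 0"
    then have neg: "y \<tau> < 0" using \<tau>S by (simp add: S_def)
    have "continuous_on {0..\<tau>} y" by (rule continuous_on_subset[OF y]) auto
    from IVT2'[of y \<tau> 0 0, OF _ _ _ this] neg y0 \<tau>0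
    obtain x where x: "0 \<le> x" "x \<le> \<tau>" "y x = 0" by auto
    then have "x < \<tau>" using neg by (cases "x = \<tau>") auto
    then show False using pos[of x] x by simp
  qed
  then show thesis using that[of \<tau>] \<tau>0 \<tau>S pos by (auto simp: S_def)
qed

lemma absorb_cases:
  fixes y :: "real \<Rightarrow> real"
  assumes y: "continuous_on {0..} y"
  obtains (never) "\<And>u. 0 \<le> u \<Longrightarrow> 0 < y u" | (start) "y 0 \<le> 0"
    | (hit) \<tau> where "0 < \<tau>" "y \<tau> = 0" "\<And>u. 0 \<le> u \<Longrightarrow> u < \<tau> \<Longrightarrow> 0 < y u"
proof (cases "y 0 \<le> 0 \<or> (\<forall>u\<ge>0. 0 < y u)")
  case True
  then show ?thesis using never start by blast
next
  case False
  then obtain t where t: "0 < y 0" "0 \<le> t" "y t \<le> 0" by force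
  show ?thesis by (rule first_zero[OF y t]) (rule hit)
qed

lemma absorb_never: "(\<And>u. 0 \<le> u \<Longrightarrow> 0 < y u) \<Longrightarrow> absorb y t = y t"
  by (simp add: absorb_def)

lemma absorb_start: "y 0 \<le> 0 \<Longrightarrow> 0 \<le> t \<Longrightarrow> absorb y t = 0"
  by (force simp: absorb_def)

lemma absorb_hit:
  assumes "0 < \<tau>" "y \<tau> = 0" "\<And>u. 0 \<le> u \<Longrightarrow> u < \<tau> \<Longrightarrow> 0 < y u" "0 \<le> t"
  shows "(\<forall>u\<in>{0..t}. 0 < y u) \<longleftrightarrow> t < \<tau>" "absorb y t = (if t < \<tau> then y t else 0)"
proof -
  show *: "(\<forall>u\<in>{0..t}. 0 < y u) \<longleftrightarrow> t < \<tau>"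
  proof
    assume a: "\<forall>u\<in>{0..t}. 0 < y u"
    show "t < \<tau>"
    proof (rule ccontr)
      assume "\<not> t < \<tau>"
      then have "0 < y \<tau>" using a assms(1) by auto
      then show False using assms(2) by simp
    qed
  qed (use assms(3) in auto)
  show "absorb y t = (if t < \<tau> then y t else 0)" unfolding absorb_def * ..
qed

lemma continuous_absorb:
  assumes y: "continuous_on {0..} y"
  shows "continuous_on {0..} (absorb y)"
  using y
proof (cases rule: absorb_cases)
  case never
  then have "absorb y = y" by (intro ext absorb_never)
  then show ?thesis using y by simp
next
  case start
  have "continuous_on {0..} (absorb y) \<longleftrightarrow> continuous_on {0..} (\<lambda>_ :: real. 0 :: real)"
    by (rule continuous_on_cong) (auto simp: absorb_start[of y, OF start])
  then show ?thesis by simp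
next
  case (hit \<tau>)
  have "continuous_on {0..} (absorb y) \<longleftrightarrow> continuous_on ({0..\<tau>} \<union> {\<tau>..}) (\<lambda>t. if t \<le> \<tau> then y t else 0)"
    using hit by (intro continuous_on_cong) (auto simp: absorb_hit(2)[of \<tau> y, OF hit])
  moreover have "continuous_on ({0..\<tau>} \<union> {\<tau>..}) (\<lambda>t. if t \<le> \<tau> then y t else 0)"
    by (rule continuous_on_If) (use hit in \<open>auto intro: continuous_on_subset[OF y]\<close>)
  ultimately show ?thesis by simp
qed

text \<open>
  As \<open>P\<close> never recovers once it has failed, the sum telescopes up to the first failure.
\<close>

lemma sum_stopped:
  fixes a :: "nat \<Rightarrow> real"
  assumes P: "\<And>i. P (Suc i) \<Longrightarrow> P i"
  shows "\<exists>j\<le>n. (\<forall>i<j. P i) \<and> (j < n \<longrightarrow> \<not> P j) \<and> (\<Sum>i<n. if P i then a (Suc i) - a i else 0) = a j - a 0"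
proof (induction n)
  case (Suc n)
  then obtain j where j: "j \<le> n" "\<forall>i<j. P i" "j < n \<longrightarrow> \<not> P j"
    "(\<Sum>i<n. if P i then a (Suc i) - a i else 0) = a j - a 0" by auto
  show ?case
  proof (cases "j < n \<or> \<not> P n")
    case True
    have "\<not> P n"
    proof (cases "j < n")
      case True
      then have "\<not> P j" using j by simp
      have "P n \<Longrightarrow> P j" using j(1) by (rule inc_induct) (auto intro: P)
      then show ?thesis using \<open>\<not> P j\<close> by blast
    qed (use True in simp)
    then show ?thesis using j by (intro exI[of _ j]) (auto simp: less_Suc_eq)
  next
    case False
    then have "j = n" "P n" using j by auto
    then show ?thesis using j by (intro exI[of _ "Suc n"]) (auto simp: less_Suc_eq)
  qed
qed simp

section \<open>The absorbed diffusion\<close>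

text \<open>
  The process \<open>Y\<close> solves \<open>Y\<^sub>t = Z + \<surd>2 W\<^sub>t + \<integral>\<^sub>0\<^sup>t B(u,Y\<^sub>u) du\<close>; the diffusion itself is \<open>Y\<close> absorbed at its first zero.
\<close>

locale absorbed_diffusion = brownian M F W Z + lipschitz_drift B C L
  for M :: "'a measure" and F W Z B C L
begin

definition noise :: "'a \<Rightarrow> real \<Rightarrow> real" where
  "noise w t = Z w + sqrt 2 * W t w"

definition Y :: "real \<Rightarrow> 'a \<Rightarrow> real" where
  "Y t w = solution (noise w) t"

definition drift_part :: "real \<Rightarrow> real \<Rightarrow> 'a \<Rightarrow> real" where
  "drift_part s t w = (LINT u:{s..t}|lborel. B u (Y u w))"

lemma space_F: "space (F s) = space M"
  using F_subalgebra by (simp add: subalgebra_def)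

lemma continuous_noise: "w \<in> space M \<Longrightarrow> continuous_on {0..} (noise w)"
  unfolding noise_def by (intro continuous_intros W_continuous)

lemma continuous_Y: "w \<in> space M \<Longrightarrow> continuous_on {0..} (\<lambda>t. Y t w)"
  unfolding Y_def by (intro continuous_solution continuous_noise)

lemma Y_adapted: "0 \<le> t \<Longrightarrow> Y t \<in> borel_measurable (F t)"
  unfolding Y_def[abs_def]
proof (rule solution_adapted[where M=M])
  show "(\<lambda>w. noise w s) \<in> borel_measurable (F s)" if "0 \<le> s" for s
    unfolding noise_def by (intro borel_measurable_add borel_measurable_times borel_measurable_const Z_measurable W_adapted that)
qed (auto intro: continuous_noise F_mono simp: space_F)

lemma Y_measurable: "0 \<le> t \<Longrightarrow> Y t \<in> borel_measurable M"
  by (rule measurable_from_subalg[OF F_subalgebra Y_adapted])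

lemma W_measurable: "0 \<le> t \<Longrightarrow> W t \<in> borel_measurable M"
  by (rule measurable_from_subalg[OF F_subalgebra W_adapted])

lemma Y_path_measurable: "w \<in> space M \<Longrightarrow> (\<lambda>u. Y (max 0 u) w) \<in> borel_measurable borel"
  by (intro borel_measurable_continuous_onI continuous_on_compose2[OF continuous_Y] continuous_intros) auto

lemma drift_path: "w \<in> space M \<Longrightarrow> (\<lambda>u. B u (Y (max 0 u) w)) \<in> borel_measurable borel"
  by (intro measurable_drift Y_path_measurable) simp

lemma Y_joint: "(\<lambda>z. Y (max 0 (fst z)) (snd z)) \<in> borel_measurable (borel \<Otimes>\<^sub>M M)"
proof -
  have "(\<lambda>(u, w). Y (max 0 u) w) \<in> borel_measurable (borel \<Otimes>\<^sub>M M)"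
    by (rule measurable_continuous_process[where I="{0..}"]) (auto intro: Y_measurable continuous_Y continuous_intros)
  then show ?thesis by (simp add: case_prod_unfold)
qed

lemma drift_part_clip: "0 \<le> s \<Longrightarrow> drift_part s t w = (LINT u:{s..t}|lborel. B u (Y (max 0 u) w))"
  unfolding drift_part_def by (intro set_lebesgue_integral_cong) auto

lemma drift_part_le: "w \<in> space M \<Longrightarrow> 0 \<le> s \<Longrightarrow> s \<le> t \<Longrightarrow> \<bar>drift_part s t w\<bar> \<le> C * (t - s)"
  unfolding drift_part_clip by (rule set_integral_interval_le) (auto intro: drift_path drift_bounded)

lemma drift_part_measurable: "0 \<le> s \<Longrightarrow> drift_part s t \<in> borel_measurable M"
proof -
  assume s: "0 \<le> s"
  have "(\<lambda>w. LINT u:{s..t}|lborel. B u (Y (max 0 u) w)) \<in> borel_measurable M"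
    by (rule measurable_time_integral) (use measurable_drift[OF measurable_fst Y_joint] in \<open>simp add: case_prod_unfold\<close>)
  then show ?thesis using drift_part_clip[OF s] by (simp cong: measurable_cong)
qed

lemma Y_increment:
  assumes w: "w \<in> space M" and st: "0 \<le> s" "s \<le> t"
  shows "Y t w - Y s w = sqrt 2 * (W t w - W s w) + drift_part s t w"
proof -
  have eq: "Y r w = noise w r + drift_part 0 r w" if "0 \<le> r" for r
    using solution_equation[OF continuous_noise[OF w] that] by (simp add: Y_def drift_part_def)
  have "set_integrable lborel {0..t} (\<lambda>u. B u (Y (max 0 u) w))"
    by (rule set_integrable_bounded_interval[OF drift_path[OF w] drift_bounded])
  from set_integral_split[OF this st] have "drift_part 0 t w = drift_part 0 s w + drift_part s t w"
    using st by (simp add: drift_part_clip)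
  then show ?thesis using eq[of t] eq[of s] st by (simp add: noise_def algebra_simps)
qed

lemma Y_0:
  assumes w: "w \<in> space M"
  shows "Y 0 w = Z w"
proof -
  have "(LINT u:{0..0}|lborel. B u (solution (noise w) u)) = 0"
    unfolding set_lebesgue_integral_def
    by (rule integral_eq_zero_AE) (use AE_lborel_singleton[of 0] in \<open>eventually_elim, auto\<close>)
  then show ?thesis
    using solution_equation[OF continuous_noise[OF w], of 0] W_0[OF w] by (simp add: Y_def noise_def)
qed

lemma Y_increment_square:
  assumes w: "w \<in> space M" and st: "0 \<le> s" "s \<le> t"
  shows "(Y t w - Y s w)\<^sup>2 \<le> 4 * (W t w - W s w)\<^sup>2 + 2 * C\<^sup>2 * (t - s)\<^sup>2"
proof -
  have "(drift_part s t w)\<^sup>2 \<le> (C * (t - s))\<^sup>2"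
    using drift_part_le[OF w st] by (intro abs_le_square_iff[THEN iffD1]) auto
  moreover have "(Y t w - Y s w)\<^sup>2 \<le> 2 * (sqrt 2 * (W t w - W s w))\<^sup>2 + 2 * (drift_part s t w)\<^sup>2"
    unfolding Y_increment[OF w st]
    using zero_le_power2[of "sqrt 2 * (W t w - W s w) - drift_part s t w"]
    by (simp add: power2_sum power2_diff)
  ultimately show ?thesis by (simp add: power_mult_distrib)
qed

lemma increment_square_integrable: "0 \<le> s \<Longrightarrow> s \<le> t \<Longrightarrow> integrable M (\<lambda>w. (W t w - W s w)\<^sup>2)"
proof (rule Bochner_Integration.integrable_bound)
  assume st: "0 \<le> s" "s \<le> t"
  show "integrable M (\<lambda>w. 1 + (W t w - W s w) ^ 4)" using increment_integrable[OF st] by simp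
  show "(\<lambda>w. (W t w - W s w)\<^sup>2) \<in> borel_measurable M"
    using st by (intro borel_measurable_power borel_measurable_diff W_measurable) auto
  have "x\<^sup>2 \<le> 1 + x ^ 4" for x :: real
  proof -
    have "2 * x\<^sup>2 \<le> x ^ 4 + 1" using zero_le_power2[of "x\<^sup>2 - 1"] by (simp add: power2_diff power_mult[symmetric])
    moreover have "0 \<le> x\<^sup>2" by simp
    ultimately show ?thesis by linarith
  qed
  then show "AE w in M. norm ((W t w - W s w)\<^sup>2) \<le> norm (1 + (W t w - W s w) ^ 4)"
    by (intro AE_I2) (simp add: abs_of_nonneg)
qed

lemma Y_increment_square_expectation:
  assumes st: "0 \<le> s" "s \<le> t" "t - s \<le> 1"
  shows "integrable M (\<lambda>w. (Y t w - Y s w)\<^sup>2)" "(LINT w|M. (Y t w - Y s w)\<^sup>2) \<le> (4 + 2 * C\<^sup>2) * (t - s)"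
proof -
  have i: "integrable M (\<lambda>w. 4 * (W t w - W s w)\<^sup>2 + 2 * C\<^sup>2 * (t - s)\<^sup>2)"
    using increment_square_integrable[OF st(1,2)] by simp
  show i': "integrable M (\<lambda>w. (Y t w - Y s w)\<^sup>2)"
  proof (rule Bochner_Integration.integrable_bound[OF i])
    show "(\<lambda>w. (Y t w - Y s w)\<^sup>2) \<in> borel_measurable M"
      using st by (intro borel_measurable_power borel_measurable_diff Y_measurable) auto
    show "AE w in M. norm ((Y t w - Y s w)\<^sup>2) \<le> norm (4 * (W t w - W s w)\<^sup>2 + 2 * C\<^sup>2 * (t - s)\<^sup>2)"
      using Y_increment_square[OF _ st(1,2)] by (intro AE_I2) (simp add: abs_of_nonneg)
  qed
  have "(LINT w|M. (Y t w - Y s w)\<^sup>2) \<le> (LINT w|M. 4 * (W t w - W s w)\<^sup>2 + 2 * C\<^sup>2 * (t - s)\<^sup>2)"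
    by (rule integral_mono[OF i' i]) (rule Y_increment_square[OF _ st(1,2)])
  also have "\<dots> = 4 * (t - s) + 2 * C\<^sup>2 * (t - s)\<^sup>2"
    using increment_square_integrable[OF st(1,2)] increment_moment2[OF st(1,2)] by (simp add: prob_space)
  also have "\<dots> \<le> 4 * (t - s) + 2 * C\<^sup>2 * (t - s)"
    using st by (intro add_left_mono mult_left_mono) (auto simp: power2_eq_square mult_left_le)
  finally show "(LINT w|M. (Y t w - Y s w)\<^sup>2) \<le> (4 + 2 * C\<^sup>2) * (t - s)" by (simp add: algebra_simps)
qed

end

section \<open>One step of Ito's formula\<close>

lemma second_order_Taylor:
  fixes \<phi> :: "real \<Rightarrow> real"
  assumes \<phi>: "\<And>x. (\<phi> has_real_derivative \<phi>' x) (at x)" "\<And>x. (\<phi>' has_real_derivative \<phi>'' x) (at x)"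
    and osc: "\<And>x y. \<bar>\<phi>'' x - \<phi>'' y\<bar> \<le> e + k * (x - y)\<^sup>2" and k: "0 \<le> k" "0 \<le> e"
  shows "\<bar>\<phi> x - \<phi> y - \<phi>' y * (x - y) - \<phi>'' y * (x - y)\<^sup>2 / 2\<bar> \<le> (e + k * (x - y)\<^sup>2) * (x - y)\<^sup>2 / 2"
proof (cases "x = y")
  case False
  define D where "D m = (if m = 0 then \<phi> else if m = Suc 0 then \<phi>' else \<phi>'')" for m :: nat
  have "\<exists>t. (if x < y then x < t \<and> t < y else y < t \<and> t < x) \<and>
      \<phi> x = (\<Sum>m<2. D m y / fact m * (x - y) ^ m) + D 2 t / fact 2 * (x - y) ^ 2"
    by (rule Taylor[where a="min x y" and b="max x y"]) (use False \<phi> in \<open>auto simp: D_def less_Suc_eq numeral_2_eq_2\<close>)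
  then obtain t where t: "if x < y then x < t \<and> t < y else y < t \<and> t < x"
    and eq: "\<phi> x = (\<Sum>m<2. D m y / fact m * (x - y) ^ m) + D 2 t / fact 2 * (x - y) ^ 2" by blast
  have S: "(\<Sum>m<2. D m y / fact m * (x - y) ^ m) = \<phi> y + \<phi>' y * (x - y)" "D 2 t = \<phi>'' t"
    by (simp_all add: D_def numeral_2_eq_2)
  have eq': "\<phi> x - \<phi> y - \<phi>' y * (x - y) - \<phi>'' y * (x - y)\<^sup>2 / 2 = (\<phi>'' t - \<phi>'' y) * (x - y)\<^sup>2 / 2"
    unfolding eq S by (simp add: left_diff_distrib diff_divide_distrib)
  have "(t - y)\<^sup>2 \<le> (x - y)\<^sup>2" using t by (intro abs_le_square_iff[THEN iffD1]) (auto split: if_splits)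
  then have "\<bar>\<phi>'' t - \<phi>'' y\<bar> \<le> e + k * (x - y)\<^sup>2"
    using osc[of t y] mult_left_mono[OF _ k(1)] by fastforce
  then show ?thesis unfolding eq' by (simp add: abs_mult mult_right_mono)
qed simp

context absorbed_diffusion
begin

definition rate :: "(real \<Rightarrow> real) \<Rightarrow> (real \<Rightarrow> real) \<Rightarrow> real \<Rightarrow> 'a \<Rightarrow> real" where
  "rate \<phi>' \<phi>'' u w = \<phi>' (Y (max 0 u) w) * B u (Y (max 0 u) w) + \<phi>'' (Y (max 0 u) w)"

lemma rate_joint:
  assumes "\<phi>' \<in> borel_measurable borel" "\<phi>'' \<in> borel_measurable borel"
  shows "(\<lambda>z. rate \<phi>' \<phi>'' (fst z) (snd z)) \<in> borel_measurable (borel \<Otimes>\<^sub>M M)"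
  unfolding rate_def
  by (intro borel_measurable_add borel_measurable_times measurable_compose[OF Y_joint assms(1)]
      measurable_compose[OF Y_joint assms(2)] measurable_drift measurable_fst Y_joint)

lemma rate_path:
  assumes "\<phi>' \<in> borel_measurable borel" "\<phi>'' \<in> borel_measurable borel" "w \<in> space M"
  shows "(\<lambda>u. rate \<phi>' \<phi>'' u w) \<in> borel_measurable borel"
  unfolding rate_def
  by (intro borel_measurable_add borel_measurable_times drift_path measurable_compose[OF Y_path_measurable assms(1)]
      measurable_compose[OF Y_path_measurable assms(2)] assms(3))

text \<open>
  Ito's formula over one short step, with an error that is small compared with the length of the step. Taylor's expansion
  at \<open>Y\<^sub>s\<close> contains \<open>\<phi>'(Y\<^sub>s) \<surd>2 N\<close> and \<open>\<phi>''(Y\<^sub>s) N\<^sup>2\<close> for the Brownian increment \<open>N\<close>; the former has weighted mean zero, the latter may be replaced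
  by \<open>\<phi>''(Y\<^sub>s) (t - s)\<close>. Products of \<open>N\<close> with the drift are of order \<open>(t - s)\<^sup>3\<^sup>/\<^sup>2\<close>. The modulus of continuity of \<open>\<phi>''\<close> is given as
  \<open>e + k (x - y)\<^sup>2\<close>, with small \<open>e\<close>, because the second and fourth moments of \<open>N\<close> are known.
\<close>

lemma one_step:
  assumes st: "0 \<le> s" "s < t" "t - s \<le> 1"
    and G: "G \<in> borel_measurable (F s)" "\<And>w. \<bar>G w\<bar> \<le> 1"
    and \<phi>: "\<And>x. (\<phi> has_real_derivative \<phi>' x) (at x)" "\<And>x. (\<phi>' has_real_derivative \<phi>'' x) (at x)"
    and c: "continuous_on UNIV \<phi>''"
    and K: "\<And>x. \<bar>\<phi> x\<bar> \<le> K" "\<And>x. \<bar>\<phi>' x\<bar> \<le> K" "\<And>x. \<bar>\<phi>'' x\<bar> \<le> K"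
    and osc: "\<And>x y. \<bar>\<phi>'' x - \<phi>'' y\<bar> \<le> e + k * (x - y)\<^sup>2" and k: "0 \<le> k" "0 \<le> e"
  shows "\<bar>LINT w|M. G w * (\<phi> (Y t w) - \<phi> (Y s w) - (LINT u:{s..t}|lborel. rate \<phi>' \<phi>'' u w))\<bar> \<le>
    (t - s) * (e * (3 + C\<^sup>2) + sqrt (t - s) * (k * (52 + 2 * C\<^sup>2 + 4 * C ^ 4) + K * (3 * C + C\<^sup>2 / 2) + C * K * (3 + C\<^sup>2)))"
proof -
  define h where "h = t - s"
  define q where "q = sqrt h"
  have h: "0 < h" "h \<le> 1" and q: "0 < q" "q \<le> 1" "q\<^sup>2 = h" using st by (auto simp: h_def q_def)
  have hq: "h \<le> q" using q by (metis mult_left_le power2_eq_square less_imp_le)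
  have K0: "0 \<le> K" using K(1)[of 0] by linarith
  have st': "s \<le> t" using st by simp
  have t0: "0 \<le> t" using st by simp
  have GM: "G \<in> borel_measurable M" by (rule measurable_from_subalg[OF F_subalgebra G(1)])
  have c\<phi>: "continuous_on UNIV \<phi>" "continuous_on UNIV \<phi>'"
    by (intro continuous_at_imp_continuous_on ballI; rule DERIV_isCont, rule \<phi>)+
  have m\<phi>: "\<phi> \<in> borel_measurable borel" "\<phi>' \<in> borel_measurable borel" "\<phi>'' \<in> borel_measurable borel"
    by (rule borel_measurable_continuous_onI, rule c\<phi> c)+
  define N where "N w = W t w - W s w" for w
  have Nm: "N \<in> borel_measurable M" unfolding N_def[abs_def] using st by (intro borel_measurable_diff W_measurable) auto
  have N4: "integrable M (\<lambda>w. N w ^ 4)" "(LINT w|M. N w ^ 4) = 3 * h\<^sup>2"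
    using increment_integrable[OF st(1) st'] increment_moment4[OF st(1) st'] by (simp_all add: N_def h_def)
  have N2: "integrable M (\<lambda>w. (N w)\<^sup>2)" "(LINT w|M. (N w)\<^sup>2) = h"
    using increment_square_integrable[OF st(1) st'] increment_moment2[OF st(1) st'] by (simp_all add: N_def h_def)
  have N1: "integrable M N"
  proof (rule Bochner_Integration.integrable_bound[OF _ Nm])
    show "integrable M (\<lambda>w. 1 + (N w)\<^sup>2)" using N2 by simp
    have "\<bar>x\<bar> \<le> 1 + x\<^sup>2" for x :: real using zero_le_power2[of "\<bar>x\<bar> - 1"] by (simp add: power2_diff)
    then show "AE w in M. norm (N w) \<le> norm (1 + (N w)\<^sup>2)" by (intro AE_I2) (simp add: abs_of_nonneg)
  qed
  have Ysm: "Y s \<in> borel_measurable M" "Y t \<in> borel_measurable M" using st by (auto intro: Y_measurable)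
  define A1 where "A1 w = G w * \<phi>' (Y s w)" for w
  define A2 where "A2 w = G w * \<phi>'' (Y s w)" for w
  have Gb: "\<bar>G w * x\<bar> \<le> b" if "\<bar>x\<bar> \<le> b" for w x b
    using mult_mono[OF G(2)[of w] that] by (simp add: abs_mult)
  have AF: "A1 \<in> borel_measurable (F s)" "A2 \<in> borel_measurable (F s)"
    unfolding A1_def[abs_def] A2_def[abs_def]
    by (intro borel_measurable_times G measurable_compose[OF Y_adapted[OF st(1)]] m\<phi>)+
  have AM: "A1 \<in> borel_measurable M" "A2 \<in> borel_measurable M"
    using AF by (auto intro: measurable_from_subalg[OF F_subalgebra])
  have Ab: "\<bar>A1 w\<bar> \<le> K" "\<bar>A2 w\<bar> \<le> K" for w unfolding A1_def A2_def by (intro Gb K)+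
  have z1: "(LINT w|M. A1 w * N w) = 0" unfolding N_def by (rule increment_orthogonal[OF st(1) st' AF(1) Ab(1)])
  have z2: "(LINT w|M. A2 w * ((N w)\<^sup>2 - h)) = 0" unfolding N_def h_def by (rule increment_square_orthogonal[OF st(1) st' AF(2) Ab(2)])
  have ibd: "integrable M (\<lambda>w. A w * X w)" if A: "A \<in> borel_measurable M" "\<And>w. \<bar>A w\<bar> \<le> K" and X: "integrable M X" for A X :: "'a \<Rightarrow> real"
  proof (rule Bochner_Integration.integrable_bound)
    show "integrable M (\<lambda>w. K * X w)" using X by simp
    show "AE w in M. norm (A w * X w) \<le> norm (K * X w)"
      using A(2) K0 by (intro AE_I2) (simp add: abs_mult mult_right_mono)
  qed (use A X in auto)
  have i1: "integrable M (\<lambda>w. A1 w * N w)" by (rule ibd[OF AM(1) Ab(1) N1])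
  have i2: "integrable M (\<lambda>w. A2 w * ((N w)\<^sup>2 - h))"
    by (rule ibd[OF AM(2) Ab(2)]) (use N2 in simp)
  define D where "D w = drift_part s t w" for w
  have Dm: "D \<in> borel_measurable M" unfolding D_def[abs_def] by (rule drift_part_measurable[OF st(1)])
  have Db: "\<bar>D w\<bar> \<le> C * h" if "w \<in> space M" for w using drift_part_le[OF that st(1) st'] by (simp add: D_def h_def)
  \<comment> \<open>\<open>R1\<close> is the remainder of the expansion at time \<open>t\<close>, and \<open>V\<close> the variation of the time integrand over the step.\<close>
  define R1 where "R1 w = \<phi> (Y t w) - \<phi> (Y s w) - \<phi>' (Y s w) * (sqrt 2 * N w + D w) - \<phi>'' (Y s w) * (N w)\<^sup>2" for w
  define V where "V u w = B u (Y (max 0 u) w) * (\<phi>' (Y (max 0 u) w) - \<phi>' (Y s w)) + (\<phi>'' (Y (max 0 u) w) - \<phi>'' (Y s w))" for u w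
  have KV: "\<bar>V u w\<bar> \<le> C * (2 * K) + 2 * K" for u w
  proof -
    have "\<bar>\<phi>' (Y (max 0 u) w) - \<phi>' (Y s w)\<bar> \<le> 2 * K" "\<bar>\<phi>'' (Y (max 0 u) w) - \<phi>'' (Y s w)\<bar> \<le> 2 * K"
      using K(2)[of "Y (max 0 u) w"] K(2)[of "Y s w"] K(3)[of "Y (max 0 u) w"] K(3)[of "Y s w"] by linarith+
    then show ?thesis unfolding V_def using C_nonneg
      by (intro order_trans[OF abs_triangle_ineq] add_mono) (auto simp: abs_mult intro!: mult_mono drift_bounded)
  qed
  have Ysj: "(\<lambda>z. Y s (snd z)) \<in> borel_measurable (borel \<Otimes>\<^sub>M M)" by (rule measurable_compose[OF measurable_snd Ysm(1)])
  have Vj: "(\<lambda>z. V (fst z) (snd z)) \<in> borel_measurable (borel \<Otimes>\<^sub>M M)"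
    unfolding V_def
    by (intro borel_measurable_add borel_measurable_diff borel_measurable_times measurable_drift measurable_fst Y_joint
        measurable_compose[OF Y_joint] measurable_compose[OF Ysj] m\<phi>)
  have Vj': "(\<lambda>(u, w). \<bar>V u w\<bar>) \<in> borel_measurable (borel \<Otimes>\<^sub>M M)" "(\<lambda>(u, w). V u w) \<in> borel_measurable (borel \<Otimes>\<^sub>M M)"
    using Vj borel_measurable_abs[OF Vj] by (simp_all add: case_prod_unfold)
  have Vp: "(\<lambda>u. V u w) \<in> borel_measurable borel" if "w \<in> space M" for w
    using measurable_Pair1[OF Vj'(2) that] by simp
  have Ip: "(LINT u:{s..t}|lborel. rate \<phi>' \<phi>'' u w) = \<phi>' (Y s w) * D w + \<phi>'' (Y s w) * h + (LINT u:{s..t}|lborel. V u w)"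
    if w: "w \<in> space M" for w
  proof -
    have iV: "set_integrable lborel {s..t} (\<lambda>u. V u w)" by (rule set_integrable_bounded_interval[OF Vp[OF w] KV])
    have iB: "set_integrable lborel {s..t} (\<lambda>u. \<phi>' (Y s w) * B u (Y (max 0 u) w))"
      by (rule set_integrable_mult_right, rule set_integrable_bounded_interval[OF drift_path[OF w] drift_bounded])
    have ic: "set_integrable lborel {s..t} (\<lambda>u. \<phi>'' (Y s w))" by (rule set_integrable_bounded_interval[where K=K]) (simp_all add: K)
    have "(LINT u:{s..t}|lborel. rate \<phi>' \<phi>'' u w) = (LINT u:{s..t}|lborel. (\<phi>' (Y s w) * B u (Y (max 0 u) w) + \<phi>'' (Y s w)) + V u w)"
      by (intro set_lebesgue_integral_cong) (auto simp: rate_def V_def algebra_simps)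
    also have "\<dots> = (LINT u:{s..t}|lborel. \<phi>' (Y s w) * B u (Y (max 0 u) w)) + (LINT u:{s..t}|lborel. \<phi>'' (Y s w)) + (LINT u:{s..t}|lborel. V u w)"
      by (subst set_integral_add(2)[OF set_integral_add(1)[OF iB ic] iV], subst set_integral_add(2)[OF iB ic]) simp
    also have "(LINT u:{s..t}|lborel. \<phi>' (Y s w) * B u (Y (max 0 u) w)) = \<phi>' (Y s w) * D w"
      by (simp add: D_def drift_part_clip[OF st(1)])
    also have "(LINT u:{s..t}|lborel. \<phi>'' (Y s w)) = \<phi>'' (Y s w) * h"
      using st by (simp add: set_lebesgue_integral_def h_def)
    finally show ?thesis .
  qed
  have split: "G w * (\<phi> (Y t w) - \<phi> (Y s w) - (LINT u:{s..t}|lborel. rate \<phi>' \<phi>'' u w)) =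
      sqrt 2 * (A1 w * N w) + A2 w * ((N w)\<^sup>2 - h) + (G w * R1 w - G w * (LINT u:{s..t}|lborel. V u w))" if w: "w \<in> space M" for w
    unfolding Ip[OF w] R1_def A1_def A2_def by (simp add: algebra_simps)
  define P where "P x = e * (2 * x\<^sup>2 + C\<^sup>2 * h\<^sup>2) + k * (16 * x ^ 4 + 4 * C ^ 4 * h ^ 4) + K * (C * h * (q + 2 * x\<^sup>2 / q) + C\<^sup>2 * h\<^sup>2 / 2)" for x :: real
  have R1b: "\<bar>R1 w\<bar> \<le> P (N w)" if w: "w \<in> space M" for w
  proof -
    define d where "d = Y t w - Y s w"
    have d: "d = sqrt 2 * N w + D w" using Y_increment[OF w st(1) st'] by (simp add: d_def N_def D_def)
    have d2: "d\<^sup>2 \<le> 4 * (N w)\<^sup>2 + 2 * C\<^sup>2 * h\<^sup>2" using Y_increment_square[OF w st(1) st'] by (simp add: d_def N_def h_def)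
    have D2: "(D w)\<^sup>2 \<le> C\<^sup>2 * h\<^sup>2"
      using abs_le_square_iff[of "D w" "C * h"] Db[OF w] C_nonneg h by (simp add: power_mult_distrib)
    have d4: "(d\<^sup>2)\<^sup>2 \<le> 2 * (16 * N w ^ 4 + 4 * C ^ 4 * h ^ 4)"
    proof -
      have "(d\<^sup>2)\<^sup>2 \<le> (4 * (N w)\<^sup>2 + 2 * C\<^sup>2 * h\<^sup>2)\<^sup>2" by (rule power_mono[OF d2]) simp
      also have "\<dots> \<le> 2 * (4 * (N w)\<^sup>2)\<^sup>2 + 2 * (2 * C\<^sup>2 * h\<^sup>2)\<^sup>2"
        using zero_le_power2[of "4 * (N w)\<^sup>2 - 2 * C\<^sup>2 * h\<^sup>2"] by (simp add: power2_sum power2_diff)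
      also have "\<dots> = 2 * (16 * N w ^ 4 + 4 * C ^ 4 * h ^ 4)" by (simp add: power_mult_distrib power_mult[symmetric])
      finally show ?thesis .
    qed
    have T: "\<bar>\<phi> (Y t w) - \<phi> (Y s w) - \<phi>' (Y s w) * d - \<phi>'' (Y s w) * d\<^sup>2 / 2\<bar> \<le> (e + k * d\<^sup>2) * d\<^sup>2 / 2"
      unfolding d_def by (rule second_order_Taylor[OF \<phi> osc k])
    have sq: "d\<^sup>2 = 2 * (N w)\<^sup>2 + (2 * sqrt 2 * N w * D w + (D w)\<^sup>2)" unfolding d by (simp add: power2_sum power_mult_distrib)
    \<comment> \<open>The inequality of arithmetic and geometric means bounds \<open>sqrt 2 |N|\<close> by a quantity with expectation \<open>3 q\<close>.\<close>
    have x1: "\<bar>sqrt 2 * N w * D w\<bar> \<le> C * h * (q + 2 * (N w)\<^sup>2 / q)"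
    proof -
      have "\<bar>sqrt 2 * N w\<bar> \<le> q + 2 * (N w)\<^sup>2 / q"
      proof -
        have "0 \<le> (\<bar>sqrt 2 * N w\<bar> - q)\<^sup>2" by simp
        then have "2 * (\<bar>sqrt 2 * N w\<bar> * q) \<le> 2 * (N w)\<^sup>2 + q\<^sup>2" by (simp add: power2_diff power_mult_distrib)
        moreover have "0 \<le> \<bar>sqrt 2 * N w\<bar> * q" using q by simp
        ultimately have "\<bar>sqrt 2 * N w\<bar> * q \<le> 2 * (N w)\<^sup>2 + q\<^sup>2" by linarith
        then have "\<bar>sqrt 2 * N w\<bar> \<le> (2 * (N w)\<^sup>2 + q\<^sup>2) / q" using q by (simp only: pos_le_divide_eq)
        also have "\<dots> = q + 2 * (N w)\<^sup>2 / q" using q(1) by (simp add: add_divide_distrib power2_eq_square)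
        finally show ?thesis .
      qed
      from mult_mono[OF this Db[OF w]] show ?thesis using q by (simp add: abs_mult mult_ac)
    qed
    have "R1 w = (\<phi> (Y t w) - \<phi> (Y s w) - \<phi>' (Y s w) * d - \<phi>'' (Y s w) * d\<^sup>2 / 2) + \<phi>'' (Y s w) * (sqrt 2 * N w * D w + (D w)\<^sup>2 / 2)"
      unfolding R1_def d[symmetric] sq by (simp add: algebra_simps)
    then have "\<bar>R1 w\<bar> \<le> (e + k * d\<^sup>2) * d\<^sup>2 / 2 + \<bar>\<phi>'' (Y s w) * (sqrt 2 * N w * D w + (D w)\<^sup>2 / 2)\<bar>"
      using T by linarith
    also have "\<bar>\<phi>'' (Y s w) * (sqrt 2 * N w * D w + (D w)\<^sup>2 / 2)\<bar> \<le> K * (C * h * (q + 2 * (N w)\<^sup>2 / q) + C\<^sup>2 * h\<^sup>2 / 2)"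
      unfolding abs_mult[of "\<phi>'' (Y s w)"] using K0 D2 x1 by (intro mult_mono K order_trans[OF abs_triangle_ineq] add_mono) auto
    also have "(e + k * d\<^sup>2) * d\<^sup>2 / 2 = e * (d\<^sup>2 / 2) + k * ((d\<^sup>2)\<^sup>2 / 2)" by (simp add: field_simps power2_eq_square)
    also have "e * (d\<^sup>2 / 2) \<le> e * (2 * (N w)\<^sup>2 + C\<^sup>2 * h\<^sup>2)" using d2 k by (intro mult_left_mono) auto
    also have "k * ((d\<^sup>2)\<^sup>2 / 2) \<le> k * (16 * N w ^ 4 + 4 * C ^ 4 * h ^ 4)" using d4 k by (intro mult_left_mono) auto
    finally show ?thesis unfolding P_def by simp
  qed
  have iP: "integrable M (\<lambda>w. P (N w))"
    unfolding P_def using N2 N4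
    by (intro Bochner_Integration.integrable_add integrable_mult_right Bochner_Integration.integrable_divide) auto
  have EP: "(LINT w|M. P (N w)) = e * (2 * h + C\<^sup>2 * h\<^sup>2) + k * (48 * h\<^sup>2 + 4 * C ^ 4 * h ^ 4) + K * (C * h * (q + 2 * h / q) + C\<^sup>2 * h\<^sup>2 / 2)"
    unfolding P_def using N2 N4 by (simp add: prob_space)
  have R1m: "R1 \<in> borel_measurable M"
    unfolding R1_def[abs_def]
    by (intro borel_measurable_diff borel_measurable_add borel_measurable_times borel_measurable_power Nm Dm borel_measurable_const
        measurable_compose[OF Ysm(1)] measurable_compose[OF Ysm(2)] m\<phi>)
  have iR1: "integrable M (\<lambda>w. G w * R1 w)"
  proof (rule Bochner_Integration.integrable_bound[OF iP borel_measurable_times[OF GM R1m]])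
    show "AE w in M. norm (G w * R1 w) \<le> norm (P (N w))"
    proof (rule AE_I2)
      fix w assume "w \<in> space M"
      from order_trans[OF Gb[OF R1b[OF this]] abs_ge_self] show "norm (G w * R1 w) \<le> norm (P (N w))" by simp
    qed
  qed
  have ER1: "\<bar>LINT w|M. G w * R1 w\<bar> \<le> (LINT w|M. P (N w))"
  proof -
    have "\<bar>LINT w|M. G w * R1 w\<bar> \<le> (LINT w|M. \<bar>G w * R1 w\<bar>)" using integral_norm_bound[of M "\<lambda>w. G w * R1 w"] by simp
    also have "\<dots> \<le> (LINT w|M. P (N w))" by (rule integral_mono[OF integrable_abs[OF iR1] iP]) (intro Gb R1b)
    finally show ?thesis .
  qed
  have Vm: "(\<lambda>w. LINT u:{s..t}|lborel. V u w) \<in> borel_measurable M" by (rule measurable_time_integral[OF Vj'(2)])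
  have Vb: "\<bar>LINT u:{s..t}|lborel. V u w\<bar> \<le> (LINT u:{s..t}|lborel. \<bar>V u w\<bar>)" if "w \<in> space M" for w
    using set_integral_norm_bound[OF set_integrable_bounded_interval[OF Vp[OF that] KV, of s t]] by simp
  have Vb': "\<bar>LINT u:{s..t}|lborel. V u w\<bar> \<le> (C * (2 * K) + 2 * K) * (t - s)" if "w \<in> space M" for w
    by (rule set_integral_interval_le[OF Vp[OF that] KV st'])
  have iV: "integrable M (\<lambda>w. G w * (LINT u:{s..t}|lborel. V u w))"
    by (rule integrable_bounded[OF borel_measurable_times[OF GM Vm] Gb[OF Vb']])
  have EVu: "(LINT w|M. \<bar>V u w\<bar>) \<le> e + q * (k * (4 + 2 * C\<^sup>2) + C * K * (3 + C\<^sup>2))" if u: "s \<le> u" "u \<le> t" for u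
  proof -
    have mu: "max 0 u = u" using u st by simp
    define y where "y w = (Y u w - Y s w)\<^sup>2" for w
    have us: "u - s \<le> h" "0 \<le> u - s" "u - s \<le> 1" using u h by (auto simp: h_def)
    have y: "integrable M y" "(LINT w|M. y w) \<le> (4 + 2 * C\<^sup>2) * h"
      using Y_increment_square_expectation[OF st(1) u(1) us(3)] mult_left_mono[OF us(1), of "4 + 2 * C\<^sup>2"]
      by (auto simp: y_def[abs_def] add_nonneg_nonneg intro: order_trans)
    have pw: "\<bar>V u w\<bar> \<le> e + k * y w + C * K * ((q + y w / q) / 2)" for w
    proof -
      have 1: "\<bar>\<phi>'' (Y u w) - \<phi>'' (Y s w)\<bar> \<le> e + k * y w" using osc unfolding y_def .
      have lip: "\<bar>\<phi>' a - \<phi>' b\<bar> \<le> K * \<bar>a - b\<bar>" for a b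
        using field_differentiable_bound[of UNIV \<phi>' \<phi>'' K a b] \<phi>(2) K(3) by (auto simp: has_field_derivative_at_within)
      have "\<bar>Y u w - Y s w\<bar> \<le> (q + y w / q) / 2"
      proof -
        have "0 \<le> (\<bar>Y u w - Y s w\<bar> - q)\<^sup>2" by simp
        then have "2 * \<bar>Y u w - Y s w\<bar> * q \<le> y w + q\<^sup>2" by (simp add: power2_diff y_def mult_ac)
        then have "2 * \<bar>Y u w - Y s w\<bar> \<le> (y w + q\<^sup>2) / q" using q by (simp only: pos_le_divide_eq)
        also have "\<dots> = q + y w / q" using q(1) by (simp add: add_divide_distrib power2_eq_square)
        finally show ?thesis by simp
      qed
      then have 2: "\<bar>\<phi>' (Y u w) - \<phi>' (Y s w)\<bar> \<le> K * ((q + y w / q) / 2)"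
        using order_trans[OF lip mult_left_mono[OF _ K0]] by blast
      have "\<bar>B u (Y u w) * (\<phi>' (Y u w) - \<phi>' (Y s w))\<bar> \<le> C * (K * ((q + y w / q) / 2))"
        unfolding abs_mult by (intro mult_mono drift_bounded 2 C_nonneg) simp
      then show ?thesis unfolding V_def mu using 1 by linarith
    qed
    have Vum: "(\<lambda>w. \<bar>V u w\<bar>) \<in> borel_measurable M" using measurable_Pair2[OF Vj'(1), of u] by simp
    have iy: "integrable M (\<lambda>w. e + k * y w + C * K * ((q + y w / q) / 2))" using y(1) by simp
    have "(LINT w|M. \<bar>V u w\<bar>) \<le> (LINT w|M. e + k * y w + C * K * ((q + y w / q) / 2))"
      by (rule integral_mono[OF _ iy pw]) (rule integrable_bounded[OF Vum, where K="C * (2 * K) + 2 * K"], use KV in simp)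
    also have "\<dots> = e + k * (LINT w|M. y w) + C * K * ((q + (LINT w|M. y w) / q) / 2)"
      using y(1) by (simp add: prob_space)
    also have "\<dots> \<le> e + k * ((4 + 2 * C\<^sup>2) * q) + C * K * ((q + (4 + 2 * C\<^sup>2) * q) / 2)"
    proof (intro add_mono mult_left_mono divide_right_mono order_refl)
      show "(LINT w|M. y w) \<le> (4 + 2 * C\<^sup>2) * q" using y(2) mult_left_mono[OF hq, of "4 + 2 * C\<^sup>2"] by (auto intro: order_trans)
      have "(LINT w|M. y w) / q \<le> (4 + 2 * C\<^sup>2) * h / q" using y(2) q by (intro divide_right_mono) auto
      also have "\<dots> = (4 + 2 * C\<^sup>2) * q" using q by (simp add: q(3)[symmetric] power2_eq_square)
      finally show "(LINT w|M. y w) / q \<le> (4 + 2 * C\<^sup>2) * q" .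
    qed (use k K0 C_nonneg in auto)
    also have "\<dots> \<le> e + q * (k * (4 + 2 * C\<^sup>2) + C * K * (3 + C\<^sup>2))"
    proof -
      have "C * K * ((q + (4 + 2 * C\<^sup>2) * q) / 2) \<le> C * K * ((3 + C\<^sup>2) * q)"
        using C_nonneg K0 q by (intro mult_left_mono) (auto simp: algebra_simps)
      then show ?thesis by (simp add: algebra_simps)
    qed
    finally show ?thesis .
  qed
  have EV: "\<bar>LINT w|M. G w * (LINT u:{s..t}|lborel. V u w)\<bar> \<le> (e + q * (k * (4 + 2 * C\<^sup>2) + C * K * (3 + C\<^sup>2))) * h"
  proof -
    have KV': "\<bar>\<bar>V u w\<bar>\<bar> \<le> C * (2 * K) + 2 * K" for u w using KV by simp
    have absm: "(\<lambda>w. LINT u:{s..t}|lborel. \<bar>V u w\<bar>) \<in> borel_measurable M" by (rule measurable_time_integral[OF Vj'(1)])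
    have absb: "\<bar>LINT u:{s..t}|lborel. \<bar>V u w\<bar>\<bar> \<le> (C * (2 * K) + 2 * K) * (t - s)" if "w \<in> space M" for w
      by (rule set_integral_interval_le[OF borel_measurable_abs[OF Vp[OF that]] KV' st'])
    have iabsV: "integrable M (\<lambda>w. LINT u:{s..t}|lborel. \<bar>V u w\<bar>)" by (rule integrable_bounded[OF absm absb])
    have "\<bar>LINT w|M. G w * (LINT u:{s..t}|lborel. V u w)\<bar> \<le> (LINT w|M. \<bar>G w * (LINT u:{s..t}|lborel. V u w)\<bar>)"
      using integral_norm_bound[of M "\<lambda>w. G w * (LINT u:{s..t}|lborel. V u w)"] by simp
    also have "\<dots> \<le> (LINT w|M. (LINT u:{s..t}|lborel. \<bar>V u w\<bar>))"
      by (rule integral_mono[OF integrable_abs[OF iV] iabsV]) (intro Gb Vb)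
    also have "\<dots> = (LINT u:{s..t}|lborel. (LINT w|M. \<bar>V u w\<bar>))"
      by (rule time_integral_Fubini[OF Vj'(1) KV'])
    also have "\<dots> \<le> (LINT u:{s..t}|lborel. e + q * (k * (4 + 2 * C\<^sup>2) + C * K * (3 + C\<^sup>2)))"
    proof (rule set_integral_mono)
      show "set_integrable lborel {s..t} (\<lambda>u. LINT w|M. \<bar>V u w\<bar>)"
        by (rule set_integrable_bounded_interval[OF expectation_measurable[OF Vj'(1) KV'] abs_expectation_le[OF KV']])
      show "set_integrable lborel {s..t} (\<lambda>u. e + q * (k * (4 + 2 * C\<^sup>2) + C * K * (3 + C\<^sup>2)))"
        by (rule set_integrable_bounded_interval[where K="\<bar>e + q * (k * (4 + 2 * C\<^sup>2) + C * K * (3 + C\<^sup>2))\<bar>"]) auto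
    qed (use EVu in auto)
    also have "\<dots> = (e + q * (k * (4 + 2 * C\<^sup>2) + C * K * (3 + C\<^sup>2))) * h"
      using st by (simp add: set_lebesgue_integral_def h_def mult.commute)
    finally show ?thesis .
  qed
  have "(LINT w|M. G w * (\<phi> (Y t w) - \<phi> (Y s w) - (LINT u:{s..t}|lborel. rate \<phi>' \<phi>'' u w))) =
      (LINT w|M. sqrt 2 * (A1 w * N w) + A2 w * ((N w)\<^sup>2 - h) + (G w * R1 w - G w * (LINT u:{s..t}|lborel. V u w)))"
    by (rule Bochner_Integration.integral_cong[OF refl split])
  also have "\<dots> = sqrt 2 * (LINT w|M. A1 w * N w) + (LINT w|M. A2 w * ((N w)\<^sup>2 - h)) +
      ((LINT w|M. G w * R1 w) - (LINT w|M. G w * (LINT u:{s..t}|lborel. V u w)))"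
    by (subst Bochner_Integration.integral_add[OF Bochner_Integration.integrable_add[OF integrable_mult_right[OF i1] i2] Bochner_Integration.integrable_diff[OF iR1 iV]],
        subst Bochner_Integration.integral_add[OF integrable_mult_right[OF i1] i2], subst Bochner_Integration.integral_diff[OF iR1 iV], subst integral_mult_right_zero) (rule refl)
  finally have "\<bar>LINT w|M. G w * (\<phi> (Y t w) - \<phi> (Y s w) - (LINT u:{s..t}|lborel. rate \<phi>' \<phi>'' u w))\<bar> \<le>
      (LINT w|M. P (N w)) + (e + q * (k * (4 + 2 * C\<^sup>2) + C * K * (3 + C\<^sup>2))) * h"
    unfolding z1 z2 using ER1 EV by linarith
  also have "(LINT w|M. P (N w)) \<le> h * (e * (2 + C\<^sup>2) + q * (k * (48 + 4 * C ^ 4) + K * (3 * C + C\<^sup>2 / 2)))"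
  proof -
    have h2: "h\<^sup>2 \<le> h * q" "h\<^sup>2 \<le> h" using hq h by (auto simp: power2_eq_square mult_left_le)
    have h4: "h ^ 4 \<le> h * q"
    proof -
      have "h ^ 4 = h\<^sup>2 * h\<^sup>2" by (simp add: power_add[symmetric])
      also have "\<dots> \<le> h * q * 1" using h h2 q by (intro mult_mono) (auto simp: power_le_one)
      finally show ?thesis by simp
    qed
    have hqq: "2 * h / q = 2 * q" using q by (simp add: q(3)[symmetric] power2_eq_square)
    have "e * (2 * h + C\<^sup>2 * h\<^sup>2) \<le> e * (2 * h + C\<^sup>2 * h)" using k h2 by (intro mult_left_mono add_left_mono) auto
    moreover have "k * (48 * h\<^sup>2 + 4 * C ^ 4 * h ^ 4) \<le> k * (48 * (h * q) + 4 * C ^ 4 * (h * q))"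
      using k h2 h4 by (intro mult_left_mono add_mono) auto
    moreover have "K * (C * h * (q + 2 * h / q) + C\<^sup>2 * h\<^sup>2 / 2) \<le> K * (C * h * (3 * q) + C\<^sup>2 * (h * q) / 2)"
    proof -
      have "C * h * (q + 2 * q) \<le> C * h * (3 * q)" by simp
      then show ?thesis unfolding hqq using K0 h2 h C_nonneg by (intro mult_left_mono add_mono divide_right_mono) auto
    qed
    ultimately have "(LINT w|M. P (N w)) \<le> e * (2 * h + C\<^sup>2 * h) + k * (48 * (h * q) + 4 * C ^ 4 * (h * q)) + K * (C * h * (3 * q) + C\<^sup>2 * (h * q) / 2)"
      unfolding EP by linarith
    also have "\<dots> = h * (e * (2 + C\<^sup>2) + q * (k * (48 + 4 * C ^ 4) + K * (3 * C + C\<^sup>2 / 2)))" by (simp add: algebra_simps)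
    finally show ?thesis .
  qed
  finally have fin: "\<bar>LINT w|M. G w * (\<phi> (Y t w) - \<phi> (Y s w) - (LINT u:{s..t}|lborel. rate \<phi>' \<phi>'' u w))\<bar> \<le>
     h * (e * (3 + C\<^sup>2) + q * (k * (52 + 2 * C\<^sup>2 + 4 * C ^ 4) + K * (3 * C + C\<^sup>2 / 2) + C * K * (3 + C\<^sup>2)))"
    by (simp add: algebra_simps)
  show ?thesis using fin by (simp add: h_def q_def)
qed

end

section \<open>Ito's formula for the absorbed diffusion\<close>

text \<open>
  Uniform continuity in a form that is linear in the squared distance: where the distance is not small, the quadratic term
  is at least twice the supremum.
\<close>

lemma C2_oscillation:
  assumes \<phi>: "C2_compact_support \<phi>" and e: "0 < e"
  obtains k where "0 \<le> k" "\<And>x y. \<bar>deriv (deriv \<phi>) x - deriv (deriv \<phi>) y\<bar> \<le> e + k * (x - y)\<^sup>2"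
proof -
  define f where "f = deriv (deriv \<phi>)"
  obtain K where "\<And>x. \<bar>\<phi> x\<bar> \<le> K" "\<And>x. \<bar>deriv \<phi> x\<bar> \<le> K" and K': "\<And>x. \<bar>deriv (deriv \<phi>) x\<bar> \<le> K"
    using C2_bounded[OF \<phi>] by blast
  then have K: "\<And>x. \<bar>f x\<bar> \<le> K" by (simp add: f_def)
  have K0: "0 \<le> K" using K[of 0] by linarith
  have c: "continuous_on UNIV f" using \<phi> by (simp add: C2_compact_support_def f_def)
  obtain R where "\<And>x. R < \<bar>x\<bar> \<Longrightarrow> \<phi> x = 0" "\<And>x. R < \<bar>x\<bar> \<Longrightarrow> deriv \<phi> x = 0" and R': "\<And>x. R < \<bar>x\<bar> \<Longrightarrow> deriv (deriv \<phi>) x = 0"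
    using C2_support[OF \<phi>] by blast
  then have R: "\<And>x. R < \<bar>x\<bar> \<Longrightarrow> f x = 0" by (simp add: f_def)
  have "uniformly_continuous_on (cball 0 (R + 1)) f"
    by (rule compact_uniformly_continuous[OF continuous_on_subset[OF c]]) auto
  then obtain d where d: "0 < d" "\<And>x y. x \<in> cball 0 (R + 1) \<Longrightarrow> y \<in> cball 0 (R + 1) \<Longrightarrow> dist y x < d \<Longrightarrow> dist (f y) (f x) < e"
    using e unfolding uniformly_continuous_on_def by meson
  define q where "q = min d 1"
  have q: "0 < q" "q \<le> 1" "q \<le> d" using d by (auto simp: q_def)
  have "\<bar>f x - f y\<bar> \<le> e + 2 * K / q\<^sup>2 * (x - y)\<^sup>2" for x y
  proof (cases "\<bar>x - y\<bar> < q")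
    case True
    have "\<bar>f x - f y\<bar> \<le> e"
    proof (cases "\<bar>x\<bar> \<le> R \<or> \<bar>y\<bar> \<le> R")
      case True
      then have "\<bar>x\<bar> \<le> R + 1" "\<bar>y\<bar> \<le> R + 1" "\<bar>x - y\<bar> < d" using \<open>\<bar>x - y\<bar> < q\<close> q by linarith+
      then show ?thesis using d(2)[of y x] by (simp add: dist_real_def)
    qed (use R e in auto)
    then show ?thesis using K0 by (auto intro: add_increasing2)
  next
    case False
    then have "q\<^sup>2 \<le> (x - y)\<^sup>2" using q by (intro abs_le_square_iff[THEN iffD1]) auto
    then have "2 * K * 1 \<le> 2 * K * ((x - y)\<^sup>2 / q\<^sup>2)" using q K0 by (intro mult_left_mono) (auto simp: pos_le_divide_eq)
    moreover have "\<bar>f x - f y\<bar> \<le> 2 * K" using K[of x] K[of y] by linarith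
    ultimately show ?thesis using e by simp
  qed
  then show thesis using that[of "2 * K / q\<^sup>2"] K0 by (simp add: f_def)
qed

context absorbed_diffusion
begin

definition alive :: "real \<Rightarrow> 'a \<Rightarrow> bool" where
  "alive r w \<longleftrightarrow> (\<forall>u\<in>{0..r}. 0 < Y u w)"

definition X :: "real \<Rightarrow> 'a \<Rightarrow> real" where
  "X t w = absorb (\<lambda>u. Y u w) t"

lemma X_alive: "X t w = (if alive t w then Y t w else 0)"
  by (simp add: X_def absorb_def alive_def)

lemma alive_antimono: "alive t w \<Longrightarrow> s \<le> t \<Longrightarrow> alive s w"
  by (auto simp: alive_def)

lemma alive_pos: "alive t w \<Longrightarrow> 0 \<le> t \<Longrightarrow> 0 < Y t w"
  by (auto simp: alive_def)

lemma X_nonneg: "0 \<le> t \<Longrightarrow> 0 \<le> X t w"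
  by (simp add: X_def absorb_nonneg)

lemma continuous_X: "w \<in> space M \<Longrightarrow> continuous_on {0..} (\<lambda>t. X t w)"
  unfolding X_def using continuous_absorb[OF continuous_Y] by simp

lemma X_0: "w \<in> space M \<Longrightarrow> X 0 w = max 0 (Z w)"
  using Y_0 by (auto simp: X_alive alive_def)

text \<open>
  By compactness a positive path stays away from zero, and by continuity this can be tested at rational fractions of the time. The
  right-hand side is a countable combination of events, which makes \<open>alive r\<close> an event of \<open>F r\<close>.
\<close>

lemma alive_iff_rational:
  assumes w: "w \<in> space M" and r: "0 \<le> r"
  shows "alive r w \<longleftrightarrow> (\<exists>m::nat. \<forall>q\<in>\<rat> \<inter> {0..1}. inverse (real (Suc m)) \<le> Y (r * q) w)"
proof
  assume a: "alive r w"
  have "continuous_on {0..r} (\<lambda>u. Y u w)" by (rule continuous_on_subset[OF continuous_Y[OF w]]) auto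
  from continuous_attains_inf[OF compact_Icc _ this] r obtain v where v: "v \<in> {0..r}" "\<And>u. u \<in> {0..r} \<Longrightarrow> Y v w \<le> Y u w" by auto
  have "0 < Y v w" using a v by (simp add: alive_def)
  then obtain m where m: "inverse (real (Suc m)) < Y v w" using reals_Archimedean by blast
  have "inverse (real (Suc m)) \<le> Y (r * q) w" if "q \<in> \<rat> \<inter> {0..1}" for q
    using v(2)[of "r * q"] m that r by (auto simp: mult_left_le)
  then show "\<exists>m::nat. \<forall>q\<in>\<rat> \<inter> {0..1}. inverse (real (Suc m)) \<le> Y (r * q) w" by blast
next
  assume "\<exists>m::nat. \<forall>q\<in>\<rat> \<inter> {0..1}. inverse (real (Suc m)) \<le> Y (r * q) w"
  then obtain m :: nat where "\<forall>q\<in>\<rat> \<inter> {0..1}. inverse (real (Suc m)) \<le> Y (r * q) w" ..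
  then have m: "\<And>q. q \<in> \<rat> \<Longrightarrow> 0 \<le> q \<Longrightarrow> q \<le> 1 \<Longrightarrow> inverse (real (Suc m)) \<le> Y (r * q) w" by simp
  define a where "a = inverse (real (Suc m))"
  have a: "0 < a" by (simp add: a_def)
  have c: "continuous_on {0..1} (\<lambda>v. Y (r * v) w)"
    by (rule continuous_on_compose2[OF continuous_Y[OF w]]) (use r in \<open>auto intro!: continuous_intros\<close>)
  have pos: "a \<le> Y (r * v) w" if v: "0 \<le> v" "v \<le> 1" for v
  proof (rule ccontr)
    assume "\<not> a \<le> Y (r * v) w"
    then have "0 < a - Y (r * v) w" by simp
    moreover have "v \<in> {0..1}" using v by simp
    ultimately obtain d where d: "0 < d" "\<And>u. u \<in> {0..1} \<Longrightarrow> dist u v < d \<Longrightarrow> dist (Y (r * u) w) (Y (r * v) w) < a - Y (r * v) w"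
      using c unfolding continuous_on_iff by meson
    have "\<exists>q\<in>\<rat>. 0 \<le> q \<and> q \<le> 1 \<and> dist q v < d"
    proof (cases "v = 1")
      case False
      obtain q where "q \<in> \<rat>" "v < q" "q < min 1 (v + d)"
        using Rats_dense_in_real[of v "min 1 (v + d)"] False v d by auto
      then show ?thesis using v by (intro bexI[of _ q]) (auto simp: dist_real_def)
    qed (use d in \<open>auto intro!: bexI[of _ 1]\<close>)
    then obtain q where q: "q \<in> \<rat>" "0 \<le> q" "q \<le> 1" "dist q v < d" by blast
    have "dist (Y (r * q) w) (Y (r * v) w) < a - Y (r * v) w" using d(2)[of q] q by simp
    then have "Y (r * q) w < a" by (simp add: dist_real_def)
    then show False using m[OF q(1-3)] by (simp add: a_def)
  qed
  show "alive r w"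
    unfolding alive_def
  proof
    fix u assume u: "u \<in> {0..r}"
    show "0 < Y u w"
    proof (cases "r = 0")
      case True
      then show ?thesis using pos[of 0] a u by simp
    next
      case False
      then have "a \<le> Y (r * (u / r)) w" using u r by (intro pos) auto
      then show ?thesis using False a by simp
    qed
  qed
qed

lemma alive_adapted:
  assumes r: "0 \<le> r"
  shows "{w \<in> space (F r). alive r w} \<in> sets (F r)"
proof -
  have rat: "(\<forall>q\<in>\<rat> \<inter> {0..1}. P q) \<longleftrightarrow> (\<forall>q\<in>{0..1}. P (real_of_rat q))" for P
    by (auto simp: Rats_def)
  have "Measurable.pred (F r) (\<lambda>w. \<exists>m::nat. \<forall>q\<in>\<rat> \<inter> {0..1}. inverse (real (Suc m)) \<le> Y (r * q) w)"
    unfolding rat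
  proof (intro pred_intros_countable(2) pred_intros_countable_bounded(3))
    fix m :: nat and p :: rat assume p: "p \<in> {0..1}"
    define q where "q = real_of_rat p"
    have q: "0 \<le> q" "q \<le> 1" using p by (auto simp: q_def)
    have [measurable]: "Y (r * q) \<in> borel_measurable (F r)"
      by (rule measurable_from_subalg[OF F_mono Y_adapted]) (use q r in \<open>auto simp: mult_left_le\<close>)
    have "Measurable.pred (F r) (\<lambda>w. inverse (real (Suc m)) \<le> Y (r * q) w)" by measurable
    then show "Measurable.pred (F r) (\<lambda>w. inverse (real (Suc m)) \<le> Y (r * real_of_rat p) w)" by (simp add: q_def)
  qed
  then have "{w \<in> space (F r). \<exists>m::nat. \<forall>q\<in>\<rat> \<inter> {0..1}. inverse (real (Suc m)) \<le> Y (r * q) w} \<in> sets (F r)"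
    by (simp add: pred_def)
  also have "{w \<in> space (F r). \<exists>m::nat. \<forall>q\<in>\<rat> \<inter> {0..1}. inverse (real (Suc m)) \<le> Y (r * q) w} = {w \<in> space (F r). alive r w}"
    using alive_iff_rational[OF _ r] by (auto simp: space_F)
  finally show ?thesis .
qed

lemma X_adapted: "0 \<le> t \<Longrightarrow> X t \<in> borel_measurable (F t)"
  unfolding X_alive[abs_def] by (rule measurable_If[OF Y_adapted _ alive_adapted]) auto

lemma X_measurable: "0 \<le> t \<Longrightarrow> X t \<in> borel_measurable M"
  by (rule measurable_from_subalg[OF F_subalgebra X_adapted])

text \<open>
  The time of absorption, or \<open>t\<close> if the path is still alive then. Whether the path is alive at \<open>\<sigma>\<close> itself depends on the case, and
  \<open>Y\<close> at \<open>\<sigma>\<close> equals \<open>X\<close> at \<open>t\<close> in both.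
\<close>

lemma absorption_time:
  assumes w: "w \<in> space M" and st: "0 \<le> s" "s \<le> t" and a: "alive s w"
  obtains \<sigma> where "s \<le> \<sigma>" "\<sigma> \<le> t" "\<And>u. u < \<sigma> \<Longrightarrow> alive u w" "\<And>u. \<sigma> < u \<Longrightarrow> u \<le> t \<Longrightarrow> \<not> alive u w" "X t w = Y \<sigma> w"
proof (cases "alive t w")
  case True
  then show ?thesis using that[of t] st alive_antimono[OF True] by (auto simp: X_alive)
next
  case False
  then obtain v where v: "0 \<le> v" "v \<le> t" "Y v w \<le> 0" by (force simp: alive_def)
  have "0 < Y 0 w" using a st by (simp add: alive_def)
  from first_zero[OF continuous_Y[OF w] this v(1,3)] obtain \<tau>
    where \<tau>: "0 < \<tau>" "\<tau> \<le> v" "Y \<tau> w = 0" "\<And>u. 0 \<le> u \<Longrightarrow> u < \<tau> \<Longrightarrow> 0 < Y u w" by blast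
  have n: "\<not> alive u w" if "\<tau> \<le> u" for u
  proof
    assume "alive u w"
    then have "0 < Y \<tau> w" using \<tau>(1) that by (simp add: alive_def)
    then show False using \<tau>(3) by simp
  qed
  show ?thesis
  proof (rule that[of \<tau>])
    show "s \<le> \<tau>" using a n[of s] by (cases "s \<le> \<tau>") auto
    show "X t w = Y \<tau> w" using \<tau>(3) False by (simp add: X_alive)
    show "alive u w" if "u < \<tau>" for u using \<tau>(4) that by (auto simp: alive_def)
  qed (use \<tau> v n in auto)
qed


text \<open>
  Each step of a grid on \<open>[s,t]\<close> carries the weight \<open>G\<close> times the indicator that the path is alive at the beginning of the step. This weight
  belongs to the past, so \<open>one_step\<close> bounds the expectation of the whole sum by \<open>(t - s) (3 + C\<^sup>2) e\<close> plus a term that vanishes with the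
  mesh. Path by path, the sum telescopes up to the first grid point after absorption and thus converges to the increment of
  \<open>m\<^sub>u = \<phi>(Y\<^sub>u) - \<integral>\<^sub>0\<^sup>u (\<phi>' B + \<phi>'')(Y) dv\<close> up to the absorption time. After that time \<open>X = 0\<close> and \<open>\<iota>(X) = 0\<close>, so this is the expression for \<open>X\<close>.
\<close>

lemma Ito_formula:
  assumes st: "0 \<le> s" "s \<le> t"
    and G: "G \<in> borel_measurable (F s)" "\<And>w. \<bar>G w\<bar> \<le> 1"
    and \<phi>: "C2_compact_support \<phi>"
  shows "(LINT w|M. G w * (\<phi> (X t w) - \<phi> (X s w) -
    (LINT u:{s..t}|lborel. iota (X u w) * (deriv \<phi> (X u w) * B u (X u w) + deriv (deriv \<phi>) (X u w))))) = 0"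
proof -
  define \<phi>' \<phi>'' where "\<phi>' = deriv \<phi>" and "\<phi>'' = deriv (deriv \<phi>)"
  have d: "\<And>x. (\<phi> has_real_derivative \<phi>' x) (at x)" "\<And>x. (\<phi>' has_real_derivative \<phi>'' x) (at x)" and c: "continuous_on UNIV \<phi>''"
    using \<phi> by (auto simp: C2_compact_support_def DERIV_deriv_iff_real_differentiable \<phi>'_def \<phi>''_def)
  have m\<phi>: "\<phi> \<in> borel_measurable borel" "\<phi>' \<in> borel_measurable borel" "\<phi>'' \<in> borel_measurable borel"
    unfolding \<phi>'_def \<phi>''_def by (rule C2_measurable[OF \<phi>])+
  obtain K where "\<And>x. \<bar>\<phi> x\<bar> \<le> K" "\<And>x. \<bar>deriv \<phi> x\<bar> \<le> K" "\<And>x. \<bar>deriv (deriv \<phi>) x\<bar> \<le> K"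
    using C2_bounded[OF \<phi>] by blast
  then have K: "\<And>x. \<bar>\<phi> x\<bar> \<le> K" "\<And>x. \<bar>\<phi>' x\<bar> \<le> K" "\<And>x. \<bar>\<phi>'' x\<bar> \<le> K"
    by (simp_all add: \<phi>'_def \<phi>''_def)
  have K0: "0 \<le> K" using K(1)[of 0] by linarith
  define h where "h = t - s"
  define r where "r n i = s + h * real i / real (Suc n)" for n i :: nat
  have h: "0 \<le> h" using st by (simp add: h_def)
  have r0: "r n 0 = s" for n by (simp add: r_def)
  have rn: "r n (Suc n) = t" for n by (simp add: r_def h_def)
  have rS: "r n (Suc i) = r n i + h / real (Suc n)" for n i by (simp add: r_def add_divide_distrib distrib_left)
  have rmono: "i \<le> j \<Longrightarrow> r n i \<le> r n j" for n i j
    unfolding r_def using h by (intro add_left_mono divide_right_mono mult_left_mono) auto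
  have rs: "s \<le> r n i" for n i using rmono[of 0 i n] r0 by simp
  have rt: "i \<le> Suc n \<Longrightarrow> r n i \<le> t" for n i using rmono[of i "Suc n" n] rn by simp
  have rp: "0 \<le> r n i" for n i using rs[of n i] st by simp
  define R where "R u w = rate \<phi>' \<phi>'' u w" for u w
  define m where "m u w = \<phi> (Y u w) - (LINT v:{0..u}|lborel. R v w)" for u w
  have Rm: "(\<lambda>u. R u w) \<in> borel_measurable borel" if "w \<in> space M" for w
    unfolding R_def by (rule rate_path[OF m\<phi>(2,3) that])
  have Rb: "\<bar>R u w\<bar> \<le> K * C + K" for u w
  proof -
    have "\<bar>\<phi>' (Y (max 0 u) w) * B u (Y (max 0 u) w)\<bar> \<le> K * C"
      unfolding abs_mult by (intro mult_mono K drift_bounded K0) simp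
    then show ?thesis using K(3)[of "Y (max 0 u) w"] unfolding R_def rate_def by linarith
  qed
  have mm: "m u \<in> borel_measurable M" if "0 \<le> u" for u
    unfolding m_def[abs_def] R_def
    by (intro borel_measurable_diff measurable_compose[OF Y_measurable[OF that] m\<phi>(1)] measurable_time_integral)
      (use rate_joint[OF m\<phi>(2,3)] in \<open>simp add: case_prod_unfold\<close>)
  have mc: "continuous_on {0..} (\<lambda>u. m u w)" if w: "w \<in> space M" for w
  proof -
    have "continuous_on {0..} (\<lambda>u. \<phi> (Y u w))"
      by (rule continuous_on_compose2[OF _ continuous_Y[OF w]])
        (auto intro!: continuous_at_imp_continuous_on DERIV_isCont[OF d(1)])
    then show ?thesis unfolding m_def by (intro continuous_on_diff continuous_on_set_integral[OF Rm[OF w] Rb])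
  qed
  have md: "m v w - m u w = \<phi> (Y v w) - \<phi> (Y u w) - (LINT x:{u..v}|lborel. R x w)" if "w \<in> space M" "0 \<le> u" "u \<le> v" for u v w
    using set_integral_split[OF set_integrable_bounded_interval[OF Rm[OF that(1)] Rb], of 0 u v] that by (simp add: m_def)
  have mb: "\<bar>m v w - m u w\<bar> \<le> 2 * K + (K * C + K) * (v - u)" if "w \<in> space M" "0 \<le> u" "u \<le> v" for u v w
    unfolding md[OF that] using K(1)[of "Y v w"] K(1)[of "Y u w"] set_integral_interval_le[OF Rm[OF that(1)] Rb that(3)] by linarith
  define J where "J n w = (\<Sum>i<Suc n. if alive (r n i) w then m (r n (Suc i)) w - m (r n i) w else 0)" for n w
  define J' where "J' w = \<phi> (X t w) - \<phi> (X s w) - (LINT u:{s..t}|lborel. iota (X u w) * (\<phi>' (X u w) * B u (X u w) + \<phi>'' (X u w)))" for w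
  have stop: "\<exists>j\<le>Suc n. (\<forall>i<j. alive (r n i) w) \<and> (j < Suc n \<longrightarrow> \<not> alive (r n j) w) \<and> J n w = m (r n j) w - m s w" for n w
    using sum_stopped[of "\<lambda>i. alive (r n i) w" "Suc n" "\<lambda>i. m (r n i) w"] alive_antimono[OF _ rmono, of n _ w] 
    unfolding J_def r0 by (meson le_SucI order_refl)
  have Jb: "\<bar>J n w\<bar> \<le> 2 * K + (K * C + K) * h" if w: "w \<in> space M" for n w
  proof -
    obtain j where j: "j \<le> Suc n" "J n w = m (r n j) w - m s w" using stop[of n w] by blast
    have "\<bar>J n w\<bar> \<le> 2 * K + (K * C + K) * (r n j - s)" unfolding j(2) by (rule mb[OF w st(1) rs])
    also have "\<dots> \<le> 2 * K + (K * C + K) * h"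
      using rt[OF j(1)] K0 C_nonneg by (intro add_left_mono mult_left_mono) (auto simp: h_def)
    finally show ?thesis .
  qed
  have Jm: "J n \<in> borel_measurable M" for n
    unfolding J_def[abs_def]
  proof (intro borel_measurable_sum measurable_If borel_measurable_diff mm rp borel_measurable_const)
    fix i
    show "{w \<in> space M. alive (r n i) w} \<in> sets M"
      using alive_adapted[OF rp, of n i] F_subalgebra[of "r n i"] by (auto simp: subalgebra_def)
  qed
  have lim: "(\<lambda>n. J n w) \<longlonglongrightarrow> J' w" if w: "w \<in> space M" for w
  proof (cases "alive s w")
    case False
    have "\<not> alive u w" if "s \<le> u" for u using alive_antimono that False by blast
    then have "J n w = 0" for n using rs by (simp add: J_def)
    moreover have "J' w = 0"
    proof -
      have "(LINT u:{s..t}|lborel. iota (X u w) * (\<phi>' (X u w) * B u (X u w) + \<phi>'' (X u w))) = (LINT u:{s..t}|lborel. 0)"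
        using \<open>\<And>u. s \<le> u \<Longrightarrow> \<not> alive u w\<close> by (intro set_lebesgue_integral_cong) (auto simp: X_alive iota_cases)
      then show ?thesis using \<open>\<And>u. s \<le> u \<Longrightarrow> \<not> alive u w\<close> st by (simp add: J'_def X_alive)
    qed
    ultimately show ?thesis by simp
  next
    case True
    obtain \<sigma> where \<sigma>: "s \<le> \<sigma>" "\<sigma> \<le> t" "\<And>u. u < \<sigma> \<Longrightarrow> alive u w" "\<And>u. \<sigma> < u \<Longrightarrow> u \<le> t \<Longrightarrow> \<not> alive u w" "X t w = Y \<sigma> w"
      using absorption_time[OF w st True] by blast
    have "J' w = m \<sigma> w - m s w"
    proof -
      define f where "f u = iota (X (max 0 u) w) * (\<phi>' (X (max 0 u) w) * B u (X (max 0 u) w) + \<phi>'' (X (max 0 u) w))" for u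
      have xm: "(\<lambda>u. X (max 0 u) w) \<in> borel_measurable borel"
        by (intro borel_measurable_continuous_onI continuous_on_compose2[OF continuous_X[OF w]] continuous_intros) auto
      have fm: "f \<in> borel_measurable borel"
        unfolding f_def[abs_def]
        by (intro borel_measurable_times borel_measurable_add measurable_drift measurable_ident_sets refl xm
            measurable_compose[OF xm iota_measurable] measurable_compose[OF xm m\<phi>(2)] measurable_compose[OF xm m\<phi>(3)])
      have "(LINT u:{s..t}|lborel. iota (X u w) * (\<phi>' (X u w) * B u (X u w) + \<phi>'' (X u w))) = (LINT u:{s..t}|lborel. f u)"
        using st by (intro set_lebesgue_integral_cong) (auto simp: f_def)
      also have "\<dots> = (LINT u:{s..\<sigma>}|lborel. R u w)"
        unfolding set_lebesgue_integral_def
      proof (rule integral_cong_AE)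
        show "AE u in lborel. indicat_real {s..t} u *\<^sub>R f u = indicat_real {s..\<sigma>} u *\<^sub>R R u w"
          using AE_lborel_singleton[of \<sigma>]
        proof eventually_elim
          case (elim u)
          have "f u = R u w" if "s \<le> u" "u < \<sigma>"
            using \<sigma>(3)[OF that(2)] alive_pos[of u w] that st by (simp add: f_def R_def rate_def X_alive iota_cases)
          moreover have "f u = 0" if "\<sigma> < u" "u \<le> t"
            using \<sigma>(4)[OF that] that \<sigma>(1) st by (simp add: f_def X_alive iota_cases)
          ultimately show ?case using elim \<sigma>(1,2) by (auto simp: indicator_def)
        qed
      qed (use fm Rm[OF w] in \<open>simp_all add: borel_measurable_times borel_measurable_indicator\<close>)
      finally show ?thesis unfolding J'_def md[OF w st(1) \<sigma>(1)] using \<sigma>(5) True by (simp add: X_alive)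
    qed
    moreover have "(\<lambda>n. J n w) \<longlonglongrightarrow> m \<sigma> w - m s w"
    proof -
      have "\<exists>j. \<sigma> \<le> r n j \<and> r n j \<le> \<sigma> + h * inverse (real (Suc n)) \<and> J n w = m (r n j) w - m s w" for n
      proof -
        obtain j where j: "j \<le> Suc n" "\<And>i. i < j \<Longrightarrow> alive (r n i) w" "j < Suc n \<Longrightarrow> \<not> alive (r n j) w" "J n w = m (r n j) w - m s w"
          using stop[of n w] by blast
        have "\<sigma> \<le> r n j"
        proof (cases "j < Suc n")
          case True
          then show ?thesis using j(3) \<sigma>(3) by (meson not_less)
        next
          case False
          then have "j = Suc n" using j(1) by simp
          then show ?thesis using \<sigma>(2) rn by simp
        qed
        moreover have "0 < j" using j(3) True r0[of n] by (cases j) auto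
        then obtain i where i: "j = Suc i" by (cases j) auto
        have "r n i \<le> \<sigma>" using j(2)[of i] \<sigma>(4)[of "r n i"] rt[of i n] j(1) i by force
        then have "r n j \<le> \<sigma> + h * inverse (real (Suc n))" unfolding i rS by (simp add: divide_inverse)
        ultimately show ?thesis using j(4) by blast
      qed
      then obtain j where j: "\<And>n. \<sigma> \<le> r n (j n)" "\<And>n. r n (j n) \<le> \<sigma> + h * inverse (real (Suc n))" "\<And>n. J n w = m (r n (j n)) w - m s w"
        by metis
      have "(\<lambda>n. \<sigma> + h * inverse (real (Suc n))) \<longlonglongrightarrow> \<sigma> + h * 0"
        by (intro tendsto_intros LIMSEQ_inverse_real_of_nat)
      then have "(\<lambda>n. r n (j n)) \<longlonglongrightarrow> \<sigma>"
        using j(1,2) by (intro tendsto_sandwich[of "\<lambda>_. \<sigma>" "\<lambda>n. r n (j n)" sequentially "\<lambda>n. \<sigma> + h * inverse (real (Suc n))" \<sigma>]) auto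
      then have "(\<lambda>n. m (r n (j n)) w) \<longlonglongrightarrow> m \<sigma> w"
        using \<sigma>(1) st rp by (intro continuous_on_tendsto_compose[OF mc[OF w]]) auto
      then show ?thesis unfolding j(3) by (intro tendsto_diff tendsto_const)
    qed
    ultimately show ?thesis by simp
  qed
  have GM: "G \<in> borel_measurable M" by (rule measurable_from_subalg[OF F_subalgebra G(1)])
  have Gb: "\<bar>G w * x\<bar> \<le> b" if "\<bar>x\<bar> \<le> b" for w x b
    using mult_mono[OF G(2)[of w] that] by (simp add: abs_mult)
  have conv: "(\<lambda>n. LINT w|M. G w * J n w) \<longlonglongrightarrow> (LINT w|M. G w * J' w)"
  proof (rule integral_bounded_tendsto[OF borel_measurable_times[OF GM Jm]])
    show "\<bar>G w * J n w\<bar> \<le> 2 * K + (K * C + K) * h" if "w \<in> space M" for n w by (rule Gb[OF Jb[OF that]])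
    show "(\<lambda>n. G w * J n w) \<longlonglongrightarrow> G w * J' w" if "w \<in> space M" for w by (intro tendsto_mult tendsto_const lim that)
  qed
  have "(LINT w|M. G w * J' w) = 0"
  proof (cases "h = 0")
    case True
    then have "J n w = 0" for n w unfolding J_def by (intro sum.neutral) (simp add: rS)
    then have "(\<lambda>n. LINT w|M. G w * J n w) = (\<lambda>_. 0)" by simp
    then show ?thesis using conv LIMSEQ_unique tendsto_const by metis
  next
    case False
    then have h0: "0 < h" using h by simp
    have step: "\<bar>LINT w|M. G w * J' w\<bar> \<le> 0 + h * (e * (3 + C\<^sup>2))" if e: "0 < e" for e
    proof -
      obtain k where k: "0 \<le> k" "\<And>x y. \<bar>\<phi>'' x - \<phi>'' y\<bar> \<le> e + k * (x - y)\<^sup>2"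
        unfolding \<phi>''_def using C2_oscillation[OF \<phi> e] by blast
      define A where "A = k * (52 + 2 * C\<^sup>2 + 4 * C ^ 4) + K * (3 * C + C\<^sup>2 / 2) + C * K * (3 + C\<^sup>2)"
      define \<delta> where "\<delta> n = h * inverse (real (Suc n))" for n
      have \<delta>lim: "\<delta> \<longlonglongrightarrow> 0" unfolding \<delta>_def[abs_def] using tendsto_mult[OF tendsto_const LIMSEQ_inverse_real_of_nat, of h] by simp
      have summand: "\<bar>LINT w|M. G w * (if alive (r n i) w then m (r n (Suc i)) w - m (r n i) w else 0)\<bar> \<le> \<delta> n * (e * (3 + C\<^sup>2) + sqrt (\<delta> n) * A)"
        if \<delta>1: "\<delta> n \<le> 1" for n i
      proof -
        \<comment> \<open>The indicator of being alive at the beginning of the step becomes part of the weight.\<close>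
        define g where "g w = (if alive (r n i) w then G w else 0)" for w
        have gm: "g \<in> borel_measurable (F (r n i))"
          unfolding g_def[abs_def]
          by (rule measurable_If[OF measurable_from_subalg[OF F_mono[OF rs] G(1)] _ alive_adapted[OF rp]]) simp
        have gb: "\<bar>g w\<bar> \<le> 1" for w using G(2)[of w] by (simp add: g_def)
        have \<delta>r: "r n (Suc i) - r n i = \<delta> n" unfolding rS \<delta>_def by (simp add: divide_inverse)
        have lt: "r n i < r n (Suc i)" unfolding rS using h0 by simp
        have "(LINT w|M. G w * (if alive (r n i) w then m (r n (Suc i)) w - m (r n i) w else 0)) =
          (LINT w|M. g w * (\<phi> (Y (r n (Suc i)) w) - \<phi> (Y (r n i) w) - (LINT u:{r n i..r n (Suc i)}|lborel. rate \<phi>' \<phi>'' u w)))"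
          by (rule Bochner_Integration.integral_cong[OF refl]) (simp add: g_def md[OF _ rp less_imp_le[OF lt], unfolded R_def])
        then show ?thesis
          using one_step[OF rp lt _ gm gb d c K k(2,1) less_imp_le[OF e]] \<delta>1 unfolding \<delta>r A_def by simp
      qed
      have bound: "\<bar>LINT w|M. G w * J n w\<bar> \<le> h * (e * (3 + C\<^sup>2) + sqrt (\<delta> n) * A)" if \<delta>1: "\<delta> n \<le> 1" for n
      proof -
        have i: "integrable M (\<lambda>w. G w * (if alive (r n i) w then m (r n (Suc i)) w - m (r n i) w else 0))" if i: "i < Suc n" for i
        proof (rule integrable_bounded[OF _ Gb])
          show "(\<lambda>w. G w * (if alive (r n i) w then m (r n (Suc i)) w - m (r n i) w else 0)) \<in> borel_measurable M"
          proof (intro borel_measurable_times GM measurable_If borel_measurable_diff mm rp borel_measurable_const)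
            show "{w \<in> space M. alive (r n i) w} \<in> sets M"
              using alive_adapted[OF rp, of n i] F_subalgebra[of "r n i"] by (auto simp: subalgebra_def)
          qed
          have "0 \<le> 2 * K + (K * C + K) * (r n (Suc i) - r n i)"
            using K0 C_nonneg rmono[of i "Suc i" n] by (intro add_nonneg_nonneg mult_nonneg_nonneg) auto
          then show "\<bar>if alive (r n i) w then m (r n (Suc i)) w - m (r n i) w else 0\<bar> \<le> 2 * K + (K * C + K) * (r n (Suc i) - r n i)" if "w \<in> space M" for w
            using mb[OF that rp rmono, of i "Suc i" n] by simp
        qed
        have "(LINT w|M. G w * J n w) = (\<Sum>i<Suc n. LINT w|M. G w * (if alive (r n i) w then m (r n (Suc i)) w - m (r n i) w else 0))"
          unfolding J_def sum_distrib_left by (rule Bochner_Integration.integral_sum) (use i in auto)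
        also have "\<bar>\<dots>\<bar> \<le> (\<Sum>i<Suc n. \<delta> n * (e * (3 + C\<^sup>2) + sqrt (\<delta> n) * A))"
          by (rule order_trans[OF sum_abs sum_mono]) (rule summand[OF \<delta>1])
        also have "\<dots> = h * (e * (3 + C\<^sup>2) + sqrt (\<delta> n) * A)"
          unfolding sum_constant \<delta>_def by (simp del: of_nat_Suc)
        finally show ?thesis .
      qed
      show ?thesis
      proof (rule LIMSEQ_le)
        show "(\<lambda>n. \<bar>LINT w|M. G w * J n w\<bar>) \<longlonglongrightarrow> \<bar>LINT w|M. G w * J' w\<bar>" by (intro tendsto_rabs conv)
        have "(\<lambda>n. h * (e * (3 + C\<^sup>2) + sqrt (\<delta> n) * A)) \<longlonglongrightarrow> h * (e * (3 + C\<^sup>2) + sqrt 0 * A)"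
          by (intro tendsto_intros \<delta>lim)
        then show "(\<lambda>n. h * (e * (3 + C\<^sup>2) + sqrt (\<delta> n) * A)) \<longlonglongrightarrow> 0 + h * (e * (3 + C\<^sup>2))" by simp
        have "eventually (\<lambda>n. \<delta> n < 1) sequentially" by (rule order_tendstoD(2)[OF \<delta>lim]) simp
        then obtain N where "\<And>n. N \<le> n \<Longrightarrow> \<delta> n < 1" by (auto simp: eventually_sequentially)
        then show "\<exists>N. \<forall>n\<ge>N. \<bar>LINT w|M. G w * J n w\<bar> \<le> h * (e * (3 + C\<^sup>2) + sqrt (\<delta> n) * A)"
          using bound by (intro exI[of _ N]) (auto intro: less_imp_le)
      qed
    qed
    have pos: "0 < h * (3 + C\<^sup>2)" using h0 by (simp add: add_pos_nonneg)
    have "\<bar>LINT w|M. G w * J' w\<bar> \<le> 0"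
    proof (rule field_le_epsilon)
      fix e :: real assume e: "0 < e"
      have "h * (e / (h * (3 + C\<^sup>2)) * (3 + C\<^sup>2)) = e" using pos by (simp add: field_simps)
      then show "\<bar>LINT w|M. G w * J' w\<bar> \<le> 0 + e"
        using step[OF divide_pos_pos[OF e pos]] by simp
    qed
    then show ?thesis by simp
  qed
  then show ?thesis by (simp add: J'_def \<phi>'_def \<phi>''_def)
qed

end

section \<open>The law of the absorbed diffusion\<close>

context absorbed_diffusion
begin

definition path :: "'a \<Rightarrow> real \<Rightarrow> real" where
  "path w = (\<lambda>t\<in>{0..}. X t w)"

lemma path_eq: "0 \<le> t \<Longrightarrow> path w t = X t w"
  by (simp add: path_def)

lemma path_in_space: "w \<in> space M \<Longrightarrow> path w \<in> space path_space"
proof -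
  assume w: "w \<in> space M"
  have "continuous_on {0..} (path w) \<longleftrightarrow> continuous_on {0..} (\<lambda>t. X t w)"
    by (rule continuous_on_cong) (auto simp: path_eq)
  then show ?thesis using continuous_X[OF w] by (simp add: space_path_space path_def)
qed

lemma path_adapted: "0 \<le> s \<Longrightarrow> path \<in> measurable (F s) (canonical_filtration s)"
  unfolding canonical_filtration_def
proof (rule measurable_measure_of)
  show "path \<in> space (F s) \<rightarrow> space path_space" using path_in_space by (auto simp: space_F)
  fix A assume "A \<in> {(\<lambda>\<omega>. \<omega> r) -` A \<inter> space path_space | r A. 0 \<le> r \<and> r \<le> s \<and> A \<in> sets borel}"
  then obtain r A' where A: "A = (\<lambda>\<omega>. \<omega> r) -` A' \<inter> space path_space" "0 \<le> r" "r \<le> s" "A' \<in> sets borel" by auto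
  have "X r -` A' \<inter> space (F s) \<in> sets (F s)"
    by (rule measurable_sets[OF measurable_from_subalg[OF F_mono[OF A(3)] X_adapted[OF A(2)]] A(4)])
  also have "X r -` A' \<inter> space (F s) = path -` A \<inter> space (F s)"
    using path_in_space A by (auto simp: space_F path_eq)
  finally show "path -` A \<inter> space (F s) \<in> sets (F s)" .
qed auto

lemma path_measurable: "path \<in> measurable M path_space"
  unfolding path_space_def
proof (rule measurable_restrict_space2)
  show "path \<in> space M \<rightarrow> {\<omega>. continuous_on {0..} \<omega>}" using path_in_space by (auto simp: space_path_space)
  show "path \<in> measurable M (PiM {0..} (\<lambda>_. borel))"
    unfolding path_def[abs_def] by (rule measurable_restrict) (auto intro: X_measurable)
qed

definition law :: "(real \<Rightarrow> real) measure" where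
  "law = distr M path_space path"

lemma sets_law: "sets law = sets path_space"
  by (simp add: law_def)

lemma law_linear_solution: "linear_solution law B C"
proof -
  interpret law: prob_space law unfolding law_def by (rule prob_space_distr[OF path_measurable])
  interpret law: path_drift law B C
    by unfold_locales (rule sets_law drift_measurable drift_bounded)+
  show ?thesis
  proof unfold_locales
    fix t :: real assume t: "0 \<le> t"
    have "{w \<in> space path_space. 0 \<le> w t} \<in> sets path_space" using measurable_path_eval[OF t] by measurable
    then show "AE w in law. 0 \<le> w t"
      unfolding law_def using X_nonneg[OF t] by (subst AE_distr_iff[OF path_measurable]) (auto simp: path_eq[OF t])
  next
    fix \<phi> s t G
    assume \<phi>: "C2_compact_support \<phi>" and st: "0 \<le> s" "s \<le> t" and G: "G \<in> borel_measurable (canonical_filtration s)" "\<And>w. \<bar>G w\<bar> \<le> (1 :: real)"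
    define H where "H w = G w * (\<phi> (w t) - \<phi> (w s) - law.compensator \<phi> s t w)" for w
    have Hm: "H \<in> borel_measurable path_space"
      unfolding H_def[abs_def] using st
      by (intro borel_measurable_times borel_measurable_diff measurable_canonical_imp_path[OF G(1)]
          measurable_canonical_imp_path[OF law.compensator_measurable[OF \<phi> st order_refl]]
          measurable_compose[OF measurable_path_eval C2_measurable(1)[OF \<phi>]]) auto
    have "(LINT w|law. H w) = (LINT w|M. H (path w))"
      unfolding law_def by (rule integral_distr[OF path_measurable Hm])
    also have "\<dots> = (LINT w|M. G (path w) * (\<phi> (X t w) - \<phi> (X s w) -
        (LINT u:{s..t}|lborel. iota (X u w) * (deriv \<phi> (X u w) * B u (X u w) + deriv (deriv \<phi>) (X u w)))))"
    proof -
      have "law.compensator \<phi> s t (path w) = (LINT u:{s..t}|lborel. iota (X u w) * (deriv \<phi> (X u w) * B u (X u w) + deriv (deriv \<phi>) (X u w)))" for w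
        unfolding law.compensator_def using st by (intro set_lebesgue_integral_cong) (auto simp: path_eq)
      then show ?thesis using st by (simp add: H_def path_eq)
    qed
    also have "\<dots> = 0"
      by (rule Ito_formula[OF st measurable_compose[OF path_adapted[OF st(1)] G(1)] G(2) \<phi>])
    finally show "(LINT w|law. G w * (\<phi> (w t) - \<phi> (w s) -
          (LINT u:{s..t}|lborel. iota (w u) * (deriv \<phi> (w u) * B u (w u) + deriv (deriv \<phi>) (w u))))) = 0"
      by (simp add: H_def law.compensator_def)
  qed
qed

lemma law_initial: "marginal law 0 = distr M borel (\<lambda>w. max 0 (Z w))"
proof -
  have "marginal law 0 = distr M borel ((\<lambda>w. w 0) \<circ> path)"
    unfolding marginal_def law_def by (rule distr_distr[OF measurable_path_eval path_measurable]) simp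
  also have "\<dots> = distr M borel (\<lambda>w. max 0 (Z w))"
    by (rule distr_cong) (auto simp: path_eq X_0)
  finally show ?thesis .
qed

end

text \<open>
  Absorption replaces a negative starting point by zero; the starting points of \<open>\<rho>\<close> are almost surely nonnegative, so the initial
  law is \<open>\<rho>\<close>.
\<close>

theorem (in lipschitz_drift) linear_solution_exists:
  assumes \<rho>: "prob_space \<rho>" "sets \<rho> = sets borel" "AE x in \<rho>. 0 \<le> x"
  shows "\<exists>Q. linear_solution Q B C \<and> marginal Q 0 = \<rho>"
proof -
  obtain F W Z where br: "brownian (\<rho> \<Otimes>\<^sub>M dyadic_space) F W Z" and Z: "distr (\<rho> \<Otimes>\<^sub>M dyadic_space) borel Z = \<rho>"
    using Brownian_motion_exists[OF \<rho>(1,2)] by blast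
  interpret brownian "\<rho> \<Otimes>\<^sub>M dyadic_space" F W Z by (rule br)
  interpret absorbed_diffusion "\<rho> \<Otimes>\<^sub>M dyadic_space" F W Z B C L by unfold_locales
  have Zm: "Z \<in> borel_measurable (\<rho> \<Otimes>\<^sub>M dyadic_space)"
    by (rule measurable_from_subalg[OF F_subalgebra Z_measurable])
  have "marginal law 0 = distr (distr (\<rho> \<Otimes>\<^sub>M dyadic_space) borel Z) borel (max 0)"
    unfolding law_initial by (subst distr_distr[OF _ Zm]) (auto simp: comp_def)
  also have "\<dots> = distr \<rho> borel (\<lambda>x. x)"
    unfolding Z using \<rho>(3) by (intro distr_cong_AE) (auto simp: \<rho>(2) max_def measurable_cong_sets[OF \<rho>(2) refl])
  also have "\<dots> = \<rho>" by (rule distr_id2) (simp add: \<rho>(2))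
  finally show ?thesis using law_linear_solution by auto
qed

section \<open>Existence and uniqueness for the mean-field equation\<close>

locale lipschitz_interaction = interaction b C for b C +
  fixes L :: real
  assumes b_Lipschitz: "\<And>t x x' y. \<bar>b (max 0 t) x y - b (max 0 t) x' y\<bar> \<le> L * \<bar>x - x'\<bar>"
begin

lemma lipschitz_drift_mean_drift:
  assumes Q: "prob_space Q" "sets Q = sets path_space"
  shows "lipschitz_drift (mean_drift b Q) C L"
proof -
  interpret Q: path_drift Q "mean_drift b Q" C by (rule path_drift_mean_drift[OF Q])
  show ?thesis
  proof
    fix u x x'
    define y where "y w = w (max 0 u)" for w :: "real \<Rightarrow> real"
    have ym: "y \<in> borel_measurable Q" unfolding y_def[abs_def] by (rule Q.eval_max_measurable')
    have m: "(\<lambda>w. iota (y w) * b (max 0 u) z (y w)) \<in> borel_measurable Q" for z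
      by (intro borel_measurable_times measurable_compose[OF ym iota_measurable] measurable_compose[OF ym measurable_b_section])
    have i: "integrable Q (\<lambda>w. iota (y w) * b (max 0 u) z (y w))" for z
      by (rule Q.integrable_bounded[OF m, where K=C]) (use b_bounded[of u] C_nonneg in \<open>auto simp: iota_cases\<close>)
    have "mean_drift b Q u x - mean_drift b Q u x' =
        (LINT w|Q. iota (y w) * b (max 0 u) x (y w) - iota (y w) * b (max 0 u) x' (y w))"
      unfolding mean_drift_eq[OF Q(2)] y_def[symmetric] by (rule Bochner_Integration.integral_diff[OF i i, symmetric])
    also have "\<bar>\<dots>\<bar> \<le> L * \<bar>x - x'\<bar>"
    proof (rule Q.abs_expectation_le)
      have "0 \<le> L * \<bar>x - x'\<bar>" using b_Lipschitz[of 0 x 0 x'] by linarith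
      then show "\<bar>iota (y w) * b (max 0 u) x (y w) - iota (y w) * b (max 0 u) x' (y w)\<bar> \<le> L * \<bar>x - x'\<bar>" for w
        using b_Lipschitz[of u x "y w" x'] by (simp add: iota_cases)
    qed
    finally show "\<bar>mean_drift b Q u x - mean_drift b Q u x'\<bar> \<le> L * \<bar>x - x'\<bar>" .
  qed (rule Q.drift_measurable Q.drift_bounded)+
qed

text \<open>
  Picard iteration for the map that takes a drift to the mean field of its solution. The contraction yields a limit \<open>B\<close> of
  the drifts that is bounded and Lipschitz with the same constants. The mean field of the solution with drift \<open>B\<close> is close to
  that of the solution with drift \<open>Bs n\<close>, which is \<open>Bs (Suc n)\<close>; so it equals \<open>B\<close>.
\<close>

theorem weak_solution_exists:
  assumes \<rho>: "prob_space \<rho>" "sets \<rho> = sets borel" "AE x in \<rho>. 0 \<le> x"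
  shows "\<exists>Q. weak_solution b \<rho> Q"
proof -
  define sol where "sol B = (SOME Q. linear_solution Q B C \<and> marginal Q 0 = \<rho>)" for B
  have sol: "linear_solution (sol B) B C" "marginal (sol B) 0 = \<rho>" if "lipschitz_drift B C L" for B
    using someI_ex[OF lipschitz_drift.linear_solution_exists[OF that \<rho>]] by (simp_all add: sol_def)
  have sol_prob: "prob_space (sol B)" "sets (sol B) = sets path_space" if "lipschitz_drift B C L" for B
    using sol(1)[OF that] by (simp_all add: linear_solution_def path_drift_def path_drift_axioms_def)
  define Bs where "Bs n = ((\<lambda>B. mean_drift b (sol B)) ^^ n) (\<lambda>_ _. 0)" for n :: nat
  have Bs: "Bs 0 = (\<lambda>_ _. 0)" "Bs (Suc n) = mean_drift b (sol (Bs n))" for n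
    by (simp_all add: Bs_def)
  have L0: "0 \<le> L" using b_Lipschitz[of 0 1 0 0] by simp
  have lip: "lipschitz_drift (Bs n) C L" for n
  proof (induction n)
    case 0
    show ?case unfolding Bs by unfold_locales (use C_nonneg L0 in auto)
  next
    case (Suc n)
    then show ?case unfolding Bs by (intro lipschitz_drift_mean_drift sol_prob)
  qed
  have clip: "Bs n (max 0 u) x = Bs n u x" for n u x
    by (cases n) (simp_all add: Bs mean_drift_def)
  obtain l where l: "0 < l" "pi / sqrt (2 * l) * C \<le> 1/4" using exists_contraction_rate[OF C_nonneg] by metis
  have step: "\<bar>Bs (Suc n) u x - Bs n u x\<bar> \<le> C * (1/2) ^ n * exp (l * u)" if "0 \<le> u" for n u x
    using that
  proof (induction n arbitrary: u x)
    case 0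
    have "\<bar>Bs (Suc 0) u x - Bs 0 u x\<bar> \<le> C * 1" using lipschitz_drift.drift_bounded[OF lip, of "Suc 0" u x] by (simp add: Bs(1))
    also have "\<dots> \<le> C * exp (l * u)" using 0 l C_nonneg by (intro mult_left_mono) auto
    finally show ?case by simp
  next
    case (Suc n)
    have "\<bar>mean_drift b (sol (Bs (Suc n))) u x - mean_drift b (sol (Bs n)) u x\<bar> \<le> C * (1/2) ^ n / 2 * exp (l * u)"
      by (rule mean_drift_contraction[OF sol(1)[OF lip] sol(1)[OF lip] _ l Suc.IH]) (use C_nonneg Suc.prems sol(2)[OF lip] in auto)
    then show ?case unfolding Bs(2)[of "Suc n"] Bs(2)[of n] by simp
  qed
  define B where "B u x = lim (\<lambda>n. Bs n u x)" for u x
  have conv: "(\<lambda>n. Bs n u x) \<longlonglongrightarrow> B u x" "\<bar>B u x - Bs n u x\<bar> \<le> 2 * C * (1/2) ^ n * exp (l * max 0 u)" for u x n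
  proof -
    have st: "\<bar>Bs (Suc n) u x - Bs n u x\<bar> \<le> C * exp (l * max 0 u) * (1/2) ^ n" for n
      using step[of "max 0 u" n x] unfolding clip by (simp add: mult_ac)
    obtain z where z: "(\<lambda>n. Bs n u x) \<longlonglongrightarrow> z" "\<And>n. \<bar>Bs n u x - z\<bar> \<le> C * exp (l * max 0 u) / (1 - 1/2) * (1/2) ^ n"
      by (rule geometric_Cauchy[of "1/2" "\<lambda>n. Bs n u x" "C * exp (l * max 0 u)", OF _ _ st]) auto
    have "z = B u x" unfolding B_def using z(1) by (rule limI[symmetric])
    then show "(\<lambda>n. Bs n u x) \<longlonglongrightarrow> B u x" "\<bar>B u x - Bs n u x\<bar> \<le> 2 * C * (1/2) ^ n * exp (l * max 0 u)"
      using z(1) z(2)[of n] by (simp_all add: abs_minus_commute mult_ac)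
  qed
  have lipB: "lipschitz_drift B C L"
  proof
    show "(\<lambda>(u, x). B u x) \<in> borel_measurable (borel \<Otimes>\<^sub>M borel)"
      by (rule borel_measurable_LIMSEQ_real[where u="\<lambda>n (u, x). Bs n u x"])
        (auto intro: conv(1) lipschitz_drift.drift_measurable[OF lip])
    show "\<bar>B u x\<bar> \<le> C" for u x
      by (rule LIMSEQ_le_const2[OF tendsto_rabs[OF conv(1)]]) (use lipschitz_drift.drift_bounded[OF lip] in blast)
    show "\<bar>B u x - B u y\<bar> \<le> L * \<bar>x - y\<bar>" for u x y
      by (rule LIMSEQ_le_const2[OF tendsto_rabs[OF tendsto_diff[OF conv(1) conv(1)]]])
        (use lipschitz_drift.drift_Lipschitz[OF lip] in blast)
  qed
  define Q where "Q = sol B"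
  have fixed: "mean_drift b Q u x = B u x" if u: "0 \<le> u" for u x
  proof -
    have close: "\<bar>B v y - Bs n v y\<bar> \<le> 2 * C * (1/2) ^ n * exp (l * v)" if "0 \<le> v" for v y n
      using conv(2)[of v y n] that by simp
    have "\<bar>mean_drift b Q u x - Bs (Suc n) u x\<bar> \<le> 2 * C * (1/2) ^ n / 2 * exp (l * u)" for n
      unfolding Bs(2) Q_def
      by (rule mean_drift_contraction[OF sol(1)[OF lipB] sol(1)[OF lip] _ l close _ u])
        (simp_all add: sol(2)[OF lip] sol(2)[OF lipB] C_nonneg)
    then have near: "\<bar>Bs (Suc n) u x - mean_drift b Q u x\<bar> \<le> C * exp (l * u) * (1/2) ^ n" for n
      by (simp add: abs_minus_commute mult_ac)
    have "(\<lambda>n. C * exp (l * u) * (1/2) ^ n) \<longlonglongrightarrow> 0"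
      by (intro tendsto_mult_right_zero LIMSEQ_power_zero) simp
    then have "(\<lambda>n. Bs (Suc n) u x - mean_drift b Q u x) \<longlonglongrightarrow> 0"
      by (rule Lim_null_comparison[rotated]) (simp add: near)
    then have "(\<lambda>n. Bs (Suc n) u x) \<longlonglongrightarrow> mean_drift b Q u x"
      by (rule LIM_zero_cancel)
    then show ?thesis using LIMSEQ_unique[OF _ LIMSEQ_Suc[OF conv(1)]] by blast
  qed
  have "mean_drift b Q u x = B u x" for u x
    using fixed[of "max 0 u" x] by (simp add: mean_drift_def B_def clip)
  then have "mean_drift b Q = B" by (intro ext)
  then have "weak_solution b \<rho> Q" unfolding weak_solution_iff using sol[OF lipB] by (simp add: Q_def)
  then show ?thesis ..
qed

end

theorem theorem2p5:
  fixes b :: "real \<Rightarrow> real \<Rightarrow> real \<Rightarrow> real"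
    and P :: "'p measure" and Z :: "'p \<Rightarrow> real" and \<rho> :: "real \<Rightarrow> real"
  assumes b_measurable:
      "(\<lambda>(t, x, y). b t x y) \<in> borel_measurable (restrict_space borel ({0..} \<times> UNIV))"
    and b_bounded: "bounded_spatial b"
    and b_Hoelder: "Hoelder_spatial b"
    and b_differentiable: "\<And>t x y. t \<ge> 0 \<Longrightarrow> (\<lambda>z. b t z y) differentiable (at x)"
    and db_bounded: "bounded_spatial (partial_1 b)"
    and db_Hoelder: "Hoelder_spatial (partial_1 b)"
    and P_prob: "prob_space P"
    and Z_measurable: "Z \<in> borel_measurable P"
    and Z_law: "distr P borel Z \<in> P2_nonneg"
    and \<rho>_nonneg: "\<And>x. x \<ge> 0 \<Longrightarrow> \<rho> x \<ge> 0"
    and Z_density: "distributed P lborel Z (\<lambda>x. ennreal (\<rho> x) * indicator {0..} x)"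
    and \<rho>_integrable: "(\<integral>\<^sup>+x\<in>{0<..1}. ennreal (\<rho> x / x\<^sup>2) \<partial>lborel) < \<infinity>"
  shows "\<exists>!Q. weak_solution b (distr P borel Z) Q"
proof -
  obtain C where C: "\<And>t x y. 0 \<le> t \<Longrightarrow> \<bar>b t x y\<bar> \<le> C"
    using b_bounded unfolding bounded_spatial_def by blast
  obtain L where L: "\<And>t x y. 0 \<le> t \<Longrightarrow> \<bar>partial_1 b t x y\<bar> \<le> L"
    using db_bounded unfolding bounded_spatial_def by blast
  interpret lipschitz_interaction b C L
  proof
    have "(\<lambda>z. (max 0 (fst z), snd z)) \<in> measurable (borel \<Otimes>\<^sub>M borel \<Otimes>\<^sub>M borel)
        (restrict_space (borel :: (real \<times> real \<times> real) measure) ({0..} \<times> UNIV))"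
    proof (rule measurable_restrict_space2)
      have "(\<lambda>z. (max 0 (fst z), snd z)) \<in> measurable (borel \<Otimes>\<^sub>M borel \<Otimes>\<^sub>M borel)
          (borel \<Otimes>\<^sub>M borel \<Otimes>\<^sub>M borel :: (real \<times> real \<times> real) measure)" by measurable
      then show "(\<lambda>z. (max 0 (fst z), snd z)) \<in> measurable (borel \<Otimes>\<^sub>M borel \<Otimes>\<^sub>M borel)
          (borel :: (real \<times> real \<times> real) measure)" by (simp add: borel_prod)
    qed auto
    from measurable_compose[OF this b_measurable]
    show "(\<lambda>(t, x, y). b (max 0 t) x y) \<in> borel_measurable (borel \<Otimes>\<^sub>M borel \<Otimes>\<^sub>M borel)"
      by (simp add: case_prod_unfold)
    show "\<bar>b (max 0 t) x y\<bar> \<le> C" for t x y by (rule C) simp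
    fix t x x' y
    have "((\<lambda>z. b (max 0 t) z y) has_real_derivative partial_1 b (max 0 t) z y) (at z)" for z
      unfolding partial_1_def DERIV_deriv_iff_real_differentiable by (rule b_differentiable) simp
    then show "\<bar>b (max 0 t) x y - b (max 0 t) x' y\<bar> \<le> L * \<bar>x - x'\<bar>"
      using field_differentiable_bound[of UNIV "\<lambda>z. b (max 0 t) z y" "\<lambda>z. partial_1 b (max 0 t) z y" L x x'] L
      by (auto simp: has_field_derivative_at_within)
  qed
  have law: "prob_space (distr P borel Z)" "measure (distr P borel Z) {0..} = 1"
    using Z_law by (simp_all add: P2_nonneg_def)
  interpret law: prob_space "distr P borel Z" by (rule law)
  have "AE x in distr P borel Z. 0 \<le> x"
    using law.AE_prob_1[OF law(2)] by simp
  from weak_solution_exists[OF law(1) _ this] obtain Q where Q: "weak_solution b (distr P borel Z) Q" by auto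
  then show ?thesis by (rule ex1I) (rule weak_solution_unique[OF _ Q])
qed

end
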